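(* Let $p$ be a prime and $X$ a finite ordered set. For a set $Y$, $\widehat Y=\{\hat y\mid y\in Y\}$ denotes a set of variables in bijection with $Y$. (1) Let $\lambda=0$, let $S=M^{c}(X)$ be the free commutative monoid generated by $X$, and $\mathrm{TL}=\mathrm{TL}(S)$. Then $$\mathrm{Sha}_{\mathbb{F}_p,\lambda}(\mathbb{F}_p[X])\cong\mathbb{F}_p[X]\otimes\left(\mathbb{F}_p[\widehat{\mathrm{TL}}]/\langle\hat w^{\,p}\mid\hat w\in\widehat{\mathrm{TL}}\rangle\right).$$ (2) Let $0\ne\lambda\in\mathbb{F}_p$, $S=M^{c}(X)$ and $\mathrm{TEL}_2=\mathrm{TEL}_2(S)$. Then $$\mathrm{Sha}_{\mathbb{F}_p,\lambda}(\mathbb{F}_p[X])\cong\mathbb{F}_p[X\cup\widehat{\mathrm{TEL}}_2]\otimes\left(\mathbb{F}_p[\widehat W]/\langle\hat w^{\,p}-\hat w\mid\hat w\in\widehat W\rangle\right),\quad W=\{1^{\otimes p^i}\mid i\ge0\},$$ where the $1$ in $W$ is the identity of $M^{c}(X)$. (3) Let $A=\mathbb{F}_p[X]/\langle x^p-x\mid x\in X\rangle$ and $0\ne\lambda\in\mathbb{F}_p$. Let $G=\{e\}\cup\mu_{p-1}$ be the monoid obtained from the cyclic group $\mu_{p-1}$ of order $p-1$ by adjoining a new identity element $e$, let $S=G^{|X|}$ (in the class $\mathcal{P}$, with a well order), and let $\mathrm{TEL}=\mathrm{TEL}(S)$. Then $$\mathrm{Sha}_{\mathbb{F}_p,\lambda}(A)\cong\mathbb{F}_p[X\cup\widehat{\mathrm{TEL}}]/\langle\hat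 w^{\,p}-\hat w\mid\hat w\in X\cup\widehat{\mathrm{TEL}}\rangle.$$ (4) Let $A=\mathbb{F}_p[X]/\langle x^p-1\mid x\in X\rangle$ and $0\ne\lambda\in\mathbb{F}_p$. Let $S=\mu_p^{|X|}$, where $\mu_p$ is the cyclic multiplicative group of order $p$ ($S$ is in the class $\mathcal{J}$, with a well order for which the identity is smallest), $\mathrm{TL}_1=\mathrm{TL}_1(S)$ and $\widetilde{\mathrm{TL}}_2=\widetilde{\mathrm{TL}}_2(S)$. Then $$\mathrm{Sha}_{\mathbb{F}_p,\lambda}(A)\cong\Big(\mathbb{F}_p[X]/\langle x^p-1\mid x\in X\rangle\Big)\otimes\Big(\mathbb{F}_p[\widehat{\mathrm{TL}}_1]/\langle\hat w^{\,p}-\hat w\mid\hat w\in\widehat{\mathrm{TL}}_1\rangle\Big)\otimes\Big(\mathbb{F}_p[\widehat{\widetilde{\mathrm{TL}}}_2]/\langle\hat w^{\,p}\mid\hat w\in\widehat{\widetilde{\mathrm{TL}}}_2\rangle\Big).$$ All isomorphisms are of $\mathbb{F}_p$-algebras.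
   Context: Mixable shuffle algebra: let $\mathbf{k}$ be a commutative ring, $\lambda\in\mathbf{k}$, and $A$ a commutative $\mathbf{k}$-algebra. Then $\mathrm{MS}_{\mathbf{k},\lambda}(A)=\bigoplus_{n\ge0}A^{\otimes n}$ ($A^{\otimes0}=\mathbf{k}$) with the bilinear product $\diamond$ whose identity is $1\in\mathbf{k}$ and, for pure tensors $\mathfrak{a}=a_1\otimes\mathfrak{a}'$, $\mathfrak{b}=b_1\otimes\mathfrak{b}'$ of length $\ge1$ (with $a\otimes1_{\mathbf{k}}$ read as $a$), $\mathfrak{a}\diamond\mathfrak{b}=a_1\otimes(\mathfrak{a}'\diamond\mathfrak{b})+b_1\otimes(\mathfrak{a}\diamond\mathfrak{b}')+\lambda(a_1b_1)\otimes(\mathfrak{a}'\diamond\mathfrak{b}')$. For an abelian semigroup $S$, $\mathrm{MS}_{\mathbf{k},\lambda}(S):=\mathrm{MS}_{\mathbf{k},\lambda}(\mathbf{k}S)$, which is free on the words $M^{\otimes}(S)=\{1\}\cup\{u_1\otimes\cdots\otimes u_r\mid u_i\in S,\ r\ge1\}$. For unital commutative $A$, the free commutative Rota-Baxter algebra of weight $\lambda$ on $A$ is the tensor product algebra $\mathrm{Sha}_{\mathbf{k},\lambda}(A)=A\otimes\mathrm{MS}_{\mathbf{k},\lambda}(A)$. Orders: $M^{c}(X)$ is ordered by total degree and then, for equal degree, lexicographically as induced by the order on $X$; the identity is smallest. For an abelian semigroup $S$, let $S_1=\{g\in S\mid g^p=g\}$, $S_2=S\setminus S_1$. $\mathcal{P}$: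 well-ordered abelian semigroups with $a>b\Rightarrow a^p>b^p$ and $a^p\ge a$ for all $a,b$. $\mathcal{J}$: well-ordered abelian semigroups with $g^{p^2}=g^p$ for all $g$ and $g_1<g_2$ whenever $g_1\in S_1,g_2\in S_2$. Words: for $w=u_1\otimes\cdots\otimes u_r$ put $w^{\langle p\rangle}=u_1^p\otimes\cdots\otimes u_r^p$; $w^{\otimes k}$ is the $k$-fold concatenation power. Lexicographic order on words: $u<v$ iff either $v=u\otimes x$ with $x$ non-empty, or $u=x\otimes a\otimes u'$, $v=x\otimes b\otimes v'$ with letters $a<b$. A Lyndon word is a non-empty word $w$ such that $w=u\otimes v$ with $u,v$ non-empty implies $w<v$. $\mathrm{L}=\mathrm{Lyn}(S)$ is the set of Lyndon words. For $W\subseteq M^{\otimes}(S)$: $W_1=\{w\in W\mid w^{\langle p\rangle}=w\}$, $W_2=\{w\in W\mid w^{\langle p\rangle}\ne w\}$, $\mathrm{E}(W)=\{w\in W\mid w=w^{\langle p\rangle}\text{ or }w\ne u^{\langle p\rangle}\text{ for every }u\in M^{\otimes}(S)\}$, $\mathrm{T}(W)=\{w^{\otimes p^i}\mid w\in W,\ i\ge0\}$. Set $\mathrm{TL}=\mathrm{T}(\mathrm{L})$, $\mathrm{TL}_i=\mathrm{T}(\mathrm{L}_i)$, $\mathrm{TEL}=\mathrm{T}(\mathrm{E}(\mathrm{L}))$, $\mathrm{TEL}_i=\mathrm{T}(\mathrm{E}(\mathrm{L}_i))$, $i=1,2$. For $S\in\mathcal{J}$, $\widetilde{\mathrm{TL}}_2=\{w-w^{\langle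 p\rangle}\mid w\in\mathrm{TL}_2\}$. Unions of variable sets such as $X\cup\widehat{\mathrm{TEL}}$ are disjoint. *)

theory Defs
  imports
    "HOL-Algebra.Algebra"
    "HOL-Number_Theory.Residues"
    "HOL-Library.Multiset"
begin

section \<open>Algebras over a commutative ring\<close>

text \<open>Algebras are records of type \<^type>\<open>module\<close> satisfying the locale \<^locale>\<open>algebra\<close>. The relation
  below includes the assertion that both sides are commutative \<open>R\<close>-algebras, so that it cannot hold
  for records with ill-defined operations.\<close>

definition alg_isomorphic ::
  "('r, 'm) ring_scheme \<Rightarrow> ('r, 'a) module \<Rightarrow> ('r, 'b) module \<Rightarrow> bool" where
  "alg_isomorphic R A B \<longleftrightarrow>
     algebra R A \<and> algebra R B \<and>
     (\<exists>h \<in> ring_iso A B. \<forall>c \<in> carrier R. \<forall>a \<in> carrier A. h (c \<odot>\<^bsub>A\<^esub> a) = c \<odot>\<^bsub>B\<^esub> h a)"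

text \<open>The quotient \<open>M / I\<close>: the library's \<^const>\<open>FactRing\<close> with the induced scalar multiplication.\<close>

definition quot_alg :: "('r, 'a) module \<Rightarrow> 'a set \<Rightarrow> ('r, 'a set) module" where
  "quot_alg M I =
     \<lparr>carrier = carrier (M Quot I), monoid.mult = monoid.mult (M Quot I), monoid.one = monoid.one (M Quot I),
      ring.zero = ring.zero (M Quot I), ring.add = ring.add (M Quot I),
      smult = (\<lambda>c K. \<Union>x\<in>K. I +>\<^bsub>M\<^esub> (c \<odot>\<^bsub>M\<^esub> x))\<rparr>"

definition submodule_span :: "('r, 'm) ring_scheme \<Rightarrow> ('r, 'a) module \<Rightarrow> 'a set \<Rightarrow> 'a set" where
  "submodule_span R M G = \<Inter>{N. submodule N R M \<and> G \<subseteq> N}"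

text \<open>\<open>basis_elem R x\<close> is the basis element \<open>x\<close> of a free \<open>R\<close>-module.\<close>

definition basis_elem :: "('r, 'm) ring_scheme \<Rightarrow> 'b \<Rightarrow> 'b \<Rightarrow> 'r" where
  "basis_elem R x = (\<lambda>y. if y = x then \<one>\<^bsub>R\<^esub> else \<zero>\<^bsub>R\<^esub>)"

text \<open>The free \<open>R\<close>-module on the set \<open>B\<close> (finitely supported functions, extended by \<open>\<zero>\<close> outside
  of \<open>B\<close>), with the bilinear product given on basis elements by \<open>u \<cdot> v = \<mu> u v\<close> and with the basis
  element \<open>e\<close> as identity.\<close>

definition free_alg ::
  "('r, 'm) ring_scheme \<Rightarrow> 'b set \<Rightarrow> 'b \<Rightarrow> ('b \<Rightarrow> 'b \<Rightarrow> 'b \<Rightarrow> 'r) \<Rightarrow> ('r, 'b \<Rightarrow> 'r) module" where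
  "free_alg R B e \<mu> =
     \<lparr>carrier = {f. (\<forall>x\<in>B. f x \<in> carrier R) \<and> (\<forall>x. x \<notin> B \<longrightarrow> f x = \<zero>\<^bsub>R\<^esub>) \<and> finite {x. f x \<noteq> \<zero>\<^bsub>R\<^esub>}},
      monoid.mult = (\<lambda>f g x. finsum R (\<lambda>(u, v). f u \<otimes>\<^bsub>R\<^esub> g v \<otimes>\<^bsub>R\<^esub> \<mu> u v x)
                                 ({u. f u \<noteq> \<zero>\<^bsub>R\<^esub>} \<times> {v. g v \<noteq> \<zero>\<^bsub>R\<^esub>})),
      monoid.one = basis_elem R e,
      ring.zero = (\<lambda>_. \<zero>\<^bsub>R\<^esub>),
      ring.add = (\<lambda>f g x. f x \<oplus>\<^bsub>R\<^esub> g x),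
      smult = (\<lambda>c f x. c \<otimes>\<^bsub>R\<^esub> f x)\<rparr>"

text \<open>The monoid algebra \<open>RS\<close>.\<close>

definition monoid_alg ::
  "('r, 'm) ring_scheme \<Rightarrow> ('s, 'n) monoid_scheme \<Rightarrow> ('r, 's \<Rightarrow> 'r) module" where
  "monoid_alg R S = free_alg R (carrier S) \<one>\<^bsub>S\<^esub> (\<lambda>u v. basis_elem R (u \<otimes>\<^bsub>S\<^esub> v))"

text \<open>The free commutative monoid \<open>M\<^sup>c(Xs)\<close>, with monomials as multisets over \<open>Xs\<close>.\<close>

definition free_comm_monoid :: "'x set \<Rightarrow> 'x multiset monoid" where
  "free_comm_monoid Xs = \<lparr>carrier = {m. set_mset m \<subseteq> Xs}, monoid.mult = (\<lambda>u v. u + v), monoid.one = {#}\<rparr>"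

definition poly_alg :: "('r, 'm) ring_scheme \<Rightarrow> 'v set \<Rightarrow> ('r, 'v multiset \<Rightarrow> 'r) module" where
  "poly_alg R V = monoid_alg R (free_comm_monoid V)"

definition poly_var :: "('r, 'm) ring_scheme \<Rightarrow> 'v \<Rightarrow> 'v multiset \<Rightarrow> 'r" where
  "poly_var R v = basis_elem R {#v#}"

text \<open>\<open>R[V] / \<langle>\<phi> v | v \<in> V\<rangle>\<close>, where \<open>\<phi>\<close> is given as a function of the variable as an element of
  \<open>R[V]\<close>.\<close>

definition poly_quot ::
  "('r, 'm) ring_scheme \<Rightarrow> 'v set \<Rightarrow> (('v multiset \<Rightarrow> 'r) \<Rightarrow> ('v multiset \<Rightarrow> 'r))
     \<Rightarrow> ('r, ('v multiset \<Rightarrow> 'r) set) module" where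
  "poly_quot R V \<phi> =
     quot_alg (poly_alg R V) (genideal (poly_alg R V) {\<phi> (poly_var R v) | v. v \<in> V})"

text \<open>The tensor product \<open>A \<otimes>\<^sub>R B\<close>: the free module on \<open>A \<times> B\<close>, with
  \<open>(a, b) \<cdot> (a', b') = (a a', b b')\<close>, modulo the submodule of bilinearity relations (which is an
  ideal).\<close>

definition tensor_rels ::
  "('r, 'm) ring_scheme \<Rightarrow> ('r, 'a) module \<Rightarrow> ('r, 'b) module \<Rightarrow> ('a \<times> 'b \<Rightarrow> 'r) set" where
  "tensor_rels R A B =
     (let F = monoid_alg R (A \<times>\<times> B); t = (\<lambda>a b. basis_elem R (a, b)) in
        {t (a \<oplus>\<^bsub>A\<^esub> a') b \<ominus>\<^bsub>F\<^esub> (t a b \<oplus>\<^bsub>F\<^esub> t a' b) | a a' b.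
            a \<in> carrier A \<and> a' \<in> carrier A \<and> b \<in> carrier B} \<union>
        {t a (b \<oplus>\<^bsub>B\<^esub> b') \<ominus>\<^bsub>F\<^esub> (t a b \<oplus>\<^bsub>F\<^esub> t a b') | a b b'.
            a \<in> carrier A \<and> b \<in> carrier B \<and> b' \<in> carrier B} \<union>
        {t (c \<odot>\<^bsub>A\<^esub> a) b \<ominus>\<^bsub>F\<^esub> c \<odot>\<^bsub>F\<^esub> t a b | c a b.
            c \<in> carrier R \<and> a \<in> carrier A \<and> b \<in> carrier B} \<union>
        {t a (c \<odot>\<^bsub>B\<^esub> b) \<ominus>\<^bsub>F\<^esub> c \<odot>\<^bsub>F\<^esub> t a b | c a b.
            c \<in> carrier R \<and> a \<in> carrier A \<and> b \<in> carrier B})"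

definition tensor_alg ::
  "('r, 'm) ring_scheme \<Rightarrow> ('r, 'a) module \<Rightarrow> ('r, 'b) module
     \<Rightarrow> ('r, ('a \<times> 'b \<Rightarrow> 'r) set) module" where
  "tensor_alg R A B =
     (let F = monoid_alg R (A \<times>\<times> B) in quot_alg F (submodule_span R F (tensor_rels R A B)))"


section \<open>Mixable shuffle algebras and free commutative Rota--Baxter algebras\<close>

text \<open>\<open>prefix_letter R a f\<close> is \<open>a \<otimes> f\<close>, for \<open>f\<close> a linear combination of words.\<close>

definition prefix_letter ::
  "('r, 'm) ring_scheme \<Rightarrow> 'a \<Rightarrow> ('a list \<Rightarrow> 'r) \<Rightarrow> 'a list \<Rightarrow> 'r" where
  "prefix_letter R a f = (\<lambda>w. case w of [] \<Rightarrow> \<zero>\<^bsub>R\<^esub> | b # w' \<Rightarrow> if b = a then f w' else \<zero>\<^bsub>R\<^esub>)"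

text \<open>The mixable shuffle product of two words whose letters are elements of \<open>A\<close>, as a formal
  linear combination of such words.\<close>

fun mix_prod ::
  "('r, 'm) ring_scheme \<Rightarrow> 'r \<Rightarrow> ('a, 'n) monoid_scheme \<Rightarrow> 'a list \<Rightarrow> 'a list \<Rightarrow> 'a list \<Rightarrow> 'r" where
  "mix_prod R l A [] v = basis_elem R v"
| "mix_prod R l A (a # u) [] = basis_elem R (a # u)"
| "mix_prod R l A (a # u) (b # v) =
     (\<lambda>w. prefix_letter R a (mix_prod R l A u (b # v)) w \<oplus>\<^bsub>R\<^esub>
          prefix_letter R b (mix_prod R l A (a # u) v) w \<oplus>\<^bsub>R\<^esub>
          l \<otimes>\<^bsub>R\<^esub> prefix_letter R (a \<otimes>\<^bsub>A\<^esub> b) (mix_prod R l A u v) w)"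

definition words_alg ::
  "('r, 'm) ring_scheme \<Rightarrow> 'r \<Rightarrow> ('r, 'a) module \<Rightarrow> ('r, 'a list \<Rightarrow> 'r) module" where
  "words_alg R l A = free_alg R (lists (carrier A)) [] (mix_prod R l A)"

text \<open>Dividing the free module on the words over \<open>A\<close> by the submodule of multilinearity relations
  gives the direct sum of all tensor powers of \<open>A\<close>; the class of the word \<open>[a\<^sub>1, \<dots>, a\<^sub>n]\<close> is the pure
  tensor of \<open>a\<^sub>1, \<dots>, a\<^sub>n\<close>. The submodule is an ideal for the mixable shuffle product.\<close>

definition multilin_rels ::
  "('r, 'm) ring_scheme \<Rightarrow> 'r \<Rightarrow> ('r, 'a) module \<Rightarrow> ('a list \<Rightarrow> 'r) set" where
  "multilin_rels R l A =
     (let F = words_alg R l A; t = basis_elem R in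
        {t (u @ (a \<oplus>\<^bsub>A\<^esub> b) # v) \<ominus>\<^bsub>F\<^esub> (t (u @ a # v) \<oplus>\<^bsub>F\<^esub> t (u @ b # v)) | u v a b.
            u \<in> lists (carrier A) \<and> v \<in> lists (carrier A) \<and> a \<in> carrier A \<and> b \<in> carrier A} \<union>
        {t (u @ (c \<odot>\<^bsub>A\<^esub> a) # v) \<ominus>\<^bsub>F\<^esub> c \<odot>\<^bsub>F\<^esub> t (u @ a # v) | u v c a.
            u \<in> lists (carrier A) \<and> v \<in> lists (carrier A) \<and> c \<in> carrier R \<and> a \<in> carrier A})"

definition MS ::
  "('r, 'm) ring_scheme \<Rightarrow> 'r \<Rightarrow> ('r, 'a) module \<Rightarrow> ('r, ('a list \<Rightarrow> 'r) set) module" where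
  "MS R l A =
     (let F = words_alg R l A in quot_alg F (submodule_span R F (multilin_rels R l A)))"

definition Sha ::
  "('r, 'm) ring_scheme \<Rightarrow> 'r \<Rightarrow> ('r, 'a) module
     \<Rightarrow> ('r, ('a \<times> ('a list \<Rightarrow> 'r) set \<Rightarrow> 'r) set) module" where
  "Sha R l A = tensor_alg R A (MS R l A)"

text \<open>The word \<open>u\<^sub>1 \<otimes> \<dots> \<otimes> u\<^sub>r\<close> over \<open>S\<close> as an element of \<open>MS(S) = MS(RS)\<close>.\<close>

definition MS_word ::
  "('r, 'm) ring_scheme \<Rightarrow> 'r \<Rightarrow> ('s, 'n) monoid_scheme \<Rightarrow> 's list
     \<Rightarrow> (('s \<Rightarrow> 'r) list \<Rightarrow> 'r) set" where
  "MS_word R l S w =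
     (let A = monoid_alg R S; F = words_alg R l A in
        submodule_span R F (multilin_rels R l A) +>\<^bsub>F\<^esub> basis_elem R (map (basis_elem R) w))"


section \<open>Orders, Lyndon words and \<open>p\<close>-power operations on words\<close>

text \<open>Orders are reflexive relations on the carrier of \<open>S\<close>. For monomials of equal degree, the
  exponents of the largest variable in which the monomials differ decide.\<close>

definition deglex :: "'x::linorder set \<Rightarrow> 'x multiset rel" where
  "deglex Xs = {(u, v). set_mset u \<subseteq> Xs \<and> set_mset v \<subseteq> Xs \<and>
     (u = v \<or> size u < size v \<or>
      size u = size v \<and>
        (\<exists>x. count u x < count v x \<and> (\<forall>y > x. count u y = count v y)))}"

definition class_P :: "nat \<Rightarrow> ('s, 'n) monoid_scheme \<Rightarrow> 's rel \<Rightarrow> bool" where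
  "class_P p S r \<longleftrightarrow> comm_monoid S \<and> well_order_on (carrier S) r \<and>
     (\<forall>a\<in>carrier S. \<forall>b\<in>carrier S.
        (b, a) \<in> r - Id \<longrightarrow> (b [^]\<^bsub>S\<^esub> p, a [^]\<^bsub>S\<^esub> p) \<in> r - Id) \<and>
     (\<forall>a\<in>carrier S. (a, a [^]\<^bsub>S\<^esub> p) \<in> r)"

definition class_J :: "nat \<Rightarrow> ('s, 'n) monoid_scheme \<Rightarrow> 's rel \<Rightarrow> bool" where
  "class_J p S r \<longleftrightarrow> comm_monoid S \<and> well_order_on (carrier S) r \<and>
     (\<forall>g\<in>carrier S. g [^]\<^bsub>S\<^esub> (p\<^sup>2) = g [^]\<^bsub>S\<^esub> p) \<and>
     (\<forall>g1\<in>carrier S. \<forall>g2\<in>carrier S.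
        g1 [^]\<^bsub>S\<^esub> p = g1 \<and> g2 [^]\<^bsub>S\<^esub> p \<noteq> g2 \<longrightarrow> (g1, g2) \<in> r - Id)"

text \<open>\<^const>\<open>lexord\<close> of a strict order is the lexicographic order in which proper prefixes are
  smaller.\<close>

definition Lyn :: "('s, 'n) monoid_scheme \<Rightarrow> 's rel \<Rightarrow> 's list set" where
  "Lyn S r = {w \<in> lists (carrier S). w \<noteq> [] \<and>
     (\<forall>u v. w = u @ v \<and> u \<noteq> [] \<and> v \<noteq> [] \<longrightarrow> (w, v) \<in> lexord (r - Id))}"

definition letter_pow :: "nat \<Rightarrow> ('s, 'n) monoid_scheme \<Rightarrow> 's list \<Rightarrow> 's list" where
  "letter_pow p S w = map (\<lambda>g. g [^]\<^bsub>S\<^esub> p) w"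

definition word_pow :: "'s list \<Rightarrow> nat \<Rightarrow> 's list" where
  "word_pow w k = concat (replicate k w)"

definition part1 :: "nat \<Rightarrow> ('s, 'n) monoid_scheme \<Rightarrow> 's list set \<Rightarrow> 's list set" where
  "part1 p S W = {w \<in> W. letter_pow p S w = w}"

definition part2 :: "nat \<Rightarrow> ('s, 'n) monoid_scheme \<Rightarrow> 's list set \<Rightarrow> 's list set" where
  "part2 p S W = {w \<in> W. letter_pow p S w \<noteq> w}"

definition E_words :: "nat \<Rightarrow> ('s, 'n) monoid_scheme \<Rightarrow> 's list set \<Rightarrow> 's list set" where
  "E_words p S W =
     {w \<in> W. w = letter_pow p S w \<or> (\<forall>u \<in> lists (carrier S). w \<noteq> letter_pow p S u)}"

definition T_words :: "nat \<Rightarrow> 's list set \<Rightarrow> 's list set" where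
  "T_words p W = {word_pow w (p ^ i) | w i. w \<in> W}"

definition TL :: "nat \<Rightarrow> ('s, 'n) monoid_scheme \<Rightarrow> 's rel \<Rightarrow> 's list set" where
  "TL p S r = T_words p (Lyn S r)"

definition TL1 :: "nat \<Rightarrow> ('s, 'n) monoid_scheme \<Rightarrow> 's rel \<Rightarrow> 's list set" where
  "TL1 p S r = T_words p (part1 p S (Lyn S r))"

definition TL2 :: "nat \<Rightarrow> ('s, 'n) monoid_scheme \<Rightarrow> 's rel \<Rightarrow> 's list set" where
  "TL2 p S r = T_words p (part2 p S (Lyn S r))"

definition TEL :: "nat \<Rightarrow> ('s, 'n) monoid_scheme \<Rightarrow> 's rel \<Rightarrow> 's list set" where
  "TEL p S r = T_words p (E_words p S (Lyn S r))"

definition TEL2 :: "nat \<Rightarrow> ('s, 'n) monoid_scheme \<Rightarrow> 's rel \<Rightarrow> 's list set" where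
  "TEL2 p S r = T_words p (E_words p S (part2 p S (Lyn S r)))"

text \<open>The differences \<open>w - w\<^bsup>\<langle>p\<rangle>\<^esup>\<close> are formed in \<open>MS(S)\<close>, which depends on the ground ring and
  the weight.\<close>

definition TL2_tilde ::
  "('r, 'm) ring_scheme \<Rightarrow> 'r \<Rightarrow> nat \<Rightarrow> ('s, 'n) monoid_scheme \<Rightarrow> 's rel
     \<Rightarrow> (('s \<Rightarrow> 'r) list \<Rightarrow> 'r) set set" where
  "TL2_tilde R l p S r =
     {MS_word R l S w \<ominus>\<^bsub>MS R l (monoid_alg R S)\<^esub> MS_word R l S (letter_pow p S w) | w. w \<in> TL2 p S r}"


section \<open>The monoids of the statement\<close>

definition adjoin_identity :: "('g, 'n) monoid_scheme \<Rightarrow> 'g option monoid" where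
  "adjoin_identity G =
     \<lparr>carrier = insert None (Some ` carrier G),
      monoid.mult = (\<lambda>x y. case x of None \<Rightarrow> y | Some a \<Rightarrow>
                             (case y of None \<Rightarrow> x | Some b \<Rightarrow> Some (a \<otimes>\<^bsub>G\<^esub> b))),
      monoid.one = None\<rparr>"

text \<open>The direct power of \<open>G\<close> with one factor for each element of \<open>Xs\<close>
  (\<^const>\<open>product_group\<close> does not use inverses and applies to monoids).\<close>

definition monoid_power :: "('g, 'n) monoid_scheme \<Rightarrow> 'x set \<Rightarrow> ('x \<Rightarrow> 'g) monoid" where
  "monoid_power G Xs = product_group Xs (\<lambda>_. G)"

end

theory Submission
  imports Defs
begin

text \<open>Both sides of each isomorphism are compared with algebras \<open>F[V] / \<langle>v\<^sup>p - \<psi> v | v \<in> V\<rangle>\<close>, where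
  \<open>\<psi> v\<close> is zero, the identity or a variable (\<open>TP V \<psi>\<close> below). Such an algebra is determined by the
  set \<open>V\<close> with its relations, up to renaming of variables.

  The right-hand sides are of this form: a polynomial ring in \<open>x\<close> has the variables \<open>x\<^bsup>p^j\<^esup>\<close>, each
  of which is the \<open>p\<close>-th power of its predecessor, because exponents have unique expansions in base
  \<open>p\<close> (\<open>poly_alg_TP\<close>); quotients by \<open>v\<^sup>p\<close>, \<open>v\<^sup>p - v\<close> and \<open>v\<^sup>p - 1\<close> are of this form by definition
  (\<open>poly_quot_isomorphic\<close>); and a tensor product takes the disjoint union of the variables
  (\<open>tensor_TP\<close>).

  For the left-hand sides, the coefficient algebra \<open>A\<close> has a commutative monoid \<open>S\<close> of monomials as
  a basis, so that \<open>MS(A)\<close> is free on the words over \<open>S\<close>, with the mixable shuffle product of words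
  (\<open>MS_isomorphic\<close>). Since prefixing a letter is a Rota--Baxter operator, powers of a word can be
  expanded, and modulo \<open>p\<close> there remains \<open>w\<^sup>p = l\<^bsup>(p-1)|w|\<^esup> w\<^bsup>\<langle>p\<rangle>\<^esup>\<close> (\<open>pow_word_p\<close>).

  Generators are found in weight zero. Words are well-ordered by length and then lexicographically,
  and a word is called a generator if modulo \<open>p\<close> it is not a polynomial in smaller words. Products
  of generators with exponents smaller than \<open>p\<close> span by induction, as \<open>p\<close>-th powers of nonempty
  words vanish. They are independent because deleting the first letter, if it equals a given one,
  is a derivation of the shuffle product: if an element has all its derivatives in a differentially
  closed subalgebra that does not contain it, then its powers \<open>1, v, \<dots>, v\<^bsup>p-1\<^esup>\<close> are independent
  over this subalgebra (\<open>power_independent\<close>), and this applies to the subalgebras that are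
  generated by all words smaller than a given one. For weight \<open>l\<close> the product differs from the
  shuffle product by shorter words, so that the same words generate (\<open>words_isomorphic_TP\<close>), now
  with relations given by the formula for \<open>w\<^sup>p\<close>. These are \<open>w\<^sup>p = 0\<close> in weight zero and \<open>w\<^sup>p =
  w\<^bsup>\<langle>p\<rangle>\<^esup>\<close> otherwise; if all letters satisfy \<open>s\<^sup>p = 1\<close>, every generator that is not of the form \<open>1 \<otimes>
  \<dots> \<otimes> 1\<close> is replaced by its difference with the word of this form of the same length, which makes
  it nilpotent.

  It remains to count. The words \<open>s\<^bsup>\<otimes> p^i\<^esup>\<close> are generators for every letter \<open>s\<close>
  (\<open>replicate_in_gens\<close>), and they belong to the sets of words of the theorem, as single letters are
  Lyndon words. So for each kind of relation the two sets of variables are either both empty or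
  both countably infinite, and there is a bijection between them that respects the relations. In
  the second part the map \<open>w \<mapsto> w\<^bsup>\<langle>p\<rangle>\<^esup>\<close> fixes the words in the letter \<open>1\<close> and decomposes the other
  generators into infinite orbits, each of which is a polynomial variable (\<open>orbit_decomposition\<close>).\<close>

section \<open>Integral chains\<close>

text \<open>Elements of free \<open>F\<close>-algebras are functions with values in \<open>{0, \<dots>, p - 1}\<close>, so that every
  identity between them is one between residues. All computations are carried out with integral
  linear combinations of basis elements, where sums and multiples are exact, and are reduced modulo
  \<open>p\<close> only at the end.\<close>

type_synonym 'b frag = "'b \<Rightarrow>\<^sub>0 int"

definition chains :: "'b set \<Rightarrow> 'b frag set" where
  "chains B = {x. Poly_Mapping.keys x \<subseteq> B}"

definition bil :: "('a \<Rightarrow> 'b \<Rightarrow> 'c frag) \<Rightarrow> 'a frag \<Rightarrow> 'b frag \<Rightarrow> 'c frag" where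
  "bil M x y = frag_extend (\<lambda>u. frag_extend (M u) y) x"

lemma zero_chains [simp]: "0 \<in> chains B"
  by (simp add: chains_def)

lemma frag_of_chains [simp]: "frag_of u \<in> chains B \<longleftrightarrow> u \<in> B"
  by (simp add: chains_def)

lemma add_chains [simp]: "x \<in> chains B \<Longrightarrow> y \<in> chains B \<Longrightarrow> x + y \<in> chains B"
  using keys_add[of x y] by (auto simp: chains_def)

lemma diff_chains [simp]: "x \<in> chains B \<Longrightarrow> y \<in> chains B \<Longrightarrow> x - y \<in> chains B"
  using keys_diff[of x y] by (auto simp: chains_def)

lemma uminus_chains [simp]: "x \<in> chains B \<Longrightarrow> - x \<in> chains B"
  by (auto simp: chains_def)

lemma cmul_chains [simp]: "x \<in> chains B \<Longrightarrow> frag_cmul c x \<in> chains B"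
  using keys_cmul[of c x] by (auto simp: chains_def)

lemma chains_mono: "x \<in> chains B \<Longrightarrow> B \<subseteq> C \<Longrightarrow> x \<in> chains C"
  by (auto simp: chains_def)

lemma chains_UNIV [simp]: "x \<in> chains UNIV"
  by (auto simp: chains_def)

lemma frag_extend_chains:
  assumes "x \<in> chains B" "\<And>u. u \<in> B \<Longrightarrow> t u \<in> chains C"
  shows "frag_extend t x \<in> chains C"
  using keys_frag_extend[of t x] assms by (fastforce simp: chains_def)

lemma bil_chains:
  assumes "x \<in> chains A" "y \<in> chains B" "\<And>u v. u \<in> A \<Longrightarrow> v \<in> B \<Longrightarrow> M u v \<in> chains C"
  shows "bil M x y \<in> chains C"
  unfolding bil_def
  by (rule frag_extend_chains[OF assms(1)], rule frag_extend_chains[OF assms(2)], rule assms(3))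

text \<open>Closure under differences alone suffices for the step, because the chains are the additive
  group generated by the basis elements.\<close>

lemma chains_induct [consumes 1, case_names zero one diff]:
  assumes "x \<in> chains B" "P 0" "\<And>u. u \<in> B \<Longrightarrow> P (frag_of u)"
    "\<And>x y. P x \<Longrightarrow> P y \<Longrightarrow> P (x - y)"
  shows "P x"
  using assms unfolding chains_def by (auto intro: frag_induction)

text \<open>In this form, identities between multilinear expressions are reduced to identities between
  basis elements.\<close>

lemma additive_eq_on_chains:
  fixes f g :: "'b frag \<Rightarrow> 'c::ab_group_add"
  assumes "x \<in> chains B" "\<And>u. u \<in> B \<Longrightarrow> f (frag_of u) = g (frag_of u)"
    and "\<And>x y. f (x - y) = f x - f y" "\<And>x y. g (x - y) = g x - g y"
  shows "f x = g x"
  using assms(1)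
proof (induction rule: chains_induct)
  case zero
  have "f (0 - 0) = 0" "g (0 - 0) = 0" using assms(3)[of 0 0] assms(4)[of 0 0] by simp_all
  then show ?case by simp
qed (use assms in auto)

lemma bil_of [simp]: "bil M (frag_of u) (frag_of v) = M u v"
  by (simp add: bil_def)

lemma bil_zero [simp]: "bil M 0 y = 0" "bil M x 0 = 0"
  by (auto simp: bil_def intro: frag_extend_eq_0)

lemma bil_diff_left: "bil M (x - x') y = bil M x y - bil M x' y"
  by (simp add: bil_def frag_extend_diff)

lemma bil_add_left: "bil M (x + x') y = bil M x y + bil M x' y"
  by (simp add: bil_def frag_extend_add)

lemma frag_extend_fun_add:
  "frag_extend (\<lambda>u. f u + g u) x = frag_extend f x + frag_extend g x"
  unfolding frag_extend_def by (simp add: frag_cmul_distrib2 sum.distrib)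

lemma frag_extend_fun_cmul:
  "frag_extend (\<lambda>u. frag_cmul c (f u)) x = frag_cmul c (frag_extend f x)"
  unfolding frag_extend_def by (simp add: frag_cmul_sum mult.commute)

lemma frag_extend_fun_diff:
  "frag_extend (\<lambda>u. f u - g u) x = frag_extend f x - frag_extend g x"
  using frag_extend_fun_add[of f "\<lambda>u. frag_cmul (-1) (g u)" x] frag_extend_fun_cmul[of "-1" g x]
  by simp

lemma bil_diff_right: "bil M x (y - y') = bil M x y - bil M x y'"
  by (simp add: bil_def frag_extend_diff frag_extend_fun_diff)

lemma bil_add_right: "bil M x (y + y') = bil M x y + bil M x y'"
  by (simp add: bil_def frag_extend_add frag_extend_fun_add)

lemma bil_cmul_left: "bil M (frag_cmul c x) y = frag_cmul c (bil M x y)"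
  by (simp add: bil_def frag_extend_cmul)

lemma bil_cmul_right: "bil M x (frag_cmul c y) = frag_cmul c (bil M x y)"
  by (simp add: bil_def frag_extend_cmul frag_extend_fun_cmul)

lemma lookup_frag_extend:
  "Poly_Mapping.lookup (frag_extend t x) b
    = (\<Sum>u\<in>Poly_Mapping.keys x. Poly_Mapping.lookup x u * Poly_Mapping.lookup (t u) b)"
  unfolding frag_extend_def
  by (induction "Poly_Mapping.keys x" rule: infinite_finite_induct) (auto simp: lookup_sum)

section \<open>Reduction modulo a prime\<close>

locale prime_modulus =
  fixes p :: nat
  assumes p_prime: "Factorial_Ring.prime p"
begin

abbreviation F :: "int ring" where "F \<equiv> residue_ring (int p)"

lemma p_gt_1: "1 < p" "1 < int p"
proof -
  show "1 < p" by (rule prime_gt_1_nat[OF p_prime])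
  then show "1 < int p" by simp
qed

lemma cring_F: "cring F"
proof -
  interpret residues "int p" F by (unfold_locales, rule p_gt_1(2))
  show ?thesis by (rule cring)
qed

lemma F_simps [simp]:
  "carrier F = {0..int p - 1}" "\<zero>\<^bsub>F\<^esub> = 0" "\<one>\<^bsub>F\<^esub> = 1"
  "x \<otimes>\<^bsub>F\<^esub> y = (x * y) mod int p" "x \<oplus>\<^bsub>F\<^esub> y = (x + y) mod int p"
  by (simp_all add: residue_ring_def)

lemma mod_in_F [simp]: "x mod int p \<in> carrier F"
  using p_gt_1 by simp

lemma finsum_F:
  assumes "finite A" "\<And>a. a \<in> A \<Longrightarrow> f a \<in> carrier F"
  shows "finsum F f A = (\<Sum>a\<in>A. f a) mod int p"
proof -
  interpret cring F by (rule cring_F)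
  show ?thesis
    using assms
  proof (induction A rule: finite_induct)
    case (insert a A)
    have "finsum F f (insert a A) = f a \<oplus>\<^bsub>F\<^esub> finsum F f A"
      using insert by (intro finsum_insert) auto
    then show ?case using insert by (simp add: mod_simps)
  qed simp
qed

definition rd :: "'b frag \<Rightarrow> 'b \<Rightarrow> int" where
  "rd x = (\<lambda>b. Poly_Mapping.lookup x b mod int p)"

definition eqp :: "'b frag \<Rightarrow> 'b frag \<Rightarrow> bool" (infix \<open>=\<^sub>p\<close> 50) where
  "x =\<^sub>p y \<longleftrightarrow> (\<forall>b. int p dvd Poly_Mapping.lookup (x - y) b)"

lemma rd_eq_iff: "rd x = rd y \<longleftrightarrow> x =\<^sub>p y"
  by (simp add: rd_def eqp_def fun_eq_iff lookup_minus mod_eq_dvd_iff)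

text \<open>Congruence is membership of the difference in the subgroup of multiples of \<open>p\<close>, which every
  additive map preserves without any bookkeeping of coefficients.\<close>

lemma eqp_iff_cmul: "x =\<^sub>p y \<longleftrightarrow> (\<exists>z. x - y = frag_cmul (int p) z)"
proof
  assume *: "x =\<^sub>p y"
  define z where "z = Abs_poly_mapping (\<lambda>b. Poly_Mapping.lookup (x - y) b div int p)"
  have "finite {b. Poly_Mapping.lookup (x - y) b div int p \<noteq> 0}"
    by (rule finite_subset[OF _ finite_keys[of "x - y"]]) (auto simp: in_keys_iff)
  then have "Poly_Mapping.lookup z b = Poly_Mapping.lookup (x - y) b div int p" for b
    by (simp add: z_def)
  then have "x - y = frag_cmul (int p) z"
    using * by (intro poly_mapping_eqI) (simp add: eqp_def)
  then show "\<exists>z. x - y = frag_cmul (int p) z" ..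
qed (auto simp: eqp_def)

lemma eqp_refl [simp, intro]: "x =\<^sub>p x"
  by (simp add: eqp_def)

lemma eqp_sym: "x =\<^sub>p y \<Longrightarrow> y =\<^sub>p x"
  by (simp flip: rd_eq_iff)

lemma eqp_trans [trans]: "x =\<^sub>p y \<Longrightarrow> y =\<^sub>p z \<Longrightarrow> x =\<^sub>p z"
  by (simp flip: rd_eq_iff)

lemma eqp_eq_trans [trans]: "x =\<^sub>p y \<Longrightarrow> y = z \<Longrightarrow> x =\<^sub>p z" "x = y \<Longrightarrow> y =\<^sub>p z \<Longrightarrow> x =\<^sub>p z"
  by simp_all

lemma eqp_add: "x =\<^sub>p x' \<Longrightarrow> y =\<^sub>p y' \<Longrightarrow> x + y =\<^sub>p x' + y'"
  by (auto simp: rd_def fun_eq_iff lookup_add simp flip: rd_eq_iff intro: mod_add_cong)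

lemma eqp_diff: "x =\<^sub>p x' \<Longrightarrow> y =\<^sub>p y' \<Longrightarrow> x - y =\<^sub>p x' - y'"
  by (auto simp: rd_def fun_eq_iff lookup_minus simp flip: rd_eq_iff intro: mod_diff_cong)

lemma eqp_cmul: "x =\<^sub>p x' \<Longrightarrow> frag_cmul c x =\<^sub>p frag_cmul c x'"
  by (auto simp: eqp_def lookup_minus simp flip: right_diff_distrib)

lemma eqp_minus: "x =\<^sub>p x' \<Longrightarrow> - x =\<^sub>p - x'"
  using eqp_cmul[of x x' "-1"] by simp

lemma eqp_sum: "(\<And>i. i \<in> I \<Longrightarrow> f i =\<^sub>p g i) \<Longrightarrow> sum f I =\<^sub>p sum g I"
  by (induction I rule: infinite_finite_induct) (auto intro: eqp_add)

lemma p_cmul_eqp: "frag_cmul (int p) x =\<^sub>p 0"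
  by (simp add: eqp_def)

lemma cmul_mod_eqp: "frag_cmul (c mod int p) x =\<^sub>p frag_cmul c x"
  unfolding eqp_def by (simp add: lookup_minus mod_eq_dvd_iff[symmetric] mod_simps)

lemma eqp_0_iff: "x =\<^sub>p 0 \<longleftrightarrow> (\<forall>b. int p dvd Poly_Mapping.lookup x b)"
  by (simp add: eqp_def)

lemma eqp_diff_0_iff: "x - y =\<^sub>p 0 \<longleftrightarrow> x =\<^sub>p y"
  by (simp add: eqp_def)

lemma frag_extend_eqp: "x =\<^sub>p y \<Longrightarrow> frag_extend t x =\<^sub>p frag_extend t y"
  unfolding eqp_iff_cmul by (metis frag_extend_cmul frag_extend_diff)

lemma frag_extend_fun_eqp:
  assumes "x \<in> chains B" "\<And>u. u \<in> B \<Longrightarrow> t u =\<^sub>p t' u"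
  shows "frag_extend t x =\<^sub>p frag_extend t' x"
  unfolding frag_extend_def using assms by (intro eqp_sum eqp_cmul) (auto simp: chains_def)

lemma bil_eqp: "x =\<^sub>p x' \<Longrightarrow> y =\<^sub>p y' \<Longrightarrow> bil M x y =\<^sub>p bil M x' y'"
proof -
  assume "x =\<^sub>p x'" "y =\<^sub>p y'"
  then have "bil M x y =\<^sub>p bil M x' y"
    by (simp add: bil_def frag_extend_eqp)
  also have "bil M x' y =\<^sub>p bil M x' y'"
    unfolding bil_def by (rule frag_extend_fun_eqp[of _ UNIV]) (auto intro: frag_extend_eqp \<open>y =\<^sub>p y'\<close>)
  finally show ?thesis .
qed

lemma additive_eqp_on_chains:
  assumes "x \<in> chains B" "\<And>u. u \<in> B \<Longrightarrow> f (frag_of u) =\<^sub>p g (frag_of u)"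
    and "\<And>x y. f (x - y) = f x - f y" "\<And>x y. g (x - y) = g x - g y"
  shows "f x =\<^sub>p g x"
  using assms(1)
proof (induction rule: chains_induct)
  case zero
  have "f (0 - 0) = 0" "g (0 - 0) = 0" using assms(3)[of 0 0] assms(4)[of 0 0] by simp_all
  then show ?case by simp
qed (use assms in \<open>auto intro: eqp_diff\<close>)

lemma rd_frag_of: "rd (frag_of b) = basis_elem F b"
  using p_gt_1 by (auto simp: rd_def basis_elem_def)

lemma rd_zero: "rd 0 = (\<lambda>_. 0)"
  by (simp add: rd_def)

section \<open>Algebra isomorphisms\<close>

text \<open>\<open>realizes A B mul e \<pi>\<close>: the algebra \<open>A\<close> is the image of the integral chains on \<open>B\<close> under a
  map that respects all operations. Two algebras that are realized by the same chains with the same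
  kernel are isomorphic.\<close>

definition realizes ::
  "(int, 'a) module \<Rightarrow> 'b set \<Rightarrow> ('b frag \<Rightarrow> 'b frag \<Rightarrow> 'b frag) \<Rightarrow> 'b frag \<Rightarrow> ('b frag \<Rightarrow> 'a) \<Rightarrow> bool" where
  "realizes A B mul e \<pi> \<longleftrightarrow>
     \<pi> ` chains B = carrier A \<and> e \<in> chains B \<and> \<pi> e = \<one>\<^bsub>A\<^esub> \<and> \<pi> 0 = \<zero>\<^bsub>A\<^esub> \<and>
     (\<forall>x\<in>chains B. \<forall>y\<in>chains B.
        mul x y \<in> chains B \<and> \<pi> (x + y) = \<pi> x \<oplus>\<^bsub>A\<^esub> \<pi> y \<and> \<pi> (mul x y) = \<pi> x \<otimes>\<^bsub>A\<^esub> \<pi> y) \<and>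
     (\<forall>c\<in>carrier F. \<forall>x\<in>chains B. \<pi> (frag_cmul c x) = c \<odot>\<^bsub>A\<^esub> \<pi> x)"

lemma realizesD:
  assumes "realizes A B mul e \<pi>"
  shows "\<pi> ` chains B = carrier A" "e \<in> chains B" "\<pi> e = \<one>\<^bsub>A\<^esub>" "\<pi> 0 = \<zero>\<^bsub>A\<^esub>"
    "x \<in> chains B \<Longrightarrow> \<pi> x \<in> carrier A"
    "x \<in> chains B \<Longrightarrow> y \<in> chains B \<Longrightarrow> mul x y \<in> chains B"
    "x \<in> chains B \<Longrightarrow> y \<in> chains B \<Longrightarrow> \<pi> (x + y) = \<pi> x \<oplus>\<^bsub>A\<^esub> \<pi> y"
    "x \<in> chains B \<Longrightarrow> y \<in> chains B \<Longrightarrow> \<pi> (mul x y) = \<pi> x \<otimes>\<^bsub>A\<^esub> \<pi> y"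
    "c \<in> carrier F \<Longrightarrow> x \<in> chains B \<Longrightarrow> \<pi> (frag_cmul c x) = c \<odot>\<^bsub>A\<^esub> \<pi> x"
  using assms unfolding realizes_def by (blast, blast, blast, blast, blast, blast, blast, blast, blast)

text \<open>The isomorphism sends \<open>\<rho> x\<close> to \<open>\<pi> x\<close>. It transports the ring and module laws of \<open>N\<close> to \<open>A\<close>,
  which typically is a quotient with inconvenient operations.\<close>

lemma alg_isomorphic_if_same_kernel:
  assumes A: "realizes A B mul e \<pi>" and N: "realizes N B mul e \<rho>" and "algebra F N"
    and ker: "\<And>x y. x \<in> chains B \<Longrightarrow> y \<in> chains B \<Longrightarrow> \<pi> x = \<pi> y \<longleftrightarrow> \<rho> x = \<rho> y"
  shows "alg_isomorphic F A N"
proof -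
  interpret N: algebra F N by fact
  note m_closed = monoid.m_closed[OF ring.is_monoid[OF cring.axioms(1)[OF N.M_cring]]]
  note a = realizesD[OF A] and n = realizesD[OF N]
  define g where "g b = \<pi> (SOME x. x \<in> chains B \<and> \<rho> x = b)" for b
  have g: "g (\<rho> x) = \<pi> x" if "x \<in> chains B" for x
    unfolding g_def
    by (rule someI2[where a = x]) (use that ker in auto)
  have N_ex: "\<exists>x\<in>chains B. b = \<rho> x" if "b \<in> carrier N" for b
    using that n(1) by blast
  have A_ex: "\<exists>x\<in>chains B. a = \<pi> x" if "a \<in> carrier A" for a
    using that a(1) by blast
  have g_closed: "g b \<in> carrier A" if b: "b \<in> carrier N" for b
  proof -
    obtain x where x: "x \<in> chains B" "b = \<rho> x" using N_ex[OF b] by blast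
    show ?thesis using g[OF x(1)] a(5)[OF x(1)] x(2) by simp
  qed
  have iso: "g \<in> ring_iso N A"
  proof (rule ring_iso_memI)
    show "bij_betw g (carrier N) (carrier A)"
    proof (rule bij_betwI')
      fix b c assume "b \<in> carrier N" "c \<in> carrier N"
      then obtain x y where xy: "x \<in> chains B" "y \<in> chains B" "b = \<rho> x" "c = \<rho> y"
        using N_ex by metis
      then show "(g b = g c) = (b = c)" using g[OF xy(1)] g[OF xy(2)] ker[OF xy(1,2)] by simp
    next
      fix b assume "b \<in> carrier N" then show "g b \<in> carrier A" by (rule g_closed)
    next
      fix y assume "y \<in> carrier A"
      then obtain x where x: "x \<in> chains B" "y = \<pi> x" using A_ex by blast
      then show "\<exists>x\<in>carrier N. y = g x" using g[OF x(1)] n(5)[OF x(1)] by force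
    qed
  next
    fix b assume "b \<in> carrier N" then show "g b \<in> carrier A" by (rule g_closed)
  next
    fix b c assume "b \<in> carrier N" "c \<in> carrier N"
    then obtain x y where xy: "x \<in> chains B" "y \<in> chains B" "b = \<rho> x" "c = \<rho> y"
      using N_ex by metis
    show "g (b \<otimes>\<^bsub>N\<^esub> c) = g b \<otimes>\<^bsub>A\<^esub> g c"
      using g[OF n(6)[OF xy(1,2)]] g[OF xy(1)] g[OF xy(2)] a(8)[OF xy(1,2)] n(8)[OF xy(1,2)] xy(3,4)
      by simp
    show "g (b \<oplus>\<^bsub>N\<^esub> c) = g b \<oplus>\<^bsub>A\<^esub> g c"
      using g[OF add_chains[OF xy(1,2)]] g[OF xy(1)] g[OF xy(2)] a(7)[OF xy(1,2)] n(7)[OF xy(1,2)]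
        xy(3,4) by simp
  next
    show "g \<one>\<^bsub>N\<^esub> = \<one>\<^bsub>A\<^esub>" using g[of e] a n by simp
  qed
  have zero: "g \<zero>\<^bsub>N\<^esub> = \<zero>\<^bsub>A\<^esub>" using g[of 0] a n by simp
  \<comment> \<open>The image of a ring under an isomorphism has the image of zero as its zero, which has to be
      identified with the zero of \<open>A\<close>.\<close>
  have "cring (A\<lparr>ring.zero := g \<zero>\<^bsub>N\<^esub>\<rparr>)"
    by (rule cring.ring_iso_imp_img_cring[OF N.M_cring iso])
  moreover have "A\<lparr>ring.zero := g \<zero>\<^bsub>N\<^esub>\<rparr> = A"
    unfolding zero by simp
  ultimately have cA: "cring A" by simp
  have smult: "g (c \<odot>\<^bsub>N\<^esub> b) = c \<odot>\<^bsub>A\<^esub> g b" if cb: "c \<in> carrier F" "b \<in> carrier N" for b c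
  proof -
    obtain x where x: "x \<in> chains B" "b = \<rho> x" using N_ex[OF cb(2)] by blast
    show ?thesis
      using g[OF cmul_chains[OF x(1)], of c] g[OF x(1)] a(9)[OF that(1) x(1)] n(9)[OF that(1) x(1)] x(2)
      by simp
  qed
  note hom = smult ring_iso_memE[OF iso]
  have A_ex': "\<exists>b\<in>carrier N. a = g b" if "a \<in> carrier A" for a
    using ring_iso_memE(5)[OF iso] that by (auto simp: bij_betw_def)
  have "algebra F A"
  proof (rule algebraI)
    fix a b x assume ab: "a \<in> carrier F" "b \<in> carrier F" and x: "x \<in> carrier A"
    obtain y where y: "y \<in> carrier N" "x = g y" using A_ex'[OF x] by blast
    show "a \<odot>\<^bsub>A\<^esub> x \<in> carrier A"
      using g_closed[OF N.smult_closed[OF ab(1) y(1)]] smult[OF ab(1) y(1)] y(2) by simp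
    have "g ((a \<oplus>\<^bsub>F\<^esub> b) \<odot>\<^bsub>N\<^esub> y) = (a \<oplus>\<^bsub>F\<^esub> b) \<odot>\<^bsub>A\<^esub> x"
      unfolding y by (rule smult) (use ab y N.R.a_closed in blast)+
    moreover have "g ((a \<oplus>\<^bsub>F\<^esub> b) \<odot>\<^bsub>N\<^esub> y) = a \<odot>\<^bsub>A\<^esub> x \<oplus>\<^bsub>A\<^esub> b \<odot>\<^bsub>A\<^esub> x"
      using hom(4)[OF N.smult_closed[OF ab(1) y(1)] N.smult_closed[OF ab(2) y(1)]]
        smult[OF ab(1) y(1)] smult[OF ab(2) y(1)] N.smult_l_distr[OF ab y(1)] y(2) by simp
    ultimately show "(a \<oplus>\<^bsub>F\<^esub> b) \<odot>\<^bsub>A\<^esub> x = a \<odot>\<^bsub>A\<^esub> x \<oplus>\<^bsub>A\<^esub> b \<odot>\<^bsub>A\<^esub> x" by simp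
    have "g ((a \<otimes>\<^bsub>F\<^esub> b) \<odot>\<^bsub>N\<^esub> y) = (a \<otimes>\<^bsub>F\<^esub> b) \<odot>\<^bsub>A\<^esub> x"
      unfolding y by (rule smult) (use ab y N.R.m_closed in blast)+
    moreover have "g ((a \<otimes>\<^bsub>F\<^esub> b) \<odot>\<^bsub>N\<^esub> y) = a \<odot>\<^bsub>A\<^esub> (b \<odot>\<^bsub>A\<^esub> x)"
      using smult[OF ab(1) N.smult_closed[OF ab(2) y(1)]] smult[OF ab(2) y(1)]
        N.smult_assoc1[OF ab y(1)] y(2) by simp
    ultimately show "(a \<otimes>\<^bsub>F\<^esub> b) \<odot>\<^bsub>A\<^esub> x = a \<odot>\<^bsub>A\<^esub> (b \<odot>\<^bsub>A\<^esub> x)" by simp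
  next
    fix a x y assume a: "a \<in> carrier F" and xy: "x \<in> carrier A" "y \<in> carrier A"
    obtain x' y' where y: "x' \<in> carrier N" "x = g x'" "y' \<in> carrier N" "y = g y'"
      using A_ex' xy by metis
    show "a \<odot>\<^bsub>A\<^esub> (x \<oplus>\<^bsub>A\<^esub> y) = a \<odot>\<^bsub>A\<^esub> x \<oplus>\<^bsub>A\<^esub> a \<odot>\<^bsub>A\<^esub> y"
      using smult[OF a N.M.a_closed[OF y(1,3)]] smult[OF a y(1)] smult[OF a y(3)]
        hom(4)[OF y(1,3)] hom(4)[OF N.smult_closed[OF a y(1)] N.smult_closed[OF a y(3)]]
        N.smult_r_distr[OF a y(1,3)] y(2,4) by simp
    show "a \<odot>\<^bsub>A\<^esub> x \<otimes>\<^bsub>A\<^esub> y = a \<odot>\<^bsub>A\<^esub> (x \<otimes>\<^bsub>A\<^esub> y)"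
      using smult[OF a m_closed[OF y(1,3)]] smult[OF a y(1)]
        hom(3)[OF y(1,3)] hom(3)[OF N.smult_closed[OF a y(1)] y(3)]
        N.smult_assoc2[OF a y(1,3)] y(2,4) by simp
  next
    fix x assume x: "x \<in> carrier A"
    obtain y where y: "y \<in> carrier N" "x = g y" using A_ex'[OF x] by blast
    show "\<one>\<^bsub>F\<^esub> \<odot>\<^bsub>A\<^esub> x = x" using y smult[OF N.R.one_closed y(1)] N.smult_one[OF y(1)] by simp
  qed (use cring_F cA in auto)
  moreover have "inv_into (carrier N) g \<in> ring_iso A N"
    by (rule ring_iso_set_sym[OF cring.axioms(1)[OF N.M_cring] iso])
  moreover have "inv_into (carrier N) g (c \<odot>\<^bsub>A\<^esub> a) = c \<odot>\<^bsub>N\<^esub> inv_into (carrier N) g a"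
    if ca: "c \<in> carrier F" "a \<in> carrier A" for a c
  proof -
    obtain b where b: "b \<in> carrier N" "a = g b" using A_ex'[OF ca(2)] by blast
    have inj: "inj_on g (carrier N)" using ring_iso_memE(5)[OF iso] by (simp add: bij_betw_def)
    show ?thesis
      unfolding b(2) smult[OF that(1) b(1), symmetric]
      using inv_into_f_f[OF inj b(1)] inv_into_f_f[OF inj N.smult_closed[OF that(1) b(1)]] by simp
  qed
  ultimately show ?thesis
    unfolding alg_isomorphic_def using \<open>algebra F N\<close> by blast
qed

lemma alg_isomorphic_sym:
  assumes "alg_isomorphic F A N"
  shows "alg_isomorphic F N A"
proof -
  obtain h where alg: "algebra F A" "algebra F N" and h: "h \<in> ring_iso A N"
    and sm: "\<And>c a. c \<in> carrier F \<Longrightarrow> a \<in> carrier A \<Longrightarrow> h (c \<odot>\<^bsub>A\<^esub> a) = c \<odot>\<^bsub>N\<^esub> h a"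
    using assms unfolding alg_isomorphic_def by blast
  interpret A: algebra F A by fact
  have bij: "bij_betw h (carrier A) (carrier N)" by (rule ring_iso_memE(5)[OF h])
  have "inv_into (carrier A) h (c \<odot>\<^bsub>N\<^esub> b) = c \<odot>\<^bsub>A\<^esub> inv_into (carrier A) h b"
    if cb: "c \<in> carrier F" "b \<in> carrier N" for b c
  proof -
    obtain a where a: "a \<in> carrier A" "b = h a"
      using bij_betw_imp_surj_on[OF bij] cb(2) by blast
    show ?thesis unfolding a(2) sm[OF that(1) a(1), symmetric]
      using inv_into_f_f[OF bij_betw_imp_inj_on[OF bij] a(1)]
        inv_into_f_f[OF bij_betw_imp_inj_on[OF bij] A.smult_closed[OF that(1) a(1)]] by simp
  qed
  then show ?thesis
    unfolding alg_isomorphic_def using alg ring_iso_set_sym[OF cring.axioms(1)[OF A.M_cring] h] by blast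
qed

lemma alg_isomorphic_trans [trans]:
  assumes "alg_isomorphic F A N" "alg_isomorphic F N L"
  shows "alg_isomorphic F A L"
proof -
  obtain h k where alg: "algebra F A" "algebra F N" "algebra F L"
    and h: "h \<in> ring_iso A N" and k: "k \<in> ring_iso N L"
    and sm: "\<And>c a. c \<in> carrier F \<Longrightarrow> a \<in> carrier A \<Longrightarrow> h (c \<odot>\<^bsub>A\<^esub> a) = c \<odot>\<^bsub>N\<^esub> h a"
      "\<And>c a. c \<in> carrier F \<Longrightarrow> a \<in> carrier N \<Longrightarrow> k (c \<odot>\<^bsub>N\<^esub> a) = c \<odot>\<^bsub>L\<^esub> k a"
    using assms unfolding alg_isomorphic_def by blast
  show ?thesis
    unfolding alg_isomorphic_def
  proof (intro conjI bexI[of _ "k \<circ> h"] ballI)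
    fix c a assume *: "c \<in> carrier F" "a \<in> carrier A"
    show "(k \<circ> h) (c \<odot>\<^bsub>A\<^esub> a) = c \<odot>\<^bsub>L\<^esub> (k \<circ> h) a"
      using sm(1)[OF *] sm(2)[OF *(1) ring_iso_memE(1)[OF h *(2)]] by simp
  qed (use alg ring_iso_set_trans[OF h k] in blast)+
qed

lemma alg_isomorphic_refl: "algebra F A \<Longrightarrow> alg_isomorphic F A A"
  unfolding alg_isomorphic_def using ring_iso_set_refl[of A] by (auto intro!: bexI[of _ id])

end

section \<open>Free modules with a bilinear product\<close>

context prime_modulus
begin

text \<open>The structure constants \<open>\<mu>\<close> modulo \<open>p\<close> are lifted to integral ones \<open>M\<close>. The product of the
  free algebra is then the reduction of the bilinear extension of \<open>M\<close>.\<close>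

definition lifts ::
  "'b set \<Rightarrow> 'b \<Rightarrow> ('b \<Rightarrow> 'b \<Rightarrow> 'b \<Rightarrow> int) \<Rightarrow> ('b \<Rightarrow> 'b \<Rightarrow> 'b frag) \<Rightarrow> bool" where
  "lifts B e \<mu> M \<longleftrightarrow> e \<in> B \<and> (\<forall>u\<in>B. \<forall>v\<in>B. M u v \<in> chains B \<and> rd (M u v) = \<mu> u v)"

lemma liftsD:
  assumes "lifts B e \<mu> M"
  shows "e \<in> B" "u \<in> B \<Longrightarrow> v \<in> B \<Longrightarrow> M u v \<in> chains B"
    "u \<in> B \<Longrightarrow> v \<in> B \<Longrightarrow> rd (M u v) = \<mu> u v"
    "x \<in> chains B \<Longrightarrow> y \<in> chains B \<Longrightarrow> bil M x y \<in> chains B"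
  using assms unfolding lifts_def by (auto intro: bil_chains)

lemma free_alg_simps:
  "carrier (free_alg F B e \<mu>)
    = {f. (\<forall>x\<in>B. f x \<in> carrier F) \<and> (\<forall>x. x \<notin> B \<longrightarrow> f x = 0) \<and> finite {x. f x \<noteq> 0}}"
  "\<one>\<^bsub>free_alg F B e \<mu>\<^esub> = basis_elem F e" "\<zero>\<^bsub>free_alg F B e \<mu>\<^esub> = (\<lambda>_. 0)"
  "f \<oplus>\<^bsub>free_alg F B e \<mu>\<^esub> g = (\<lambda>x. (f x + g x) mod int p)"
  "c \<odot>\<^bsub>free_alg F B e \<mu>\<^esub> f = (\<lambda>x. (c * f x) mod int p)"
  by (simp_all add: free_alg_def)

lemma rd_in_carrier: "x \<in> chains B \<Longrightarrow> rd x \<in> carrier (free_alg F B e \<mu>)"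
proof -
  assume x: "x \<in> chains B"
  have "finite {b. rd x b \<noteq> 0}"
    by (rule finite_subset[OF _ finite_keys[of x]]) (auto simp: rd_def in_keys_iff)
  moreover have "rd x b = 0" if "b \<notin> B" for b
  proof -
    have "b \<notin> Poly_Mapping.keys x" using x that by (auto simp: chains_def)
    then show ?thesis by (simp add: rd_def in_keys_iff)
  qed
  moreover have "rd x b \<in> carrier F" for b unfolding rd_def by (rule mod_in_F)
  ultimately show ?thesis unfolding free_alg_simps by blast
qed

lemma carrier_rd:
  assumes "f \<in> carrier (free_alg F B e \<mu>)"
  shows "\<exists>x\<in>chains B. f = rd x"
proof
  have fin: "finite {x. f x \<noteq> 0}" using assms by (simp add: free_alg_simps)
  then have l: "Poly_Mapping.lookup (Abs_poly_mapping f) = f" by simp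
  show "Abs_poly_mapping f \<in> chains B"
  proof -
    have "b \<in> B" if "b \<in> Poly_Mapping.keys (Abs_poly_mapping f)" for b
    proof (rule ccontr)
      assume "b \<notin> B"
      then have "f b = 0" using assms by (simp add: free_alg_simps)
      then show False using that l by (simp add: in_keys_iff)
    qed
    then show ?thesis by (auto simp: chains_def)
  qed
  show "f = rd (Abs_poly_mapping f)"
  proof
    fix b show "f b = rd (Abs_poly_mapping f) b"
    proof (cases "b \<in> B")
      case True
      then have "f b \<in> {0..int p - 1}" using assms by (simp add: free_alg_simps)
      then show ?thesis by (simp add: rd_def l)
    next
      case False
      then have "f b = 0" using assms by (simp add: free_alg_simps)
      then show ?thesis by (simp add: rd_def l)
    qed
  qed
qed

lemma rd_image_chains: "rd ` chains B = carrier (free_alg F B e \<mu>)"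
proof (intro equalityI subsetI)
  fix f assume "f \<in> rd ` chains B"
  then obtain x where "x \<in> chains B" "f = rd x" by (rule imageE)
  then show "f \<in> carrier (free_alg F B e \<mu>)" by (simp only: rd_in_carrier)
next
  fix f assume "f \<in> carrier (free_alg F B e \<mu>)"
  then obtain x where "x \<in> chains B" "f = rd x" by (rule carrier_rd[THEN bexE])
  then show "f \<in> rd ` chains B" by (simp only: imageI)
qed

lemma rd_add: "rd (x + y) = rd x \<oplus>\<^bsub>free_alg F B e \<mu>\<^esub> rd y"
  by (auto simp: rd_def free_alg_simps lookup_add mod_simps)

lemma rd_cmul: "rd (frag_cmul c x) = c \<odot>\<^bsub>free_alg F B e \<mu>\<^esub> rd x"
  by (auto simp: rd_def free_alg_simps mod_simps)

lemma rd_zero': "rd 0 = \<zero>\<^bsub>free_alg F B e \<mu>\<^esub>"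
  by (simp add: rd_zero free_alg_simps)

lemma lookup_bil:
  "Poly_Mapping.lookup (bil M x y) b
    = (\<Sum>(u, v)\<in>Poly_Mapping.keys x \<times> Poly_Mapping.keys y.
        Poly_Mapping.lookup x u * Poly_Mapping.lookup y v * Poly_Mapping.lookup (M u v) b)"
  unfolding bil_def lookup_frag_extend
  by (simp add: sum_distrib_left mult.assoc flip: sum.cartesian_product)

text \<open>The product in \<^const>\<open>free_alg\<close> sums over the supports of the reduced coefficients, the bilinear
  extension over the possibly larger supports of the integral ones; the additional terms vanish
  modulo \<open>p\<close>.\<close>

lemma rd_bil:
  assumes "lifts B e \<mu> M" and x: "x \<in> chains B" and y: "y \<in> chains B"
  shows "rd (bil M x y) = rd x \<otimes>\<^bsub>free_alg F B e \<mu>\<^esub> rd y"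
proof
  fix b
  let ?X = "{u. rd x u \<noteq> 0}" and ?Y = "{u. rd y u \<noteq> 0}"
  have sub: "?X \<subseteq> Poly_Mapping.keys x" "?Y \<subseteq> Poly_Mapping.keys y"
    by (auto simp: rd_def in_keys_iff)
  then have fin: "finite ?X" "finite ?Y"
    using finite_subset[OF _ finite_keys] by blast+
  have "(rd x \<otimes>\<^bsub>free_alg F B e \<mu>\<^esub> rd y) b
      = finsum F (\<lambda>(u, v). ((rd x u * rd y v) mod int p * \<mu> u v b) mod int p) (?X \<times> ?Y)"
    by (simp add: free_alg_def)
  also have "\<dots> = (\<Sum>(u, v)\<in>?X \<times> ?Y. ((rd x u * rd y v) mod int p * \<mu> u v b) mod int p) mod int p"
    by (subst finsum_F) (use fin mod_in_F in \<open>auto simp del: F_simps\<close>)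
  also have "\<dots> = (\<Sum>(u, v)\<in>Poly_Mapping.keys x \<times> Poly_Mapping.keys y.
      ((rd x u * rd y v) mod int p * \<mu> u v b) mod int p) mod int p"
    using sub by (subst sum.mono_neutral_left[of "Poly_Mapping.keys x \<times> Poly_Mapping.keys y"]) auto
  also have "\<dots> = (\<Sum>(u, v)\<in>Poly_Mapping.keys x \<times> Poly_Mapping.keys y.
      (Poly_Mapping.lookup x u * Poly_Mapping.lookup y v * Poly_Mapping.lookup (M u v) b) mod int p) mod int p"
  proof -
    have "((rd x u * rd y v) mod int p * \<mu> u v b) mod int p
        = (Poly_Mapping.lookup x u * Poly_Mapping.lookup y v * Poly_Mapping.lookup (M u v) b) mod int p"
      if "u \<in> Poly_Mapping.keys x" "v \<in> Poly_Mapping.keys y" for u v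
    proof -
      have "u \<in> B" "v \<in> B" using that x y by (auto simp: chains_def)
      then have "\<mu> u v b = Poly_Mapping.lookup (M u v) b mod int p"
        using liftsD(3)[OF assms(1), symmetric] by (simp add: rd_def)
      then show ?thesis by (simp add: rd_def mod_simps)
    qed
    then show ?thesis by (intro arg_cong[of _ _ "\<lambda>z. z mod int p"] sum.cong) auto
  qed
  also have "\<dots> = rd (bil M x y) b"
    unfolding rd_def lookup_bil by (subst (2) mod_sum_eq[symmetric]) (simp add: case_prod_unfold)
  finally show "rd (bil M x y) b = (rd x \<otimes>\<^bsub>free_alg F B e \<mu>\<^esub> rd y) b" by simp
qed

lemma realizes_free_alg:
  assumes "lifts B e \<mu> M"
  shows "realizes (free_alg F B e \<mu>) B (bil M) (frag_of e) rd"
  unfolding realizes_def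
  using assms rd_image_chains[of B e \<mu>]
  by (auto simp: liftsD rd_bil[OF assms] rd_add[of _ _ B e \<mu>] rd_cmul[of _ _ B e \<mu>] rd_frag_of
      free_alg_simps(2) rd_zero'[of B e \<mu>] simp del: F_simps)

lemma module_free_alg: "module F (free_alg F B e \<mu>)" (is "module F ?G")
proof (rule moduleI)
  note ex = carrier_rd[of _ B e \<mu>] and ops = rd_add[of _ _ B e \<mu>, symmetric] rd_cmul[of _ _ B e \<mu>, symmetric]
    rd_zero'[of B e \<mu>, symmetric]
  have closed: "x \<in> chains B \<Longrightarrow> rd x \<in> carrier ?G" for x by (rule rd_in_carrier)
  show "abelian_group ?G"
  proof (rule abelian_groupI)
    fix f assume "f \<in> carrier ?G"
    then obtain x where x: "x \<in> chains B" "f = rd x" using ex by blast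
    have "rd (- x) \<oplus>\<^bsub>?G\<^esub> f = \<zero>\<^bsub>?G\<^esub>" using x by (simp add: ops)
    then show "\<exists>g\<in>carrier ?G. g \<oplus>\<^bsub>?G\<^esub> f = \<zero>\<^bsub>?G\<^esub>"
      using x closed uminus_chains by blast
    show "\<zero>\<^bsub>?G\<^esub> \<oplus>\<^bsub>?G\<^esub> f = f" using x by (simp add: ops)
  next
    fix f g assume "f \<in> carrier ?G" "g \<in> carrier ?G"
    then obtain x y where x: "x \<in> chains B" "f = rd x" "y \<in> chains B" "g = rd y" using ex by meson
    show "f \<oplus>\<^bsub>?G\<^esub> g \<in> carrier ?G" using x by (simp add: ops closed)
    show "f \<oplus>\<^bsub>?G\<^esub> g = g \<oplus>\<^bsub>?G\<^esub> f" using x by (simp add: ops add.commute)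
    fix h assume "h \<in> carrier ?G"
    then obtain z where z: "z \<in> chains B" "h = rd z" using ex by meson
    show "(f \<oplus>\<^bsub>?G\<^esub> g) \<oplus>\<^bsub>?G\<^esub> h = f \<oplus>\<^bsub>?G\<^esub> (g \<oplus>\<^bsub>?G\<^esub> h)" using x z by (simp add: ops add.assoc)
  next
    show "\<zero>\<^bsub>?G\<^esub> \<in> carrier ?G" by (simp add: ops closed)
  qed
  fix f assume "f \<in> carrier ?G"
  then obtain x where x: "x \<in> chains B" "f = rd x" using ex by blast
  show "\<one>\<^bsub>F\<^esub> \<odot>\<^bsub>?G\<^esub> f = f" using x by (simp add: ops)
  fix a assume a: "a \<in> carrier F"
  show "a \<odot>\<^bsub>?G\<^esub> f \<in> carrier ?G" using x by (simp add: ops closed)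
  fix b
  show "(a \<oplus>\<^bsub>F\<^esub> b) \<odot>\<^bsub>?G\<^esub> f = a \<odot>\<^bsub>?G\<^esub> f \<oplus>\<^bsub>?G\<^esub> b \<odot>\<^bsub>?G\<^esub> f"
    using x cmul_mod_eqp by (simp add: ops frag_cmul_distrib[symmetric] rd_eq_iff)
  show "(a \<otimes>\<^bsub>F\<^esub> b) \<odot>\<^bsub>?G\<^esub> f = a \<odot>\<^bsub>?G\<^esub> (b \<odot>\<^bsub>?G\<^esub> f)"
    using x cmul_mod_eqp by (simp add: ops rd_eq_iff)
next
  note ex = carrier_rd[of _ B e \<mu>] and ops = rd_add[of _ _ B e \<mu>, symmetric] rd_cmul[of _ _ B e \<mu>, symmetric]
  fix a f g assume "f \<in> carrier ?G" "g \<in> carrier ?G"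
  then obtain x y where x: "x \<in> chains B" "f = rd x" "y \<in> chains B" "g = rd y" using ex by meson
  show "a \<odot>\<^bsub>?G\<^esub> (f \<oplus>\<^bsub>?G\<^esub> g) = a \<odot>\<^bsub>?G\<^esub> f \<oplus>\<^bsub>?G\<^esub> a \<odot>\<^bsub>?G\<^esub> g"
    using x by (simp add: ops frag_cmul_distrib2)
qed (rule cring_F)

lemma algebra_free_alg:
  assumes L: "lifts B e \<mu> M"
    and comm: "\<And>u v. u \<in> B \<Longrightarrow> v \<in> B \<Longrightarrow> M u v = M v u"
    and assoc: "\<And>u v w. u \<in> B \<Longrightarrow> v \<in> B \<Longrightarrow> w \<in> B \<Longrightarrow>
      bil M (M u v) (frag_of w) = bil M (frag_of u) (M v w)"
    and unit: "\<And>u. u \<in> B \<Longrightarrow> M e u = frag_of u"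
  shows "algebra F (free_alg F B e \<mu>)" (is "algebra F ?G")
proof -
  have c: "bil M x y = bil M y x" if x: "x \<in> chains B" and y: "y \<in> chains B" for x y
    by (rule additive_eq_on_chains[OF x], rule additive_eq_on_chains[OF y])
      (auto simp: comm bil_diff_left bil_diff_right)
  have a: "bil M (bil M x y) z = bil M x (bil M y z)"
    if x: "x \<in> chains B" and y: "y \<in> chains B" and z: "z \<in> chains B" for x y z
    by (rule additive_eq_on_chains[OF x], rule additive_eq_on_chains[OF y], rule additive_eq_on_chains[OF z])
      (auto simp: assoc bil_diff_left bil_diff_right)
  have u: "bil M (frag_of e) x = x" if x: "x \<in> chains B" for x
    by (rule additive_eq_on_chains[OF x]) (auto simp: unit bil_diff_right)
  interpret G: module F ?G by (rule module_free_alg)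
  have e: "frag_of e \<in> chains B" using liftsD(1)[OF L] by simp
  note ex = carrier_rd[of _ B e \<mu>] and ops = rd_add[of _ _ B e \<mu>, symmetric] rd_cmul[of _ _ B e \<mu>, symmetric]
    rd_bil[OF L, symmetric]
  have one: "\<one>\<^bsub>?G\<^esub> = rd (frag_of e)" by (simp add: rd_frag_of free_alg_simps)
  have closed: "x \<in> chains B \<Longrightarrow> rd x \<in> carrier ?G" for x by (rule rd_in_carrier)
  have "cring ?G"
  proof (rule cringI)
    show "abelian_group ?G" ..
    show "comm_monoid ?G"
    proof (rule comm_monoidI)
      show "\<one>\<^bsub>?G\<^esub> \<in> carrier ?G" using closed[OF e] one by simp
      fix f assume "f \<in> carrier ?G"
      then obtain x where x: "x \<in> chains B" "f = rd x" using ex by blast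
      show "\<one>\<^bsub>?G\<^esub> \<otimes>\<^bsub>?G\<^esub> f = f" using x e by (simp add: one ops u)
      fix g assume "g \<in> carrier ?G"
      then obtain y where y: "y \<in> chains B" "g = rd y" using ex by blast
      show "f \<otimes>\<^bsub>?G\<^esub> g \<in> carrier ?G" using x y by (simp add: ops closed liftsD[OF L])
      show "f \<otimes>\<^bsub>?G\<^esub> g = g \<otimes>\<^bsub>?G\<^esub> f" using x y by (simp add: ops c)
      fix h assume "h \<in> carrier ?G"
      then obtain z where z: "z \<in> chains B" "h = rd z" using ex by blast
      show "f \<otimes>\<^bsub>?G\<^esub> g \<otimes>\<^bsub>?G\<^esub> h = f \<otimes>\<^bsub>?G\<^esub> (g \<otimes>\<^bsub>?G\<^esub> h)"
        using x y z by (simp add: ops liftsD[OF L] a)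
    qed
  next
    fix f g h assume "f \<in> carrier ?G" "g \<in> carrier ?G" "h \<in> carrier ?G"
    then obtain x y z where x: "x \<in> chains B" "f = rd x" "y \<in> chains B" "g = rd y" "z \<in> chains B" "h = rd z"
      using ex by meson
    show "(f \<oplus>\<^bsub>?G\<^esub> g) \<otimes>\<^bsub>?G\<^esub> h = f \<otimes>\<^bsub>?G\<^esub> h \<oplus>\<^bsub>?G\<^esub> g \<otimes>\<^bsub>?G\<^esub> h"
      using x by (simp add: ops liftsD[OF L] bil_add_left)
  qed
  then show ?thesis
  proof (intro algebraI cring_F G.smult_closed G.smult_l_distr G.smult_r_distr G.smult_assoc1 G.smult_one)
    fix c f g assume "f \<in> carrier ?G" "g \<in> carrier ?G"
    then obtain x y where x: "x \<in> chains B" "f = rd x" "y \<in> chains B" "g = rd y" using ex by meson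
    show "c \<odot>\<^bsub>?G\<^esub> f \<otimes>\<^bsub>?G\<^esub> g = c \<odot>\<^bsub>?G\<^esub> (f \<otimes>\<^bsub>?G\<^esub> g)"
      using x by (simp add: ops liftsD[OF L] bil_cmul_left)
  qed auto
qed

lemma bil_hom_eqp:
  assumes "\<And>u v. u \<in> B \<Longrightarrow> v \<in> B \<Longrightarrow> frag_extend t (M u v) =\<^sub>p bil M' (t u) (t v)"
    and x: "x \<in> chains B" and y: "y \<in> chains B"
  shows "frag_extend t (bil M x y) =\<^sub>p bil M' (frag_extend t x) (frag_extend t y)"
  by (rule additive_eqp_on_chains[OF x], rule additive_eqp_on_chains[OF y])
    (auto simp: assms(1) bil_diff_left bil_diff_right frag_extend_diff)

text \<open>A map \<open>t\<close> on basis elements that is multiplicative modulo \<open>p\<close> makes the target an image of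
  the integral chains on the source. Surjectivity has to be checked on basis elements only.\<close>

lemma realizes_pullback:
  assumes L': "lifts B' e' \<mu>' M'" and "e \<in> B"
    and M: "\<And>u v. u \<in> B \<Longrightarrow> v \<in> B \<Longrightarrow> M u v \<in> chains B"
    and t: "\<And>u. u \<in> B \<Longrightarrow> t u \<in> chains B'"
    and mult: "\<And>u v. u \<in> B \<Longrightarrow> v \<in> B \<Longrightarrow> frag_extend t (M u v) =\<^sub>p bil M' (t u) (t v)"
    and unit: "t e =\<^sub>p frag_of e'"
    and surj: "\<And>b. b \<in> B' \<Longrightarrow> \<exists>x\<in>chains B. frag_extend t x =\<^sub>p frag_of b"
  shows "realizes (free_alg F B' e' \<mu>') B (bil M) (frag_of e) (\<lambda>x. rd (frag_extend t x))"
proof -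
  note R = realizesD[OF realizes_free_alg[OF L']]
  have T: "frag_extend t x \<in> chains B'" if "x \<in> chains B" for x
    using that t by (rule frag_extend_chains)
  have T_onto: "\<exists>x\<in>chains B. frag_extend t x =\<^sub>p y" if "y \<in> chains B'" for y
    using that
  proof (induction rule: chains_induct)
    case zero then show ?case by (intro bexI[of _ 0]) auto
  next
    case (diff x y)
    then obtain a b where "a \<in> chains B" "frag_extend t a =\<^sub>p x" "b \<in> chains B" "frag_extend t b =\<^sub>p y"
      by blast
    then show ?case by (intro bexI[of _ "a - b"]) (auto simp: frag_extend_diff eqp_diff)
  qed (use surj in auto)
  have "(\<lambda>x. rd (frag_extend t x)) ` chains B = rd ` chains B'"
  proof (intro equalityI subsetI)
    fix f assume "f \<in> (\<lambda>x. rd (frag_extend t x)) ` chains B"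
    then obtain x where "x \<in> chains B" "f = rd (frag_extend t x)" by (rule imageE)
    then show "f \<in> rd ` chains B'" using T[of x] by simp
  next
    fix f assume "f \<in> rd ` chains B'"
    then obtain y where y: "f = rd y" "y \<in> chains B'" by (rule imageE)
    obtain x where "x \<in> chains B" "frag_extend t x =\<^sub>p y" by (rule T_onto[OF y(2), THEN bexE])
    then show "f \<in> (\<lambda>x. rd (frag_extend t x)) ` chains B"
      using y(1) by (intro image_eqI[of _ _ x]) (simp_all add: rd_eq_iff eqp_sym)
  qed
  moreover have "rd (frag_extend t (bil M x y)) = rd (frag_extend t x) \<otimes>\<^bsub>free_alg F B' e' \<mu>'\<^esub> rd (frag_extend t y)"
    if "x \<in> chains B" "y \<in> chains B" for x y
    using bil_hom_eqp[of B t M M' x y] mult that R(8)[OF T[OF that(1)] T[OF that(2)]] by (simp flip: rd_eq_iff)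
  moreover have "rd (t e) = \<one>\<^bsub>free_alg F B' e' \<mu>'\<^esub>"
    using unit R(3) by (simp flip: rd_eq_iff)
  ultimately show ?thesis
    unfolding realizes_def
    using R \<open>e \<in> B\<close> M T
    by (auto simp: frag_extend_add frag_extend_cmul bil_chains simp del: F_simps)
qed

lemma alg_isomorphic_free_alg:
  assumes L: "lifts B e \<mu> M" and L': "lifts B' e' \<mu>' M'" and alg: "algebra F (free_alg F B' e' \<mu>')"
    and t: "\<And>u. u \<in> B \<Longrightarrow> t u \<in> chains B'"
    and mult: "\<And>u v. u \<in> B \<Longrightarrow> v \<in> B \<Longrightarrow> frag_extend t (M u v) =\<^sub>p bil M' (t u) (t v)"
    and unit: "t e =\<^sub>p frag_of e'"
    and surj: "\<And>b. b \<in> B' \<Longrightarrow> \<exists>x\<in>chains B. frag_extend t x =\<^sub>p frag_of b"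
    and inj: "\<And>x. x \<in> chains B \<Longrightarrow> frag_extend t x =\<^sub>p 0 \<Longrightarrow> x =\<^sub>p 0"
  shows "alg_isomorphic F (free_alg F B e \<mu>) (free_alg F B' e' \<mu>')"
proof (rule alg_isomorphic_if_same_kernel[OF realizes_free_alg[OF L] _ alg])
  show "realizes (free_alg F B' e' \<mu>') B (bil M) (frag_of e) (\<lambda>x. rd (frag_extend t x))"
    using L' liftsD(1,2)[OF L] t mult unit surj by (rule realizes_pullback)
next
  fix x y assume xy: "x \<in> chains B" "y \<in> chains B"
  show "(rd x = rd y) = (rd (frag_extend t x) = rd (frag_extend t y))"
    unfolding rd_eq_iff
    using inj[OF diff_chains[OF xy]] frag_extend_eqp[of x y t]
    by (auto simp: frag_extend_diff eqp_diff_0_iff)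
qed

text \<open>Products and sums in a quotient are unions over cosets. If \<open>I\<close> is the kernel of a map onto a
  known algebra, then the cosets are the images of the fibres of this map, and the quotient is
  realized by the same chains with the same kernel as the known algebra.\<close>

context
  fixes B :: "'b set" and e \<mu> M I and N :: "(int, 'n) module" and \<rho>
  assumes L: "lifts B e \<mu> M" and N: "realizes N B (bil M) (frag_of e) \<rho>" and alg: "algebra F N"
    and I: "I \<subseteq> carrier (free_alg F B e \<mu>)"
    and ker: "\<And>x. x \<in> chains B \<Longrightarrow> rd x \<in> I \<longleftrightarrow> \<rho> x = \<zero>\<^bsub>N\<^esub>"
begin

private abbreviation "G \<equiv> free_alg F B e \<mu>"
private definition "K x = rd ` {y \<in> chains B. \<rho> y = \<rho> x}"

interpretation N: algebra F N by (rule alg)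

private lemma K_E:
  assumes "f \<in> K x" obtains y where "y \<in> chains B" "\<rho> y = \<rho> x" "f = rd y"
  using assms unfolding K_def by auto

private lemma K_I: "y \<in> chains B \<Longrightarrow> \<rho> y = \<rho> x \<Longrightarrow> rd y \<in> K x"
  unfolding K_def by simp

private lemma mem_K: "x \<in> chains B \<Longrightarrow> rd x \<in> K x"
  by (rule K_I) auto

private lemma rho_diff:
  assumes "x \<in> chains B" "y \<in> chains B"
  shows "\<rho> (x - y) = \<rho> x \<ominus>\<^bsub>N\<^esub> \<rho> y"
proof -
  note r = realizesD[OF N]
  have "\<rho> x = \<rho> (x - y) \<oplus>\<^bsub>N\<^esub> \<rho> y" using r(7)[of "x - y" y] assms by simp
  then show ?thesis
    using r(5) assms by (simp add: N.M.minus_eq N.M.a_assoc N.M.r_neg)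
qed

private lemma rho_eq_iff:
  assumes "x \<in> chains B" "y \<in> chains B"
  shows "\<rho> x = \<rho> y \<longleftrightarrow> rd (x - y) \<in> I"
  using ker[OF diff_chains[OF assms]] rho_diff[OF assms]
    ring.r_right_minus_eq[OF cring.axioms(1)[OF N.M_cring] realizesD(5)[OF N assms(1)] realizesD(5)[OF N assms(2)]]
  by simp

private lemma rd_eq_imp: "x \<in> chains B \<Longrightarrow> y \<in> chains B \<Longrightarrow> rd x = rd y \<Longrightarrow> \<rho> x = \<rho> y"
proof -
  assume *: "x \<in> chains B" "y \<in> chains B" "rd x = rd y"
  have "rd 0 \<in> I" using ker[of 0] realizesD(4)[OF N] by simp
  moreover have "rd (x - y) = rd 0" using *(3) by (simp add: rd_eq_iff eqp_diff_0_iff)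
  ultimately show ?thesis using rho_eq_iff[OF *(1,2)] by simp
qed

private lemma coset: "x \<in> chains B \<Longrightarrow> I +>\<^bsub>G\<^esub> rd x = K x"
proof -
  assume x: "x \<in> chains B"
  note r = realizesD[OF N]
  have *: "rd h \<oplus>\<^bsub>G\<^esub> rd x \<in> K x" if "h \<in> chains B" "rd h \<in> I" for h
  proof -
    have "\<rho> (h + x) = \<rho> x" using r(7)[OF that(1) x] ker[OF that(1)] that(2) r(5)[OF x] by simp
    then show ?thesis unfolding K_def rd_add[symmetric] using x that by (intro image_eqI[of _ _ "h + x"]) auto
  qed
  have **: "\<exists>h\<in>I. rd y = h \<oplus>\<^bsub>G\<^esub> rd x" if "y \<in> chains B" "\<rho> y = \<rho> x" for y
    using rho_eq_iff[OF that(1) x] that(2) by (intro bexI[of _ "rd (y - x)"]) (simp_all flip: rd_add)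
  show ?thesis
  proof (intro equalityI subsetI)
    fix f assume "f \<in> I +>\<^bsub>G\<^esub> rd x"
    then obtain a where a: "a \<in> I" "f = a \<oplus>\<^bsub>G\<^esub> rd x" by (auto simp: a_r_coset_def')
    obtain h where "h \<in> chains B" "a = rd h" by (rule carrier_rd[OF subsetD[OF I a(1)], THEN bexE])
    then show "f \<in> K x" using a * by simp
  next
    fix f assume "f \<in> K x"
    then obtain y where "f = rd y" "y \<in> {y \<in> chains B. \<rho> y = \<rho> x}" unfolding K_def by (rule imageE)
    then show "f \<in> I +>\<^bsub>G\<^esub> rd x" using ** by (auto simp: a_r_coset_def')
  qed
qed

private lemma K_eq_iff:
  assumes "x \<in> chains B" "y \<in> chains B"
  shows "K x = K y \<longleftrightarrow> \<rho> x = \<rho> y"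
proof
  assume "K x = K y"
  then have "rd x \<in> K y" using mem_K[OF assms(1)] by simp
  then obtain z where z: "z \<in> chains B" "\<rho> z = \<rho> y" "rd x = rd z" by (rule K_E)
  then show "\<rho> x = \<rho> y" using rd_eq_imp[OF assms(1) z(1,3)] by simp
qed (simp add: K_def)

lemma realizes_quot_alg:
  "realizes (quot_alg G I) B (bil M) (frag_of e) (\<lambda>x. I +>\<^bsub>G\<^esub> rd x)"
  and quot_alg_kernel:
  "x \<in> chains B \<Longrightarrow> y \<in> chains B \<Longrightarrow> I +>\<^bsub>G\<^esub> rd x = I +>\<^bsub>G\<^esub> rd y \<longleftrightarrow> \<rho> x = \<rho> y"
proof -
  note r = realizesD[OF N] and q = realizesD[OF realizes_free_alg[OF L]]
  show ker': "x \<in> chains B \<Longrightarrow> y \<in> chains B \<Longrightarrow> I +>\<^bsub>G\<^esub> rd x = I +>\<^bsub>G\<^esub> rd y \<longleftrightarrow> \<rho> x = \<rho> y" for x y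
    by (simp add: coset K_eq_iff)
  have K_mem: "K x = K x'" if "\<rho> x = \<rho> x'" for x x' using that by (simp add: K_def)
  show "realizes (quot_alg G I) B (bil M) (frag_of e) (\<lambda>x. I +>\<^bsub>G\<^esub> rd x)"
    unfolding realizes_def
  proof (intro conjI ballI)
    show "(\<lambda>x. I +>\<^bsub>G\<^esub> rd x) ` chains B = carrier (quot_alg G I)"
    proof -
      have "carrier (quot_alg G I) = (\<lambda>f. I +>\<^bsub>G\<^esub> f) ` carrier G"
        unfolding quot_alg_def FactRing_def A_RCOSETS_def' by auto
      then show ?thesis unfolding rd_image_chains[symmetric] image_image ..
    qed
    show "frag_of e \<in> chains B" by (rule q(2))
    show "I +>\<^bsub>G\<^esub> rd (frag_of e) = \<one>\<^bsub>quot_alg G I\<^esub>"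
      by (simp add: quot_alg_def FactRing_def q(3))
    have "K 0 = I"
    proof -
      have "{y \<in> chains B. \<rho> y = \<rho> 0} = {y \<in> chains B. rd y \<in> I}" using ker r(4) by auto
      then have "K 0 = rd ` {y \<in> chains B. rd y \<in> I}" unfolding K_def by simp
      also have "\<dots> = I"
      proof (intro equalityI subsetI)
        fix f assume f: "f \<in> I"
        obtain h where "h \<in> chains B" "f = rd h" by (rule carrier_rd[OF subsetD[OF I f], THEN bexE])
        then show "f \<in> rd ` {y \<in> chains B. rd y \<in> I}" using f by simp
      qed auto
      finally show ?thesis .
    qed
    then show "I +>\<^bsub>G\<^esub> rd 0 = \<zero>\<^bsub>quot_alg G I\<^esub>"
      by (simp add: quot_alg_def FactRing_def coset)
  next
    fix x y assume x: "x \<in> chains B" and y: "y \<in> chains B"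
    show "bil M x y \<in> chains B" by (rule q(6)[OF x y])
    have "K x <+>\<^bsub>G\<^esub> K y = K (x + y)"
    proof
      show "K x <+>\<^bsub>G\<^esub> K y \<subseteq> K (x + y)"
      proof
        fix f assume "f \<in> K x <+>\<^bsub>G\<^esub> K y"
        then obtain a b where ab: "a \<in> K x" "b \<in> K y" "f = a \<oplus>\<^bsub>G\<^esub> b" by (auto simp: set_add_def')
        obtain x' where x': "x' \<in> chains B" "\<rho> x' = \<rho> x" "a = rd x'" using ab(1) by (rule K_E)
        obtain y' where y': "y' \<in> chains B" "\<rho> y' = \<rho> y" "b = rd y'" using ab(2) by (rule K_E)
        have "f = rd (x' + y')" unfolding ab(3) x'(3) y'(3) by (rule rd_add[symmetric])
        then show "f \<in> K (x + y)" using x' y' x y r(7) by (auto intro: K_I)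
      qed
    next
      show "K (x + y) \<subseteq> K x <+>\<^bsub>G\<^esub> K y"
      proof
        fix f assume "f \<in> K (x + y)"
        then obtain z where z: "z \<in> chains B" "\<rho> z = \<rho> (x + y)" "f = rd z" by (rule K_E)
        then have "\<rho> (z - x) = \<rho> y"
          using rho_eq_iff[of z "x + y"] rho_eq_iff[of "z - x" y] x y by (simp add: algebra_simps)
        moreover have "f = rd x \<oplus>\<^bsub>G\<^esub> rd (z - x)" using z by (simp flip: rd_add)
        ultimately show "f \<in> K x <+>\<^bsub>G\<^esub> K y"
          using mem_K[OF x] K_I[OF diff_chains[OF z(1) x]] by (auto simp: set_add_def')
      qed
    qed
    then show "I +>\<^bsub>G\<^esub> rd (x + y) = (I +>\<^bsub>G\<^esub> rd x) \<oplus>\<^bsub>quot_alg G I\<^esub> (I +>\<^bsub>G\<^esub> rd y)"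
      using x y by (simp add: coset quot_alg_def FactRing_def)
    have "(\<Union>a\<in>K x. \<Union>b\<in>K y. I +>\<^bsub>G\<^esub> (a \<otimes>\<^bsub>G\<^esub> b)) = K (bil M x y)"
    proof -
      have "I +>\<^bsub>G\<^esub> (a \<otimes>\<^bsub>G\<^esub> b) = K (bil M x y)" if ab: "a \<in> K x" "b \<in> K y" for a b
      proof -
        obtain x' where x': "x' \<in> chains B" "\<rho> x' = \<rho> x" "a = rd x'" using ab(1) by (rule K_E)
        obtain y' where y': "y' \<in> chains B" "\<rho> y' = \<rho> y" "b = rd y'" using ab(2) by (rule K_E)
        note * = x' y'
        have "I +>\<^bsub>G\<^esub> (a \<otimes>\<^bsub>G\<^esub> b) = K (bil M x' y')"
          using coset[OF q(6)[OF *(1,4)]] q(8)[OF *(1,4)] *(3,6) by simp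
        also have "\<dots> = K (bil M x y)" by (rule K_mem) (use * r(8) x y in simp)
        finally show ?thesis .
      qed
      then show ?thesis using mem_K[OF x] mem_K[OF y] by auto
    qed
    then show "I +>\<^bsub>G\<^esub> rd (bil M x y) = (I +>\<^bsub>G\<^esub> rd x) \<otimes>\<^bsub>quot_alg G I\<^esub> (I +>\<^bsub>G\<^esub> rd y)"
      using x y by (simp add: coset quot_alg_def FactRing_def rcoset_mult_def q(6))
  next
    fix c x assume c: "c \<in> carrier F" and x: "x \<in> chains B"
    have "(\<Union>a\<in>K x. I +>\<^bsub>G\<^esub> (c \<odot>\<^bsub>G\<^esub> a)) = K (frag_cmul c x)"
    proof -
      have "I +>\<^bsub>G\<^esub> (c \<odot>\<^bsub>G\<^esub> a) = K (frag_cmul c x)" if aK: "a \<in> K x" for a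
      proof -
        obtain x' where *: "x' \<in> chains B" "\<rho> x' = \<rho> x" "a = rd x'" using aK by (rule K_E)
        then have "I +>\<^bsub>G\<^esub> (c \<odot>\<^bsub>G\<^esub> a) = K (frag_cmul c x')"
          using q(9)[OF c *(1)] coset[OF cmul_chains[OF *(1)], of c] by simp
        also have "\<dots> = K (frag_cmul c x)" by (rule K_mem) (use * r(9)[OF c] x in simp)
        finally show ?thesis .
      qed
      then show ?thesis using mem_K[OF x] by auto
    qed
    then show "I +>\<^bsub>G\<^esub> rd (frag_cmul c x) = c \<odot>\<^bsub>quot_alg G I\<^esub> (I +>\<^bsub>G\<^esub> rd x)"
      using x by (simp add: coset quot_alg_def)
  qed
qed

lemma quot_alg_isomorphic: "alg_isomorphic F (quot_alg G I) N"
  by (rule alg_isomorphic_if_same_kernel[OF realizes_quot_alg N alg quot_alg_kernel])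

end

lemma rd_diff_mem:
  assumes "additive_subgroup I (free_alg F B e \<mu>)" "x \<in> chains B" "y \<in> chains B" "rd x \<in> I" "rd y \<in> I"
  shows "rd (x - y) \<in> I"
proof -
  let ?G = "free_alg F B e \<mu>"
  interpret G: module F ?G by (rule module_free_alg)
  interpret I: additive_subgroup I ?G by fact
  have "rd (- y) \<oplus>\<^bsub>?G\<^esub> rd y = \<zero>\<^bsub>?G\<^esub>" by (simp flip: rd_add add: rd_zero'[of B e \<mu>])
  then have "\<ominus>\<^bsub>?G\<^esub> rd y = rd (- y)"
    using assms by (intro G.M.minus_equality) (auto simp del: F_simps intro: rd_in_carrier)
  then have "rd (- y) \<in> I" using I.a_inv_closed[OF assms(5)] by simp
  then have "rd x \<oplus>\<^bsub>?G\<^esub> rd (- y) \<in> I" using assms by blast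
  then show ?thesis by (simp flip: rd_add)
qed

text \<open>The way in which all quotients are identified: \<open>t\<close> sends generators of the presented algebra
  to the concrete one, \<open>s\<close> is a section, and every generator is congruent to the section of its
  image.\<close>

lemma quot_alg_presentation:
  assumes L: "lifts B e \<mu> M" and L': "lifts B' e' \<mu>' M'" and alg: "algebra F (free_alg F B' e' \<mu>')"
    and t: "\<And>u. u \<in> B \<Longrightarrow> t u \<in> chains B'"
    and mult: "\<And>u v. u \<in> B \<Longrightarrow> v \<in> B \<Longrightarrow> frag_extend t (M u v) =\<^sub>p bil M' (t u) (t v)"
    and unit: "t e =\<^sub>p frag_of e'"
    and s: "\<And>b. b \<in> B' \<Longrightarrow> s b \<in> chains B"
    and retract: "\<And>b. b \<in> B' \<Longrightarrow> frag_extend t (s b) =\<^sub>p frag_of b"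
    and I: "additive_subgroup I (free_alg F B e \<mu>)"
    and sound: "\<And>x. x \<in> chains B \<Longrightarrow> rd x \<in> I \<Longrightarrow> frag_extend t x =\<^sub>p 0"
    and complete: "\<And>u. u \<in> B \<Longrightarrow> rd (frag_of u - frag_extend s (t u)) \<in> I"
  shows "alg_isomorphic F (quot_alg (free_alg F B e \<mu>) I) (free_alg F B' e' \<mu>')"
    and "x \<in> chains B \<Longrightarrow> y \<in> chains B \<Longrightarrow>
      I +>\<^bsub>free_alg F B e \<mu>\<^esub> rd x = I +>\<^bsub>free_alg F B e \<mu>\<^esub> rd y \<longleftrightarrow> frag_extend t x =\<^sub>p frag_extend t y"
    and "realizes (quot_alg (free_alg F B e \<mu>) I) B (bil M) (frag_of e) (\<lambda>x. I +>\<^bsub>free_alg F B e \<mu>\<^esub> rd x)"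
proof -
  interpret I: additive_subgroup I "free_alg F B e \<mu>" by fact
  have N: "realizes (free_alg F B' e' \<mu>') B (bil M) (frag_of e) (\<lambda>x. rd (frag_extend t x))"
    using L' liftsD(1,2)[OF L] t mult unit by (rule realizes_pullback) (use s retract in auto)
  have compl: "rd (x - frag_extend s (frag_extend t x)) \<in> I" if "x \<in> chains B" for x
  proof -
    have *: "frag_extend s (frag_extend t x) \<in> chains B" if "x \<in> chains B" for x
      by (rule frag_extend_chains[OF frag_extend_chains[OF that]]) (rule t s, assumption)+
    have "x \<in> chains B \<and> rd (x - frag_extend s (frag_extend t x)) \<in> I"
      using that
    proof (induction rule: chains_induct)
      case zero
      then show ?case using I.zero_closed by (simp add: rd_zero'[of B e \<mu>])
    next
      case (one u) then show ?case using complete by simp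
    next
      case (diff x y)
      have "rd ((x - frag_extend s (frag_extend t x)) - (y - frag_extend s (frag_extend t y))) \<in> I"
        by (rule rd_diff_mem[OF I]) (use diff * in auto)
      then show ?case using diff by (simp add: frag_extend_diff algebra_simps)
    qed
    then show ?thesis by simp
  qed
  have ker: "rd x \<in> I \<longleftrightarrow> rd (frag_extend t x) = \<zero>\<^bsub>free_alg F B' e' \<mu>'\<^esub>" if x: "x \<in> chains B" for x
  proof -
    have "rd x \<in> I" if "frag_extend t x =\<^sub>p 0"
    proof -
      have "frag_extend s (frag_extend t x) =\<^sub>p 0"
        using frag_extend_eqp[OF that, of s] by simp
      then have "x - frag_extend s (frag_extend t x) =\<^sub>p x - 0" by (intro eqp_diff) auto
      then show ?thesis using compl[OF x] by (simp flip: rd_eq_iff)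
    qed
    then show ?thesis using sound[OF x] unfolding rd_zero'[symmetric] rd_eq_iff by blast
  qed
  note args = L N alg I.a_subset ker
  show "alg_isomorphic F (quot_alg (free_alg F B e \<mu>) I) (free_alg F B' e' \<mu>')"
    by (rule quot_alg_isomorphic[OF args])
  show "x \<in> chains B \<Longrightarrow> y \<in> chains B \<Longrightarrow>
      I +>\<^bsub>free_alg F B e \<mu>\<^esub> rd x = I +>\<^bsub>free_alg F B e \<mu>\<^esub> rd y \<longleftrightarrow> frag_extend t x =\<^sub>p frag_extend t y"
    using quot_alg_kernel[OF args] by (simp add: rd_eq_iff)
  show "realizes (quot_alg (free_alg F B e \<mu>) I) B (bil M) (frag_of e) (\<lambda>x. I +>\<^bsub>free_alg F B e \<mu>\<^esub> rd x)"
    by (rule realizes_quot_alg[OF args])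
qed

lemma submodule_additive_subgroup:
  assumes "submodule I F (free_alg F B e \<mu>)"
  shows "additive_subgroup I (free_alg F B e \<mu>)"
  using submodule.axioms(1)[OF assms] by (rule additive_subgroupI)

lemma submodule_span_is_submodule:
  assumes "R \<subseteq> carrier (free_alg F B e \<mu>)"
  shows "submodule (submodule_span F (free_alg F B e \<mu>) R) F (free_alg F B e \<mu>)"
    "R \<subseteq> submodule_span F (free_alg F B e \<mu>) R"
proof -
  interpret G: module F "free_alg F B e \<mu>" by (rule module_free_alg)
  let ?G = "free_alg F B e \<mu>" and ?S = "submodule_span F (free_alg F B e \<mu>) R"
  have sub: "?S \<subseteq> carrier ?G"
    unfolding submodule_span_def using G.carrier_is_submodule assms by blast
  show "submodule ?S F ?G"
    by (rule G.submoduleI)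
      (use sub G.submoduleE additive_subgroup.zero_closed[OF submodule_additive_subgroup] in \<open>auto simp: submodule_span_def simp del: F_simps\<close>)
  show "R \<subseteq> ?S" unfolding submodule_span_def by blast
qed

text \<open>The residues of the chains that \<open>t\<close> annihilates form a submodule, so that relations need to
  be verified on generators only.\<close>

lemma submodule_span_sound:
  assumes R: "\<And>g. g \<in> R \<Longrightarrow> \<exists>x\<in>chains B. g = rd x \<and> frag_extend t x =\<^sub>p 0"
    and x: "x \<in> chains B" "rd x \<in> submodule_span F (free_alg F B e \<mu>) R"
  shows "frag_extend t x =\<^sub>p 0"
proof -
  let ?G = "free_alg F B e \<mu>"
  interpret G: module F ?G by (rule module_free_alg)
  define N where "N = {rd x | x. x \<in> chains B \<and> frag_extend t x =\<^sub>p 0}"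
  have N_I: "rd x \<in> N" if "x \<in> chains B" "frag_extend t x =\<^sub>p 0" for x
    using that unfolding N_def by auto
  have N_E: thesis if "f \<in> N" "\<And>x. x \<in> chains B \<Longrightarrow> frag_extend t x =\<^sub>p 0 \<Longrightarrow> f = rd x \<Longrightarrow> thesis" for f thesis
    using that unfolding N_def by auto
  have minus: "\<ominus>\<^bsub>?G\<^esub> rd y = rd (- y)" if "y \<in> chains B" for y
  proof (rule G.M.minus_equality)
    show "rd (- y) \<oplus>\<^bsub>?G\<^esub> rd y = \<zero>\<^bsub>?G\<^esub>" by (simp flip: rd_add add: rd_zero'[of B e \<mu>])
  qed (use that in \<open>auto intro: rd_in_carrier simp del: F_simps\<close>)
  have "submodule N F ?G"
  proof (rule G.submoduleI)
    show "N \<subseteq> carrier ?G" unfolding N_def using rd_in_carrier by auto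
    have "rd 0 \<in> N" by (rule N_I) auto
    then show "\<zero>\<^bsub>?G\<^esub> \<in> N" by (simp add: rd_zero'[of B e \<mu>])
  next
    fix a assume "a \<in> N"
    then obtain x where x: "x \<in> chains B" "frag_extend t x =\<^sub>p 0" "a = rd x" by (rule N_E)
    have "frag_extend t (- x) =\<^sub>p 0" using eqp_minus[OF x(2)] by (simp add: frag_extend_minus)
    then show "\<ominus>\<^bsub>?G\<^esub> a \<in> N" using x minus N_I[of "- x"] by simp
    fix c
    have "frag_extend t (frag_cmul c x) =\<^sub>p 0" using eqp_cmul[OF x(2), of c] by (simp add: frag_extend_cmul)
    then show "c \<odot>\<^bsub>?G\<^esub> a \<in> N" using x N_I[of "frag_cmul c x"] by (simp flip: rd_cmul)
    fix b assume "b \<in> N"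
    then obtain y where y: "y \<in> chains B" "frag_extend t y =\<^sub>p 0" "b = rd y" by (rule N_E)
    have "frag_extend t (x + y) =\<^sub>p 0" using eqp_add[OF x(2) y(2)] by (simp add: frag_extend_add)
    then show "a \<oplus>\<^bsub>?G\<^esub> b \<in> N" using x y N_I[of "x + y"] by (simp flip: rd_add)
  qed
  moreover have "R \<subseteq> N"
  proof
    fix g assume "g \<in> R"
    then obtain y where "y \<in> chains B" "g = rd y \<and> frag_extend t y =\<^sub>p 0" by (rule R[THEN bexE])
    then show "g \<in> N" using N_I by simp
  qed
  ultimately have "rd x \<in> N" using x unfolding submodule_span_def by blast
  then obtain y where "y \<in> chains B" "frag_extend t y =\<^sub>p 0" "rd x = rd y" by (rule N_E)
  then show ?thesis using frag_extend_eqp[of x y t] eqp_trans[of "frag_extend t x" "frag_extend t y" 0]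
    by (simp add: rd_eq_iff)
qed

end

text \<open>As a simplification rule, \<^verbatim>\<open>single_one\<close> turns the chain of an empty multiset, that is of a
  zero index, into the unit of a convolution product, which hides that it is a basis element.\<close>

declare single_one [simp del]

section \<open>Algebras given by integral structure constants\<close>

context prime_modulus
begin

definition FA :: "'b set \<Rightarrow> 'b \<Rightarrow> ('b \<Rightarrow> 'b \<Rightarrow> 'b frag) \<Rightarrow> (int, 'b \<Rightarrow> int) module" where
  "FA B e M = free_alg F B e (\<lambda>u v. rd (M u v))"

text \<open>The laws are required of the integral structure constants, not only modulo \<open>p\<close>, so that they
  extend to equations between chains.\<close>

definition comm_alg_basis :: "'b set \<Rightarrow> 'b \<Rightarrow> ('b \<Rightarrow> 'b \<Rightarrow> 'b frag) \<Rightarrow> bool" where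
  "comm_alg_basis B e M \<longleftrightarrow> e \<in> B \<and> (\<forall>u\<in>B. \<forall>v\<in>B. M u v \<in> chains B \<and> M u v = M v u) \<and>
     (\<forall>u\<in>B. \<forall>v\<in>B. \<forall>w\<in>B. bil M (M u v) (frag_of w) = bil M (frag_of u) (M v w)) \<and>
     (\<forall>u\<in>B. M e u = frag_of u)"

lemma comm_alg_basisD:
  assumes "comm_alg_basis B e M"
  shows "e \<in> B" "u \<in> B \<Longrightarrow> v \<in> B \<Longrightarrow> M u v \<in> chains B" "u \<in> B \<Longrightarrow> v \<in> B \<Longrightarrow> M u v = M v u"
    "u \<in> B \<Longrightarrow> v \<in> B \<Longrightarrow> w \<in> B \<Longrightarrow> bil M (M u v) (frag_of w) = bil M (frag_of u) (M v w)"
    "u \<in> B \<Longrightarrow> M e u = frag_of u"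
  using assms unfolding comm_alg_basis_def by blast+

lemma comm_alg_basis_lifts: "comm_alg_basis B e M \<Longrightarrow> lifts B e (\<lambda>u v. rd (M u v)) M"
  unfolding comm_alg_basis_def lifts_def by blast

lemma algebra_FA: "comm_alg_basis B e M \<Longrightarrow> algebra F (FA B e M)"
  unfolding FA_def
  by (rule algebra_free_alg[OF comm_alg_basis_lifts]) (auto dest: comm_alg_basisD)

lemma FA_isomorphic_basis:
  assumes L: "comm_alg_basis B e M" and L': "comm_alg_basis B' e' M'"
    and f: "bij_betw f B B'" and unit: "f e = e'"
    and mult: "\<And>u v. u \<in> B \<Longrightarrow> v \<in> B \<Longrightarrow> frag_extend (\<lambda>u. frag_of (f u)) (M u v) =\<^sub>p M' (f u) (f v)"
  shows "alg_isomorphic F (FA B e M) (FA B' e' M')"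
  unfolding FA_def
proof (rule alg_isomorphic_free_alg[OF comm_alg_basis_lifts[OF L] comm_alg_basis_lifts[OF L']])
  show "algebra F (free_alg F B' e' (\<lambda>u v. rd (M' u v)))"
    using algebra_FA[OF L'] by (simp add: FA_def)
  show "frag_of (f u) \<in> chains B'" if "u \<in> B" for u
    using bij_betwE[OF f] that by simp
  show "frag_of (f e) =\<^sub>p frag_of e'" by (simp add: unit)
  show "\<exists>x\<in>chains B. frag_extend (\<lambda>u. frag_of (f u)) x =\<^sub>p frag_of b" if b: "b \<in> B'" for b
  proof -
    obtain u where "u \<in> B" "b = f u" using f b by (auto simp: bij_betw_def)
    then show ?thesis by (intro bexI[of _ "frag_of u"]) auto
  qed
  fix x assume x: "x \<in> chains B" and 0: "frag_extend (\<lambda>u. frag_of (f u)) x =\<^sub>p 0"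
  let ?g = "frag_extend (\<lambda>b. frag_of (inv_into B f b))"
  have "?g (frag_extend (\<lambda>u. frag_of (f u)) x) = x"
    by (rule additive_eq_on_chains[OF x])
      (auto simp: frag_extend_diff inv_into_f_f[OF bij_betw_imp_inj_on[OF f]])
  then show "x =\<^sub>p 0" using frag_extend_eqp[OF 0, of "\<lambda>b. frag_of (inv_into B f b)"] by simp
qed (use mult in auto)

lemma rd_diff:
  assumes "x \<in> chains B" "y \<in> chains B"
  shows "rd (x - y) = rd x \<ominus>\<^bsub>free_alg F B e \<mu>\<^esub> rd y"
proof -
  let ?G = "free_alg F B e \<mu>"
  interpret G: module F ?G by (rule module_free_alg)
  have "\<ominus>\<^bsub>?G\<^esub> rd y = rd (- y)"
  proof (rule G.M.minus_equality)
    show "rd (- y) \<oplus>\<^bsub>?G\<^esub> rd y = \<zero>\<^bsub>?G\<^esub>" by (simp flip: rd_add add: rd_zero'[of B e \<mu>])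
  qed (use assms in \<open>auto intro: rd_in_carrier simp del: F_simps\<close>)
  then show ?thesis by (simp add: a_minus_def flip: rd_add)
qed


section \<open>Algebras with a truncated polynomial basis\<close>

definition small :: "('v \<Rightarrow> 'v multiset option) \<Rightarrow> bool" where
  "small \<psi> \<longleftrightarrow> (\<forall>v k. \<psi> v = Some k \<longrightarrow> size k \<le> 1)"

text \<open>The normal form of a monomial modulo relations \<open>v\<^sup>p = \<psi> v\<close>, where each \<open>\<psi> v\<close> is zero
  (\<open>None\<close>), the identity or a variable. Such a relation lowers the degree, which is why rewriting
  terminates; the test on \<open>size k\<close> extends this to arbitrary \<open>\<psi>\<close>. The variable that is rewritten
  first is immaterial, but a function has to choose one.\<close>

function red :: "('v \<Rightarrow> 'v multiset option) \<Rightarrow> 'v multiset \<Rightarrow> 'v multiset option" where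
  "red \<psi> m = (if \<exists>v. p \<le> count m v
     then let v = (SOME v. p \<le> count m v) in
       Option.bind (\<psi> v) (\<lambda>k. if size k \<le> 1 then red \<psi> (m - replicate_mset p v + k) else None)
     else Some m)"
  by pat_completeness auto

lemma p_le_count_mem: "p \<le> count m v \<Longrightarrow> v \<in># m"
  using p_gt_1 by (cases "v \<in># m") (auto simp: not_in_iff)

lemma size_reduct:
  assumes "p \<le> count m v" "size k \<le> 1"
  shows "size (m - replicate_mset p v + k) < size m"
proof -
  have "replicate_mset p v \<subseteq># m" using assms by (simp add: count_le_replicate_mset_subset_eq)
  then have "size (m - replicate_mset p v) = size m - p" "p \<le> size m"
    using size_mset_mono[of "replicate_mset p v" m] by (simp_all add: size_Diff_submset)
  then show ?thesis using assms p_gt_1 by simp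
qed

termination red
proof (relation "measure (\<lambda>(\<psi>, m). size m)")
  fix \<psi> :: "'v \<Rightarrow> 'v multiset option" and m k :: "'v multiset" and v
  assume "\<exists>v. p \<le> count m v" "v = (SOME v. p \<le> count m v)" and k: "size k \<le> 1"
  then have "p \<le> count m v" using someI_ex[of "\<lambda>v. p \<le> count m v"] by simp
  from size_reduct[OF this k] show "((\<psi>, m - replicate_mset p v + k), \<psi>, m) \<in> measure (\<lambda>(\<psi>, m). size m)"
    by simp
qed auto

declare red.simps [simp del]

lemma red_truncated: "(\<And>v. count m v < p) \<Longrightarrow> red \<psi> m = Some m"
  by (subst red.simps) (auto simp flip: not_le)

lemma red_SOME:
  assumes "small \<psi>" "p \<le> count m v"
  obtains u where "p \<le> count m u" "red \<psi> m = Option.bind (\<psi> u) (\<lambda>k. red \<psi> (m - replicate_mset p u + k))"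
proof
  let ?u = "SOME v. p \<le> count m v"
  show "p \<le> count m ?u" using assms(2) by (rule someI)
  show "red \<psi> m = Option.bind (\<psi> ?u) (\<lambda>k. red \<psi> (m - replicate_mset p ?u + k))"
    using assms by (subst red.simps) (auto simp: small_def Let_def split: bind_split)
qed

text \<open>Rewriting steps at two different variables commute, because they remove disjoint parts of the
  monomial. By induction on the degree the normal form hence does not depend on the choice of the
  variable.\<close>

lemma red_step:
  assumes \<psi>: "small \<psi>" and "p \<le> count m v"
  shows "red \<psi> m = Option.bind (\<psi> v) (\<lambda>k. red \<psi> (m - replicate_mset p v + k))"
  using assms(2)
proof (induction "size m" arbitrary: m v rule: less_induct)
  case less
  obtain u where u: "p \<le> count m u" "red \<psi> m = Option.bind (\<psi> u) (\<lambda>k. red \<psi> (m - replicate_mset p u + k))"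
    using red_SOME[OF \<psi> less.prems] .
  show ?case
  proof (cases "u = v")
    case False
    have IH: "red \<psi> (m - replicate_mset p x + k)
        = Option.bind (\<psi> y) (\<lambda>j. red \<psi> (m - replicate_mset p x + k - replicate_mset p y + j))"
      if "p \<le> count m x" "p \<le> count m y" "x \<noteq> y" "\<psi> x = Some k" for x y k
      using that \<psi> by (intro less.hyps size_reduct) (auto simp: small_def)
    have comm: "m - replicate_mset p u + k - replicate_mset p v + j
        = m - replicate_mset p v + j - replicate_mset p u + k" for j k
      using u(1) less.prems False by (intro multiset_eqI) auto
    show ?thesis
      unfolding u(2)
      using IH[OF u(1) less.prems False] IH[OF less.prems u(1) False[symmetric]]
      by (cases "\<psi> u"; cases "\<psi> v") (simp_all add: comm)
  qed (use u in simp)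
qed

lemma red_cases:
  assumes \<psi>: "small \<psi>"
  obtains "\<And>v. count m v < p" "red \<psi> m = Some m"
  | v where "p \<le> count m v" "red \<psi> m = Option.bind (\<psi> v) (\<lambda>k. red \<psi> (m - replicate_mset p v + k))"
  using red_step[OF \<psi>, of m] red_truncated[of m \<psi>] by (meson not_le)

lemma red_Some:
  assumes \<psi>: "small \<psi>" and "red \<psi> m = Some n"
  shows "count n v < p"
    and "set_mset m \<subseteq> V \<Longrightarrow> (\<And>v k. v \<in> V \<Longrightarrow> \<psi> v = Some k \<Longrightarrow> set_mset k \<subseteq> V) \<Longrightarrow> set_mset n \<subseteq> V"
proof -
  have *: "(\<forall>v. count n v < p) \<and>
    (set_mset m \<subseteq> V \<longrightarrow> (\<forall>v k. v \<in> V \<longrightarrow> \<psi> v = Some k \<longrightarrow> set_mset k \<subseteq> V) \<longrightarrow> set_mset n \<subseteq> V)"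
    using assms(2)
  proof (induction "size m" arbitrary: m rule: less_induct)
    case less
    show ?case
    proof (cases m rule: red_cases[OF \<psi>])
      case 1
      then show ?thesis using less.prems by simp
    next
      case (2 v)
      then obtain k where k: "\<psi> v = Some k" "red \<psi> (m - replicate_mset p v + k) = Some n"
        using less.prems by (cases "\<psi> v") auto
      have "v \<in># m" using 2(1) by (rule p_le_count_mem)
      then have "set_mset (m - replicate_mset p v + k) \<subseteq> V"
        if "set_mset m \<subseteq> V" "\<forall>v k. v \<in> V \<longrightarrow> \<psi> v = Some k \<longrightarrow> set_mset k \<subseteq> V"
        using that k(1) by (auto dest!: in_diffD)
      moreover have "size k \<le> 1" using \<psi> k by (simp add: small_def)
      ultimately show ?thesis using less.hyps[OF size_reduct[OF 2(1)] k(2)] by simp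
    qed
  qed
  show "count n v < p" using * by simp
  show "set_mset m \<subseteq> V \<Longrightarrow> (\<And>v k. v \<in> V \<Longrightarrow> \<psi> v = Some k \<Longrightarrow> set_mset k \<subseteq> V) \<Longrightarrow> set_mset n \<subseteq> V"
    using * by simp
qed

text \<open>Reducing a factor does not change the normal form of a product. This is what makes
  multiplication of normal forms associative.\<close>

lemma red_add:
  assumes \<psi>: "small \<psi>"
  shows "Option.bind (red \<psi> m) (\<lambda>k. red \<psi> (k + n)) = red \<psi> (m + n)"
proof (induction "size m" arbitrary: m rule: less_induct)
  case less
  show ?case
  proof (cases m rule: red_cases[OF \<psi>])
    case (2 v)
    have "m + n - replicate_mset p v + k = m - replicate_mset p v + k + n" for k
      using 2(1) by (intro multiset_eqI) auto
    moreover have "red \<psi> (m + n) = Option.bind (\<psi> v) (\<lambda>k. red \<psi> (m + n - replicate_mset p v + k))"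
      using 2(1) by (intro red_step \<psi>) simp
    moreover have "Option.bind (red \<psi> (m - replicate_mset p v + k)) (\<lambda>k. red \<psi> (k + n))
        = red \<psi> (m - replicate_mset p v + k + n)" if "\<psi> v = Some k" for k
      using that \<psi> 2(1) by (intro less.hyps size_reduct) (auto simp: small_def)
    ultimately show ?thesis unfolding 2(2) by (cases "\<psi> v") (simp_all add: add_ac)
  qed simp
qed

definition fr :: "'b option \<Rightarrow> 'b frag" where
  "fr m = (case m of None \<Rightarrow> 0 | Some k \<Rightarrow> frag_of k)"

lemma fr_simps [simp]: "fr None = 0" "fr (Some k) = frag_of k"
  by (simp_all add: fr_def)

definition truncated :: "'v set \<Rightarrow> 'v multiset set" where
  "truncated V = {m. set_mset m \<subseteq> V \<and> (\<forall>v. count m v < p)}"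

definition relations :: "'v set \<Rightarrow> ('v \<Rightarrow> 'v multiset option) \<Rightarrow> bool" where
  "relations V \<psi> \<longleftrightarrow> small \<psi> \<and> (\<forall>v\<in>V. \<forall>k. \<psi> v = Some k \<longrightarrow> set_mset k \<subseteq> V)"

text \<open>The algebra \<open>F[V] / \<langle>v\<^sup>p - \<psi> v | v \<in> V\<rangle>\<close> on its basis of monomials with exponents smaller
  than \<open>p\<close>. All algebras of the theorem are brought into this form, in which they are compared
  through their sets of variables.\<close>

definition TP :: "'v set \<Rightarrow> ('v \<Rightarrow> 'v multiset option) \<Rightarrow> (int, 'v multiset \<Rightarrow> int) module" where
  "TP V \<psi> = FA (truncated V) {#} (\<lambda>u v. fr (red \<psi> (u + v)))"

lemma relations_small: "relations V \<psi> \<Longrightarrow> small \<psi>"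
  by (simp add: relations_def)

lemma red_in_truncated:
  assumes "relations V \<psi>" "set_mset m \<subseteq> V"
  shows "fr (red \<psi> m) \<in> chains (truncated V)"
proof (cases "red \<psi> m")
  case (Some n)
  then show ?thesis
    using red_Some[OF relations_small[OF assms(1)] Some] assms by (auto simp: truncated_def relations_def)
qed simp

lemma bil_red:
  assumes "small \<psi>"
  shows "bil (\<lambda>u v. fr (red \<psi> (u + v))) (fr (red \<psi> m)) (frag_of n) = fr (red \<psi> (m + n))"
    "bil (\<lambda>u v. fr (red \<psi> (u + v))) (frag_of n) (fr (red \<psi> m)) = fr (red \<psi> (m + n))"
  unfolding red_add[OF assms, of m n, symmetric]
  by (cases "red \<psi> m"; simp add: add.commute)+

lemma bil_red2:
  assumes "small \<psi>"
  shows "bil (\<lambda>u v. fr (red \<psi> (u + v))) (fr (red \<psi> m)) (fr (red \<psi> n)) = fr (red \<psi> (m + n))"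
proof (cases "red \<psi> n")
  case None
  then have "red \<psi> (m + n) = None" using red_add[OF assms, of n m] by (simp add: add.commute)
  then show ?thesis using None by simp
next
  case (Some k)
  have "red \<psi> (m + k) = red \<psi> (m + n)" using red_add[OF assms, of n m] Some by (simp add: add.commute)
  then show ?thesis using bil_red(1)[OF assms, of m k] Some by simp
qed

lemma empty_truncated [simp]: "{#} \<in> truncated V"
  using p_gt_1 by (simp add: truncated_def)

lemma truncated_red: "m \<in> truncated V \<Longrightarrow> red \<psi> m = Some m"
  by (rule red_truncated) (simp add: truncated_def)

lemma truncated_add_red:
  "relations V \<psi> \<Longrightarrow> u \<in> truncated V \<Longrightarrow> v \<in> truncated V \<Longrightarrow> fr (red \<psi> (u + v)) \<in> chains (truncated V)"
  by (rule red_in_truncated) (auto simp: truncated_def)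

lemma TP_basis:
  assumes "relations V \<psi>"
  shows "comm_alg_basis (truncated V) {#} (\<lambda>u v. fr (red \<psi> (u + v)))"
  unfolding comm_alg_basis_def
  by (simp add: bil_red[OF relations_small[OF assms]] truncated_add_red[OF assms] truncated_red add_ac)

lemma algebra_TP: "relations V \<psi> \<Longrightarrow> algebra F (TP V \<psi>)"
  unfolding TP_def by (rule algebra_FA[OF TP_basis])

lemma count_image_mset_inj_on:
  assumes "inj_on f V" "set_mset m \<subseteq> V" "v \<in> V"
  shows "count (image_mset f m) (f v) = count m v"
proof -
  have "f -` {f v} \<inter> set_mset m = {v} \<inter> set_mset m"
    using assms by (auto dest: inj_onD)
  then have "count (image_mset f m) (f v) = sum (count m) ({v} \<inter> set_mset m)"
    by (simp add: count_image_mset)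
  also have "\<dots> = count m v" by (cases "v \<in># m") (auto simp: not_in_iff)
  finally show ?thesis .
qed

text \<open>Renaming the variables maps rewriting steps to rewriting steps.\<close>

lemma red_image_mset:
  assumes f: "inj_on f V" and \<psi>: "relations V \<psi>" and \<psi>': "small \<psi>'"
    and comm: "\<And>v. v \<in> V \<Longrightarrow> \<psi>' (f v) = map_option (image_mset f) (\<psi> v)"
    and m: "set_mset m \<subseteq> V"
  shows "red \<psi>' (image_mset f m) = map_option (image_mset f) (red \<psi> m)"
  using m
proof (induction "size m" arbitrary: m rule: less_induct)
  case less
  note cnt = count_image_mset_inj_on[OF f less.prems]
  show ?case
  proof (cases m rule: red_cases[OF relations_small[OF \<psi>]])
    case 1
    have "count (image_mset f m) w < p" for w
    proof (cases "w \<in># image_mset f m")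
      case True
      then obtain v where "v \<in># m" "w = f v" by auto
      then show ?thesis using cnt[of v] less.prems 1(1) by auto
    next
      case False
      then have "count (image_mset f m) w = 0" by (simp only: not_in_iff)
      then show ?thesis using p_gt_1 by simp
    qed
    then show ?thesis using 1 by (simp add: red_truncated)
  next
    case (2 v)
    have v: "v \<in># m" using 2(1) by (rule p_le_count_mem)
    then have vV: "v \<in> V" using less.prems by auto
    have sub: "replicate_mset p v \<subseteq># m" using 2 by (simp add: count_le_replicate_mset_subset_eq)
    have im: "image_mset f (m - replicate_mset p v + k) = image_mset f m - replicate_mset p (f v) + image_mset f k" for k
      by (simp only: image_mset_union image_mset_Diff[OF sub] image_replicate_mset)
    have IH: "red \<psi>' (image_mset f (m - replicate_mset p v + k)) = map_option (image_mset f) (red \<psi> (m - replicate_mset p v + k))"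
      if k: "\<psi> v = Some k" for k
    proof (rule less.hyps)
      show "size (m - replicate_mset p v + k) < size m"
        using 2 k \<psi> by (intro size_reduct) (auto simp: relations_def small_def)
      show "set_mset (m - replicate_mset p v + k) \<subseteq> V"
        using less.prems vV k \<psi> by (fastforce simp: relations_def dest!: in_diffD)
    qed
    have "red \<psi>' (image_mset f m)
        = Option.bind (\<psi>' (f v)) (\<lambda>k. red \<psi>' (image_mset f m - replicate_mset p (f v) + k))"
      using 2(1) cnt[OF vV] by (intro red_step[OF \<psi>']) simp
    then show ?thesis
      unfolding 2(2) comm[OF vV] using IH im by (cases "\<psi> v") simp_all
  qed
qed

lemma TP_isomorphic_bij:
  assumes f: "bij_betw f V V'" and \<psi>: "relations V \<psi>" and \<psi>': "relations V' \<psi>'"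
    and comm: "\<And>v. v \<in> V \<Longrightarrow> \<psi>' (f v) = map_option (image_mset f) (\<psi> v)"
  shows "alg_isomorphic F (TP V \<psi>) (TP V' \<psi>')"
  unfolding TP_def
proof (rule FA_isomorphic_basis[OF TP_basis[OF \<psi>] TP_basis[OF \<psi>']])
  have inj: "inj_on f V" and im: "f ` V = V'" using f by (auto simp: bij_betw_def)
  have trunc: "image_mset g m \<in> truncated (g ` V)" if g: "inj_on g V" and m: "m \<in> truncated V"
    for g :: "'c \<Rightarrow> 'd" and V m
  proof -
    have "count (image_mset g m) w < p" for w
    proof (cases "w \<in># image_mset g m")
      case True
      then obtain v where "v \<in># m" "w = g v" by auto
      then show ?thesis using count_image_mset_inj_on[OF g, of m v] m by (auto simp: truncated_def)
    next
      case False
      then have "count (image_mset g m) w = 0" by (simp only: not_in_iff)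
      then show ?thesis using p_gt_1 by simp
    qed
    then show ?thesis using m by (auto simp: truncated_def)
  qed
  show "bij_betw (image_mset f) (truncated V) (truncated V')"
  proof (rule bij_betw_byWitness[where f' = "image_mset (inv_into V f)"])
    show "\<forall>m\<in>truncated V. image_mset (inv_into V f) (image_mset f m) = m"
    proof
      fix m assume "m \<in> truncated V"
      then have "image_mset (inv_into V f \<circ> f) m = image_mset id m"
        using inj by (intro image_mset_cong) (auto simp: truncated_def)
      then show "image_mset (inv_into V f) (image_mset f m) = m" by (simp add: multiset.map_comp)
    qed
    show "\<forall>m\<in>truncated V'. image_mset f (image_mset (inv_into V f) m) = m"
    proof
      fix m assume "m \<in> truncated V'"
      then have "image_mset (f \<circ> inv_into V f) m = image_mset id m"
        using im by (intro image_mset_cong) (auto simp: truncated_def f_inv_into_f)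
      then show "image_mset f (image_mset (inv_into V f) m) = m" by (simp add: multiset.map_comp)
    qed
    show "image_mset f ` truncated V \<subseteq> truncated V'"
      using trunc[OF inj] im by auto
    have "inv_into V f ` V' = V" by (rule bij_betw_imp_surj_on[OF bij_betw_inv_into[OF f]])
    then show "image_mset (inv_into V f) ` truncated V' \<subseteq> truncated V"
      using trunc[of "inv_into V f" V'] inj_on_inv_into[of V' f V] im by auto
  qed
  fix u v assume "u \<in> truncated V" "v \<in> truncated V"
  then have "red \<psi>' (image_mset f (u + v)) = map_option (image_mset f) (red \<psi> (u + v))"
    by (intro red_image_mset[OF inj \<psi> relations_small[OF \<psi>'] comm]) (auto simp: truncated_def)
  then show "frag_extend (\<lambda>u. frag_of (image_mset f u)) (fr (red \<psi> (u + v)))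
      =\<^sub>p fr (red \<psi>' (image_mset f u + image_mset f v))"
    by (cases "red \<psi> (u + v)") simp_all
qed simp


section \<open>Polynomial rings and their quotients\<close>

lemma poly_alg_FA: "poly_alg F V = FA {m. set_mset m \<subseteq> V} {#} (\<lambda>u v. frag_of (u + v))"
  by (simp add: poly_alg_def monoid_alg_def FA_def free_comm_monoid_def rd_frag_of)

lemma poly_alg_basis: "comm_alg_basis {m. set_mset m \<subseteq> V} {#} (\<lambda>u v. frag_of (u + v))"
  by (simp add: comm_alg_basis_def add_ac)

lemma algebra_poly_alg: "algebra F (poly_alg F V)"
  unfolding poly_alg_FA by (rule algebra_FA[OF poly_alg_basis])

lemma poly_var_pow:
  assumes "v \<in> V"
  shows "poly_var F v [^]\<^bsub>poly_alg F V\<^esub> n = rd (frag_of (replicate_mset n v))"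
proof -
  interpret algebra F "poly_alg F V" by (rule algebra_poly_alg)
  have mon: "Group.monoid (poly_alg F V)" using M_cring by (simp add: cring_def ring_def)
  show ?thesis
  proof (induction n)
    case 0
    then show ?case by (simp add: poly_alg_FA FA_def free_alg_simps rd_frag_of)
  next
    case (Suc n)
    have "rd (frag_of (replicate_mset n v)) \<otimes>\<^bsub>poly_alg F V\<^esub> rd (frag_of {#v#})
        = rd (bil (\<lambda>u v. frag_of (u + v)) (frag_of (replicate_mset n v)) (frag_of {#v#}))"
      unfolding poly_alg_FA FA_def
      by (rule rd_bil[OF comm_alg_basis_lifts[OF poly_alg_basis], symmetric]) (use assms in auto)
    then show ?case
      using Suc monoid.nat_pow_Suc[OF mon] by (simp add: poly_var_def rd_frag_of)
  qed
qed

text \<open>Reduction to normal form is a ring homomorphism that annihilates the generators of the ideal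
  and therefore the ideal. Conversely every monomial is congruent to its normal form modulo the
  ideal, because a rewriting step changes a monomial by a multiple of a generator.\<close>

lemma poly_quot_isomorphic:
  assumes \<psi>: "relations V \<psi>"
    and \<phi>: "\<And>v. v \<in> V \<Longrightarrow> \<phi> (poly_var F v) = rd (frag_of (replicate_mset p v) - fr (\<psi> v))"
  shows "alg_isomorphic F (poly_quot F V \<phi>) (TP V \<psi>)"
proof -
  let ?B = "{m. set_mset m \<subseteq> V}" and ?M = "\<lambda>u v. frag_of (u + v) :: 'a multiset frag"
  let ?M' = "\<lambda>u v. fr (red \<psi> (u + v))" and ?T = "frag_extend (\<lambda>m. fr (red \<psi> m))"
  let ?P = "poly_alg F V" and ?C = "TP V \<psi>"
  define I where "I = genideal ?P {\<phi> (poly_var F v) | v. v \<in> V}"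
  note sm = relations_small[OF \<psi>]
  interpret P: algebra F ?P by (rule algebra_poly_alg)
  interpret C: algebra F ?C by (rule algebra_TP[OF \<psi>])
  have ringP: "ring ?P" and ringC: "ring ?C" using P.M_cring C.M_cring by (auto simp: cring_def)
  note RP = realizes_free_alg[OF comm_alg_basis_lifts[OF poly_alg_basis[of V]], folded FA_def, folded poly_alg_FA]
  have psi_in: "fr (\<psi> v) \<in> chains ?B" if "v \<in> V" for v
    using \<psi> that by (cases "\<psi> v") (auto simp: relations_def)
  have gen_in: "frag_of (replicate_mset p v) - fr (\<psi> v) \<in> chains ?B" if "v \<in> V" for v
    using psi_in[OF that] that by (intro diff_chains) (auto split: if_splits)
  have RC: "realizes ?C ?B (bil ?M) (frag_of {#}) (\<lambda>x. rd (?T x))"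
    unfolding TP_def FA_def
  proof (rule realizes_pullback[OF comm_alg_basis_lifts[OF TP_basis[OF \<psi>]]])
    show "fr (red \<psi> u) \<in> chains (truncated V)" if "u \<in> ?B" for u
      using red_in_truncated[OF \<psi>] that by simp
    show "\<exists>x\<in>chains ?B. ?T x =\<^sub>p frag_of b" if "b \<in> truncated V" for b
      using that truncated_red[OF that] by (intro bexI[of _ "frag_of b"]) (auto simp: truncated_def)
  qed (auto simp: bil_red2[OF sm] truncated_red[OF empty_truncated])
  have gens: "{\<phi> (poly_var F v) | v. v \<in> V} \<subseteq> carrier ?P"
    using \<phi> gen_in realizesD(5)[OF RP] by auto
  have idl: "ideal I ?P" unfolding I_def by (rule ring.genideal_ideal[OF ringP gens])
  interpret I: ideal I ?P by (rule idl)
  have I_sub: "additive_subgroup I ?P" ..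
  \<comment> \<open>The ideal is the least one that contains the generators, so the kernel of a ring homomorphism
      on residues is needed; \<open>?T\<close> is defined on chains only.\<close>
  define h where "h f = rd (?T (SOME x. x \<in> chains ?B \<and> rd x = f))" for f
  have h: "h (rd x) = rd (?T x)" if x: "x \<in> chains ?B" for x
  proof -
    define y where "y = (SOME y. y \<in> chains ?B \<and> rd y = rd x)"
    have "y \<in> chains ?B \<and> rd y = rd x"
      unfolding y_def by (rule someI[of _ x]) (use x in simp)
    then show ?thesis using frag_extend_eqp[of y x] unfolding h_def y_def[symmetric] by (simp add: rd_eq_iff)
  qed
  have ex: "\<exists>x\<in>chains ?B. f = rd x" if "f \<in> carrier ?P" for f
    by (rule carrier_rd[OF that[unfolded poly_alg_FA FA_def]])
  have "h \<in> ring_hom ?P ?C"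
  proof (rule ring_hom_memI)
    fix f assume "f \<in> carrier ?P"
    then obtain x where "x \<in> chains ?B" "f = rd x" using ex by meson
    then show "h f \<in> carrier ?C" using h realizesD(5)[OF RC] by simp
  next
    fix f g assume "f \<in> carrier ?P" "g \<in> carrier ?P"
    then obtain x y where xy: "x \<in> chains ?B" "f = rd x" "y \<in> chains ?B" "g = rd y" using ex by meson
    show "h (f \<otimes>\<^bsub>?P\<^esub> g) = h f \<otimes>\<^bsub>?C\<^esub> h g"
      using realizesD(8)[OF RP xy(1,3)] realizesD(8)[OF RC xy(1,3)]
        h[OF realizesD(6)[OF RP xy(1,3)]] xy h by simp
    show "h (f \<oplus>\<^bsub>?P\<^esub> g) = h f \<oplus>\<^bsub>?C\<^esub> h g"
      using realizesD(7)[OF RP xy(1,3)] realizesD(7)[OF RC xy(1,3)]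
        h[OF add_chains[OF xy(1,3)]] xy h by simp
  next
    show "h \<one>\<^bsub>?P\<^esub> = \<one>\<^bsub>?C\<^esub>"
      using realizesD(3)[OF RP] realizesD(3)[OF RC] h[OF realizesD(2)[OF RP]] by simp
  qed
  then have hom: "ring_hom_ring ?P ?C h" by (rule ring_hom_ringI2[OF ringP ringC])
  have "I \<subseteq> a_kernel ?P ?C h"
    unfolding I_def
  proof (rule ring.genideal_minimal[OF ringP ring_hom_ring.kernel_is_ideal[OF hom]], rule subsetI)
    fix f assume "f \<in> {\<phi> (poly_var F v) | v. v \<in> V}"
    then obtain v where v: "v \<in> V" "f = \<phi> (poly_var F v)" by blast
    have "?T (frag_of (replicate_mset p v)) = ?T (fr (\<psi> v))"
    proof -
      have "red \<psi> (replicate_mset p v) = Option.bind (\<psi> v) (red \<psi>)"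
        using red_step[OF sm, of "replicate_mset p v" v] by simp
      then show ?thesis by (cases "\<psi> v") simp_all
    qed
    then have "h f = rd 0" unfolding v(2) \<phi>[OF v(1)] h[OF gen_in[OF v(1)]] by (simp add: frag_extend_diff)
    then have "h f = \<zero>\<^bsub>?C\<^esub>" unfolding TP_def FA_def using rd_zero' by metis
    then show "f \<in> a_kernel ?P ?C h" using v gens by (auto simp: a_kernel_def')
  qed
  then have sound: "?T x =\<^sub>p 0" if "x \<in> chains ?B" "rd x \<in> I" for x
  proof -
    have "h (rd x) = \<zero>\<^bsub>?C\<^esub>" using that \<open>I \<subseteq> a_kernel ?P ?C h\<close> by (auto simp: a_kernel_def')
    then have "rd (?T x) = rd 0" unfolding h[OF that(1)] TP_def FA_def rd_zero'[symmetric] .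
    then show ?thesis by (simp add: rd_eq_iff)
  qed
  have complete: "rd (frag_of m - fr (red \<psi> m)) \<in> I" if "m \<in> ?B" for m
    using that
  proof (induction "size m" arbitrary: m rule: less_induct)
    case less
    have zero: "rd 0 \<in> I" using I.zero_closed unfolding poly_alg_FA FA_def rd_zero'[symmetric] .
    show ?case
    proof (cases m rule: red_cases[OF sm])
      case 1 then show ?thesis using zero by simp
    next
      case (2 v)
      have v: "v \<in># m" using 2(1) by (rule p_le_count_mem)
      then have vV: "v \<in> V" using less.prems by auto
      let ?n = "m - replicate_mset p v"
      have m: "m = ?n + replicate_mset p v"
        using 2 by (simp add: count_le_replicate_mset_subset_eq)
      have n: "?n \<in> ?B" using less.prems by (auto dest: in_diffD)
      have "rd (frag_of (replicate_mset p v) - fr (\<psi> v)) \<in> I"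
        unfolding I_def \<phi>[OF vV, symmetric]
        using ring.genideal_self[OF ringP gens] vV by blast
      moreover have "rd (frag_of ?n) \<in> carrier ?P" using n realizesD(5)[OF RP] by simp
      ultimately have "rd (frag_of ?n) \<otimes>\<^bsub>?P\<^esub> rd (frag_of (replicate_mset p v) - fr (\<psi> v)) \<in> I"
        using I.I_l_closed by blast
      moreover have "rd (frag_of ?n) \<otimes>\<^bsub>?P\<^esub> rd (frag_of (replicate_mset p v) - fr (\<psi> v))
         = rd (bil ?M (frag_of ?n) (frag_of (replicate_mset p v) - fr (\<psi> v)))"
        by (rule realizesD(8)[OF RP, symmetric]) (use n gen_in[OF vV] in auto)
      moreover have "bil ?M (frag_of ?n) (frag_of (replicate_mset p v) - fr (\<psi> v))
         = frag_of m - bil ?M (frag_of ?n) (fr (\<psi> v))"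
        using m by (simp add: bil_diff_right)
      ultimately have A: "rd (frag_of m - bil ?M (frag_of ?n) (fr (\<psi> v))) \<in> I" by simp
      show ?thesis
      proof (cases "\<psi> v")
        case None
        then show ?thesis using A 2 by simp
      next
        case (Some k)
        have k: "?n + k \<in> ?B" using n \<psi> Some vV by (auto simp: relations_def)
        have "rd (frag_of (?n + k) - fr (red \<psi> (?n + k))) \<in> I"
          using \<psi> Some 2 k by (intro less.hyps size_reduct) (auto simp: relations_def small_def)
        with A have "rd ((frag_of m - frag_of (?n + k)) + (frag_of (?n + k) - fr (red \<psi> (?n + k)))) \<in> I"
          unfolding rd_add[of _ _ ?B "{#}" "\<lambda>u v. rd (?M u v)"] FA_def[symmetric] poly_alg_FA[symmetric]
          using I.a_closed Some by simp
        then show ?thesis using 2 Some by simp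
      qed
    qed
  qed
  show ?thesis
    unfolding poly_quot_def I_def[symmetric]
    unfolding poly_alg_FA TP_def FA_def
  proof (rule quot_alg_presentation(1)[where s = frag_of])
    show "lifts ?B {#} (\<lambda>u v. rd (?M u v)) ?M"
      by (rule comm_alg_basis_lifts[OF poly_alg_basis])
    show "lifts (truncated V) {#} (\<lambda>u v. rd (?M' u v)) ?M'"
      by (rule comm_alg_basis_lifts[OF TP_basis[OF \<psi>]])
    show "algebra F (free_alg F (truncated V) {#} (\<lambda>u v. rd (?M' u v)))"
      using algebra_TP[OF \<psi>] by (simp add: TP_def FA_def)
    show "additive_subgroup I (free_alg F ?B {#} (\<lambda>u v. rd (?M u v)))"
      using I_sub by (simp add: poly_alg_FA FA_def)
    show "fr (red \<psi> u) \<in> chains (truncated V)" if "u \<in> ?B" for u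
      using red_in_truncated[OF \<psi>] that by simp
    show "rd (frag_of u - frag_extend frag_of (fr (red \<psi> u))) \<in> I" if "u \<in> ?B" for u
      using complete[OF that] by (simp flip: frag_expansion)
    show "?T (frag_of b) =\<^sub>p frag_of b" if "b \<in> truncated V" for b
      using truncated_red[OF that] by simp
    show "frag_of b \<in> chains ?B" if "b \<in> truncated V" for b
      using that by (simp add: truncated_def)
  qed (use sound in \<open>auto simp: bil_red2[OF sm] truncated_red[OF empty_truncated]\<close>)
qed

lemma relations_simps [simp]:
  "relations V (\<lambda>_. None)" "relations V (\<lambda>v. Some {#v#})" "relations V (\<lambda>_. Some {#})"
  by (auto simp: relations_def small_def)

lemma poly_quot_nilpotent: "alg_isomorphic F (poly_quot F V (\<lambda>w. w [^]\<^bsub>poly_alg F V\<^esub> p)) (TP V (\<lambda>_. None))"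
  by (rule poly_quot_isomorphic) (auto simp: poly_var_pow)

lemma poly_quot_boolean:
  "alg_isomorphic F (poly_quot F V (\<lambda>w. w [^]\<^bsub>poly_alg F V\<^esub> p \<ominus>\<^bsub>poly_alg F V\<^esub> w)) (TP V (\<lambda>v. Some {#v#}))"
proof (rule poly_quot_isomorphic)
  fix v assume v: "v \<in> V"
  have "rd (frag_of (replicate_mset p v) - frag_of {#v#})
      = rd (frag_of (replicate_mset p v)) \<ominus>\<^bsub>poly_alg F V\<^esub> rd (frag_of {#v#})"
    unfolding poly_alg_FA FA_def by (rule rd_diff) (use v in auto)
  then show "poly_var F v [^]\<^bsub>poly_alg F V\<^esub> p \<ominus>\<^bsub>poly_alg F V\<^esub> poly_var F v
      = rd (frag_of (replicate_mset p v) - fr (Some {#v#}))"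
    using poly_var_pow[OF v] by (simp add: poly_var_def rd_frag_of)
qed simp

lemma poly_quot_unipotent:
  "alg_isomorphic F (poly_quot F V (\<lambda>w. w [^]\<^bsub>poly_alg F V\<^esub> p \<ominus>\<^bsub>poly_alg F V\<^esub> \<one>\<^bsub>poly_alg F V\<^esub>))
     (TP V (\<lambda>_. Some {#}))"
proof (rule poly_quot_isomorphic)
  fix v assume v: "v \<in> V"
  have "rd (frag_of (replicate_mset p v) - frag_of {#})
      = rd (frag_of (replicate_mset p v)) \<ominus>\<^bsub>poly_alg F V\<^esub> rd (frag_of {#})"
    unfolding poly_alg_FA FA_def by (rule rd_diff) (use v in auto)
  moreover have "\<one>\<^bsub>poly_alg F V\<^esub> = rd (frag_of {#})"
    by (simp add: poly_alg_FA FA_def free_alg_simps rd_frag_of)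
  ultimately show "poly_var F v [^]\<^bsub>poly_alg F V\<^esub> p \<ominus>\<^bsub>poly_alg F V\<^esub> \<one>\<^bsub>poly_alg F V\<^esub>
      = rd (frag_of (replicate_mset p v) - fr (Some {#}))"
    using poly_var_pow[OF v] by simp
qed simp

end

context prime_modulus
begin

section \<open>Polynomial rings via base p expansion of the exponents\<close>

text \<open>In \<open>F[x\<^sub>0, x\<^sub>1, \<dots>] / \<langle>x\<^sub>j\<^sup>p - x\<^bsub>j+1\<^esub>\<rangle>\<close> every variable is a power of the first one: \<open>x\<^sub>j =
  x\<^sub>0\<^bsup>p^j\<^esup>\<close>. The normal forms are the expansions of exponents in base \<open>p\<close>, so that this algebra is
  a polynomial ring in one variable. The pair \<open>(x, j)\<close> stands for \<open>x\<^sub>j\<close>.\<close>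

definition shift :: "'v \<times> nat \<Rightarrow> ('v \<times> nat) multiset option" where
  "shift v = Some {#(fst v, Suc (snd v))#}"

definition digit_sum :: "('v \<times> nat) multiset \<Rightarrow> 'v multiset" where
  "digit_sum m = (\<Sum>v\<in>#m. replicate_mset (p ^ snd v) (fst v))"

lemma shift_relations [simp]: "relations (V \<times> UNIV) shift"
  by (auto simp: relations_def small_def shift_def)

lemma digit_sum_add: "digit_sum (m + n) = digit_sum m + digit_sum n"
  by (simp add: digit_sum_def)

lemma digit_sum_single [simp]: "digit_sum {#v#} = replicate_mset (p ^ snd v) (fst v)"
  by (simp add: digit_sum_def)

lemma count_digit_sum:
  assumes "\<forall>v\<in>#m. snd v < N"
  shows "count (digit_sum m) x = (\<Sum>j<N. p ^ j * count m (x, j))"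
  using assms
proof (induction m)
  case empty
  then show ?case by (simp add: digit_sum_def)
next
  case (add v m)
  obtain y i where v: "v = (y, i)" by fastforce
  have "count (digit_sum (add_mset v m)) x = count (replicate_mset (p ^ i) y) x + count (digit_sum m) x"
    by (simp add: digit_sum_def v)
  also have "count (digit_sum m) x = (\<Sum>j<N. p ^ j * count m (x, j))"
    using add by simp
  also have "count (replicate_mset (p ^ i) y) x = (\<Sum>j<N. p ^ j * (if (x, j) = v then 1 else 0))"
    using add.prems by (cases "x = y") (simp_all add: v if_distrib cong: if_cong)
  finally show ?case
    by (simp add: sum.distrib[symmetric] algebra_simps) (auto intro!: sum.cong)
qed

lemma digits_unique:
  fixes a b :: "nat \<Rightarrow> nat"
  assumes "\<And>j. a j < p" "\<And>j. b j < p" "(\<Sum>j<N. p ^ j * a j) = (\<Sum>j<N. p ^ j * b j)" "j < N"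
  shows "a j = b j"
  using assms
proof (induction N arbitrary: a b j)
  case (Suc N)
  have split: "(\<Sum>j<Suc N. p ^ j * c j) = c 0 + p * (\<Sum>j<N. p ^ j * c (Suc j))" for c :: "nat \<Rightarrow> nat"
    by (simp add: sum.lessThan_Suc_shift sum_distrib_left mult.assoc del: sum.lessThan_Suc)
  have eq: "a 0 + p * (\<Sum>j<N. p ^ j * a (Suc j)) = b 0 + p * (\<Sum>j<N. p ^ j * b (Suc j))"
    using Suc.prems(3) unfolding split .
  have "(a 0 + p * (\<Sum>j<N. p ^ j * a (Suc j))) mod p = a 0" "(b 0 + p * (\<Sum>j<N. p ^ j * b (Suc j))) mod p = b 0"
    using Suc.prems(1,2) by simp_all
  then have 0: "a 0 = b 0" using eq by simp
  show ?case
  proof (cases j)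
    case (Suc i)
    have "(\<Sum>j<N. p ^ j * a (Suc j)) = (\<Sum>j<N. p ^ j * b (Suc j))" using eq 0 p_gt_1 by simp
    then show ?thesis using Suc.IH[of "\<lambda>j. a (Suc j)" "\<lambda>j. b (Suc j)" i] Suc.prems Suc by simp
  qed (use 0 in simp)
qed simp

lemma sum_bound: "\<exists>N. \<forall>v\<in>#m. snd v < (N :: nat)"
proof -
  have "finite (snd ` set_mset m)" by simp
  then obtain N where "\<forall>n\<in>snd ` set_mset m. n < N" using finite_nat_set_iff_bounded by blast
  then show ?thesis by blast
qed

lemma digit_sum_inj:
  fixes V :: "'v set"
  shows "inj_on digit_sum (truncated (V \<times> (UNIV :: nat set)))"
proof (rule inj_onI, rule multiset_eqI)
  fix m n :: "('v \<times> nat) multiset" and v :: "'v \<times> nat"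
  assume m: "m \<in> truncated (V \<times> UNIV)" "n \<in> truncated (V \<times> UNIV)" and eq: "digit_sum m = digit_sum n"
  obtain x i where v: "v = (x, i)" by fastforce
  obtain N1 N2 where N: "\<forall>v\<in>#m. snd v < N1" "\<forall>v\<in>#n. snd v < N2" using sum_bound by meson
  define N where "N = max (max N1 N2) (Suc i)"
  have mn: "\<forall>v\<in>#m. snd v < N" "\<forall>v\<in>#n. snd v < N" "i < N"
    using N by (force simp: N_def less_max_iff_disj)+
  have "count m (x, i) = count n (x, i)"
  proof (rule digits_unique[of "\<lambda>j. count m (x, j)" "\<lambda>j. count n (x, j)" N])
    show "(\<Sum>j<N. p ^ j * count m (x, j)) = (\<Sum>j<N. p ^ j * count n (x, j))"
      using count_digit_sum[OF mn(1)] count_digit_sum[OF mn(2)] eq by metis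
  qed (use m mn in \<open>auto simp: truncated_def\<close>)
  then show "count m v = count n v" by (simp add: v)
qed

lemma digit_sum_replicate: "digit_sum (replicate_mset n v) = replicate_mset (n * p ^ snd v) (fst v)"
  by (induction n) (auto simp: digit_sum_def intro!: multiset_eqI)

lemma red_shift:
  obtains k where "red shift m = Some k" "digit_sum k = digit_sum m"
proof -
  have "\<exists>k. red shift m = Some k \<and> digit_sum k = digit_sum m"
  proof (induction "size m" arbitrary: m rule: less_induct)
    case less
    have sm: "small (shift :: 'a \<times> nat \<Rightarrow> _)" by (auto simp: small_def shift_def)
    show ?case
    proof (cases m rule: red_cases[OF sm])
      case (2 v)
      let ?k = "{#(fst v, Suc (snd v))#}" and ?n = "m - replicate_mset p v"
      have m: "m = ?n + replicate_mset p v"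
        using 2 by (simp add: count_le_replicate_mset_subset_eq)
      have "digit_sum (?n + ?k) = digit_sum m"
        using arg_cong[OF m, of digit_sum]
        by (simp add: digit_sum_add digit_sum_replicate del: union_mset_add_mset_right)
      moreover have "red shift m = red shift (?n + ?k)" unfolding 2(2) by (simp add: shift_def)
      moreover have "size (?n + ?k) < size m" using 2(1) by (intro size_reduct) auto
      ultimately show ?thesis using less[of "?n + ?k"] by simp
    qed simp
  qed
  then show ?thesis using that by blast
qed

lemma poly_alg_TP: "alg_isomorphic F (poly_alg F V) (TP (V \<times> UNIV) shift)"
proof (rule alg_isomorphic_sym, unfold poly_alg_FA TP_def,
    rule FA_isomorphic_basis[OF TP_basis[OF shift_relations] poly_alg_basis])
  have supp: "set_mset (digit_sum m) \<subseteq> V" if "set_mset m \<subseteq> V \<times> UNIV" for m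
    using that unfolding digit_sum_def by (induction m) (auto split: if_splits)
  show "bij_betw digit_sum (truncated (V \<times> UNIV)) {m. set_mset m \<subseteq> V}"
    unfolding bij_betw_def
  proof (intro conjI digit_sum_inj equalityI subsetI)
    fix m assume m: "m \<in> {m. set_mset m \<subseteq> V}"
    \<comment> \<open>Carrying turns the trivial expansion, with all units in the lowest digit, into the expansion
        with digits smaller than \<open>p\<close>.\<close>
    let ?m = "image_mset (\<lambda>v. (v, 0::nat)) m"
    obtain k where k: "red shift ?m = Some k" "digit_sum k = digit_sum ?m" by (rule red_shift)
    have "set_mset ?m \<subseteq> V \<times> UNIV" using m by auto
    from red_in_truncated[OF shift_relations this] have "k \<in> truncated (V \<times> UNIV)" using k by simp
    moreover have "digit_sum ?m = m" by (induction m) (auto simp: digit_sum_def)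
    ultimately show "m \<in> digit_sum ` truncated (V \<times> UNIV)" using k by (metis imageI)
  qed (use supp in \<open>auto simp: truncated_def\<close>)
  show "digit_sum {#} = {#}" by (simp add: digit_sum_def)
  fix u v :: "('a \<times> nat) multiset"
  obtain k where "red shift (u + v) = Some k" "digit_sum k = digit_sum (u + v)" by (rule red_shift)
  then show "frag_extend (\<lambda>u. frag_of (digit_sum u)) (fr (red shift (u + v)))
      =\<^sub>p frag_of (digit_sum u + digit_sum v)"
    by (simp add: digit_sum_add)
qed


section \<open>Tensor products\<close>

text \<open>The algebra is, up to congruence, the given chains: the form in which a factor of a tensor
  product enters. The inverse of \<open>h\<close> is only determined modulo \<open>p\<close>, and \<open>chain_of\<close> picks a
  preimage.\<close>

definition presents :: "(int, 'a) module \<Rightarrow> 's set \<Rightarrow> 's \<Rightarrow> ('s \<Rightarrow> 's \<Rightarrow> 's frag) \<Rightarrow> ('s frag \<Rightarrow> 'a) \<Rightarrow> bool" where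
  "presents A B e M h \<longleftrightarrow> realizes A B (bil M) (frag_of e) h \<and>
     (\<forall>x\<in>chains B. \<forall>y\<in>chains B. h x = h y \<longleftrightarrow> x =\<^sub>p y)"

lemma alg_isomorphic_presents:
  assumes iso: "alg_isomorphic F A (FA B e M)" and L: "comm_alg_basis B e M"
  obtains h where "presents A B e M h"
proof -
  let ?N = "FA B e M"
  obtain k where k: "k \<in> ring_iso ?N A" "algebra F A"
    and sm: "\<And>c a. c \<in> carrier F \<Longrightarrow> a \<in> carrier ?N \<Longrightarrow> k (c \<odot>\<^bsub>?N\<^esub> a) = c \<odot>\<^bsub>A\<^esub> k a"
    using alg_isomorphic_sym[OF iso] unfolding alg_isomorphic_def by blast
  interpret A: algebra F A by fact
  interpret N: algebra F ?N using algebra_FA[OF L] .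
  note R = realizesD[OF realizes_free_alg[OF comm_alg_basis_lifts[OF L]], folded FA_def]
  note K = ring_iso_memE[OF k(1)]
  have "k \<zero>\<^bsub>?N\<^esub> = \<zero>\<^bsub>A\<^esub>"
    using ring_hom_zero[of k ?N A] k(1) N.M_cring A.M_cring by (simp add: ring_iso_def cring_def)
  moreover have "k ` carrier ?N = carrier A" using K(5) by (simp add: bij_betw_def)
  ultimately have "realizes A B (bil M) (frag_of e) (k \<circ> rd)"
    unfolding realizes_def image_comp[symmetric] R(1)
    using R K sm by (simp del: F_simps)
  moreover have "(k \<circ> rd) x = (k \<circ> rd) y \<longleftrightarrow> x =\<^sub>p y" if "x \<in> chains B" "y \<in> chains B" for x y
    using inj_onD[OF bij_betw_imp_inj_on[OF K(5)], of "rd x" "rd y"] R(5)[OF that(1)] R(5)[OF that(2)]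
    unfolding rd_eq_iff[symmetric] by auto
  ultimately show ?thesis using that unfolding presents_def by blast
qed

definition chain_of :: "'s set \<Rightarrow> ('s frag \<Rightarrow> 'a) \<Rightarrow> 'a \<Rightarrow> 's frag" where
  "chain_of B h a = (SOME x. x \<in> chains B \<and> h x = a)"

lemma chain_of:
  assumes "presents A B e M h" "a \<in> carrier A"
  shows "chain_of B h a \<in> chains B" "h (chain_of B h a) = a"
proof -
  have "\<exists>x. x \<in> chains B \<and> h x = a"
    using assms realizesD(1)[of A B "bil M" "frag_of e" h] unfolding presents_def by force
  from someI_ex[OF this] show "chain_of B h a \<in> chains B" "h (chain_of B h a) = a" by (simp_all add: chain_of_def)
qed

lemma presentsD:
  assumes "presents A B e M h"
  shows "realizes A B (bil M) (frag_of e) h" "x \<in> chains B \<Longrightarrow> y \<in> chains B \<Longrightarrow> h x = h y \<longleftrightarrow> x =\<^sub>p y"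
  using assms unfolding presents_def by blast+

lemma chain_of_eqp:
  assumes P: "presents A B e M h" and a: "a \<in> carrier A" "x \<in> chains B" "h x = a"
  shows "chain_of B h a =\<^sub>p x"
  using presentsD(2)[OF P chain_of(1)[OF P a(1)] a(2)] chain_of(2)[OF P a(1)] a(3) by simp

lemma chain_of_ops:
  assumes P: "presents A B e M h" and A: "algebra F A" and a: "a \<in> carrier A" and b: "b \<in> carrier A"
  shows "chain_of B h (a \<oplus>\<^bsub>A\<^esub> b) =\<^sub>p chain_of B h a + chain_of B h b"
    and "chain_of B h (a \<otimes>\<^bsub>A\<^esub> b) =\<^sub>p bil M (chain_of B h a) (chain_of B h b)"
    and "c \<in> carrier F \<Longrightarrow> chain_of B h (c \<odot>\<^bsub>A\<^esub> a) =\<^sub>p frag_cmul c (chain_of B h a)"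
    and "chain_of B h \<one>\<^bsub>A\<^esub> =\<^sub>p frag_of e"
proof -
  note R = realizesD[OF presentsD(1)[OF P]] and la = chain_of[OF P a] and lb = chain_of[OF P b]
  show "chain_of B h (a \<oplus>\<^bsub>A\<^esub> b) =\<^sub>p chain_of B h a + chain_of B h b"
    using R(5)[OF add_chains[OF la(1) lb(1)]] R(7)[OF la(1) lb(1)] la lb by (intro chain_of_eqp[OF P]) simp_all
  show "chain_of B h (a \<otimes>\<^bsub>A\<^esub> b) =\<^sub>p bil M (chain_of B h a) (chain_of B h b)"
    using R(6)[OF la(1) lb(1)] R(5)[OF R(6)[OF la(1) lb(1)]] R(8)[OF la(1) lb(1)] la lb
    by (intro chain_of_eqp[OF P]) simp_all
  show "chain_of B h (c \<odot>\<^bsub>A\<^esub> a) =\<^sub>p frag_cmul c (chain_of B h a)" if "c \<in> carrier F"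
    using R(5)[OF cmul_chains[OF la(1)], of c] R(9)[OF that la(1)] la by (intro chain_of_eqp[OF P]) simp_all
  show "chain_of B h \<one>\<^bsub>A\<^esub> =\<^sub>p frag_of e"
    using R(2,3) R(5)[OF R(2)] by (intro chain_of_eqp[OF P]) auto
qed

text \<open>For \<open>I\<close> the relations of a tensor product and \<open>\<phi>\<close> the pure tensor as a function of one slot,
  additivity modulo \<open>I\<close> expands this slot in a basis.\<close>

lemma slot_expansion:
  assumes I: "additive_subgroup I (free_alg F D e' \<mu>)" and P: "presents A B e M h"
    and \<phi>: "\<And>a. a \<in> carrier A \<Longrightarrow> \<phi> a \<in> chains D"
    and add: "\<And>a b. a \<in> carrier A \<Longrightarrow> b \<in> carrier A \<Longrightarrow> rd (\<phi> (a \<oplus>\<^bsub>A\<^esub> b) - (\<phi> a + \<phi> b)) \<in> I"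
    and x: "x \<in> chains B"
  shows "rd (\<phi> (h x) - frag_extend (\<lambda>u. \<phi> (h (frag_of u))) x) \<in> I"
proof -
  note R = realizesD[OF presentsD(1)[OF P]]
  interpret I: additive_subgroup I "free_alg F D e' \<mu>" by fact
  have zero: "rd 0 \<in> I" using I.zero_closed by (simp add: rd_zero'[of D e' \<mu>])
  note dm = rd_diff_mem[OF I]
  have in_D: "\<phi> (h x) \<in> chains D" if "x \<in> chains B" for x using \<phi> R(5)[OF that] by blast
  have ext_D: "frag_extend (\<lambda>u. \<phi> (h (frag_of u))) x \<in> chains D" if "x \<in> chains B" for x
    using that by (rule frag_extend_chains) (use in_D in simp)
  have "x \<in> chains B \<and> rd (\<phi> (h x) - frag_extend (\<lambda>u. \<phi> (h (frag_of u))) x) \<in> I"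
    using x
  proof (induction rule: chains_induct)
    case zero
    have h0: "h 0 \<in> carrier A" by (rule R(5)) simp
    have "h 0 \<oplus>\<^bsub>A\<^esub> h 0 = h 0" using R(7)[of 0 0] by simp
    then have "rd (\<phi> (h 0) - (\<phi> (h 0) + \<phi> (h 0))) \<in> I" using add[OF h0 h0] by simp
    then have neg: "rd (- \<phi> (h 0)) \<in> I" by simp
    have "rd (0 - (- \<phi> (h 0))) \<in> I"
      by (rule dm) (use neg in_D[of 0] \<open>rd 0 \<in> I\<close> in auto)
    then show ?case by simp
  next
    case (one u)
    then show ?case using \<open>rd 0 \<in> I\<close> by simp
  next
    case (diff x y)
    let ?E = "frag_extend (\<lambda>u. \<phi> (h (frag_of u)))"
    have xy: "x \<in> chains B" "y \<in> chains B" using diff by auto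
    have "h x = h (x - y) \<oplus>\<^bsub>A\<^esub> h y" using R(7)[OF diff_chains[OF xy] xy(2)] by simp
    then have A: "rd (\<phi> (h x) - (\<phi> (h (x - y)) + \<phi> (h y))) \<in> I"
      using add[OF R(5)[OF diff_chains[OF xy]] R(5)[OF xy(2)]] by simp
    have B: "rd ((\<phi> (h x) - ?E x) - (\<phi> (h y) - ?E y)) \<in> I"
      by (rule dm) (use diff xy in_D ext_D in auto)
    have "rd (((\<phi> (h x) - ?E x) - (\<phi> (h y) - ?E y)) - (\<phi> (h x) - (\<phi> (h (x - y)) + \<phi> (h y)))) \<in> I"
      by (rule dm) (use A B xy in_D ext_D in auto)
    then show ?case using xy by (simp add: frag_extend_diff algebra_simps)
  qed
  then show ?thesis by simp
qed

definition tens :: "'a frag \<Rightarrow> 'b frag \<Rightarrow> ('a \<times> 'b) frag" where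
  "tens = bil (\<lambda>a b. frag_of (a, b))"

definition tens_mult ::
  "('a \<Rightarrow> 'a \<Rightarrow> 'a frag) \<Rightarrow> ('b \<Rightarrow> 'b \<Rightarrow> 'b frag) \<Rightarrow> 'a \<times> 'b \<Rightarrow> 'a \<times> 'b \<Rightarrow> ('a \<times> 'b) frag" where
  "tens_mult M1 M2 u v = tens (M1 (fst u) (fst v)) (M2 (snd u) (snd v))"

text \<open>Both sides are additive in each of the four arguments, which are therefore replaced by basis
  elements one after the other.\<close>

lemma bil_tens_mult:
  "bil (tens_mult M1 M2) (tens x y) (tens x' y') = tens (bil M1 x x') (bil M2 y y')"
proof -
  have 1: "bil (tens_mult M1 M2) (tens (frag_of u) (frag_of v)) (tens (frag_of a) (frag_of b))
      = tens (bil M1 (frag_of u) (frag_of a)) (bil M2 (frag_of v) (frag_of b))" for u v a b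
    by (simp add: tens_def tens_mult_def)
  have 2: "bil (tens_mult M1 M2) (tens x (frag_of v)) (tens (frag_of a) (frag_of b))
      = tens (bil M1 x (frag_of a)) (bil M2 (frag_of v) (frag_of b))" for x v a b
    by (rule additive_eq_on_chains[of x UNIV "\<lambda>x. bil (tens_mult M1 M2) (tens x (frag_of v)) (tens (frag_of a) (frag_of b))"
        "\<lambda>x. tens (bil M1 x (frag_of a)) (bil M2 (frag_of v) (frag_of b))"])
      (simp_all only: chains_UNIV 1, simp_all add: tens_def bil_diff_left)
  have 3: "bil (tens_mult M1 M2) (tens x y) (tens (frag_of a) (frag_of b))
      = tens (bil M1 x (frag_of a)) (bil M2 y (frag_of b))" for x y a b
    by (rule additive_eq_on_chains[of y UNIV "\<lambda>y. bil (tens_mult M1 M2) (tens x y) (tens (frag_of a) (frag_of b))"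
        "\<lambda>y. tens (bil M1 x (frag_of a)) (bil M2 y (frag_of b))"])
      (simp_all only: chains_UNIV 2, simp_all add: tens_def bil_diff_left bil_diff_right)
  have 4: "bil (tens_mult M1 M2) (tens x y) (tens x' (frag_of b))
      = tens (bil M1 x x') (bil M2 y (frag_of b))" for b
    by (rule additive_eq_on_chains[of x' UNIV "\<lambda>x'. bil (tens_mult M1 M2) (tens x y) (tens x' (frag_of b))"
        "\<lambda>x'. tens (bil M1 x x') (bil M2 y (frag_of b))"])
      (simp_all only: chains_UNIV 3, simp_all add: tens_def bil_diff_left bil_diff_right)
  show ?thesis
    by (rule additive_eq_on_chains[of y' UNIV "\<lambda>y'. bil (tens_mult M1 M2) (tens x y) (tens x' y')"
        "\<lambda>y'. tens (bil M1 x x') (bil M2 y y')"])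
      (simp_all only: chains_UNIV 4, simp_all add: tens_def bil_diff_right)
qed

lemma tens_chains: "x \<in> chains A \<Longrightarrow> y \<in> chains B \<Longrightarrow> tens x y \<in> chains (A \<times> B)"
  unfolding tens_def by (rule bil_chains) auto

lemma tens_eqp: "x =\<^sub>p x' \<Longrightarrow> y =\<^sub>p y' \<Longrightarrow> tens x y =\<^sub>p tens x' y'"
  unfolding tens_def by (rule bil_eqp)

lemma tens_linear:
  "tens (x + x') y = tens x y + tens x' y" "tens x (y + y') = tens x y + tens x y'"
  "tens (frag_cmul c x) y = frag_cmul c (tens x y)" "tens x (frag_cmul c y) = frag_cmul c (tens x y)"
  by (simp_all add: tens_def bil_add_left bil_add_right bil_cmul_left bil_cmul_right)

lemma tens_basis:
  assumes L1: "comm_alg_basis B1 e1 M1" and L2: "comm_alg_basis B2 e2 M2"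
  shows "comm_alg_basis (B1 \<times> B2) (e1, e2) (tens_mult M1 M2)"
proof -
  note c1 = comm_alg_basisD[OF L1] and c2 = comm_alg_basisD[OF L2]
  have t: "frag_of u = tens (frag_of (fst u)) (frag_of (snd u))" for u :: "'a \<times> 'b"
    by (simp add: tens_def)
  have "bil (tens_mult M1 M2) (tens_mult M1 M2 u v) (frag_of w) = bil (tens_mult M1 M2) (frag_of u) (tens_mult M1 M2 v w)"
    if "u \<in> B1 \<times> B2" "v \<in> B1 \<times> B2" "w \<in> B1 \<times> B2" for u v w
    using that unfolding t tens_mult_def[of M1 M2 u v] tens_mult_def[of M1 M2 v w] bil_tens_mult
    by (auto simp: c1(4) c2(4))
  then show ?thesis
    unfolding comm_alg_basis_def
    using c1 c2 by (auto simp: tens_mult_def tens_chains) (simp_all add: tens_def)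
qed

text \<open>Expanding both components of a pure tensor in bases is compatible with the bilinearity
  relations, and every pure tensor is congruent to its expansion modulo these relations.\<close>

lemma tensor_alg_isomorphic:
  assumes A: "alg_isomorphic F A (FA B1 e1 M1)" and L1: "comm_alg_basis B1 e1 M1"
    and B: "alg_isomorphic F B (FA B2 e2 M2)" and L2: "comm_alg_basis B2 e2 M2"
  shows "alg_isomorphic F (tensor_alg F A B) (FA (B1 \<times> B2) (e1, e2) (tens_mult M1 M2))"
proof -
  obtain h k where P: "presents A B1 e1 M1 h" and Q: "presents B B2 e2 M2 k"
    using alg_isomorphic_presents[OF A L1] alg_isomorphic_presents[OF B L2] by metis
  have algA: "algebra F A" and algB: "algebra F B" using A B by (auto simp: alg_isomorphic_def)
  interpret A: algebra F A by fact
  interpret B: algebra F B by fact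
  note mA = monoid.m_closed[OF ring.is_monoid[OF cring.axioms(1)[OF A.M_cring]]]
    monoid.one_closed[OF ring.is_monoid[OF cring.axioms(1)[OF A.M_cring]]]
  note mB = monoid.m_closed[OF ring.is_monoid[OF cring.axioms(1)[OF B.M_cring]]]
    monoid.one_closed[OF ring.is_monoid[OF cring.axioms(1)[OF B.M_cring]]]
  let ?chain_of = "chain_of B1 h" and ?lg = "chain_of B2 k"
  note RA = realizesD[OF presentsD(1)[OF P]] and RB = realizesD[OF presentsD(1)[OF Q]]
  define D where "D = carrier A \<times> carrier B"
  define M where "M = (\<lambda>u v. frag_of (u \<otimes>\<^bsub>A \<times>\<times> B\<^esub> v))"
  define t where "t = (\<lambda>(a, b). tens (?chain_of a) (?lg b))"
  define s where "s = (\<lambda>(u, v). frag_of (h (frag_of u), k (frag_of v)))"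
  let ?e = "(\<one>\<^bsub>A\<^esub>, \<one>\<^bsub>B\<^esub>)"
  define G where "G = free_alg F D ?e (\<lambda>u v. rd (M u v))"
  have G: "monoid_alg F (A \<times>\<times> B) = G"
    unfolding monoid_alg_def G_def D_def M_def rd_frag_of by (simp add: DirProd_def)
  define I where "I = submodule_span F G (tensor_rels F A B)"
  have mult: "(a, b) \<otimes>\<^bsub>A \<times>\<times> B\<^esub> (a', b') = (a \<otimes>\<^bsub>A\<^esub> a', b \<otimes>\<^bsub>B\<^esub> b')" for a b a' b'
    by (simp add: DirProd_def)
  have LG: "lifts D ?e (\<lambda>u v. rd (M u v)) M"
    unfolding lifts_def D_def M_def using mA mB by (auto simp: mult)
  have diff: "rd x \<ominus>\<^bsub>G\<^esub> rd y = rd (x - y)" if "x \<in> chains D" "y \<in> chains D" for x y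
    unfolding G_def by (rule rd_diff[symmetric, OF that])
  have add: "rd x \<oplus>\<^bsub>G\<^esub> rd y = rd (x + y)" for x y unfolding G_def by (rule rd_add[symmetric])
  have cmul: "c \<odot>\<^bsub>G\<^esub> rd x = rd (frag_cmul c x)" for c x unfolding G_def by (rule rd_cmul[symmetric])
  have rels: "tensor_rels F A B =
     {rd (frag_of (a \<oplus>\<^bsub>A\<^esub> a', b) - (frag_of (a, b) + frag_of (a', b))) | a a' b.
            a \<in> carrier A \<and> a' \<in> carrier A \<and> b \<in> carrier B} \<union>
     {rd (frag_of (a, b \<oplus>\<^bsub>B\<^esub> b') - (frag_of (a, b) + frag_of (a, b'))) | a b b'.
            a \<in> carrier A \<and> b \<in> carrier B \<and> b' \<in> carrier B} \<union>
     {rd (frag_of (c \<odot>\<^bsub>A\<^esub> a, b) - frag_cmul c (frag_of (a, b))) | c a b.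
            c \<in> carrier F \<and> a \<in> carrier A \<and> b \<in> carrier B} \<union>
     {rd (frag_of (a, c \<odot>\<^bsub>B\<^esub> b) - frag_cmul c (frag_of (a, b))) | c a b.
            c \<in> carrier F \<and> a \<in> carrier A \<and> b \<in> carrier B}"
  proof -
    have 1: "rd (frag_of (a \<oplus>\<^bsub>A\<^esub> a', b)) \<ominus>\<^bsub>G\<^esub> rd (frag_of (a, b) + frag_of (a', b))
        = rd (frag_of (a \<oplus>\<^bsub>A\<^esub> a', b) - (frag_of (a, b) + frag_of (a', b)))"
      if "a \<in> carrier A" "a' \<in> carrier A" "b \<in> carrier B" for a a' b
      using that by (intro diff) (auto simp: D_def)
    have 2: "rd (frag_of (a, b \<oplus>\<^bsub>B\<^esub> b')) \<ominus>\<^bsub>G\<^esub> rd (frag_of (a, b) + frag_of (a, b'))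
        = rd (frag_of (a, b \<oplus>\<^bsub>B\<^esub> b') - (frag_of (a, b) + frag_of (a, b')))"
      if "a \<in> carrier A" "b \<in> carrier B" "b' \<in> carrier B" for a b b'
      using that by (intro diff) (auto simp: D_def)
    have 3: "rd (frag_of (c \<odot>\<^bsub>A\<^esub> a, b)) \<ominus>\<^bsub>G\<^esub> rd (frag_cmul c (frag_of (a, b)))
        = rd (frag_of (c \<odot>\<^bsub>A\<^esub> a, b) - frag_cmul c (frag_of (a, b)))"
      if "c \<in> carrier F" "a \<in> carrier A" "b \<in> carrier B" for c a b
      using that A.smult_closed by (intro diff) (auto simp: D_def simp del: F_simps)
    have 4: "rd (frag_of (a, c \<odot>\<^bsub>B\<^esub> b)) \<ominus>\<^bsub>G\<^esub> rd (frag_cmul c (frag_of (a, b)))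
        = rd (frag_of (a, c \<odot>\<^bsub>B\<^esub> b) - frag_cmul c (frag_of (a, b)))"
      if "c \<in> carrier F" "a \<in> carrier A" "b \<in> carrier B" for c a b
      using that B.smult_closed by (intro diff) (auto simp: D_def simp del: F_simps)
    show ?thesis
      unfolding tensor_rels_def Let_def G rd_frag_of[symmetric] add cmul
      by (intro arg_cong2[where f = "(\<union>)"] Collect_cong ex_cong1)
        (auto simp: 1 2 3 4 simp del: F_simps)
  qed
  have lfA: "?chain_of a \<in> chains B1" if "a \<in> carrier A" for a using chain_of(1)[OF P that] .
  have lgB: "?lg b \<in> chains B2" if "b \<in> carrier B" for b using chain_of(1)[OF Q that] .
  have sub_carrier: "tensor_rels F A B \<subseteq> carrier G"
    unfolding rels G_def
    using A.smult_closed B.smult_closed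
    by (auto intro!: rd_in_carrier diff_chains add_chains cmul_chains simp: D_def simp del: F_simps)
  have sub_I: "submodule I F G" "tensor_rels F A B \<subseteq> I"
    using submodule_span_is_submodule[OF sub_carrier[unfolded G_def]] unfolding I_def G_def by simp_all
  have add_I: "additive_subgroup I G"
    using submodule_additive_subgroup[OF sub_I(1)[unfolded G_def]] unfolding G_def .
  have in_I: "rd (frag_of (a \<oplus>\<^bsub>A\<^esub> a', b) - (frag_of (a, b) + frag_of (a', b))) \<in> I"
    if "a \<in> carrier A" "a' \<in> carrier A" "b \<in> carrier B" for a a' b
    by (rule subsetD[OF sub_I(2)]) (use that in \<open>unfold rels, blast\<close>)
  have in_I': "rd (frag_of (a, b \<oplus>\<^bsub>B\<^esub> b') - (frag_of (a, b) + frag_of (a, b'))) \<in> I"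
    if "a \<in> carrier A" "b \<in> carrier B" "b' \<in> carrier B" for a b b'
    by (rule subsetD[OF sub_I(2)]) (use that in \<open>unfold rels, blast\<close>)
  have complete: "rd (frag_of u - frag_extend s (t u)) \<in> I" if uD: "u \<in> D" for u
  proof -
    obtain a b where u: "u = (a, b)" "a \<in> carrier A" "b \<in> carrier B" using uD by (auto simp: D_def)
    have hu: "h (frag_of i) \<in> carrier A" if "i \<in> B1" for i using RA(5) that by simp
    have kv: "k (frag_of j) \<in> carrier B" if "j \<in> B2" for j using RB(5) that by simp
    have E1: "rd (frag_of (h x, b) - frag_extend (\<lambda>i. frag_of (h (frag_of i), b)) x) \<in> I" if "x \<in> chains B1" for x
      by (rule slot_expansion[OF add_I[unfolded G_def] P _ _ that, where \<phi> = "\<lambda>a. frag_of (a, b)"])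
        (use u in_I in \<open>auto simp: D_def\<close>)
    have E2: "rd (frag_of (a', k y) - frag_extend (\<lambda>j. frag_of (a', k (frag_of j))) y) \<in> I"
      if "y \<in> chains B2" "a' \<in> carrier A" for y a'
      by (rule slot_expansion[OF add_I[unfolded G_def] Q _ _ that(1), where \<phi> = "\<lambda>b. frag_of (a', b)"])
        (use that in_I' in \<open>auto simp: D_def\<close>)
    have E3: "rd (frag_extend (\<lambda>i. frag_of (h (frag_of i), k y)) x - frag_extend s (tens x y)) \<in> I"
      if x: "x \<in> chains B1" and y: "y \<in> chains B2" for x y
    proof -
      have D: "frag_extend (\<lambda>i. frag_of (h (frag_of i), k y)) x \<in> chains D" if "x \<in> chains B1" for x
        using that by (rule frag_extend_chains) (use hu RB(5)[OF y] in \<open>auto simp: D_def\<close>)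
      have D': "frag_extend s (tens x y) \<in> chains D" if "x \<in> chains B1" for x
        using tens_chains[OF that y] by (rule frag_extend_chains) (use hu kv in \<open>auto simp: D_def s_def\<close>)
      have "x \<in> chains B1 \<and> ?thesis" using x
      proof (induction rule: chains_induct)
        case zero
        then show ?case using additive_subgroup.zero_closed[OF add_I]
          by (simp add: tens_def rd_zero'[of D ?e "\<lambda>u v. rd (M u v)"] G_def)
      next
        case (one i)
        have "frag_extend s (tens (frag_of i) y) = frag_extend (\<lambda>j. frag_of (h (frag_of i), k (frag_of j))) y"
          by (rule additive_eq_on_chains[OF y]) (auto simp: tens_def bil_diff_right frag_extend_diff s_def)
        then show ?case using E2[OF y hu[OF one]] one by simp
      next
        case (diff x x')
        have "rd ((frag_extend (\<lambda>i. frag_of (h (frag_of i), k y)) x - frag_extend s (tens x y))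
            - (frag_extend (\<lambda>i. frag_of (h (frag_of i), k y)) x' - frag_extend s (tens x' y))) \<in> I"
          by (rule rd_diff_mem[OF add_I[unfolded G_def]]) (use diff D D' in auto)
        then show ?case using diff
          by (simp add: tens_def bil_diff_left frag_extend_diff algebra_simps)
      qed
      then show ?thesis by blast
    qed
    let ?x = "?chain_of a" and ?y = "?lg b"
    have x: "?x \<in> chains B1" "h ?x = a" and y: "?y \<in> chains B2" "k ?y = b"
      using chain_of[OF P u(2)] chain_of[OF Q u(3)] by auto
    have "rd (frag_of (a, b) - frag_extend (\<lambda>i. frag_of (h (frag_of i), b)) ?x) \<in> I"
      using E1[OF x(1)] x(2) by simp
    moreover have "rd (frag_extend (\<lambda>i. frag_of (h (frag_of i), b)) ?x - frag_extend s (tens ?x ?y)) \<in> I"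
      using E3[OF x(1) y(1)] y(2) by simp
    ultimately have "rd (frag_of (a, b) - frag_extend (\<lambda>i. frag_of (h (frag_of i), b)) ?x) \<oplus>\<^bsub>G\<^esub>
       rd (frag_extend (\<lambda>i. frag_of (h (frag_of i), b)) ?x - frag_extend s (tens ?x ?y)) \<in> I"
      by (rule additive_subgroup.a_closed[OF add_I])
    then show ?thesis by (simp add: add u t_def)
  qed
  have sound: "frag_extend t x =\<^sub>p 0" if "x \<in> chains D" "rd x \<in> I" for x
  proof (rule submodule_span_sound[OF _ that(1) that(2)[unfolded I_def G_def]])
    note oA = chain_of_ops[OF P algA] and oB = chain_of_ops[OF Q algB]
    fix g assume g: "g \<in> tensor_rels F A B"
    have wit: "\<exists>x\<in>chains D. g = rd x \<and> frag_extend t x =\<^sub>p 0"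
      if "g = rd y" "y \<in> chains D" "frag_extend t y =\<^sub>p 0" for y
      using that by (intro bexI[of _ y]) auto
    from g consider
      a a' b where "a \<in> carrier A" "a' \<in> carrier A" "b \<in> carrier B"
        "g = rd (frag_of (a \<oplus>\<^bsub>A\<^esub> a', b) - (frag_of (a, b) + frag_of (a', b)))"
    | a b b' where "a \<in> carrier A" "b \<in> carrier B" "b' \<in> carrier B"
        "g = rd (frag_of (a, b \<oplus>\<^bsub>B\<^esub> b') - (frag_of (a, b) + frag_of (a, b')))"
    | c a b where "c \<in> carrier F" "a \<in> carrier A" "b \<in> carrier B"
        "g = rd (frag_of (c \<odot>\<^bsub>A\<^esub> a, b) - frag_cmul c (frag_of (a, b)))"
    | c a b where "c \<in> carrier F" "a \<in> carrier A" "b \<in> carrier B"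
        "g = rd (frag_of (a, c \<odot>\<^bsub>B\<^esub> b) - frag_cmul c (frag_of (a, b)))"
      unfolding rels by (elim UnE CollectE exE conjE)
    then show "\<exists>x\<in>chains D. g = rd x \<and> frag_extend t x =\<^sub>p 0"
    proof cases
      case 1
      have "tens (?chain_of (a \<oplus>\<^bsub>A\<^esub> a')) (?lg b) =\<^sub>p tens (?chain_of a) (?lg b) + tens (?chain_of a') (?lg b)"
        using tens_eqp[OF oA(1)[OF 1(1,2)] eqp_refl, of "?lg b"] by (simp add: tens_linear)
      note eq = this
      show ?thesis
        by (intro wit[OF 1(4)]) (use 1 eq in \<open>auto simp: D_def t_def frag_extend_diff frag_extend_add eqp_diff_0_iff\<close>)
    next
      case 2
      have "tens (?chain_of a) (?lg (b \<oplus>\<^bsub>B\<^esub> b')) =\<^sub>p tens (?chain_of a) (?lg b) + tens (?chain_of a) (?lg b')"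
        using tens_eqp[OF eqp_refl oB(1)[OF 2(2,3)], of "?chain_of a"] by (simp add: tens_linear)
      note eq = this
      show ?thesis
        by (intro wit[OF 2(4)]) (use 2 eq in \<open>auto simp: D_def t_def frag_extend_diff frag_extend_add eqp_diff_0_iff\<close>)
    next
      case 3
      have "tens (?chain_of (c \<odot>\<^bsub>A\<^esub> a)) (?lg b) =\<^sub>p frag_cmul c (tens (?chain_of a) (?lg b))"
        using tens_eqp[OF oA(3)[OF 3(2) 3(2) 3(1)] eqp_refl, of "?lg b"] by (simp add: tens_linear)
      note eq = this
      show ?thesis
        by (intro wit[OF 3(4)]) (use 3 eq A.smult_closed[OF 3(1,2)] in \<open>auto simp: D_def t_def frag_extend_diff frag_extend_cmul eqp_diff_0_iff\<close>)
    next
      case 4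
      have "tens (?chain_of a) (?lg (c \<odot>\<^bsub>B\<^esub> b)) =\<^sub>p frag_cmul c (tens (?chain_of a) (?lg b))"
        using tens_eqp[OF eqp_refl oB(3)[OF 4(3) 4(3) 4(1)], of "?chain_of a"] by (simp add: tens_linear)
      note eq = this
      show ?thesis
        by (intro wit[OF 4(4)]) (use 4 eq B.smult_closed[OF 4(1,3)] in \<open>auto simp: D_def t_def frag_extend_diff frag_extend_cmul eqp_diff_0_iff\<close>)
    qed
  qed
  show ?thesis
    unfolding tensor_alg_def Let_def G I_def[symmetric]
    unfolding G_def FA_def
  proof (rule quot_alg_presentation(1)[where s = s and t = t, OF LG comm_alg_basis_lifts[OF tens_basis[OF L1 L2]]])
    show "algebra F (free_alg F (B1 \<times> B2) (e1, e2) (\<lambda>u v. rd (tens_mult M1 M2 u v)))"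
      using algebra_FA[OF tens_basis[OF L1 L2]] by (simp add: FA_def)
    show "t u \<in> chains (B1 \<times> B2)" if "u \<in> D" for u
      using that lfA lgB by (auto simp: t_def D_def intro: tens_chains)
    show "frag_extend t (M u v) =\<^sub>p bil (tens_mult M1 M2) (t u) (t v)" if "u \<in> D" "v \<in> D" for u v
    proof -
      obtain a b a' b' where u: "u = (a, b)" "v = (a', b')" "a \<in> carrier A" "b \<in> carrier B" "a' \<in> carrier A" "b' \<in> carrier B"
        using \<open>u \<in> D\<close> \<open>v \<in> D\<close> by (auto simp: D_def)
      show ?thesis
        using tens_eqp[OF chain_of_ops(2)[OF P algA u(3,5)] chain_of_ops(2)[OF Q algB u(4,6)]]
        by (simp add: u M_def t_def mult bil_tens_mult)
    qed
    show "t ?e =\<^sub>p frag_of (e1, e2)"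
      using tens_eqp[OF chain_of_ops(4)[OF P algA mA(2) mA(2)] chain_of_ops(4)[OF Q algB mB(2) mB(2)]]
      by (simp add: t_def) (simp add: tens_def)
    show "s b \<in> chains D" if "b \<in> B1 \<times> B2" for b
      using that RA(5) RB(5) by (auto simp: s_def D_def)
    show "frag_extend t (s b) =\<^sub>p frag_of b" if "b \<in> B1 \<times> B2" for b
    proof -
      obtain i j where b: "b = (i, j)" "i \<in> B1" "j \<in> B2" using \<open>b \<in> B1 \<times> B2\<close> by auto
      have "?chain_of (h (frag_of i)) =\<^sub>p frag_of i" "?lg (k (frag_of j)) =\<^sub>p frag_of j"
        using b RA(5) RB(5) by (auto intro: chain_of_eqp[OF P] chain_of_eqp[OF Q])
      from tens_eqp[OF this] show ?thesis by (simp add: b s_def t_def) (simp add: tens_def)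
    qed
    show "additive_subgroup I (free_alg F D ?e (\<lambda>u v. rd (M u v)))"
      using add_I by (simp add: G_def)
  qed (use sound complete in auto)
qed

definition sum_rel ::
  "('v \<Rightarrow> 'v multiset option) \<Rightarrow> ('w \<Rightarrow> 'w multiset option) \<Rightarrow> 'v + 'w \<Rightarrow> ('v + 'w) multiset option" where
  "sum_rel \<psi> \<chi> = case_sum (\<lambda>v. map_option (image_mset Inl) (\<psi> v)) (\<lambda>w. map_option (image_mset Inr) (\<chi> w))"

lemma sum_rel_simps [simp]:
  "sum_rel \<psi> \<chi> (Inl v) = map_option (image_mset Inl) (\<psi> v)"
  "sum_rel \<psi> \<chi> (Inr w) = map_option (image_mset Inr) (\<chi> w)"
  by (simp_all add: sum_rel_def)

lemma sum_rel_relations: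
  assumes "relations V \<psi>" "relations W \<chi>"
  shows "relations (V <+> W) (sum_rel \<psi> \<chi>)"
  using assms by (force simp: relations_def small_def sum_rel_def split: sum.splits)

text \<open>A tensor product of two truncated polynomial algebras adjoins the variables of the second to
  those of the first; a pair of monomials becomes their product.\<close>

lemma tensor_TP:
  assumes A: "alg_isomorphic F A (TP V \<psi>)" and \<psi>: "relations V \<psi>"
    and B: "alg_isomorphic F B (TP W \<chi>)" and \<chi>: "relations W \<chi>"
  shows "alg_isomorphic F (tensor_alg F A B) (TP (V <+> W) (sum_rel \<psi> \<chi>))"
proof -
  note L1 = TP_basis[OF \<psi>] and L2 = TP_basis[OF \<chi>] and S = sum_rel_relations[OF \<psi> \<chi>]
  note sm = relations_small[OF S]
  define f where "f = (\<lambda>(m, n). image_mset Inl m + image_mset Inr n :: ('b + 'd) multiset)"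
  define g where "g = (\<lambda>k. (image_mset projl (filter_mset isl k :: ('b + 'd) multiset), image_mset projr (filter_mset (\<lambda>x. \<not> isl x) k)))"
  have cnt: "count (f (m, n)) (Inl v) = count m v" "count (f (m, n)) (Inr w) = count n w" for m n v w
  proof -
    have 0: "count (image_mset Inr n) (Inl v) = 0" "count (image_mset Inl m) (Inr w) = 0"
      by (auto simp: count_eq_zero_iff simp del: count_image_mset)
    show "count (f (m, n)) (Inl v) = count m v" "count (f (m, n)) (Inr w) = count n w"
      using 0 count_image_mset_inj_on[of Inl UNIV m v] count_image_mset_inj_on[of Inr UNIV n w] by (simp_all add: f_def)
  qed
  have trunc: "f (m, n) \<in> truncated (V <+> W)" if "m \<in> truncated V" "n \<in> truncated W" for m n
  proof -
    have "count (f (m, n)) x < p" for x using that cnt[of m n] by (cases x) (auto simp: truncated_def)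
    then show ?thesis using that by (auto simp: truncated_def f_def)
  qed
  have redf: "fr (red (sum_rel \<psi> \<chi>) (f (m, n))) = frag_extend (\<lambda>u. frag_of (f u)) (tens (fr (red \<psi> m)) (fr (red \<chi> n)))"
    if "set_mset m \<subseteq> V" "set_mset n \<subseteq> W" for m n
  proof -
    have i1: "red (sum_rel \<psi> \<chi>) (image_mset Inl m) = map_option (image_mset Inl) (red \<psi> m)"
      by (rule red_image_mset[OF _ \<psi> sm _ that(1)]) auto
    have i2: "red (sum_rel \<psi> \<chi>) (image_mset Inr n) = map_option (image_mset Inr) (red \<chi> n)"
      by (rule red_image_mset[OF _ \<chi> sm _ that(2)]) auto
    have fr': "fr (red (sum_rel \<psi> \<chi>) (f (m, n))) = bil (\<lambda>u v. fr (red (sum_rel \<psi> \<chi>) (u + v)))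
        (fr (map_option (image_mset Inl) (red \<psi> m))) (fr (map_option (image_mset Inr) (red \<chi> n)))"
      unfolding i1[symmetric] i2[symmetric] bil_red2[OF sm] by (simp add: f_def)
    show ?thesis
    proof (cases "red \<psi> m = None \<or> red \<chi> n = None")
      case True
      then show ?thesis unfolding fr' by (auto simp: tens_def)
    next
      case False
      then obtain m' n' where k: "red \<psi> m = Some m'" "red \<chi> n = Some n'" by auto
      have "m' \<in> truncated V" "n' \<in> truncated W"
        using red_in_truncated[OF \<psi> that(1)] red_in_truncated[OF \<chi> that(2)] k by simp_all
      then have "red (sum_rel \<psi> \<chi>) (f (m', n')) = Some (f (m', n'))" by (rule truncated_red[OF trunc])
      then show ?thesis unfolding fr' by (simp add: k tens_def f_def)
    qed
  qed
  have "alg_isomorphic F (tensor_alg F A B)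
     (FA (truncated V \<times> truncated W) ({#}, {#})
        (tens_mult (\<lambda>u v. fr (red \<psi> (u + v))) (\<lambda>u v. fr (red \<chi> (u + v)))))"
    using tensor_alg_isomorphic[OF A[unfolded TP_def] L1 B[unfolded TP_def] L2] .
  also have "alg_isomorphic F \<dots> (TP (V <+> W) (sum_rel \<psi> \<chi>))"
    unfolding TP_def
  proof (rule FA_isomorphic_basis[OF tens_basis[OF L1 L2] TP_basis[OF S], where f = f])
    show "bij_betw f (truncated V \<times> truncated W) (truncated (V <+> W))"
    proof (rule bij_betw_byWitness[where f' = g])
      have gf: "g (f (m, n)) = (m, n)" for m n
        by (simp add: f_def g_def filter_mset_image_mset comp_def multiset.map_comp)
      then show "\<forall>a\<in>truncated V \<times> truncated W. g (f a) = a" by auto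
      have fg: "f (g k) = k" for k
      proof -
        have 1: "image_mset (Inl \<circ> projl) (filter_mset isl k) = image_mset id (filter_mset isl k)"
          by (intro image_mset_cong) auto
        have 2: "image_mset (Inr \<circ> projr) (filter_mset (\<lambda>x. \<not> isl x) k) = image_mset id (filter_mset (\<lambda>x. \<not> isl x) k)"
          by (intro image_mset_cong) (auto simp: sum.expand)
        show ?thesis using 1 2 by (simp add: f_def g_def multiset.map_comp)
      qed
      then show "\<forall>a'\<in>truncated (V <+> W). f (g a') = a'" by blast
      show "f ` (truncated V \<times> truncated W) \<subseteq> truncated (V <+> W)" using trunc by auto
      show "g ` truncated (V <+> W) \<subseteq> truncated V \<times> truncated W"
      proof
        fix a assume "a \<in> g ` truncated (V <+> W)"
        then obtain k where k: "k \<in> truncated (V <+> W)" "a = g k" by blast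
        obtain m n where mn: "g k = (m, n)" by fastforce
        then have fk: "f (m, n) = k" using fg[of k] by simp
        have "set_mset m \<subseteq> V" "set_mset n \<subseteq> W"
          using k(1) unfolding fk[symmetric] by (auto simp: truncated_def f_def Plus_def image_subset_iff)
        then show "a \<in> truncated V \<times> truncated W"
          using k(1) cnt[of m n, unfolded fk, symmetric] unfolding k(2) mn by (auto simp: truncated_def)
      qed
    qed
    show "f ({#}, {#}) = {#}" by (simp add: f_def)
    fix u v assume "u \<in> truncated V \<times> truncated W" "v \<in> truncated V \<times> truncated W"
    then obtain m n m' n' where *: "u = (m, n)" "v = (m', n')"
      "set_mset (m + m') \<subseteq> V" "set_mset (n + n') \<subseteq> W" by (auto simp: truncated_def)
    have "f (m + m', n + n') = f u + f v" by (simp add: f_def *)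
    then show "frag_extend (\<lambda>u. frag_of (f u)) (tens_mult (\<lambda>u v. fr (red \<psi> (u + v))) (\<lambda>u v. fr (red \<chi> (u + v))) u v)
       =\<^sub>p fr (red (sum_rel \<psi> \<chi>) (f u + f v))"
      using redf[OF *(3,4)] by (simp add: * tens_mult_def)
  qed
  finally show ?thesis .
qed

end

section \<open>The mixable shuffle ring on integral chains of words\<close>

text \<open>The tensor \<open>a \<otimes> x\<close> for an integral chain \<open>x\<close> of words.\<close>

definition pre :: "'s \<Rightarrow> 's list frag \<Rightarrow> 's list frag" where
  "pre a = frag_extend (\<lambda>w. frag_of (a # w))"

context
  fixes m :: "'s \<Rightarrow> 's \<Rightarrow> 's" and l :: int
begin

text \<open>The mixable shuffle product with integral coefficients, of which \<^const>\<open>mix_prod\<close> is the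
  reduction.\<close>

fun mix :: "'s list \<Rightarrow> 's list \<Rightarrow> 's list frag" where
  "mix [] v = frag_of v"
| "mix (a # u) [] = frag_of (a # u)"
| "mix (a # u) (b # v) =
     pre a (mix u (b # v)) + pre b (mix (a # u) v) + frag_cmul l (pre (m a b) (mix u v))"

end

lemma frag_cmul_diff2: "frag_cmul c (x - y) = frag_cmul c x - frag_cmul c y"
  by (rule poly_mapping_eqI) (simp add: lookup_minus right_diff_distrib)

lemma pre_of [simp]: "pre a (frag_of w) = frag_of (a # w)"
  by (simp add: pre_def)

lemma pre_diff: "pre a (x - y) = pre a x - pre a y"
  by (simp add: pre_def frag_extend_diff)

lemma pre_add: "pre a (x + y) = pre a x + pre a y"
  by (simp add: pre_def frag_extend_add)

lemma pre_cmul: "pre a (frag_cmul c x) = frag_cmul c (pre a x)"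
  by (simp add: pre_def frag_extend_cmul)

lemma pre_zero [simp]: "pre a 0 = 0"
  by (simp add: pre_def)

lemma pre_sum: "finite I \<Longrightarrow> pre a (\<Sum>i\<in>I. f i) = (\<Sum>i\<in>I. pre a (f i))"
  by (induction I rule: finite_induct) (auto simp: pre_add)

lemma lookup_pre: "Poly_Mapping.lookup (pre a x) w = (case w of [] \<Rightarrow> 0 | b # w' \<Rightarrow> if b = a then Poly_Mapping.lookup x w' else 0)"
proof -
  have "Poly_Mapping.lookup (pre a x) w
      = (\<Sum>u\<in>Poly_Mapping.keys x. if w = a # u then Poly_Mapping.lookup x u else 0)"
    unfolding pre_def lookup_frag_extend by (intro sum.cong) auto
  also have "\<dots> = (case w of [] \<Rightarrow> 0 | b # w' \<Rightarrow> if b = a then Poly_Mapping.lookup x w' else 0)"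
  proof (cases w)
    case (Cons b w')
    have "(\<Sum>u\<in>Poly_Mapping.keys x. if w = a # u then Poly_Mapping.lookup x u else 0)
        = (\<Sum>u\<in>Poly_Mapping.keys x. if u = w' then (if b = a then Poly_Mapping.lookup x w' else 0) else 0)"
      using Cons by (intro sum.cong) auto
    then show ?thesis using Cons by (auto simp: in_keys_iff)
  qed simp
  finally show ?thesis .
qed

lemma pre_chains: "x \<in> chains (lists C) \<Longrightarrow> a \<in> C \<Longrightarrow> pre a x \<in> chains (lists C)"
  unfolding pre_def by (erule frag_extend_chains) auto

lemma mix_Nil_right [simp]: "mix m l u [] = frag_of u"
  by (cases u) auto

lemma mix_chains:
  assumes "\<And>a b. a \<in> C \<Longrightarrow> b \<in> C \<Longrightarrow> m a b \<in> C" "u \<in> lists C" "v \<in> lists C"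
  shows "mix m l u v \<in> chains (lists C)"
  using assms(2,3)
proof (induction u v rule: mix.induct)
  case (3 a u b v)
  then show ?case using assms(1)[of a b] by (auto intro!: pre_chains add_chains cmul_chains)
qed auto

lemma mix_comm:
  assumes "\<And>a b. m a b = m b a"
  shows "mix m l u v = mix m l v u"
  by (induction u v rule: mix.induct) (simp_all add: assms add_ac)

lemma biadditive_eq:
  fixes f g :: "'a frag \<Rightarrow> 'b frag \<Rightarrow> 'c::ab_group_add"
  assumes "x \<in> chains A" "y \<in> chains B"
    and eq: "\<And>u v. u \<in> A \<Longrightarrow> v \<in> B \<Longrightarrow> f (frag_of u) (frag_of v) = g (frag_of u) (frag_of v)"
    and f: "\<And>x x' y. f (x - x') y = f x y - f x' y" "\<And>x y y'. f x (y - y') = f x y - f x y'"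
    and g: "\<And>x x' y. g (x - x') y = g x y - g x' y" "\<And>x y y'. g x (y - y') = g x y - g x y'"
  shows "f x y = g x y"
proof -
  have 1: "f (frag_of u) y = g (frag_of u) y" if "u \<in> A" for u
    by (rule additive_eq_on_chains[OF assms(2), of "f (frag_of u)" "g (frag_of u)"])
      (use eq that f g in simp_all)
  show ?thesis
    by (rule additive_eq_on_chains[OF assms(1), of "\<lambda>x. f x y" "\<lambda>x. g x y"]) (use 1 f g in simp_all)
qed

text \<open>The defining recursion of the mixable shuffle product extends bilinearly to chains.\<close>

lemma bil_mix_pre:
  "bil (mix m l) (pre a x) (pre b y) = pre a (bil (mix m l) x (pre b y)) + pre b (bil (mix m l) (pre a x) y)
     + frag_cmul l (pre (m a b) (bil (mix m l) x y))"
  by (rule biadditive_eq[of x UNIV y UNIV "\<lambda>x y. bil (mix m l) (pre a x) (pre b y)"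
      "\<lambda>x y. pre a (bil (mix m l) x (pre b y)) + pre b (bil (mix m l) (pre a x) y)
         + frag_cmul l (pre (m a b) (bil (mix m l) x y))"])
    (simp_all add: pre_diff bil_diff_left bil_diff_right frag_cmul_diff2 algebra_simps)

lemma bil_mix_Nil [simp]: "bil (mix m l) (frag_of []) x = x" "bil (mix m l) x (frag_of []) = x"
proof -
  show "bil (mix m l) (frag_of []) x = x"
    by (rule additive_eq_on_chains[of x UNIV]) (auto simp: bil_diff_right)
  show "bil (mix m l) x (frag_of []) = x"
    by (rule additive_eq_on_chains[of x UNIV "\<lambda>x. bil (mix m l) x (frag_of [])"]) (auto simp: bil_diff_left)
qed

text \<open>Expanding both triple products by the recursion yields the same seven terms, according to
  which of the three first letters are used up by the first letter of the result; they agree by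
  induction on the total length.\<close>

lemma mix_assoc:
  assumes assoc: "\<And>a b c. m (m a b) c = m a (m b c)"
  shows "bil (mix m l) (mix m l u v) (frag_of w) = bil (mix m l) (frag_of u) (mix m l v w)"
proof (induction "length u + length v + length w" arbitrary: u v w rule: less_induct)
  case less
  let ?\<mu> = "bil (mix m l)"
  note lin = bil_add_left bil_add_right bil_cmul_left bil_cmul_right pre_add pre_cmul frag_cmul_distrib2 assoc
  show ?case
  proof (cases "u = [] \<or> v = [] \<or> w = []")
    case True
    then show ?thesis by auto
  next
    case False
    then obtain a u' b v' c w' where uvw: "u = a # u'" "v = b # v'" "w = c # w'"
      by (metis neq_Nil_conv)
    have pw: "frag_of (d # z) = pre d (frag_of z)" for d :: 'a and z by simp
    have IH: "?\<mu> (mix m l x y) (frag_of z) = ?\<mu> (frag_of x) (mix m l y z)"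
      if "length x + length y + length z < length u + length v + length w" for x y z
      using less that by blast
    let ?U = "frag_of u'" and ?V = "frag_of v'" and ?W = "frag_of w'"
    have mixpre: "mix m l (d # x) (e # y) = ?\<mu> (pre d (frag_of x)) (pre e (frag_of y))" for d e x y by simp
    have "?\<mu> (mix m l u v) (frag_of w)
        = ?\<mu> (pre a (mix m l u' v)) (pre c ?W) + ?\<mu> (pre b (mix m l u v')) (pre c ?W)
          + frag_cmul l (?\<mu> (pre (m a b) (mix m l u' v')) (pre c ?W))"
      by (simp add: uvw lin)
    also have "\<dots> = pre a (?\<mu> (mix m l u' v) (frag_of w)) + pre c (?\<mu> (pre a (mix m l u' v)) ?W)
          + frag_cmul l (pre (m a c) (?\<mu> (mix m l u' v) ?W))
        + (pre b (?\<mu> (mix m l u v') (frag_of w)) + pre c (?\<mu> (pre b (mix m l u v')) ?W)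
          + frag_cmul l (pre (m b c) (?\<mu> (mix m l u v') ?W)))
        + frag_cmul l (pre (m a b) (?\<mu> (mix m l u' v') (frag_of w)) + pre c (?\<mu> (pre (m a b) (mix m l u' v')) ?W)
          + frag_cmul l (pre (m (m a b) c) (?\<mu> (mix m l u' v') ?W)))"
      unfolding bil_mix_pre by (simp add: uvw)
    also have "\<dots> = pre a (?\<mu> (mix m l u' v) (frag_of w)) + pre b (?\<mu> (mix m l u v') (frag_of w))
        + frag_cmul l (pre (m a b) (?\<mu> (mix m l u' v') (frag_of w)))
        + pre c (?\<mu> (mix m l u v) ?W)
        + frag_cmul l (pre (m a c) (?\<mu> (mix m l u' v) ?W)) + frag_cmul l (pre (m b c) (?\<mu> (mix m l u v') ?W))
        + frag_cmul (l * l) (pre (m a (m b c)) (?\<mu> (mix m l u' v') ?W))"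
      by (simp add: uvw lin add_ac)
    also have "\<dots> = pre a (?\<mu> ?U (mix m l v w)) + pre b (?\<mu> (frag_of u) (mix m l v' w))
        + frag_cmul l (pre (m a b) (?\<mu> ?U (mix m l v' w)))
        + pre c (?\<mu> (frag_of u) (mix m l v w'))
        + frag_cmul l (pre (m a c) (?\<mu> ?U (mix m l v w'))) + frag_cmul l (pre (m b c) (?\<mu> (frag_of u) (mix m l v' w')))
        + frag_cmul (l * l) (pre (m a (m b c)) (?\<mu> ?U (mix m l v' w')))"
      using IH[of u' v w] IH[of u v' w] IH[of u' v' w] IH[of u v w'] IH[of u' v w'] IH[of u v' w'] IH[of u' v' w']
      by (simp add: uvw)
    also have "\<dots> = pre a (?\<mu> ?U (pre b (mix m l v' w))) + pre b (?\<mu> (pre a ?U) (mix m l v' w))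
          + frag_cmul l (pre (m a b) (?\<mu> ?U (mix m l v' w)))
        + (pre a (?\<mu> ?U (pre c (mix m l v w'))) + pre c (?\<mu> (pre a ?U) (mix m l v w'))
          + frag_cmul l (pre (m a c) (?\<mu> ?U (mix m l v w'))))
        + frag_cmul l (pre a (?\<mu> ?U (pre (m b c) (mix m l v' w'))) + pre (m b c) (?\<mu> (pre a ?U) (mix m l v' w'))
          + frag_cmul l (pre (m a (m b c)) (?\<mu> ?U (mix m l v' w'))))"
      by (simp add: uvw lin add_ac)
    also have "\<dots> = ?\<mu> (pre a ?U) (pre b (mix m l v' w)) + ?\<mu> (pre a ?U) (pre c (mix m l v w'))
        + frag_cmul l (?\<mu> (pre a ?U) (pre (m b c) (mix m l v' w')))"
      unfolding bil_mix_pre ..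
    also have "\<dots> = ?\<mu> (frag_of u) (mix m l v w)"
      by (simp add: uvw lin)
    finally show ?thesis .
  qed
qed

locale mixable_shuffle =
  fixes op :: "'s \<Rightarrow> 's \<Rightarrow> 's" and l :: int
  assumes op_assoc: "op (op a b) c = op a (op b c)" and op_comm: "op a b = op b a"
begin

abbreviation msh :: "'s list frag \<Rightarrow> 's list frag \<Rightarrow> 's list frag" (infixl \<open>\<diamondop>\<close> 70) where
  "x \<diamondop> y \<equiv> bil (mix op l) x y"

lemma msh_comm: "x \<diamondop> y = y \<diamondop> x"
  by (rule biadditive_eq[of x UNIV y UNIV "\<lambda>x y. x \<diamondop> y" "\<lambda>x y. y \<diamondop> x"])
    (simp_all add: bil_diff_left bil_diff_right mix_comm[OF op_comm])

lemma msh_assoc: "(x \<diamondop> y) \<diamondop> z = x \<diamondop> (y \<diamondop> z)"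
proof -
  have "(frag_of u \<diamondop> frag_of v) \<diamondop> z = frag_of u \<diamondop> (frag_of v \<diamondop> z)" for u v
    by (rule additive_eq_on_chains[of z UNIV "\<lambda>z. (frag_of u \<diamondop> frag_of v) \<diamondop> z" "\<lambda>z. frag_of u \<diamondop> (frag_of v \<diamondop> z)"])
      (simp_all add: bil_diff_right mix_assoc[OF op_assoc])
  then show ?thesis
    by (intro biadditive_eq[of x UNIV y UNIV "\<lambda>x y. (x \<diamondop> y) \<diamondop> z" "\<lambda>x y. x \<diamondop> (y \<diamondop> z)"])
      (simp_all add: bil_diff_left bil_diff_right)
qed

sublocale Q: comm_ring_1 "bil (mix op l)" "frag_of []" "(+)" 0 "(-)" uminus
  by unfold_locales
    (simp_all add: msh_assoc msh_comm[of "frag_of []"] bil_add_left bil_add_right, rule msh_comm)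

abbreviation pow :: "'s list frag \<Rightarrow> nat \<Rightarrow> 's list frag" where
  "pow x n \<equiv> Q.power x n"

text \<open>The power \<open>s\<^bsup>j+1\<^esup>\<close>: a semigroup has no zeroth powers.\<close>

definition letter_power :: "'s \<Rightarrow> nat \<Rightarrow> 's" where
  "letter_power s j = (op s ^^ j) s"

lemma letter_power_Suc: "letter_power s (Suc j) = op s (letter_power s j)"
  by (simp add: letter_power_def)

lemma msh_sum_right: "finite I \<Longrightarrow> x \<diamondop> (\<Sum>i\<in>I. f i) = (\<Sum>i\<in>I. x \<diamondop> f i)"
  by (induction I rule: finite_induct) (auto simp: bil_add_right)

text \<open>Prefixing a letter is a Rota--Baxter operator. The binomial coefficient counts the \<open>Suc j\<close> of
  the \<open>n\<close> factors whose first letters are merged into the first letter of the product.\<close>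

lemma pow_pre:
  "pow (pre s x) n = (if n = 0 then frag_of [] else \<Sum>j<n. frag_cmul (int (n choose Suc j) * l ^ j)
     (pre (letter_power s j) (pow x (Suc j) \<diamondop> pow (pre s x) (n - Suc j))))"
proof (induction n)
  case (Suc n)
  let ?X = "pre s x"
  define T where "T i = pre (letter_power s i) (pow x (Suc i) \<diamondop> pow ?X (n - i))" for i
  define Y where "Y j = pow x (Suc j) \<diamondop> pow ?X (n - Suc j)" for j
  show ?case
  proof (cases "n = 0")
    case True
    then show ?thesis by (simp add: letter_power_def)
  next
    case False
    then have IH: "pow ?X n = (\<Sum>j<n. frag_cmul (int (n choose Suc j) * l ^ j) (pre (letter_power s j) (Y j)))"
      using Suc by (simp add: Y_def)
    have XY: "?X \<diamondop> Y j = pow x (Suc j) \<diamondop> pow ?X (n - j)" if "j < n" for j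
    proof -
      have "pow ?X (n - j) = ?X \<diamondop> pow ?X (n - Suc j)"
        using that by (metis Q.power_Suc Suc_diff_Suc)
      then show ?thesis by (simp add: Y_def Q.mult.left_commute del: Q.power_Suc)
    qed
    have xY: "x \<diamondop> Y j = pow x (Suc (Suc j)) \<diamondop> pow ?X (n - Suc j)" for j
      by (simp add: Y_def msh_assoc)
    have step: "?X \<diamondop> pre (letter_power s j) (Y j)
        = pre s (x \<diamondop> pre (letter_power s j) (Y j)) + T j + frag_cmul l (T (Suc j))" if "j < n" for j
      unfolding bil_mix_pre XY[OF that] xY T_def letter_power_Suc ..
    have "pow ?X (Suc n) = ?X \<diamondop> pow ?X n" by simp
    also have "\<dots> = (\<Sum>j<n. frag_cmul (int (n choose Suc j) * l ^ j) (?X \<diamondop> pre (letter_power s j) (Y j)))"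
      unfolding IH by (simp add: msh_sum_right bil_cmul_right)
    also have "\<dots> = (\<Sum>j<n. frag_cmul (int (n choose Suc j) * l ^ j) (pre s (x \<diamondop> pre (letter_power s j) (Y j)))
        + frag_cmul (int (n choose Suc j) * l ^ j) (T j) + frag_cmul (int (n choose Suc j) * l ^ Suc j) (T (Suc j)))"
      by (intro sum.cong) (simp_all add: step frag_cmul_distrib2 mult_ac)
    also have "\<dots> = pre s (x \<diamondop> pow ?X n)
        + (\<Sum>j<n. frag_cmul (int (n choose Suc j) * l ^ j) (T j))
        + (\<Sum>j<n. frag_cmul (int (n choose Suc j) * l ^ Suc j) (T (Suc j)))"
      unfolding IH by (simp add: sum.distrib msh_sum_right bil_cmul_right pre_sum pre_cmul)
    also have "pre s (x \<diamondop> pow ?X n) = frag_cmul (int (n choose 0) * l ^ 0) (T 0)"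
      by (simp add: T_def letter_power_def)
    also have "(\<Sum>j<n. frag_cmul (int (n choose Suc j) * l ^ j) (T j))
        = (\<Sum>j<Suc n. frag_cmul (int (n choose Suc j) * l ^ j) (T j))"
      by simp
    finally have "pow ?X (Suc n) = (\<Sum>j<Suc n. frag_cmul (int (n choose Suc j) * l ^ j) (T j))
        + (\<Sum>j<Suc n. frag_cmul (int (n choose j) * l ^ j) (T j))"
      unfolding sum.lessThan_Suc_shift[of "\<lambda>j. frag_cmul (int (n choose j) * l ^ j) (T j)"]
      by (simp add: add_ac)
    also have "\<dots> = (\<Sum>j<Suc n. frag_cmul (int (Suc n choose Suc j) * l ^ j) (T j))"
      unfolding sum.distrib[symmetric] frag_cmul_distrib[symmetric]
      by (intro sum.cong) (simp_all add: algebra_simps)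
    finally show ?thesis by (simp only: T_def diff_Suc_Suc nat.simps if_False)
  qed
qed simp

lemma pow_add:
  "pow (x + y) n = (\<Sum>k\<le>n. frag_cmul (int (n choose k)) (pow x k \<diamondop> pow y (n - k)))"
proof (induction n)
  case (Suc n)
  define T where "T k = pow x k \<diamondop> pow y (Suc n - k)" for k
  have x: "x \<diamondop> (pow x k \<diamondop> pow y (n - k)) = T (Suc k)" for k
    by (simp add: T_def msh_assoc)
  have y: "y \<diamondop> (pow x k \<diamondop> pow y (n - k)) = T k" if "k \<le> n" for k
    using that by (simp add: T_def Q.mult.left_commute Suc_diff_le)
  have "pow (x + y) (Suc n) = x \<diamondop> pow (x + y) n + y \<diamondop> pow (x + y) n"
    by (simp add: bil_add_left)
  also have "\<dots> = (\<Sum>k\<le>n. frag_cmul (int (n choose k)) (T (Suc k))) + (\<Sum>k\<le>n. frag_cmul (int (n choose k)) (T k))"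
    unfolding Suc by (simp add: msh_sum_right bil_cmul_right x y)
  also have "(\<Sum>k\<le>n. frag_cmul (int (n choose k)) (T k)) = (\<Sum>k\<le>Suc n. frag_cmul (int (n choose k)) (T k))"
    by simp
  also have "\<dots> = T 0 + (\<Sum>k\<le>n. frag_cmul (int (n choose Suc k)) (T (Suc k)))"
    by (subst sum.atMost_Suc_shift) simp
  finally have "pow (x + y) (Suc n) = T 0 + (\<Sum>k\<le>n. frag_cmul (int (n choose k)) (T (Suc k)) + frag_cmul (int (n choose Suc k)) (T (Suc k)))"
    by (simp add: sum.distrib)
  also have "\<dots> = (\<Sum>k\<le>Suc n. frag_cmul (int (Suc n choose k)) (T k))"
    by (subst sum.atMost_Suc_shift) (simp add: frag_cmul_distrib[symmetric])
  finally show ?case by (simp add: T_def)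
qed simp

end

locale mixable_shuffle_mod = prime_modulus p + mixable_shuffle op l
  for p :: nat and op :: "'s \<Rightarrow> 's \<Rightarrow> 's" and l :: int
begin

lemma cmul_dvd_eqp: "int p dvd c \<Longrightarrow> frag_cmul c x =\<^sub>p 0"
  by (simp add: eqp_def)

lemma pre_eqp: "x =\<^sub>p y \<Longrightarrow> pre a x =\<^sub>p pre a y"
  unfolding pre_def by (rule frag_extend_eqp)

text \<open>For \<open>n = p\<close> all binomial coefficients but the last one vanish modulo \<open>p\<close>.\<close>

lemma pow_pre_p:
  "pow (pre s x) p =\<^sub>p frag_cmul (l ^ (p - 1)) (pre (letter_power s (p - 1)) (pow x p))"
proof -
  define f where "f j = frag_cmul (int (p choose Suc j) * l ^ j)
     (pre (letter_power s j) (pow x (Suc j) \<diamondop> pow (pre s x) (p - Suc j)))" for j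
  have p: "p = Suc (p - 1)" using p_gt_1 by simp
  have "pow (pre s x) p = (\<Sum>j<p. f j)" using p_gt_1 by (subst pow_pre) (simp add: f_def)
  also have "\<dots> = (\<Sum>j<p - 1. f j) + f (p - 1)" by (subst p) (rule sum.lessThan_Suc)
  also have "\<dots> =\<^sub>p 0 + f (p - 1)"
  proof (rule eqp_add)
    have "(\<Sum>j<p - 1. f j) =\<^sub>p (\<Sum>j<p - 1. 0)"
    proof (rule eqp_sum)
      fix j assume "j \<in> {..<p - 1}"
      then have "p dvd p choose Suc j" by (intro dvd_choose_prime) (use p_prime in auto)
      then show "f j =\<^sub>p 0" unfolding f_def by (intro cmul_dvd_eqp) auto
    qed
    then show "(\<Sum>j<p - 1. f j) =\<^sub>p 0" by simp
  qed simp
  also have "0 + f (p - 1) = frag_cmul (l ^ (p - 1)) (pre (letter_power s (p - 1)) (pow x p))"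
    using p by (simp add: f_def del: Q.power_Suc)
  finally show ?thesis .
qed

text \<open>The \<open>p\<close>-th power of a word is a multiple of the word of \<open>p\<close>-th powers of its letters. It is
  zero for weight zero and nonempty words; for a weight \<open>l\<close> in \<open>{1, \<dots>, p - 1}\<close> the coefficient is
  \<open>1\<close> by Fermat's theorem. This decides which relations the generators of the algebra satisfy.\<close>

lemma pow_word_p:
  "pow (frag_of w) p =\<^sub>p frag_cmul (l ^ ((p - 1) * length w)) (frag_of (map (\<lambda>s. letter_power s (p - 1)) w))"
proof (induction w)
  case Nil
  then show ?case by (simp add: Q.power_one)
next
  case (Cons s w)
  have "pow (frag_of (s # w)) p = pow (pre s (frag_of w)) p" by simp
  also have "\<dots> =\<^sub>p frag_cmul (l ^ (p - 1)) (pre (letter_power s (p - 1)) (pow (frag_of w) p))"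
    by (rule pow_pre_p)
  also have "\<dots> =\<^sub>p frag_cmul (l ^ (p - 1)) (pre (letter_power s (p - 1))
      (frag_cmul (l ^ ((p - 1) * length w)) (frag_of (map (\<lambda>s. letter_power s (p - 1)) w))))"
    by (intro eqp_cmul pre_eqp Cons)
  also have "\<dots> = frag_cmul (l ^ ((p - 1) * length (s # w))) (frag_of (map (\<lambda>s. letter_power s (p - 1)) (s # w)))"
    by (simp add: pre_cmul power_add)
  finally show ?case .
qed

lemma pow_add_p: "pow (x + y) p =\<^sub>p pow x p + pow y p"
proof -
  define f where "f k = frag_cmul (int (p choose k)) (pow x k \<diamondop> pow y (p - k))" for k
  have "pow (x + y) p = sum f {..p}" by (simp add: pow_add f_def)
  also have "\<dots> =\<^sub>p (\<Sum>k\<le>p. if k = 0 \<or> k = p then f k else 0)"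
  proof (rule eqp_sum)
    fix k assume "k \<in> {..p}"
    then have "p dvd p choose k" if "k \<noteq> 0" "k \<noteq> p"
      using that p_prime by (intro dvd_choose_prime) auto
    then have "f k =\<^sub>p 0" if "k \<noteq> 0" "k \<noteq> p"
      using that unfolding f_def by (intro cmul_dvd_eqp) auto
    then show "f k =\<^sub>p (if k = 0 \<or> k = p then f k else 0)" by auto
  qed
  also have "(\<Sum>k\<le>p. if k = 0 \<or> k = p then f k else 0) = (\<Sum>k\<in>{0, p}. f k)"
    by (rule sum.mono_neutral_cong_right) auto
  also have "\<dots> = pow x p + pow y p" using p_gt_1 by (simp add: f_def add.commute)
  finally show ?thesis .
qed

lemma pow_diff_p: "pow (x - y) p =\<^sub>p pow x p - pow y p"
proof -
  have "pow x p =\<^sub>p pow (x - y) p + pow y p" using pow_add_p[of "x - y" y] by simp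
  from eqp_diff[OF this eqp_refl[of "pow y p"]] show ?thesis by (simp add: eqp_sym)
qed

end

section \<open>The mixable shuffle algebra of a monoid algebra\<close>

text \<open>The tensor \<open>f \<otimes> x\<close> for a linear combination \<open>f\<close> of letters.\<close>

definition prep :: "'s frag \<Rightarrow> 's list frag \<Rightarrow> 's list frag" where
  "prep = bil (\<lambda>s u. frag_of (s # u))"

lemma prep_of [simp]: "prep (frag_of s) x = pre s x"
  by (simp add: prep_def pre_def bil_def)

lemma prep_linear:
  "prep (f - g) x = prep f x - prep g x" "prep f (x - y) = prep f x - prep f y"
  "prep (f + g) x = prep f x + prep g x" "prep f (x + y) = prep f x + prep f y"
  "prep (frag_cmul c f) x = frag_cmul c (prep f x)" "prep f (frag_cmul c x) = frag_cmul c (prep f x)"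
  by (simp_all add: prep_def bil_diff_left bil_diff_right bil_add_left bil_add_right bil_cmul_left bil_cmul_right)

lemma bil_mix_prep:
  assumes "f \<in> chains C" "g \<in> chains C"
    and M: "\<And>a b. a \<in> C \<Longrightarrow> b \<in> C \<Longrightarrow> M a b = frag_of (m a b)"
  shows "bil (mix m l) (prep f x) (prep g y) = prep f (bil (mix m l) x (prep g y)) + prep g (bil (mix m l) (prep f x) y)
     + frag_cmul l (prep (bil M f g) (bil (mix m l) x y))"
  by (rule biadditive_eq[OF assms(1,2), of "\<lambda>f g. bil (mix m l) (prep f x) (prep g y)"
      "\<lambda>f g. prep f (bil (mix m l) x (prep g y)) + prep g (bil (mix m l) (prep f x) y)
         + frag_cmul l (prep (bil M f g) (bil (mix m l) x y))"])
    (simp_all add: bil_mix_pre M prep_linear bil_diff_left bil_diff_right frag_cmul_diff2 algebra_simps)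

lemma prep_chains: "f \<in> chains C \<Longrightarrow> x \<in> chains (lists C) \<Longrightarrow> prep f x \<in> chains (lists C)"
  unfolding prep_def by (rule bil_chains) auto

text \<open>A commutative monoid operation on a carrier, made total: products with an element outside of
  the carrier are a fixed element outside of the carrier, so that associativity is preserved.\<close>

definition total_mult :: "('s, 'n) monoid_scheme \<Rightarrow> 's \<Rightarrow> 's \<Rightarrow> 's" where
  "total_mult S s t = (if s \<in> carrier S \<and> t \<in> carrier S then s \<otimes>\<^bsub>S\<^esub> t else (SOME z. z \<notin> carrier S))"

lemma total_mult_in [simp]: "s \<in> carrier S \<Longrightarrow> t \<in> carrier S \<Longrightarrow> total_mult S s t = s \<otimes>\<^bsub>S\<^esub> t"
  by (simp add: total_mult_def)

lemma mixable_shuffle_total_mult: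
  assumes "comm_monoid S"
  shows "mixable_shuffle (total_mult S)"
proof
  interpret comm_monoid S by fact
  have out: "(SOME z. z \<notin> carrier S) \<notin> carrier S" if "x \<notin> carrier S" for x
    using that by (rule someI)
  show "total_mult S a b = total_mult S b a" for a b
    by (simp add: total_mult_def m_comm)
  show "total_mult S (total_mult S a b) c = total_mult S a (total_mult S b c)" for a b c
    using out by (auto simp: total_mult_def m_assoc)
qed

context prime_modulus
begin

lemma mix_prod_rd: "mix_prod F l A u v = rd (mix (monoid.mult A) l u v)"
proof (induction u v rule: mix.induct)
  case (3 a u b v)
  have pl: "prefix_letter F a (rd x) = rd (pre a x)" for a :: 'a and x
    by (auto simp: prefix_letter_def rd_def lookup_pre fun_eq_iff split: list.split)
  show ?case
    unfolding mix_prod.simps 3 pl by (auto simp: fun_eq_iff rd_def lookup_add mod_simps)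
qed (auto simp: rd_frag_of)

lemma words_alg_FA: "words_alg F l A = FA (lists (carrier A)) [] (mix (monoid.mult A) l)"
proof -
  have "mix_prod F l A = (\<lambda>u v. rd (mix (monoid.mult A) l u v))" by (intro ext) (simp add: mix_prod_rd)
  then show ?thesis by (simp add: words_alg_def FA_def)
qed

definition WA :: "('s, 'n) monoid_scheme \<Rightarrow> int \<Rightarrow> (int, 's list \<Rightarrow> int) module" where
  "WA S l = FA (lists (carrier S)) [] (mix (total_mult S) l)"

lemma WA_basis:
  assumes "comm_monoid S"
  shows "comm_alg_basis (lists (carrier S)) [] (mix (total_mult S) l)"
proof -
  interpret mixable_shuffle "total_mult S" l by (rule mixable_shuffle_total_mult[OF assms])
  interpret comm_monoid S by fact
  show ?thesis
    unfolding comm_alg_basis_def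
    using mix_assoc[OF op_assoc] mix_comm[OF op_comm] by (auto intro!: mix_chains)
qed

lemma monoid_alg_FA: "monoid_alg F S = FA (carrier S) \<one>\<^bsub>S\<^esub> (\<lambda>s t. frag_of (s \<otimes>\<^bsub>S\<^esub> t))"
  by (simp add: monoid_alg_def FA_def rd_frag_of)

lemma monoid_alg_basis:
  assumes "comm_monoid S"
  shows "comm_alg_basis (carrier S) \<one>\<^bsub>S\<^esub> (\<lambda>s t. frag_of (s \<otimes>\<^bsub>S\<^esub> t))"
proof -
  interpret comm_monoid S by fact
  show ?thesis by (auto simp: comm_alg_basis_def m_assoc) (simp add: m_comm)
qed

text \<open>If \<open>f\<close> expands the elements of an algebra in a basis, then this expands pure tensors into
  words over the basis.\<close>

fun expand :: "('a \<Rightarrow> 's frag) \<Rightarrow> 'a list \<Rightarrow> 's list frag" where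
  "expand f [] = frag_of []"
| "expand f (a # w) = prep (f a) (expand f w)"

lemma prep_eqp: "f =\<^sub>p f' \<Longrightarrow> x =\<^sub>p x' \<Longrightarrow> prep f x =\<^sub>p prep f' x'"
  unfolding prep_def by (rule bil_eqp)

lemma frag_extend_expand_pre: "frag_extend (expand f) (pre a x) = prep (f a) (frag_extend (expand f) x)"
  by (rule additive_eq_on_chains[of x UNIV]) (auto simp: pre_diff frag_extend_diff prep_linear)

text \<open>If \<open>A\<close> has the commutative monoid \<open>S\<close> as a basis, then expanding every letter of a word over
  \<open>A\<close> in this basis is multiplicative, respects multilinearity, and every word is congruent to its
  expansion modulo the multilinearity relations. So \<open>MS(A)\<close> is the free module on words over \<open>S\<close>.\<close>

lemma MS_presentation:
  fixes l :: int
  assumes S: "comm_monoid S" and A: "algebra F A"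
    and P: "presents A (carrier S) \<one>\<^bsub>S\<^esub> (\<lambda>s t. frag_of (s \<otimes>\<^bsub>S\<^esub> t)) h"
  defines "I \<equiv> submodule_span F (words_alg F l A) (multilin_rels F l A)"
    and "T \<equiv> frag_extend (expand (chain_of (carrier S) h))"
  shows "alg_isomorphic F (MS F l A) (WA S l)"
    and "x \<in> chains (lists (carrier A)) \<Longrightarrow> y \<in> chains (lists (carrier A)) \<Longrightarrow>
      I +>\<^bsub>words_alg F l A\<^esub> rd x = I +>\<^bsub>words_alg F l A\<^esub> rd y \<longleftrightarrow> T x =\<^sub>p T y"
    and "realizes (MS F l A) (lists (carrier A)) (bil (mix (monoid.mult A) l)) (frag_of []) (\<lambda>x. I +>\<^bsub>words_alg F l A\<^esub> rd x)"
    and "w \<in> lists (carrier S) \<Longrightarrow> T (frag_of (map (\<lambda>s. h (frag_of s)) w)) =\<^sub>p frag_of w"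
proof -
  interpret S: comm_monoid S by fact
  interpret A: algebra F A by fact
  note mA = monoid.m_closed[OF ring.is_monoid[OF cring.axioms(1)[OF A.M_cring]]]
  note R = realizesD[OF presentsD(1)[OF P]]
  let ?C = "carrier S" and ?chain_of = "chain_of (carrier S) h" and ?m = "total_mult S"
  let ?D = "lists (carrier A)" and ?M = "mix (monoid.mult A) l" and ?W = "mix (total_mult S) l"
  let ?t = "expand ?chain_of"
  define s where "s w = frag_of (map (\<lambda>s. h (frag_of s)) w)" for w
  define G where "G = free_alg F ?D [] (\<lambda>u v. rd (?M u v))"
  have G: "words_alg F l A = G" by (simp add: words_alg_FA FA_def G_def)
  have lfC: "?chain_of a \<in> chains ?C" if "a \<in> carrier A" for a using chain_of(1)[OF P that] .
  have hs: "h (frag_of s) \<in> carrier A" if "s \<in> ?C" for s using that R(5) by simp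
  have lifts_D: "lifts ?D [] (\<lambda>u v. rd (?M u v)) ?M"
    unfolding lifts_def using mA by (auto intro!: mix_chains)
  have t_chains: "?t u \<in> chains (lists ?C)" if "u \<in> ?D" for u
    using that by (induction u) (auto intro: prep_chains lfC)
  have ops: "?chain_of (a \<oplus>\<^bsub>A\<^esub> b) =\<^sub>p ?chain_of a + ?chain_of b" "?chain_of (a \<otimes>\<^bsub>A\<^esub> b) =\<^sub>p bil (\<lambda>s t. frag_of (s \<otimes>\<^bsub>S\<^esub> t)) (?chain_of a) (?chain_of b)"
    if "a \<in> carrier A" "b \<in> carrier A" for a b
    using chain_of_ops[OF P A that] by blast+
  have ops_s: "?chain_of (c \<odot>\<^bsub>A\<^esub> a) =\<^sub>p frag_cmul c (?chain_of a)" if "c \<in> carrier F" "a \<in> carrier A" for a c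
    using chain_of_ops(3)[OF P A that(2) that(2) that(1)] .
  have mult: "T (?M u v) =\<^sub>p bil ?W (?t u) (?t v)" if "u \<in> ?D" "v \<in> ?D" for u v
    using that
  proof (induction u v rule: mix.induct)
    case (3 a u b v)
    have *: "a \<in> carrier A" "b \<in> carrier A" "u \<in> ?D" "v \<in> ?D" using 3 by auto
    have "T (?M (a # u) (b # v)) = prep (?chain_of a) (T (?M u (b # v))) + prep (?chain_of b) (T (?M (a # u) v))
        + frag_cmul l (prep (?chain_of (a \<otimes>\<^bsub>A\<^esub> b)) (T (?M u v)))"
      by (simp add: T_def frag_extend_add frag_extend_cmul frag_extend_expand_pre)
    also have "\<dots> =\<^sub>p prep (?chain_of a) (bil ?W (?t u) (?t (b # v))) + prep (?chain_of b) (bil ?W (?t (a # u)) (?t v))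
        + frag_cmul l (prep (bil (\<lambda>s t. frag_of (s \<otimes>\<^bsub>S\<^esub> t)) (?chain_of a) (?chain_of b)) (bil ?W (?t u) (?t v)))"
      using 3 * by (intro eqp_add eqp_cmul prep_eqp ops eqp_refl) auto
    also have "\<dots> = bil ?W (?t (a # u)) (?t (b # v))"
      using bil_mix_prep[of "?chain_of a" ?C "?chain_of b" "\<lambda>s t. frag_of (s \<otimes>\<^bsub>S\<^esub> t)" ?m l "?t u" "?t v"] lfC *
      by simp
    finally show ?case .
  qed (auto simp: T_def)
  have slot: "?t (u @ (a \<oplus>\<^bsub>A\<^esub> b) # v) =\<^sub>p ?t (u @ a # v) + ?t (u @ b # v)"
    if "a \<in> carrier A" "b \<in> carrier A" for u v a b
  proof (induction u)
    case Nil
    then show ?case using prep_eqp[OF ops(1)[OF that] eqp_refl, of "?t v"] by (simp add: prep_linear)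
  next
    case (Cons c u)
    then show ?case using prep_eqp[OF eqp_refl Cons, of "?chain_of c"] by (simp add: prep_linear)
  qed
  have slot_s: "?t (u @ (c \<odot>\<^bsub>A\<^esub> a) # v) =\<^sub>p frag_cmul c (?t (u @ a # v))"
    if "c \<in> carrier F" "a \<in> carrier A" for u v a c
  proof (induction u)
    case Nil
    then show ?case using prep_eqp[OF ops_s[OF that] eqp_refl, of "?t v"] by (simp add: prep_linear)
  next
    case (Cons d u)
    then show ?case using prep_eqp[OF eqp_refl Cons, of "?chain_of d"] by (simp add: prep_linear)
  qed
  have diff: "rd x \<ominus>\<^bsub>G\<^esub> rd y = rd (x - y)" if "x \<in> chains ?D" "y \<in> chains ?D" for x y
    unfolding G_def by (rule rd_diff[symmetric, OF that])
  have add: "rd x \<oplus>\<^bsub>G\<^esub> rd y = rd (x + y)" for x y unfolding G_def by (rule rd_add[symmetric])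
  have cmul: "c \<odot>\<^bsub>G\<^esub> rd x = rd (frag_cmul c x)" for c x unfolding G_def by (rule rd_cmul[symmetric])
  have rels: "multilin_rels F l A =
      {rd (frag_of (u @ (a \<oplus>\<^bsub>A\<^esub> b) # v) - (frag_of (u @ a # v) + frag_of (u @ b # v))) | u v a b.
            u \<in> ?D \<and> v \<in> ?D \<and> a \<in> carrier A \<and> b \<in> carrier A} \<union>
      {rd (frag_of (u @ (c \<odot>\<^bsub>A\<^esub> a) # v) - frag_cmul c (frag_of (u @ a # v))) | u v c a.
            u \<in> ?D \<and> v \<in> ?D \<and> c \<in> carrier F \<and> a \<in> carrier A}"
  proof -
    have 1: "rd (frag_of (u @ (a \<oplus>\<^bsub>A\<^esub> b) # v)) \<ominus>\<^bsub>G\<^esub> rd (frag_of (u @ a # v) + frag_of (u @ b # v))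
        = rd (frag_of (u @ (a \<oplus>\<^bsub>A\<^esub> b) # v) - (frag_of (u @ a # v) + frag_of (u @ b # v)))"
      if "\<forall>x\<in>set u. x \<in> carrier A" "\<forall>x\<in>set v. x \<in> carrier A" "a \<in> carrier A" "b \<in> carrier A" for u v a b
      using that by (intro diff add_chains) auto
    have 2: "rd (frag_of (u @ (c \<odot>\<^bsub>A\<^esub> a) # v)) \<ominus>\<^bsub>G\<^esub> rd (frag_cmul c (frag_of (u @ a # v)))
        = rd (frag_of (u @ (c \<odot>\<^bsub>A\<^esub> a) # v) - frag_cmul c (frag_of (u @ a # v)))"
      if "\<forall>x\<in>set u. x \<in> carrier A" "\<forall>x\<in>set v. x \<in> carrier A" "c \<in> carrier F" "a \<in> carrier A" for u v a c
      using that A.smult_closed[OF that(3,4)] by (intro diff cmul_chains) (auto simp del: F_simps)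
    show ?thesis
      unfolding multilin_rels_def Let_def G rd_frag_of[symmetric] add cmul
      by (intro arg_cong2[where f = "(\<union>)"] Collect_cong ex_cong1)
        (auto simp: 1 2 simp del: F_simps)
  qed
  have sub_carrier: "multilin_rels F l A \<subseteq> carrier G"
    unfolding rels G_def
    using A.smult_closed
    by (auto intro!: rd_in_carrier diff_chains add_chains cmul_chains simp del: F_simps)
  have sub_I: "submodule I F G" "multilin_rels F l A \<subseteq> I"
    using submodule_span_is_submodule[OF sub_carrier[unfolded G_def]] unfolding I_def G unfolding G_def by simp_all
  have add_I: "additive_subgroup I G"
    using submodule_additive_subgroup[OF sub_I(1)[unfolded G_def]] unfolding G_def .
  have in_I: "rd (frag_of (u @ (a \<oplus>\<^bsub>A\<^esub> b) # v) - (frag_of (u @ a # v) + frag_of (u @ b # v))) \<in> I"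
    if "u \<in> ?D" "v \<in> ?D" "a \<in> carrier A" "b \<in> carrier A" for u v a b
    by (rule subsetD[OF sub_I(2)]) (use that in \<open>unfold rels, blast\<close>)
  have zero_I: "rd 0 \<in> I"
    using additive_subgroup.zero_closed[OF add_I] by (simp add: rd_zero'[of ?D "[]" "\<lambda>u v. rd (?M u v)"] G_def)
  have ext_D: "frag_extend (\<lambda>w. frag_of (z @ map (\<lambda>s. h (frag_of s)) w)) x \<in> chains ?D"
    if "z \<in> ?D" "x \<in> chains (lists ?C)" for z x
    using that(2) by (rule frag_extend_chains) (use that hs in auto)
  \<comment> \<open>The letters are expanded from left to right; \<open>z\<close> collects the basis letters that have already
      been produced.\<close>
  have complete: "rd (frag_of (z @ u) - frag_extend (\<lambda>w. frag_of (z @ map (\<lambda>s. h (frag_of s)) w)) (?t u)) \<in> I"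
    if "z \<in> ?D" "u \<in> ?D" for z u
    using that
  proof (induction u arbitrary: z)
    case Nil
    then show ?case using zero_I by simp
  next
    case (Cons a u)
    then have a: "a \<in> carrier A" and u: "u \<in> ?D" and z: "z \<in> ?D" by auto
    let ?E = "\<lambda>z. frag_extend (\<lambda>w. frag_of (z @ map (\<lambda>s. h (frag_of s)) w))"
    let ?S = "frag_extend (\<lambda>g. frag_of (z @ h (frag_of g) # u))"
    have S_D: "?S f \<in> chains ?D" if "f \<in> chains ?C" for f
      using that by (rule frag_extend_chains) (use z u hs in auto)
    have "rd (frag_of (z @ h f # u) - ?S f) \<in> I" if "f \<in> chains ?C" for f
      by (rule slot_expansion[OF add_I[unfolded G_def] P _ _ that, where \<phi> = "\<lambda>a. frag_of (z @ a # u)"])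
        (use z u in_I in auto)
    then have 1: "rd (frag_of (z @ a # u) - ?S (?chain_of a)) \<in> I" using chain_of[OF P a] by metis
    have SE: "?S f - ?E z (prep f (?t u)) \<in> chains ?D" if "f \<in> chains ?C" for f
      by (intro diff_chains S_D ext_D[OF z] prep_chains t_chains[OF u] that)
    have "f \<in> chains ?C \<and> rd (?S f - ?E z (prep f (?t u))) \<in> I" if "f \<in> chains ?C" for f
      using that
    proof (induction rule: chains_induct)
      case zero
      then show ?case using zero_I by (simp add: prep_def)
    next
      case (one g)
      have "?E z (pre g y) = ?E (z @ [h (frag_of g)]) y" for y
        by (rule additive_eq_on_chains[of y UNIV]) (auto simp: pre_diff frag_extend_diff)
      then show ?case using Cons.IH[OF _ u, of "z @ [h (frag_of g)]"] z hs[OF one] one by simp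
    next
      case (diff f g)
      have "rd ((?S f - ?E z (prep f (?t u))) - (?S g - ?E z (prep g (?t u)))) \<in> I"
        by (rule rd_diff_mem[OF add_I[unfolded G_def]]) (use diff SE in blast)+
      then show ?case using diff by (simp add: frag_extend_diff prep_linear algebra_simps)
    qed
    then have 2: "rd (?S (?chain_of a) - ?E z (?t (a # u))) \<in> I" using lfC[OF a] by simp
    have "rd (frag_of (z @ a # u) - ?S (?chain_of a)) \<oplus>\<^bsub>G\<^esub> rd (?S (?chain_of a) - ?E z (?t (a # u))) \<in> I"
      by (rule additive_subgroup.a_closed[OF add_I 1 2])
    then show ?case unfolding add by simp
  qed
  have retract: "T (s w) =\<^sub>p frag_of w" if "w \<in> lists ?C" for w
    using that
  proof (induction w)
    case Nil then show ?case by (simp add: T_def s_def)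
  next
    case (Cons a w)
    have eq: "?chain_of (h (frag_of a)) =\<^sub>p frag_of a" using Cons R(5) by (intro chain_of_eqp[OF P]) auto
    show ?case
      using prep_eqp[OF eq, of "?t (map (\<lambda>s. h (frag_of s)) w)" "frag_of w"] Cons by (simp add: T_def s_def)
  qed
  then show "w \<in> lists ?C \<Longrightarrow> T (frag_of (map (\<lambda>s. h (frag_of s)) w)) =\<^sub>p frag_of w"
    by (simp add: s_def)
  have sound: "T x =\<^sub>p 0" if "x \<in> chains ?D" "rd x \<in> I" for x
    unfolding T_def
  proof (rule submodule_span_sound[OF _ that(1) that(2)[unfolded I_def G G_def]])
    fix g assume g: "g \<in> multilin_rels F l A"
    have wit: "\<exists>x\<in>chains ?D. g = rd x \<and> frag_extend ?t x =\<^sub>p 0"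
      if "g = rd y" "y \<in> chains ?D" "frag_extend ?t y =\<^sub>p 0" for y
      using that by (intro bexI[of _ y]) auto
    from g consider
      u v a b where "u \<in> ?D" "v \<in> ?D" "a \<in> carrier A" "b \<in> carrier A"
        "g = rd (frag_of (u @ (a \<oplus>\<^bsub>A\<^esub> b) # v) - (frag_of (u @ a # v) + frag_of (u @ b # v)))"
    | u v c a where "u \<in> ?D" "v \<in> ?D" "c \<in> carrier F" "a \<in> carrier A"
        "g = rd (frag_of (u @ (c \<odot>\<^bsub>A\<^esub> a) # v) - frag_cmul c (frag_of (u @ a # v)))"
      unfolding rels by (elim UnE CollectE exE conjE)
    then show "\<exists>x\<in>chains ?D. g = rd x \<and> frag_extend ?t x =\<^sub>p 0"
    proof cases
      case 1
      show ?thesis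
        by (rule wit[OF 1(5)]) (use 1 slot[OF 1(3,4)] in \<open>auto simp: frag_extend_diff frag_extend_add eqp_diff_0_iff\<close>)
    next
      case 2
      show ?thesis
        by (rule wit[OF 2(5)])
          (use 2 slot_s[OF 2(3,4)] A.smult_closed[OF 2(3,4)] in \<open>auto simp: frag_extend_diff frag_extend_cmul eqp_diff_0_iff simp del: F_simps\<close>)
    qed
  qed
  have s_in: "s b \<in> chains ?D" if "b \<in> lists ?C" for b using that hs by (auto simp: s_def)
  have alg: "algebra F (free_alg F (lists ?C) [] (\<lambda>u v. rd (?W u v)))"
    using algebra_FA[OF WA_basis[OF S]] by (simp add: FA_def)
  have complete': "rd (frag_of u - frag_extend s (?t u)) \<in> I" if "u \<in> ?D" for u
    using complete[of "[]" u] that by (simp add: s_def[abs_def])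
  have unit: "?t [] =\<^sub>p frag_of []" by simp
  note pres = quot_alg_presentation[OF lifts_D comm_alg_basis_lifts[OF WA_basis[OF S]] alg t_chains
    mult[unfolded T_def] unit s_in retract[unfolded T_def] add_I[unfolded G_def] sound[unfolded T_def] complete']
  show "alg_isomorphic F (MS F l A) (WA S l)"
    unfolding MS_def Let_def I_def[symmetric]
    unfolding G WA_def FA_def unfolding G_def by (rule pres(1))
  show "x \<in> chains (lists (carrier A)) \<Longrightarrow> y \<in> chains (lists (carrier A)) \<Longrightarrow>
      I +>\<^bsub>words_alg F l A\<^esub> rd x = I +>\<^bsub>words_alg F l A\<^esub> rd y \<longleftrightarrow> T x =\<^sub>p T y"
    unfolding G T_def unfolding G_def by (rule pres(2))
  show "realizes (MS F l A) (lists (carrier A)) (bil (mix (monoid.mult A) l)) (frag_of []) (\<lambda>x. I +>\<^bsub>words_alg F l A\<^esub> rd x)"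
    unfolding MS_def Let_def I_def[symmetric]
    unfolding G unfolding G_def by (rule pres(3))
qed

lemma MS_isomorphic:
  assumes S: "comm_monoid S" and A: "alg_isomorphic F A (monoid_alg F S)"
  shows "alg_isomorphic F (MS F l A) (WA S l)"
proof -
  obtain h where P: "presents A (carrier S) \<one>\<^bsub>S\<^esub> (\<lambda>s t. frag_of (s \<otimes>\<^bsub>S\<^esub> t)) h"
    using alg_isomorphic_presents[OF A[unfolded monoid_alg_FA] monoid_alg_basis[OF S]] .
  have "algebra F A" using A by (simp add: alg_isomorphic_def)
  then show ?thesis by (rule MS_presentation(1)[OF S _ P])
qed

text \<open>As words over \<open>S\<close> are linearly independent in \<open>MS(S)\<close>, differences of words can be compared
  on chains.\<close>

lemma MS_word_diff_eq_iff:
  assumes S: "comm_monoid S" and w: "w \<in> lists (carrier S)" "w' \<in> lists (carrier S)"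
    "v \<in> lists (carrier S)" "v' \<in> lists (carrier S)"
  shows "MS_word F l S w \<ominus>\<^bsub>MS F l (monoid_alg F S)\<^esub> MS_word F l S w'
      = MS_word F l S v \<ominus>\<^bsub>MS F l (monoid_alg F S)\<^esub> MS_word F l S v'
    \<longleftrightarrow> frag_of w - frag_of w' =\<^sub>p frag_of v - frag_of v'"
proof -
  let ?A = "monoid_alg F S" and ?D = "lists (carrier (monoid_alg F S))"
  have A: "algebra F ?A" unfolding monoid_alg_FA by (rule algebra_FA[OF monoid_alg_basis[OF S]])
  have P: "presents ?A (carrier S) \<one>\<^bsub>S\<^esub> (\<lambda>s t. frag_of (s \<otimes>\<^bsub>S\<^esub> t)) rd"
    unfolding presents_def monoid_alg_FA FA_def
    using realizes_free_alg[OF comm_alg_basis_lifts[OF monoid_alg_basis[OF S]]] by (simp add: rd_eq_iff)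
  note pres = MS_presentation(1-3)[OF S A P, where l = l] and pres4 = MS_presentation(4)[OF S A P]
  note R = realizesD[OF pres(3)]
  define K where "K x = submodule_span F (words_alg F l ?A) (multilin_rels F l ?A) +>\<^bsub>words_alg F l ?A\<^esub> rd x" for x
  let ?b = "\<lambda>w. frag_of (map (\<lambda>s. rd (frag_of s)) w)"
  have word: "MS_word F l S w = K (?b w)" for w
    unfolding MS_word_def Let_def K_def by (simp add: rd_frag_of)
  have b: "?b w \<in> chains ?D" if "w \<in> lists (carrier S)" for w
    using that realizesD(5)[OF presentsD(1)[OF P]] by auto
  interpret MS: algebra F "MS F l ?A" using pres(1) by (simp add: alg_isomorphic_def)
  have diff: "K x \<ominus>\<^bsub>MS F l ?A\<^esub> K y = K (x - y)" if "x \<in> chains ?D" "y \<in> chains ?D" for x y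
  proof -
    have "K x = K (x - y) \<oplus>\<^bsub>MS F l ?A\<^esub> K y" unfolding K_def using R(7)[of "x - y" y] that by simp
    moreover have "K (x - y) \<in> carrier (MS F l ?A)" "K y \<in> carrier (MS F l ?A)"
      unfolding K_def using R(5)[of "x - y"] R(5)[of y] that by simp_all
    ultimately show ?thesis by (simp add: MS.M.minus_eq MS.M.a_assoc MS.M.r_neg)
  qed
  let ?T = "frag_extend (expand (chain_of (carrier S) rd))"
  have T: "?T (?b w - ?b w') =\<^sub>p frag_of w - frag_of w'"
    if "w \<in> lists (carrier S)" "w' \<in> lists (carrier S)" for w w'
    using eqp_diff[OF pres4[OF that(1)] pres4[OF that(2)]] by (simp add: frag_extend_diff)
  have "K (?b w - ?b w') = K (?b v - ?b v') \<longleftrightarrow> ?T (?b w - ?b w') =\<^sub>p ?T (?b v - ?b v')"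
    unfolding K_def using w b by (intro pres(2)) auto
  also have "\<dots> \<longleftrightarrow> frag_of w - frag_of w' =\<^sub>p frag_of v - frag_of v'"
    using T[OF w(1,2)] T[OF w(3,4)] eqp_sym eqp_trans by meson
  finally show ?thesis unfolding word using diff b w by simp
qed

end

section \<open>Monomials in a family of chains of words\<close>

context mixable_shuffle_mod
begin

definition mon :: "('v \<Rightarrow> 's list frag) \<Rightarrow> 'v multiset \<Rightarrow> 's list frag" where
  "mon gen m = Q.prod_mset (image_mset gen m)"

lemma mon_simps [simp]:
  "mon gen {#} = frag_of []" "mon gen (add_mset v m) = gen v \<diamondop> mon gen m"
  "mon gen (m + n) = mon gen m \<diamondop> mon gen n" "mon gen (replicate_mset k v) = pow (gen v) k"
proof -
  show "mon gen {#} = frag_of []" by (simp add: mon_def)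
  show a: "mon gen (add_mset v m) = gen v \<diamondop> mon gen m" for v m by (simp add: mon_def)
  show "mon gen (m + n) = mon gen m \<diamondop> mon gen n" by (simp add: mon_def)
  show "mon gen (replicate_mset k v) = pow (gen v) k"
    by (induction k) (simp_all add: a \<open>mon gen {#} = frag_of []\<close>)
qed

text \<open>If the generators satisfy the relations \<open>\<psi>\<close>, then evaluating a monomial is unaffected by
  rewriting steps. So evaluation of monomials is multiplicative on normal forms.\<close>

lemma mon_red:
  assumes \<psi>: "relations V \<psi>" and gen: "\<And>v. v \<in> V \<Longrightarrow> pow (gen v) p =\<^sub>p frag_extend (mon gen) (fr (\<psi> v))"
    and m: "set_mset m \<subseteq> V"
  shows "mon gen m =\<^sub>p frag_extend (mon gen) (fr (red \<psi> m))"
  using m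
proof (induction "size m" arbitrary: m rule: less_induct)
  case less
  show ?case
  proof (cases m rule: red_cases[OF relations_small[OF \<psi>]])
    case 1
    then show ?thesis by simp
  next
    case (2 v)
    have v: "v \<in> V" using p_le_count_mem[OF 2(1)] less.prems by auto
    let ?n = "m - replicate_mset p v"
    have m: "m = ?n + replicate_mset p v"
      using 2(1) by (simp add: count_le_replicate_mset_subset_eq)
    have "mon gen m = mon gen ?n \<diamondop> pow (gen v) p"
      by (subst m) (simp only: mon_simps)
    also have "\<dots> =\<^sub>p mon gen ?n \<diamondop> frag_extend (mon gen) (fr (\<psi> v))"
      by (intro bil_eqp gen v eqp_refl)
    finally have eq: "mon gen m =\<^sub>p mon gen ?n \<diamondop> frag_extend (mon gen) (fr (\<psi> v))" .
    show ?thesis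
    proof (cases "\<psi> v")
      case None
      then show ?thesis using eq 2 by simp
    next
      case (Some k)
      have "mon gen (?n + k) =\<^sub>p frag_extend (mon gen) (fr (red \<psi> (?n + k)))"
      proof (rule less.hyps)
        show "size (?n + k) < size m" using 2(1) \<psi> Some by (intro size_reduct) (auto simp: relations_def small_def)
        show "set_mset (?n + k) \<subseteq> V"
          using less.prems v \<psi> Some by (fastforce simp: relations_def dest!: in_diffD)
      qed
      then have "mon gen ?n \<diamondop> mon gen k =\<^sub>p frag_extend (mon gen) (fr (red \<psi> m))"
        using 2(2) Some by simp
      from eqp_trans[OF _ this] show ?thesis using eq Some by simp
    qed
  qed
qed

lemma frag_extend_mon_mult:
  assumes \<psi>: "relations V \<psi>" and gen: "\<And>v. v \<in> V \<Longrightarrow> pow (gen v) p =\<^sub>p frag_extend (mon gen) (fr (\<psi> v))"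
    and x: "x \<in> chains (truncated V)" and y: "y \<in> chains (truncated V)"
  shows "frag_extend (mon gen) (bil (\<lambda>u v. fr (red \<psi> (u + v))) x y)
    =\<^sub>p frag_extend (mon gen) x \<diamondop> frag_extend (mon gen) y"
proof (rule bil_hom_eqp[OF _ x y])
  fix u v assume uv: "u \<in> truncated V" "v \<in> truncated V"
  then have "set_mset (u + v) \<subseteq> V" by (auto simp: truncated_def)
  from eqp_sym[OF mon_red[OF \<psi> gen this]]
  show "frag_extend (mon gen) (fr (red \<psi> (u + v))) =\<^sub>p mon gen u \<diamondop> mon gen v" by simp
qed

end


section \<open>Derivations of the shuffle algebra\<close>

locale shuffle_mod = mixable_shuffle_mod p op 0
  for p :: nat and op :: "'s \<Rightarrow> 's \<Rightarrow> 's"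
begin

abbreviation shuffle :: "'s list frag \<Rightarrow> 's list frag \<Rightarrow> 's list frag" (infixl \<open>\<diamondop>\<close> 70) where
  "x \<diamondop> y \<equiv> bil (mix op 0) x y"

text \<open>Deleting the first letter \<open>s\<close>. For the product of weight zero, the first letter of a shuffle
  comes from one of the two factors, whence this is a derivation; for other weights two first
  letters may also be merged.\<close>

definition del :: "'s \<Rightarrow> 's list frag \<Rightarrow> 's list frag" where
  "del s = frag_extend (\<lambda>w. case w of [] \<Rightarrow> 0 | a # w' \<Rightarrow> if a = s then frag_of w' else 0)"

lemma del_of [simp]: "del s (frag_of []) = 0" "del s (frag_of (a # w)) = (if a = s then frag_of w else 0)"
  by (simp_all add: del_def)

lemma del_linear: "del s (x - y) = del s x - del s y" "del s (x + y) = del s x + del s y"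
  "del s (frag_cmul c x) = frag_cmul c (del s x)" "del s 0 = 0"
  by (simp_all add: del_def frag_extend_diff frag_extend_add frag_extend_cmul)

lemma del_eqp: "x =\<^sub>p y \<Longrightarrow> del s x =\<^sub>p del s y"
  unfolding del_def by (rule frag_extend_eqp)

lemma del_pre: "del s (pre a x) = (if a = s then x else 0)"
  by (rule additive_eq_on_chains[of x UNIV]) (auto simp: del_linear pre_diff)

lemma lookup_del: "Poly_Mapping.lookup (del s x) w = Poly_Mapping.lookup x (s # w)"
proof (rule additive_eq_on_chains[of x UNIV "\<lambda>x. Poly_Mapping.lookup (del s x) w" "\<lambda>x. Poly_Mapping.lookup x (s # w)"])
  fix u show "Poly_Mapping.lookup (del s (frag_of u)) w = Poly_Mapping.lookup (frag_of u) (s # w)"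
    by (cases u) auto
qed (auto simp: del_linear lookup_minus)

lemma del_mix: "del s (mix op 0 u v) = del s (frag_of u) \<diamondop> frag_of v + frag_of u \<diamondop> del s (frag_of v)"
proof (induction u v rule: mix.induct)
  case (1 v) then show ?case by simp
next
  case (2 a u) then show ?case by simp
next
  case (3 a u b v)
  show ?case by (auto simp: del_linear del_pre)
qed

lemma del_msh: "del s (x \<diamondop> y) = del s x \<diamondop> y + x \<diamondop> del s y"
  by (rule biadditive_eq[of x UNIV y UNIV "\<lambda>x y. del s (x \<diamondop> y)" "\<lambda>x y. del s x \<diamondop> y + x \<diamondop> del s y"])
    (simp_all add: del_mix bil_diff_left bil_diff_right del_linear algebra_simps)

lemma del_pow: "del s (pow v (Suc i)) = frag_cmul (int (Suc i)) (pow v i \<diamondop> del s v)"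
proof (induction i)
  case (Suc i)
  have "del s (pow v (Suc (Suc i))) = del s v \<diamondop> pow v (Suc i) + v \<diamondop> del s (pow v (Suc i))"
    by (simp only: Q.power_Suc[of v "Suc i"] del_msh)
  also have "\<dots> = pow v (Suc i) \<diamondop> del s v + frag_cmul (int (Suc i)) (pow v (Suc i) \<diamondop> del s v)"
    unfolding Suc by (simp add: bil_cmul_right msh_assoc msh_comm[of "del s v"])
  also have "\<dots> = frag_cmul (int (Suc (Suc i))) (pow v (Suc i) \<diamondop> del s v)"
  proof -
    have "int (Suc (Suc i)) = 1 + int (Suc i)" by simp
    then show ?thesis by (simp only: frag_cmul_distrib frag_cmul_one)
  qed
  finally show ?case .
qed simp

text \<open>Subrings of the shuffle ring that contain all multiples of \<open>p\<close>: the preimages of the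
  subalgebras of the shuffle algebra modulo \<open>p\<close>.\<close>

definition psub :: "'s list frag set \<Rightarrow> bool" where
  "psub R \<longleftrightarrow> frag_of [] \<in> R \<and> (\<forall>x\<in>R. \<forall>y\<in>R. x - y \<in> R \<and> x \<diamondop> y \<in> R) \<and> (\<forall>x. frag_cmul (int p) x \<in> R)"

lemma psubD:
  assumes "psub R"
  shows "frag_of [] \<in> R" "x \<in> R \<Longrightarrow> y \<in> R \<Longrightarrow> x - y \<in> R" "x \<in> R \<Longrightarrow> y \<in> R \<Longrightarrow> x \<diamondop> y \<in> R"
    "frag_cmul (int p) x \<in> R" "0 \<in> R" "x \<in> R \<Longrightarrow> - x \<in> R" "x \<in> R \<Longrightarrow> y \<in> R \<Longrightarrow> x + y \<in> R"
    "x \<in> R \<Longrightarrow> frag_cmul c x \<in> R" "x \<in> R \<Longrightarrow> x =\<^sub>p y \<Longrightarrow> y \<in> R"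
proof -
  show 1: "frag_of [] \<in> R" and 2: "\<And>x y. x \<in> R \<Longrightarrow> y \<in> R \<Longrightarrow> x - y \<in> R"
    and "x \<in> R \<Longrightarrow> y \<in> R \<Longrightarrow> x \<diamondop> y \<in> R" and 3: "\<And>x. frag_cmul (int p) x \<in> R"
    using assms unfolding psub_def by blast+
  show 0: "0 \<in> R" using 2[OF 1 1] by simp
  show 4: "- x \<in> R" if "x \<in> R" for x using 2[OF 0 that] by simp
  show "x + y \<in> R" if "x \<in> R" "y \<in> R" for x y using 2[OF that(1) 4[OF that(2)]] by simp
  show "frag_cmul c x \<in> R" if "x \<in> R"
    using that 0 2 by (intro frag_closure_minus_cmul[where P = "\<lambda>x. x \<in> R"])
  show "y \<in> R" if xy: "x \<in> R" "x =\<^sub>p y"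
  proof -
    obtain z where "x - y = frag_cmul (int p) z" using xy(2) by (auto simp: eqp_iff_cmul)
    then have "y = x - frag_cmul (int p) z" by (simp add: algebra_simps)
    then show ?thesis using 2[OF xy(1) 3] by simp
  qed
qed

text \<open>A nonempty word with nonzero coefficient survives the deletion of its own first letter.\<close>

lemma constant_if_del_zero:
  assumes "\<And>s. del s x =\<^sub>p 0"
  shows "x =\<^sub>p frag_cmul (Poly_Mapping.lookup x []) (frag_of [])"
proof -
  have "int p dvd Poly_Mapping.lookup x (s # w)" for s w
    using assms[of s] unfolding eqp_0_iff lookup_del[symmetric] by blast
  then have "int p dvd Poly_Mapping.lookup (x - frag_cmul (Poly_Mapping.lookup x []) (frag_of [])) w" for w
    by (cases w) (simp_all add: lookup_minus)
  then show ?thesis by (simp add: eqp_def)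
qed

lemma psub_cancel:
  assumes R: "psub R" and "frag_cmul c v \<in> R" and "\<not> int p dvd c"
  shows "v \<in> R"
proof -
  have "coprime c (int p)"
    using prime_imp_coprime[of "int p" c] assms(3) p_prime by (simp add: coprime_commute)
  then obtain k where k: "[c * k = 1] (mod int p)" using cong_solve_coprime_int by blast
  have "frag_cmul (k * c) v =\<^sub>p v"
    unfolding eqp_def using k
    by (auto simp: lookup_minus cong_iff_dvd_diff mult.commute dvd_mult2 simp flip: left_diff_distrib)
      (metis dvd_mult2 left_diff_distrib mult_1)
  then show ?thesis using psubD(8)[OF R assms(2), of k] psubD(9)[OF R] by simp
qed

text \<open>If an element of a differentially closed subalgebra \<open>R\<close> has its derivatives in \<open>R\<close> without
  lying in \<open>R\<close> itself, then its powers below \<open>p\<close> are linearly independent over \<open>R\<close>: a relation of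
  minimal degree can be differentiated until its leading coefficient is a constant, and one more
  derivation then shows that the element lies in \<open>R\<close>.\<close>

lemma power_independent:
  assumes R: "psub R" and dR: "\<And>s x. x \<in> R \<Longrightarrow> del s x \<in> R"
    and v: "v \<notin> R" and dv: "\<And>s. del s v \<in> R"
    and a: "\<And>i. i < p \<Longrightarrow> a i \<in> R" and rel: "(\<Sum>i<p. a i \<diamondop> pow v i) =\<^sub>p 0" and "i < p"
  shows "a i =\<^sub>p 0"
proof (rule ccontr)
  assume nz: "\<not> a i =\<^sub>p 0"
  note RD = psubD[OF R]
  define S where "S a e = (\<Sum>i\<le>e. a i \<diamondop> pow v i)" for a and e :: nat
  define rel where "rel e a \<longleftrightarrow> (\<forall>i\<le>e. a i \<in> R) \<and> S a e =\<^sub>p 0 \<and> \<not> a e =\<^sub>p 0" for e a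
  have truncate: "\<exists>j\<le>e. i \<le> j \<and> rel j b"
    if b: "\<And>i. i \<le> e \<Longrightarrow> b i \<in> R" "S b e =\<^sub>p 0" "i \<le> e" "\<not> b i =\<^sub>p 0" for b e i
  proof -
    define J where "J = {j. j \<le> e \<and> \<not> b j =\<^sub>p 0}"
    have J: "finite J" "i \<in> J" using b by (auto simp: J_def)
    define j where "j = Max J"
    have j: "j \<in> J" "i \<le> j" using Max_in[OF J(1)] Max_ge[OF J] J(2) by (auto simp: j_def)
    have "b k =\<^sub>p 0" if "k \<in> {j<..e}" for k
    proof (rule ccontr)
      assume "\<not> b k =\<^sub>p 0"
      then have "k \<in> J" using that by (auto simp: J_def)
      then show False using Max_ge[OF J(1), of k] that by (simp add: j_def)
    qed
    then have "(\<Sum>k\<in>{j<..e}. b k \<diamondop> pow v k) =\<^sub>p (\<Sum>k\<in>{j<..e}. 0 \<diamondop> pow v k)"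
      by (intro eqp_sum bil_eqp) auto
    then have 0: "(\<Sum>k\<in>{j<..e}. b k \<diamondop> pow v k) =\<^sub>p 0" by simp
    have "{..e} = {..j} \<union> {j<..e}" using j by (auto simp: J_def)
    then have "S b e = S b j + (\<Sum>k\<in>{j<..e}. b k \<diamondop> pow v k)"
      unfolding S_def by (subst sum.union_disjoint[symmetric]) auto
    then have "S b e - (\<Sum>k\<in>{j<..e}. b k \<diamondop> pow v k) = S b j" by simp
    then have "S b j =\<^sub>p 0" using eqp_diff[OF b(2) 0] by simp
    then show ?thesis using j b by (intro exI[of _ j]) (auto simp: rel_def J_def)
  qed
  define D where "D s e a = (\<lambda>i. del s (a i) + (if i < e then frag_cmul (int (Suc i)) (a (Suc i) \<diamondop> del s v) else 0))"
    for s e and a :: "nat \<Rightarrow> 's list frag"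
  have S_D: "S (D s e a) e = del s (S a e)" for s e a
  proof -
    have ds: "del s (\<Sum>i\<le>e. f i) = (\<Sum>i\<le>e. del s (f i))" for f and e :: nat
      by (induction e) (simp_all add: del_linear)
    have "del s (S a e) = (\<Sum>i\<le>e. del s (a i) \<diamondop> pow v i) + (\<Sum>i\<le>e. a i \<diamondop> del s (pow v i))"
      unfolding S_def ds by (simp add: del_msh sum.distrib)
    also have "(\<Sum>i\<le>e. a i \<diamondop> del s (pow v i)) = (\<Sum>i<e. frag_cmul (int (Suc i)) (a (Suc i) \<diamondop> del s v) \<diamondop> pow v i)"
    proof (cases e)
      case 0 then show ?thesis by (simp add: Q.power_0)
    next
      case (Suc d)
      have "a (Suc i) \<diamondop> del s (pow v (Suc i)) = frag_cmul (int (Suc i)) (a (Suc i) \<diamondop> del s v) \<diamondop> pow v i" for i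
        unfolding del_pow by (simp add: bil_cmul_right bil_cmul_left msh_assoc msh_comm[of "pow v i"])
      then show ?thesis unfolding Suc sum.atMost_Suc_shift lessThan_Suc_atMost
        by (simp add: Q.power_0 del: Q.power_Suc)
    qed
    also have "\<dots> = (\<Sum>i\<le>e. (if i < e then frag_cmul (int (Suc i)) (a (Suc i) \<diamondop> del s v) else 0) \<diamondop> pow v i)"
      by (rule sum.mono_neutral_cong_left) auto
    finally show ?thesis unfolding S_def D_def by (simp add: bil_add_left sum.distrib)
  qed
  have D_R: "D s e a i \<in> R" if "\<And>i. i \<le> e \<Longrightarrow> a i \<in> R" "i \<le> e" for s e a i
    using that dR dv RD unfolding D_def by auto
  have "\<exists>e. e < p \<and> (\<exists>a. rel e a)"
  proof -
    have "S a (p - 1) =\<^sub>p 0"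
      using assms(6) p_gt_1 by (simp add: S_def lessThan_Suc_atMost[symmetric])
    then have "\<exists>j\<le>p - 1. i \<le> j \<and> rel j a" using a \<open>i < p\<close> nz p_gt_1 by (intro truncate) auto
    then show ?thesis using p_gt_1 by (metis (no_types) One_nat_def Suc_pred less_Suc_eq_le less_trans zero_less_one)
  qed
  define e where "e = (LEAST e. e < p \<and> (\<exists>a. rel e a))"
  have e: "e < p" "\<exists>a. rel e a"
    using LeastI_ex[OF \<open>\<exists>e. e < p \<and> (\<exists>a. rel e a)\<close>] unfolding e_def[symmetric] by simp_all
  have e_min: "\<not> rel j a" if j: "j < e" for j a
  proof
    assume "rel j a"
    moreover have "\<not> (j < p \<and> (\<exists>a. rel j a))" using not_less_Least j unfolding e_def by blast
    ultimately show False using j e(1) by auto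
  qed
  \<comment> \<open>Among the relations of minimal degree \<open>e\<close>, one whose leading coefficient involves only words
      of minimal length is chosen. Differentiating shortens these words, so the derivatives of the
      leading coefficient vanish.\<close>
  define len where "len n x \<longleftrightarrow> (\<forall>w. n < length w \<longrightarrow> int p dvd Poly_Mapping.lookup x w)" for n and x :: "'s list frag"
  have ex_len: "\<exists>n. len n x" for x
  proof -
    have "finite (length ` Poly_Mapping.keys x)" by simp
    then obtain n where n: "\<forall>k\<in>length ` Poly_Mapping.keys x. k < n"
      using finite_nat_set_iff_bounded by blast
    have "int p dvd Poly_Mapping.lookup x w" if "n < length w" for w
    proof -
      have "w \<notin> Poly_Mapping.keys x" using n that by auto
      then show ?thesis by (simp add: in_keys_iff)
    qed
    then show ?thesis unfolding len_def by blast
  qed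
  obtain a0 where "rel e a0" using e(2) by blast
  then have ex: "\<exists>n a. rel e a \<and> len n (a e)" using ex_len by blast
  define n where "n = (LEAST n. \<exists>a. rel e a \<and> len n (a e))"
  obtain b where b: "rel e b" "len n (b e)" using LeastI_ex[OF ex] unfolding n_def[symmetric] by blast
  have n_min: "\<not> (rel e c \<and> len k (c e))" if "k < n" for k c
    using not_less_Least[OF that[unfolded n_def]] by blast
  have b_R: "\<And>i. i \<le> e \<Longrightarrow> b i \<in> R" and b_S: "S b e =\<^sub>p 0" and b_e: "\<not> b e =\<^sub>p 0" using b(1) by (auto simp: rel_def)
  have del_b: "del s (b e) =\<^sub>p 0" for s
  proof (rule ccontr)
    assume nz: "\<not> del s (b e) =\<^sub>p 0"
    have De: "D s e b e = del s (b e)" by (simp add: D_def)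
    have "rel e (D s e b)"
      unfolding rel_def S_D De using D_R[OF b_R] nz del_eqp[OF b_S, of s] by (simp add: del_linear)
    moreover have "n \<noteq> 0"
    proof
      assume "n = 0"
      then have "del s (b e) =\<^sub>p 0" using b(2) by (simp add: len_def eqp_0_iff lookup_del)
      then show False using nz by simp
    qed
    moreover have "len (n - 1) (D s e b e)"
      unfolding De len_def lookup_del using b(2) \<open>n \<noteq> 0\<close> by (auto simp: len_def)
    ultimately show False using n_min[of "n - 1" "D s e b"] by simp
  qed
  define c where "c = Poly_Mapping.lookup (b e) []"
  have be: "b e =\<^sub>p frag_cmul c (frag_of [])" unfolding c_def by (rule constant_if_del_zero[OF del_b])
  have c: "\<not> int p dvd c"
  proof
    assume "int p dvd c"
    then have "frag_cmul c (frag_of []) =\<^sub>p 0" by (rule cmul_dvd_eqp)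
    then show False using be b_e eqp_trans by blast
  qed
  show False
  proof (cases e)
    case 0
    then show False using b_S b_e by (simp add: S_def Q.power_0)
  next
    case (Suc d)
    \<comment> \<open>The derived relation has degree at most \<open>d < e\<close>, and all its coefficients vanish by
        minimality of \<open>e\<close>.\<close>
    have D0: "D s e b d =\<^sub>p 0" for s
    proof (rule ccontr)
      assume nz: "\<not> D s e b d =\<^sub>p 0"
      have "S (D s e b) e = S (D s e b) d + del s (b e) \<diamondop> pow v e"
        by (simp add: S_def Suc D_def)
      moreover have "del s (b e) \<diamondop> pow v e =\<^sub>p 0 \<diamondop> pow v e" by (intro bil_eqp del_b eqp_refl)
      ultimately have "S (D s e b) d =\<^sub>p 0"
        using del_eqp[OF b_S, of s] eqp_diff[of "S (D s e b) e" 0 "del s (b e) \<diamondop> pow v e" 0] unfolding S_D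
        by (simp add: del_linear)
      then have "\<exists>j\<le>d. d \<le> j \<and> rel j (D s e b)"
        using D_R[OF b_R] nz Suc by (intro truncate) auto
      then show False using e_min Suc by auto
    qed
    \<comment> \<open>This chain has derivatives \<open>D s e b d\<close>, all zero, and so is a constant. As \<open>e c\<close> is
        invertible modulo \<open>p\<close>, the element \<open>v\<close> would lie in \<open>R\<close>.\<close>
    let ?y = "b d + frag_cmul (int e * c) v"
    have "del s ?y =\<^sub>p 0" for s
    proof -
      have "frag_cmul (int e) (b e \<diamondop> del s v) =\<^sub>p frag_cmul (int e) (frag_cmul c (frag_of []) \<diamondop> del s v)"
        by (intro eqp_cmul bil_eqp be eqp_refl)
      then have "D s e b d =\<^sub>p del s ?y"
        using eqp_add[OF eqp_refl[of "del s (b d)"]] by (simp add: D_def Suc del_linear bil_cmul_left)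
      then show ?thesis using D0 eqp_sym eqp_trans by blast
    qed
    then have "?y =\<^sub>p frag_cmul (Poly_Mapping.lookup ?y []) (frag_of [])" by (rule constant_if_del_zero)
    then have "?y \<in> R" using RD(9)[OF RD(8)[OF RD(1)] eqp_sym] by blast
    moreover have "b d \<in> R" using b_R[of d] Suc by simp
    ultimately have "?y - b d \<in> R" by (rule RD(2))
    then have "frag_cmul (int e * c) v \<in> R" by simp
    moreover have "\<not> int p dvd int e * c"
    proof -
      have "\<not> p dvd e" using e(1) Suc by (auto dest: dvd_imp_le)
      then show ?thesis using c p_prime prime_dvd_mult_iff[of "int p" "int e" c] by auto
    qed
    ultimately show False using psub_cancel[OF R] v by blast
  qed
qed

end

section \<open>Generators of the shuffle algebra\<close>

context shuffle_mod
begin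

inductive_set gen_sub :: "'s list frag set \<Rightarrow> 's list frag set" for G where
  base: "x \<in> G \<Longrightarrow> x \<in> gen_sub G"
| one: "frag_of [] \<in> gen_sub G"
| diff: "x \<in> gen_sub G \<Longrightarrow> y \<in> gen_sub G \<Longrightarrow> x - y \<in> gen_sub G"
| mult: "x \<in> gen_sub G \<Longrightarrow> y \<in> gen_sub G \<Longrightarrow> x \<diamondop> y \<in> gen_sub G"
| multiple: "frag_cmul (int p) x \<in> gen_sub G"

lemma psub_gen_sub: "psub (gen_sub G)"
  unfolding psub_def by (blast intro: gen_sub.intros)

lemma gen_sub_least:
  assumes "psub R" "G \<subseteq> R" "x \<in> gen_sub G"
  shows "x \<in> R"
  using assms(3) by (induction rule: gen_sub.induct) (use assms(2) in \<open>auto simp: psubD(1-4)[OF assms(1)]\<close>)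

end

locale word_order = shuffle_mod p op
  for p :: nat and op :: "'s \<Rightarrow> 's \<Rightarrow> 's" +
  fixes C :: "'s set" and less :: "('s list \<times> 's list) set"
  assumes wf_less: "wf less" and trans_less: "trans less"
    and total_less: "u \<in> lists C \<Longrightarrow> v \<in> lists C \<Longrightarrow> u \<noteq> v \<Longrightarrow> (u, v) \<in> less \<or> (v, u) \<in> less"
    and shorter_less: "u \<in> lists C \<Longrightarrow> v \<in> lists C \<Longrightarrow> length u < length v \<Longrightarrow> (u, v) \<in> less"
begin

text \<open>A word is a generator if it is not congruent to a polynomial in smaller words. For the
  lexicographic order and over the rational numbers these are the Lyndon words. Modulo \<open>p\<close> also
  words like the powers of a letter with exponent \<open>p\<^sup>i\<close> are generators, because \<open>p\<close>-th powers
  vanish. This description suffices for inductions along the order and avoids the factorization of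
  words into Lyndon words.\<close>

definition below :: "'s list \<Rightarrow> 's list frag set" where
  "below w = gen_sub {frag_of u | u. u \<in> lists C \<and> (u, w) \<in> less}"

definition gens :: "'s list set" where
  "gens = {w \<in> lists C. frag_of w \<notin> below w}"

lemma psub_below: "psub (below w)"
  unfolding below_def by (rule psub_gen_sub)

lemmas belowD = psubD[OF psub_below]

lemma word_below: "u \<in> lists C \<Longrightarrow> (u, w) \<in> less \<Longrightarrow> frag_of u \<in> below w"
  unfolding below_def by (auto intro: gen_sub.base)

lemma chains_below: "x \<in> chains {u \<in> lists C. (u, w) \<in> less} \<Longrightarrow> x \<in> below w"
  by (induction rule: chains_induct) (auto intro: word_below belowD(2) belowD(5))

lemma below_mono: "(u, w) \<in> less \<Longrightarrow> x \<in> below u \<Longrightarrow> x \<in> below w"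
  unfolding below_def[of u]
  using gen_sub_least[OF psub_below, of "{frag_of v | v. v \<in> lists C \<and> (v, u) \<in> less}" w x]
  by (auto intro: word_below transD[OF trans_less])

lemma shorter_below: "u \<in> lists C \<Longrightarrow> w \<in> lists C \<Longrightarrow> length u < length w \<Longrightarrow> frag_of u \<in> below w"
  by (auto intro: word_below shorter_less)

lemma del_word_below:
  assumes "u \<in> lists C" "w \<in> lists C" "length u \<le> length w"
  shows "del s (frag_of u) \<in> below w"
  using assms by (cases u) (auto intro: shorter_below belowD(5))

lemma less_length: "u \<in> lists C \<Longrightarrow> w \<in> lists C \<Longrightarrow> (u, w) \<in> less \<Longrightarrow> length u \<le> length w"
  using shorter_less[of w u] transD[OF trans_less, of u w u] wf_not_refl[OF wf_less, of u] by (meson not_le)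

text \<open>Deleting a letter makes a word shorter, hence smaller, so that the derivations stabilize
  \<open>below w\<close>, and map \<open>w\<close> itself into \<open>below w\<close>.\<close>

lemma del_below:
  assumes w: "w \<in> lists C" and x: "x \<in> below w"
  shows "del s x \<in> below w"
  using x unfolding below_def
proof (induction rule: gen_sub.induct)
  case (base x)
  then obtain u where "x = frag_of u" "u \<in> lists C" "(u, w) \<in> less" by blast
  then show ?case using del_word_below[OF _ w, of u s] less_length[OF _ w] by (simp add: below_def)
qed (simp_all add: del_linear del_msh psubD(2-7)[OF psub_gen_sub])

lemma Nil_not_gens: "[] \<notin> gens"
  by (simp add: gens_def belowD(1))

text \<open>For non-zero weight the \<open>p\<close>-th power of a generator may become simpler after a combination of
  smaller words is added. Such a change preserves independence and spanning of the monomials; words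
  of equal length are required in view of the grading.\<close>

definition leading :: "('s list \<Rightarrow> 's list frag) \<Rightarrow> bool" where
  "leading g \<longleftrightarrow> (\<forall>w\<in>lists C. g w - frag_of w \<in> chains {u \<in> lists C. (u, w) \<in> less \<and> length u = length w})"

lemma leading_chains:
  assumes "leading g" "w \<in> lists C"
  shows "g w \<in> chains {u \<in> lists C. length u = length w}"
proof -
  have "g w - frag_of w \<in> chains {u \<in> lists C. length u = length w}"
    using assms unfolding leading_def by (auto elim: chains_mono)
  then have "(g w - frag_of w) + frag_of w \<in> chains {u \<in> lists C. length u = length w}"
    using assms by (intro add_chains) auto
  then show ?thesis by simp
qed

lemma leading_diff_below:
  assumes "leading g" "w \<in> lists C"
  shows "g w - frag_of w \<in> below w"
  using assms unfolding leading_def by (intro chains_below) (auto elim: chains_mono)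

lemma leading_below_iff:
  assumes "leading g" "w \<in> lists C"
  shows "g w \<in> below w \<longleftrightarrow> frag_of w \<in> below w"
  using leading_diff_below[OF assms] belowD(2)[of "g w" w "g w - frag_of w"] belowD(7)[of "g w - frag_of w" w "frag_of w"]
  by auto

lemma del_leading_below:
  assumes "leading g" "w \<in> lists C"
  shows "del s (g w) \<in> below w"
  using leading_chains[OF assms]
proof (induction rule: chains_induct)
  case (one u)
  then show ?case using del_word_below[of u w s] assms by simp
qed (auto simp: del_linear intro: belowD(5) belowD(2))

text \<open>In the shuffle algebra modulo \<open>p\<close> all \<open>p\<close>-th powers of nonempty words vanish, and taking
  \<open>p\<close>-th powers is additive.\<close>

lemma leading_pow_p:
  assumes g: "leading g" and w: "w \<in> gens"
  shows "pow (g w) p =\<^sub>p 0"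
proof -
  have "w \<noteq> []" "w \<in> lists C" using w Nil_not_gens by (auto simp: gens_def)
  then have "g w \<in> chains {u. u \<noteq> []}"
    using leading_chains[OF g, of w] by (auto elim!: chains_mono)
  then show ?thesis
  proof (induction rule: chains_induct)
    case zero
    have "pow 0 p = pow 0 (Suc (p - 1))" using p_gt_1 by simp
    then show ?case by simp
  next
    case (one u)
    then have "0 < (p - 1) * length u" using p_gt_1 by simp
    then show ?case using pow_word_p[of u] by (simp add: power_0_left)
  next
    case (diff x y)
    then show ?case using eqp_trans[OF pow_diff_p eqp_diff[OF diff]] by simp
  qed
qed

lemma ex_greatest:
  assumes "finite U" "U \<noteq> {}" "U \<subseteq> lists C"
  shows "\<exists>v\<in>U. \<forall>u\<in>U. u \<noteq> v \<longrightarrow> (u, v) \<in> less"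
  using assms
proof (induction U rule: finite_ne_induct)
  case (insert w U)
  then obtain v where v: "v \<in> U" "\<forall>u\<in>U. u \<noteq> v \<longrightarrow> (u, v) \<in> less" by auto
  show ?case
  proof (cases "(v, w) \<in> less")
    case True
    have "(u, w) \<in> less" if "u \<in> U" for u
      using v(2) that True transD[OF trans_less _ True, of u] by (cases "u = v") auto
    then show ?thesis by auto
  next
    case False
    have "w \<noteq> v" using v(1) insert(3) by auto
    then have "(w, v) \<in> less" using False total_less[of w v] insert.prems v(1) by auto
    then show ?thesis using v by (intro bexI[of _ v]) auto
  qed
qed simp

lemma mon_in_psub:
  assumes "psub R" "\<And>v. v \<in># m \<Longrightarrow> g v \<in> R"
  shows "mon g m \<in> R"
  using assms(2) by (induction m) (auto simp: psubD(1,3)[OF assms(1)])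

lemma frag_extend_in_psub:
  assumes "psub R" "x \<in> chains B" "\<And>b. b \<in> B \<Longrightarrow> f b \<in> R"
  shows "frag_extend f x \<in> R"
  using assms(2) by (induction rule: chains_induct)
    (auto simp: assms(3) frag_extend_diff psubD(2,5)[OF assms(1)])

text \<open>Induction on the number of generators that occur: a relation is a polynomial in the largest
  generator \<open>v\<close> with coefficients in \<open>below v\<close>. By independence of the powers of \<open>v\<close> all
  coefficients vanish, and these involve fewer generators.\<close>

lemma mon_independent_finite:
  assumes g: "leading g" and "finite U" "U \<subseteq> gens" "x \<in> chains (truncated U)" "frag_extend (mon g) x =\<^sub>p 0"
  shows "x =\<^sub>p 0"
  using assms(2-)
proof (induction "card U" arbitrary: U x)
  case 0
  then have "truncated U = {{#}}" using p_gt_1 by (auto simp: truncated_def)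
  have "x = frag_cmul (Poly_Mapping.lookup x {#}) (frag_of {#})"
  proof (rule poly_mapping_eqI)
    fix k show "Poly_Mapping.lookup x k = Poly_Mapping.lookup (frag_cmul (Poly_Mapping.lookup x {#}) (frag_of {#})) k"
      using 0(4) \<open>truncated U = {{#}}\<close> by (auto simp: chains_def in_keys_iff)
  qed
  then obtain c where c: "x = frag_cmul c (frag_of {#})" by blast
  have "frag_cmul c (frag_of []) =\<^sub>p (0 :: 's list frag)" using 0(5) by (simp add: c frag_extend_cmul)
  then have "int p dvd c * Poly_Mapping.lookup (frag_of []) ([] :: 's list)"
    unfolding eqp_0_iff lookup_frag_cmul by blast
  then show ?case unfolding c by (intro cmul_dvd_eqp) simp
next
  case (Suc n)
  have "U \<subseteq> lists C" using Suc.prems by (auto simp: gens_def)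
  moreover have "U \<noteq> {}" using Suc.hyps(2) by auto
  ultimately obtain v where v: "v \<in> U" and v_max: "\<And>u. u \<in> U \<Longrightarrow> u \<noteq> v \<Longrightarrow> (u, v) \<in> less"
    using ex_greatest[OF Suc.prems(1)] by blast
  let ?U = "U - {v}"
  have vC: "v \<in> lists C" and v_gens: "frag_of v \<notin> below v" using v Suc.prems by (auto simp: gens_def)
  define rest where "rest m = filter_mset (\<lambda>u. u \<noteq> v) m" for m
  have split: "m = rest m + replicate_mset (count m v) v" for m
    by (rule multiset_eqI) (auto simp: rest_def)
  have rest: "rest m \<in> truncated ?U" if "m \<in> truncated U" for m
    using that by (auto simp: truncated_def rest_def)
  define part where "part i = frag_extend (\<lambda>m. if count m v = i then frag_of (rest m) else 0)" for i
  have part: "part i x \<in> chains (truncated ?U)" for i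
    unfolding part_def using Suc.prems(3) by (rule frag_extend_chains) (use rest in auto)
  have below: "frag_extend (mon g) (part i x) \<in> below v" for i
  proof (rule frag_extend_in_psub[OF psub_below part mon_in_psub[OF psub_below]])
    fix m u assume "m \<in> truncated ?U" "u \<in># m"
    then have u: "u \<in> U" "u \<noteq> v" by (auto simp: truncated_def)
    then have uC: "u \<in> lists C" using Suc.prems by (auto simp: gens_def)
    have "(g u - frag_of u) + frag_of u \<in> below v"
      using below_mono[OF v_max[OF u] leading_diff_below[OF g uC]] word_below[OF uC v_max[OF u]] by (rule belowD(7))
    then show "g u \<in> below v" by simp
  qed
  have "(\<Sum>i<p. frag_extend (mon g) (part i x) \<diamondop> pow (g v) i) = frag_extend (mon g) x"
  proof (rule additive_eq_on_chains[OF Suc.prems(3), of "\<lambda>x. \<Sum>i<p. frag_extend (mon g) (part i x) \<diamondop> pow (g v) i" "frag_extend (mon g)"])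
    fix m assume m: "m \<in> truncated U"
    have "(\<Sum>i<p. frag_extend (mon g) (part i (frag_of m)) \<diamondop> pow (g v) i)
        = (\<Sum>i<p. if count m v = i then mon g (rest m) \<diamondop> pow (g v) i else 0)"
      by (intro sum.cong) (auto simp: part_def)
    also have "\<dots> = mon g (rest m) \<diamondop> pow (g v) (count m v)"
      using m by (simp add: truncated_def)
    also have "\<dots> = mon g m" by (subst (3) split) (simp only: mon_simps)
    finally show "(\<Sum>i<p. frag_extend (mon g) (part i (frag_of m)) \<diamondop> pow (g v) i) = frag_extend (mon g) (frag_of m)"
      by simp
  qed (simp_all add: part_def frag_extend_diff bil_diff_left sum_subtractf)
  then have rel: "(\<Sum>i<p. frag_extend (mon g) (part i x) \<diamondop> pow (g v) i) =\<^sub>p 0" using Suc.prems(4) by simp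
  have part0: "part i x =\<^sub>p 0" if "i < p" for i
  proof (rule Suc.hyps(1)[of ?U])
    show "n = card ?U" using Suc.hyps(2) Suc.prems(1) v by simp
    show "frag_extend (mon g) (part i x) =\<^sub>p 0"
      by (rule power_independent[OF psub_below del_below[OF vC] _ del_leading_below[OF g vC] below rel that])
        (simp_all add: leading_below_iff[OF g vC] v_gens)
  qed (use Suc.prems part in auto)
  have "x = (\<Sum>i<p. frag_extend (\<lambda>m. frag_of (m + replicate_mset i v)) (part i x))"
  proof (rule additive_eq_on_chains[OF Suc.prems(3), of "\<lambda>x. x" "\<lambda>x. \<Sum>i<p. frag_extend (\<lambda>m. frag_of (m + replicate_mset i v)) (part i x)"])
    fix m assume m: "m \<in> truncated U"
    have "(\<Sum>i<p. frag_extend (\<lambda>m. frag_of (m + replicate_mset i v)) (part i (frag_of m)))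
       = (\<Sum>i<p. if count m v = i then frag_of (rest m + replicate_mset i v) else 0)"
      by (intro sum.cong) (auto simp: part_def)
    also have "\<dots> = frag_of m" using m split[of m] by (simp add: truncated_def)
    finally show "frag_of m = (\<Sum>i<p. frag_extend (\<lambda>m. frag_of (m + replicate_mset i v)) (part i (frag_of m)))" ..
  qed (simp_all add: part_def frag_extend_diff sum_subtractf)
  also have "\<dots> =\<^sub>p (\<Sum>i<p. frag_extend (\<lambda>m. frag_of (m + replicate_mset i v)) 0)"
    by (intro eqp_sum frag_extend_eqp part0) auto
  finally show ?case by simp
qed

theorem mon_independent:
  assumes g: "leading g" and x: "x \<in> chains (truncated gens)" "frag_extend (mon g) x =\<^sub>p 0"
  shows "x =\<^sub>p 0"
proof (rule mon_independent_finite[OF g _ _ _ x(2)])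
  let ?U = "\<Union>m\<in>Poly_Mapping.keys x. set_mset m"
  show "finite ?U" by simp
  show "?U \<subseteq> gens" using x(1) by (fastforce simp: chains_def truncated_def)
  show "x \<in> chains (truncated ?U)" using x(1) by (fastforce simp: chains_def truncated_def)
qed

text \<open>Well-founded induction on words: the span of the truncated monomials is a subring because
  \<open>p\<close>-th powers of generators vanish, and a word either is a generator or a polynomial in smaller
  words.\<close>

theorem mon_spanning:
  assumes g: "leading g" and w: "w \<in> lists C"
  shows "\<exists>x\<in>chains (truncated gens). frag_extend (mon g) x =\<^sub>p frag_of w"
proof -
  let ?\<Theta> = "frag_extend (mon g)"
  define R where "R = {y. \<exists>x\<in>chains (truncated gens). ?\<Theta> x =\<^sub>p y}"
  have R: "psub R"
    unfolding psub_def
  proof (intro conjI ballI allI)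
    show "frag_of [] \<in> R" unfolding R_def by (intro CollectI bexI[of _ "frag_of {#}"]) auto
    show "frag_cmul (int p) x \<in> R" for x
      unfolding R_def by (intro CollectI bexI[of _ 0]) (auto intro: eqp_sym[OF p_cmul_eqp])
  next
    fix y z assume "y \<in> R" "z \<in> R"
    then obtain a b where ab: "a \<in> chains (truncated gens)" "?\<Theta> a =\<^sub>p y" "b \<in> chains (truncated gens)" "?\<Theta> b =\<^sub>p z"
      unfolding R_def by blast
    have "?\<Theta> (a - b) =\<^sub>p y - z" unfolding frag_extend_diff using ab by (intro eqp_diff)
    then show "y - z \<in> R" unfolding R_def using ab by (intro CollectI bexI[of _ "a - b"]) auto
    let ?M = "\<lambda>u v. fr (red (\<lambda>_. None) (u + v)) :: 's list multiset frag"
    have "?\<Theta> (bil ?M a b) =\<^sub>p ?\<Theta> a \<diamondop> ?\<Theta> b"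
      by (rule frag_extend_mon_mult[OF _ _ ab(1,3)]) (auto simp: leading_pow_p[OF g])
    also have "?\<Theta> a \<diamondop> ?\<Theta> b =\<^sub>p y \<diamondop> z" using ab by (intro bil_eqp)
    finally have "?\<Theta> (bil ?M a b) =\<^sub>p y \<diamondop> z" .
    moreover have "bil ?M a b \<in> chains (truncated gens)"
      using ab(1,3) by (rule bil_chains) (rule truncated_add_red, auto)
    ultimately show "y \<diamondop> z \<in> R" unfolding R_def by blast
  qed
  have "frag_of w \<in> R"
    using w
  proof (induction w rule: wf_induct_rule[OF wf_less])
    case (1 w)
    have sub: "below w \<subseteq> R"
      unfolding below_def using 1 by (intro subsetI, elim gen_sub_least[OF R, rotated]) auto
    show ?case
    proof (cases "w \<in> gens")
      case True
      then have "{#w#} \<in> truncated gens" using p_gt_1 by (auto simp: truncated_def)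
      then have "g w \<in> R" unfolding R_def by (intro CollectI bexI[of _ "frag_of {#w#}"]) auto
      moreover have "g w - frag_of w \<in> R" using leading_diff_below[OF g 1(2)] sub by blast
      ultimately have "g w - (g w - frag_of w) \<in> R" by (rule psubD(2)[OF R])
      then show ?thesis by simp
    next
      case False
      then show ?thesis using 1(2) sub by (auto simp: gens_def)
    qed
  qed
  then show ?thesis unfolding R_def by blast
qed

end

section \<open>Powers of letters and letterwise maps as generators\<close>

lemma prime_dvd_choose_prime_power:
  assumes "Factorial_Ring.prime p" "0 < a" "a < p ^ i"
  shows "p dvd (p ^ i choose a)"
proof (rule ccontr)
  assume "\<not> p dvd (p ^ i choose a)"
  then have "coprime (p ^ i) (p ^ i choose a)"
    using assms(1) by (simp add: prime_imp_coprime)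
  moreover have "p ^ i dvd a * (p ^ i choose a)"
    using times_binomial_minus1_eq[OF assms(2), of "p ^ i"] by simp
  ultimately have "p ^ i dvd a" by (simp add: coprime_dvd_mult_left_iff)
  then show False using assms by (auto dest: dvd_imp_le)
qed

context shuffle_mod
begin

text \<open>Only powers of \<open>s\<close> shuffle to a power of \<open>s\<close>, and the shuffles are counted by the positions
  of the letters of the first factor.\<close>

lemma lookup_mix_replicate:
  "Poly_Mapping.lookup (mix op 0 u v) (replicate n s) =
    (if u = replicate (length u) s \<and> v = replicate (length v) s \<and> length u + length v = n
     then int (n choose length u) else 0)"
proof (induction u v arbitrary: n rule: mix.induct)
  case (1 v)
  then show ?case by auto
next
  case (2 a u)
  have "replicate n s = a # u \<longleftrightarrow> a # u = replicate (length (a # u)) s \<and> length (a # u) = n"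
    by (metis length_replicate)
  then show ?case by simp
next
  case (3 a u b v)
  show ?case
  proof (cases n)
    case (Suc k)
    show ?thesis
      using 3(1)[of k] 3(2)[of k] by (auto simp: Suc lookup_add lookup_pre)
  qed (simp add: lookup_add lookup_pre)
qed

end

context word_order
begin

text \<open>In a shuffle of two proper parts, the coefficient of a power of a letter is a binomial
  coefficient, which is divisible by \<open>p\<close> if the exponent is a power of \<open>p\<close>.\<close>

lemma replicate_in_gens:
  assumes "s \<in> C"
  shows "replicate (p ^ i) s \<in> gens"
proof -
  let ?w = "replicate (p ^ i) s"
  define Z where "Z = {x. int p dvd Poly_Mapping.lookup x ?w}"
  have n: "0 < p ^ i" using p_gt_1 by simp
  have "psub Z"
    unfolding psub_def
  proof (intro conjI ballI allI)
    show "frag_of [] \<in> Z" using n by (auto simp: Z_def)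
    show "frag_cmul (int p) x \<in> Z" for x by (simp add: Z_def)
  next
    fix x y assume xy: "x \<in> Z" "y \<in> Z"
    show "x - y \<in> Z" using xy by (simp add: Z_def lookup_minus)
    have "int p dvd Poly_Mapping.lookup x u * Poly_Mapping.lookup y v * Poly_Mapping.lookup (mix op 0 u v) ?w" for u v
    proof (cases "u = replicate (length u) s \<and> v = replicate (length v) s \<and> length u + length v = p ^ i")
      case True
      consider "length u = 0" | "length v = 0" | "0 < length u" "length u < p ^ i" using True by linarith
      then show ?thesis
      proof cases
        case 1
        then have len: "length v = p ^ i" using True by simp
        have "v = replicate (length v) s" using True by blast
        then have "v = ?w" unfolding len .
        then show ?thesis using xy by (simp add: Z_def)
      next
        case 2
        then have len: "length u = p ^ i" using True by simp
        have "u = replicate (length u) s" using True by blast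
        then have "u = ?w" unfolding len .
        then show ?thesis using xy by (simp add: Z_def)
      next
        case 3
        then have "p dvd (p ^ i choose length u)" by (intro prime_dvd_choose_prime_power p_prime)
        then show ?thesis using True by (simp add: lookup_mix_replicate)
      qed
    qed (simp only: lookup_mix_replicate if_False mult_zero_right dvd_0_right)
    then show "x \<diamondop> y \<in> Z" unfolding Z_def mem_Collect_eq lookup_bil by (intro dvd_sum) auto
  qed
  then have "below ?w \<subseteq> Z"
    unfolding below_def
    by (intro subsetI, elim gen_sub_least[rotated 2]) (use wf_not_refl[OF wf_less] in \<open>auto simp: Z_def\<close>)
  moreover have "frag_of ?w \<notin> Z" using p_gt_1 by (simp add: Z_def)
  ultimately show ?thesis using assms by (auto simp: gens_def)
qed

text \<open>A letterwise injection that respects the order maps generators to generators: it has a left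
  inverse, sending the words that are not in its image to zero, which is a ring homomorphism.\<close>

lemma map_in_gens:
  assumes f: "\<And>a. a \<in> C \<Longrightarrow> f a \<in> C" and inj: "inj_on f C"
    and mono: "\<And>u v. u \<in> lists C \<Longrightarrow> v \<in> lists C \<Longrightarrow> (u, v) \<in> less \<Longrightarrow> (map f u, map f v) \<in> less"
    and w: "w \<in> gens"
  shows "map f w \<in> gens"
proof -
  define g where "g = inv_into C f"
  have gf: "g (f a) = a" if "a \<in> C" for a using inj that by (simp add: g_def)
  define \<rho>' where "\<rho>' = rec_list (frag_of []) (\<lambda>a _ x. if a \<in> f ` C then pre (g a) x else 0)"
  have \<rho>': "\<rho>' [] = frag_of []" "\<rho>' (a # u) = (if a \<in> f ` C then pre (g a) (\<rho>' u) else 0)" for a u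
    by (simp_all add: \<rho>'_def)
  define \<rho> where "\<rho> = frag_extend \<rho>'"
  have \<rho>_lin: "\<rho> (x - y) = \<rho> x - \<rho> y" "\<rho> (x + y) = \<rho> x + \<rho> y" "\<rho> (frag_cmul c x) = frag_cmul c (\<rho> x)" for x y c
    by (simp_all add: \<rho>_def frag_extend_diff frag_extend_add frag_extend_cmul)
  have \<rho>_of: "\<rho> (frag_of u) = \<rho>' u" for u by (simp add: \<rho>_def)
  have \<rho>_pre: "\<rho> (pre a x) = (if a \<in> f ` C then pre (g a) (\<rho> x) else 0)" for a x
    by (rule additive_eq_on_chains[of x UNIV]) (auto simp: pre_diff \<rho>_lin \<rho>_of \<rho>')
  have \<rho>_mix: "\<rho> (mix op 0 u v) = \<rho>' u \<diamondop> \<rho>' v" for u v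
  proof (induction u v rule: mix.induct)
    case (3 a u b v)
    then show ?case by (simp add: \<rho>_lin \<rho>_pre \<rho>' bil_mix_pre)
  qed (simp_all add: \<rho>_of \<rho>')
  have \<rho>_mult: "\<rho> (x \<diamondop> y) = \<rho> x \<diamondop> \<rho> y" for x y
    by (rule biadditive_eq[of x UNIV y UNIV "\<lambda>x y. \<rho> (x \<diamondop> y)" "\<lambda>x y. \<rho> x \<diamondop> \<rho> y"])
      (simp_all add: \<rho>_mix \<rho>_of bil_diff_left bil_diff_right \<rho>_lin)
  have map: "\<rho>' (map f u) = frag_of u" if "u \<in> lists C" for u
    using that by (induction u) (auto simp: \<rho>' gf)
  have not_map: "\<rho>' u = 0 \<or> (\<exists>u'\<in>lists C. u = map f u')" for u
  proof (induction u)
    case (Cons a u)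
    show ?case
    proof (cases "a \<in> f ` C")
      case True
      then obtain a' where a: "a' \<in> C" "a = f a'" by blast
      show ?thesis using Cons
      proof (elim disjE bexE)
        fix u' assume "u' \<in> lists C" "u = map f u'"
        then show ?thesis using a by (intro disjI2 bexI[of _ "a' # u'"]) auto
      qed (simp add: \<rho>')
    qed (simp add: \<rho>')
  qed (auto intro!: bexI[of _ "[]"])
  have wC: "w \<in> lists C" using w by (simp add: gens_def)
  have "\<rho> x \<in> below w" if "x \<in> below (map f w)" for x
    using that unfolding below_def[of "map f w"]
  proof (induction rule: gen_sub.induct)
    case (base x)
    then obtain u where u: "x = frag_of u" "(u, map f w) \<in> less" by blast
    show ?case
    proof (cases "\<rho>' u = 0")
      case False
      then obtain u' where u': "u' \<in> lists C" "u = map f u'" using not_map by blast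
      have "(u', w) \<in> less"
      proof (rule ccontr)
        assume "(u', w) \<notin> less"
        then have "u' = w \<or> (w, u') \<in> less" using total_less[OF u'(1) wC] by blast
        then have "u = map f w \<or> (map f w, u) \<in> less" using mono[OF wC u'(1)] u'(2) by blast
        then show False using u(2) wf_not_sym[OF wf_less] wf_not_refl[OF wf_less] by blast
      qed
      then show ?thesis using map[OF u'(1)] word_below[OF u'(1)] by (simp add: u(1) \<rho>_of u'(2))
    qed (simp add: u \<rho>_of belowD(5))
  qed (simp_all add: \<rho>_lin \<rho>_mult \<rho>_of \<rho>' belowD(1-4))
  then have "frag_of (map f w) \<notin> below (map f w)"
    using w map[OF wC] by (force simp: gens_def \<rho>_of)
  then show ?thesis using wC f by (auto simp: gens_def)
qed

end


section \<open>Transfer to non-zero weight\<close>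

text \<open>The product of weight \<open>l\<close> differs from the shuffle product by shorter words, so that
  triangularity with respect to the length of words carries over the basis of the shuffle algebra.\<close>

lemma mix_length_le:
  assumes "\<And>a b. a \<in> C \<Longrightarrow> b \<in> C \<Longrightarrow> m a b \<in> C" "u \<in> lists C" "v \<in> lists C"
  shows "mix m l u v \<in> chains {w \<in> lists C. length w \<le> length u + length v}"
  using assms(2,3)
proof (induction u v rule: mix.induct)
  case (3 a u b v)
  have p: "pre c x \<in> chains {w \<in> lists C. length w \<le> Suc n}"
    if "x \<in> chains {w \<in> lists C. length w \<le> n}" "c \<in> C" for c x n
    unfolding pre_def using that(1) by (rule frag_extend_chains) (use that in auto)
  show ?case
    using p[OF 3(1)[OF _ 3(5)], of a] p[OF 3(2)[OF 3(4)], of b] p[OF 3(3), of "m a b"] 3(4,5) assms(1)[of a b]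
    by (auto intro!: add_chains cmul_chains elim!: chains_mono)
qed (auto simp: chains_def)

lemma mix_shuffle_length:
  assumes "u \<in> lists C" "v \<in> lists C"
  shows "mix m 0 u v \<in> chains {w \<in> lists C. length w = length u + length v}"
  using assms
proof (induction u v rule: mix.induct)
  case (3 a u b v)
  have p: "pre c x \<in> chains {w \<in> lists C. length w = Suc n}"
    if "x \<in> chains {w \<in> lists C. length w = n}" "c \<in> C" for c x n
    unfolding pre_def using that(1) by (rule frag_extend_chains) (use that in auto)
  show ?case
    using p[OF 3(1)[OF _ 3(5)], of a] p[OF 3(2)[OF 3(4)], of b] 3(4,5)
    by (auto intro!: add_chains elim!: chains_mono)
qed (auto simp: chains_def)

lemma mix_diff_shuffle:
  assumes m: "\<And>a b. a \<in> C \<Longrightarrow> b \<in> C \<Longrightarrow> m a b \<in> C" and uv: "u \<in> lists C" "v \<in> lists C"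
  shows "mix m l u v - mix m 0 u v \<in> chains {w \<in> lists C. length w < length u + length v}"
  using uv
proof (induction u v rule: mix.induct)
  case (3 a u b v)
  let ?d = "\<lambda>u v. mix m l u v - mix m 0 u v"
  have p: "pre c x \<in> chains {w \<in> lists C. length w < Suc n}"
    if "x \<in> chains {w \<in> lists C. length w < n}" "c \<in> C" for c x n
    unfolding pre_def using that(1) by (rule frag_extend_chains) (use that in auto)
  have q: "pre c x \<in> chains {w \<in> lists C. length w < Suc (Suc n)}"
    if "x \<in> chains {w \<in> lists C. length w \<le> n}" "c \<in> C" for c x n
    unfolding pre_def using that(1) by (rule frag_extend_chains) (use that in auto)
  have ml: "mix m l u v \<in> chains {w \<in> lists C. length w \<le> length u + length v}"
    by (rule mix_length_le) (use m 3(4,5) in auto)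
  have eq: "?d (a # u) (b # v) = pre a (?d u (b # v)) + pre b (?d (a # u) v) + frag_cmul l (pre (m a b) (mix m l u v))"
    by (simp add: pre_diff)
  show ?case
    unfolding eq
    using p[OF 3(1)[OF _ 3(5)], of a] p[OF 3(2)[OF 3(4)], of b] 3(4,5) assms(1)[of a b]
      q[OF ml, of "m a b"]
    by (auto intro!: add_chains cmul_chains elim!: chains_mono)
qed (auto simp: chains_def)

locale weighted_word_order = word_order p op C less + L: mixable_shuffle_mod p op l
  for p :: nat and op :: "'s \<Rightarrow> 's \<Rightarrow> 's" and C less l +
  assumes op_closed: "a \<in> C \<Longrightarrow> b \<in> C \<Longrightarrow> op a b \<in> C"
begin

definition deg :: "'s list multiset \<Rightarrow> nat" where
  "deg m = (\<Sum>v\<in>#m. length v)"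

abbreviation "words_le n \<equiv> {w \<in> lists C. length w \<le> n}"
abbreviation "words_lt n \<equiv> {w \<in> lists C. length w < n}"
abbreviation "words_eq n \<equiv> {w \<in> lists C. length w = n}"

lemma bil_mix_le:
  "x \<in> chains (words_le a) \<Longrightarrow> y \<in> chains (words_le b) \<Longrightarrow> bil (mix op k) x y \<in> chains (words_le (a + b))"
  by (erule bil_chains, assumption) (rule chains_mono[OF mix_length_le[OF op_closed]], auto)

lemma bil_mix_lt:
  "x \<in> chains (words_le a) \<Longrightarrow> y \<in> chains (words_lt b) \<Longrightarrow> bil (mix op k) x y \<in> chains (words_lt (a + b))"
  by (erule bil_chains, assumption) (rule chains_mono[OF mix_length_le[OF op_closed]], auto)

lemma bil_shuffle_hom:
  "x \<in> chains (words_eq a) \<Longrightarrow> y \<in> chains (words_eq b) \<Longrightarrow> bil (mix op 0) x y \<in> chains (words_eq (a + b))"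
  by (erule bil_chains, assumption) (rule chains_mono[OF mix_shuffle_length[of _ C]], auto)

lemma bil_mix_diff:
  assumes "x \<in> chains (words_le a)" "y \<in> chains (words_le b)"
  shows "bil (mix op l) x y - bil (mix op 0) x y \<in> chains (words_lt (a + b))"
proof -
  have "bil (mix op l) x y - bil (mix op 0) x y = bil (\<lambda>u v. mix op l u v - mix op 0 u v) x y"
    by (rule biadditive_eq[of x UNIV y UNIV "\<lambda>x y. bil (mix op l) x y - bil (mix op 0) x y"])
      (simp_all add: bil_diff_left bil_diff_right)
  also have "\<dots> \<in> chains (words_lt (a + b))"
    using assms by (rule bil_chains) (rule chains_mono[OF mix_diff_shuffle[OF op_closed]], auto)
  finally show ?thesis .
qed

context
  fixes g
  assumes g: "leading g"
begin

lemma mon_hom: "set_mset m \<subseteq> gens \<Longrightarrow> mon g m \<in> chains (words_eq (deg m))"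
proof (induction m)
  case (add v m)
  then have "g v \<in> chains (words_eq (length v))" using leading_chains[OF g] by (auto simp: gens_def)
  then show ?case using add bil_shuffle_hom[of "g v" "length v" "mon g m" "deg m"] by (simp add: deg_def)
qed (simp add: deg_def)

lemma weighted_mon_le: "set_mset m \<subseteq> gens \<Longrightarrow> L.mon g m \<in> chains (words_le (deg m))"
proof (induction m)
  case (add v m)
  then have "g v \<in> chains (words_eq (length v))" using leading_chains[OF g] by (auto simp: gens_def)
  then have "g v \<in> chains (words_le (length v))" by (rule chains_mono) auto
  then show ?case using add bil_mix_le[of "g v" "length v" "L.mon g m" "deg m"] by (simp add: deg_def)
qed (simp add: deg_def)

text \<open>Replacing the products one factor at a time, each step changes the monomial by words shorter
  than its degree.\<close>

lemma weighted_mon_diff: "set_mset m \<subseteq> gens \<Longrightarrow> L.mon g m - mon g m \<in> chains (words_lt (deg m))"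
proof (induction m)
  case (add v m)
  then have "g v \<in> chains (words_eq (length v))" using leading_chains[OF g] by (auto simp: gens_def)
  then have gv: "g v \<in> chains (words_le (length v))" by (rule chains_mono) auto
  have "L.mon g m \<in> chains (words_le (deg m))" using weighted_mon_le add by simp
  from bil_mix_diff[OF gv this]
  have 1: "bil (mix op l) (g v) (L.mon g m) - bil (mix op 0) (g v) (L.mon g m) \<in> chains (words_lt (length v + deg m))" .
  have 2: "bil (mix op 0) (g v) (L.mon g m - mon g m) \<in> chains (words_lt (length v + deg m))"
    using gv add by (intro bil_mix_lt) auto
  show ?case using add_chains[OF 1 2] by (simp add: bil_diff_right deg_def)
qed (simp add: deg_def)

definition top :: "nat \<Rightarrow> 's list frag \<Rightarrow> 's list frag" where
  "top n = frag_extend (\<lambda>w. if length w = n then frag_of w else 0)"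

lemma top_linear: "top n (x - y) = top n x - top n y" "top n (x + y) = top n x + top n y" "top n 0 = 0"
  by (simp_all add: top_def frag_extend_diff frag_extend_add)

lemma top_eqp: "x =\<^sub>p y \<Longrightarrow> top n x =\<^sub>p top n y"
  unfolding top_def by (rule frag_extend_eqp)

lemma top_lt: "x \<in> chains (words_lt n) \<Longrightarrow> top n x = 0"
  by (rule additive_eq_on_chains[of x "words_lt n" "top n" "\<lambda>_. 0"]) (auto simp: top_linear, simp add: top_def)

lemma top_hom: "x \<in> chains (words_eq n) \<Longrightarrow> top n x = x"
  by (rule additive_eq_on_chains[of x "words_eq n" "top n" "\<lambda>x. x"]) (auto simp: top_linear, simp add: top_def)

lemma top_hom_neq: "x \<in> chains (words_eq k) \<Longrightarrow> k \<noteq> n \<Longrightarrow> top n x = 0"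
  by (rule additive_eq_on_chains[of x "words_eq k" "top n" "\<lambda>_. 0"]) (auto simp: top_linear, simp add: top_def)

definition part :: "nat \<Rightarrow> 's list multiset frag \<Rightarrow> 's list multiset frag" where
  "part n = frag_extend (\<lambda>m. if deg m = n then frag_of m else 0)"

lemma part_diff: "part n (x - y) = part n x - part n y"
  by (simp add: part_def frag_extend_diff)

lemma part_chains: "x \<in> chains (truncated gens) \<Longrightarrow> part n x \<in> chains {m \<in> truncated gens. deg m = n}"
  unfolding part_def by (erule frag_extend_chains) auto

lemma part_chains': "x \<in> chains (truncated gens) \<Longrightarrow> part n x \<in> chains (truncated gens)"
  by (rule chains_mono[OF part_chains]) auto

lemma top_mon:
  assumes "x \<in> chains (truncated gens)"
  shows "top n (frag_extend (mon g) x) = frag_extend (mon g) (part n x)"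
proof (rule additive_eq_on_chains[OF assms, of "\<lambda>x. top n (frag_extend (mon g) x)" "\<lambda>x. frag_extend (mon g) (part n x)"])
  fix m assume "m \<in> truncated gens"
  then have "mon g m \<in> chains (words_eq (deg m))" by (intro mon_hom) (auto simp: truncated_def)
  then show "top n (frag_extend (mon g) (frag_of m)) = frag_extend (mon g) (part n (frag_of m))"
    using top_hom[of "mon g m" n] top_hom_neq[of "mon g m" "deg m" n] by (auto simp: part_def)
qed (simp_all add: frag_extend_diff top_linear part_diff)

lemma weighted_diff_part:
  assumes "x \<in> chains {m \<in> truncated gens. deg m = n}"
  shows "frag_extend (L.mon g) x - frag_extend (mon g) x \<in> chains (words_lt n)"
proof -
  have "frag_extend (\<lambda>m. L.mon g m - mon g m) x \<in> chains (words_lt n)"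
    using assms
  proof (rule frag_extend_chains)
    fix m assume m: "m \<in> {m \<in> truncated gens. deg m = n}"
    then have "set_mset m \<subseteq> gens" by (auto simp: truncated_def)
    from weighted_mon_diff[OF this] show "L.mon g m - mon g m \<in> chains (words_lt n)" using m by simp
  qed
  then show ?thesis by (simp add: frag_extend_fun_diff)
qed

text \<open>The longest words in a relation are those of the shuffle monomials of top degree, which are
  independent.\<close>

lemma weighted_independent_deg:
  "x \<in> chains {m \<in> truncated gens. deg m < n} \<Longrightarrow> frag_extend (L.mon g) x =\<^sub>p 0 \<Longrightarrow> x =\<^sub>p 0"
proof (induction n arbitrary: x)
  case 0
  then have "x = 0" by (simp add: chains_def)
  then show ?case by simp
next
  case (Suc n)
  have x: "x \<in> chains (truncated gens)" using Suc.prems(1) by (rule chains_mono) auto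
  let ?y = "x - part n x"
  have y: "?y \<in> chains {m \<in> truncated gens. deg m < n}"
  proof -
    have "?y = frag_extend (\<lambda>m. frag_of m - (if deg m = n then frag_of m else 0)) x"
      unfolding part_def frag_extend_fun_diff by (simp flip: frag_expansion)
    also have "\<dots> \<in> chains {m \<in> truncated gens. deg m < n}"
      using Suc.prems(1) by (rule frag_extend_chains) auto
    finally show ?thesis .
  qed
  have 1: "frag_extend (L.mon g) (part n x) - frag_extend (mon g) (part n x) \<in> chains (words_lt n)"
    by (rule weighted_diff_part[OF part_chains[OF x]])
  have 2: "frag_extend (L.mon g) ?y \<in> chains (words_lt n)"
    using y
  proof (rule frag_extend_chains)
    fix m assume m: "m \<in> {m \<in> truncated gens. deg m < n}"
    then have "set_mset m \<subseteq> gens" by (auto simp: truncated_def)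
    from weighted_mon_le[OF this] show "L.mon g m \<in> chains (words_lt n)" using m by (auto elim!: chains_mono)
  qed
  have 3: "frag_extend (mon g) (part n x) \<in> chains (words_eq n)"
    using part_chains[OF x]
  proof (rule frag_extend_chains)
    fix m assume m: "m \<in> {m \<in> truncated gens. deg m = n}"
    then have "set_mset m \<subseteq> gens" by (auto simp: truncated_def)
    from mon_hom[OF this] show "mon g m \<in> chains (words_eq n)" using m by simp
  qed
  have split: "frag_extend (L.mon g) x = (frag_extend (L.mon g) (part n x) - frag_extend (mon g) (part n x))
      + frag_extend (mon g) (part n x) + frag_extend (L.mon g) ?y"
    by (simp add: frag_extend_diff)
  have "top n (frag_extend (L.mon g) x) = frag_extend (mon g) (part n x)"
    by (subst split) (simp only: top_linear(2) top_lt[OF 1] top_lt[OF 2] top_hom[OF 3] add_0 add_0_right)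
  then have "frag_extend (mon g) (part n x) =\<^sub>p 0"
    using top_eqp[OF Suc.prems(2), of n] by (simp add: top_linear)
  then have p0: "part n x =\<^sub>p 0" by (rule mon_independent[OF g part_chains'[OF x]])
  then have "frag_extend (L.mon g) ?y =\<^sub>p 0"
    using eqp_diff[OF Suc.prems(2) frag_extend_eqp[OF p0, of "L.mon g"]] by (simp add: frag_extend_diff)
  then have "?y =\<^sub>p 0" by (rule Suc.IH[OF y])
  from eqp_add[OF this p0] show ?case by simp
qed

lemma weighted_independent:
  assumes "x \<in> chains (truncated gens)" "frag_extend (L.mon g) x =\<^sub>p 0"
  shows "x =\<^sub>p 0"
proof -
  have "finite (deg ` Poly_Mapping.keys x)" by simp
  then obtain n where n: "\<forall>k\<in>deg ` Poly_Mapping.keys x. k < n" using finite_nat_set_iff_bounded by blast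
  have "x \<in> chains {m \<in> truncated gens. deg m < n}" using assms(1) n by (auto simp: chains_def)
  then show ?thesis using weighted_independent_deg assms(2) by blast
qed

lemma weighted_spanning:
  "w \<in> lists C \<Longrightarrow> \<exists>x\<in>chains (truncated gens). frag_extend (L.mon g) x =\<^sub>p frag_of w"
proof (induction "length w" arbitrary: w rule: less_induct)
  case less
  obtain x where x: "x \<in> chains (truncated gens)" "frag_extend (mon g) x =\<^sub>p frag_of w"
    using mon_spanning[OF g less.prems] by blast
  let ?x = "part (length w) x"
  have "top (length w) (frag_extend (mon g) x) =\<^sub>p top (length w) (frag_of w)" using x(2) by (rule top_eqp)
  then have eq: "frag_extend (mon g) ?x =\<^sub>p frag_of w"
    unfolding top_mon[OF x(1)] by (simp add: top_def)
  have "\<exists>y\<in>chains (truncated gens). frag_extend (L.mon g) y =\<^sub>p z" if "z \<in> chains (words_lt (length w))" for z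
    using that
  proof (induction rule: chains_induct)
    case zero then show ?case by (intro bexI[of _ 0]) auto
  next
    case (one u) then show ?case using less.hyps[of u] by auto
  next
    case (diff x y)
    then obtain a b where "a \<in> chains (truncated gens)" "frag_extend (L.mon g) a =\<^sub>p x"
      "b \<in> chains (truncated gens)" "frag_extend (L.mon g) b =\<^sub>p y" by blast
    then show ?case by (intro bexI[of _ "a - b"]) (auto simp: frag_extend_diff eqp_diff)
  qed
  then obtain y where y: "y \<in> chains (truncated gens)"
    "frag_extend (L.mon g) y =\<^sub>p frag_extend (L.mon g) ?x - frag_extend (mon g) ?x"
    using weighted_diff_part[OF part_chains[OF x(1)]] by blast
  have "frag_extend (L.mon g) (?x - y) =\<^sub>p frag_extend (L.mon g) ?x - (frag_extend (L.mon g) ?x - frag_extend (mon g) ?x)"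
    unfolding frag_extend_diff by (intro eqp_diff y eqp_refl)
  also have "\<dots> =\<^sub>p frag_of w" using eq by simp
  finally show ?case using part_chains'[OF x(1)] y(1) by (intro bexI[of _ "?x - y"]) auto
qed

text \<open>The truncated monomials in the generators form a basis for every weight. The weight enters
  only through the \<open>p\<close>-th powers of the generators, for which the family \<open>g\<close> is chosen such that
  they are zero or again members of the family.\<close>

theorem words_isomorphic_TP:
  assumes \<psi>: "relations gens \<psi>"
    and rel: "\<And>v. v \<in> gens \<Longrightarrow> L.pow (g v) p =\<^sub>p frag_extend (L.mon g) (fr (\<psi> v))"
  shows "alg_isomorphic F (FA (lists C) [] (mix op l)) (TP gens \<psi>)"
proof -
  have basis: "comm_alg_basis (lists C) [] (mix op l)"
    unfolding comm_alg_basis_def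
    using mix_assoc[OF L.op_assoc] mix_comm[OF L.op_comm] mix_chains[OF op_closed] by auto
  note TP = TP_basis[OF \<psi>]
  have "alg_isomorphic F (TP gens \<psi>) (FA (lists C) [] (mix op l))"
    unfolding TP_def FA_def
  proof (rule alg_isomorphic_free_alg[OF comm_alg_basis_lifts[OF TP] comm_alg_basis_lifts[OF basis], where t = "L.mon g"])
    show "algebra F (free_alg F (lists C) [] (\<lambda>u v. rd (mix op l u v)))"
      using algebra_FA[OF basis] by (simp add: FA_def)
    show "L.mon g u \<in> chains (lists C)" if "u \<in> truncated gens" for u
      using weighted_mon_le[of u] that by (auto simp: truncated_def elim!: chains_mono)
    show "frag_extend (L.mon g) (fr (red \<psi> (u + v))) =\<^sub>p bil (mix op l) (L.mon g u) (L.mon g v)"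
      if "u \<in> truncated gens" "v \<in> truncated gens" for u v
      using L.frag_extend_mon_mult[OF \<psi> rel, of "frag_of u" "frag_of v"] that by simp
  qed (use weighted_spanning weighted_independent in auto)
  then show ?thesis by (rule alg_isomorphic_sym)
qed

end

end

section \<open>Words in monomials\<close>

lemma lenlex_map:
  assumes "(xs, ys) \<in> lenlex r" "\<And>a b. (a, b) \<in> r \<Longrightarrow> (h a, h b) \<in> s"
  shows "(map h xs, map h ys) \<in> lenlex s"
proof (cases "length xs < length ys")
  case False
  then have "length xs = length ys" "(xs, ys) \<in> lex r" using assms(1) by (auto simp: lenlex_conv)
  then obtain zs a b xs' ys' where "xs = zs @ a # xs'" "ys = zs @ b # ys'" "(a, b) \<in> r"
    by (auto simp: lex_conv)
  then have "(map h xs, map h ys) \<in> lex s"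
    using assms(2)[of a b] \<open>length xs = length ys\<close> by (fastforce simp: lex_conv)
  then show ?thesis using \<open>length xs = length ys\<close> by (simp add: lenlex_conv)
qed (simp add: lenlex_conv)

text \<open>Monomials in finitely many variables are compared through their lists of exponents. This
  order is only used to well-order words; raising all letters to the power \<open>p\<close> multiplies the
  exponents by \<open>p\<close> and is monotone.\<close>

definition exponents :: "'x::linorder set \<Rightarrow> 'x multiset \<Rightarrow> nat list" where
  "exponents Xs m = map (count m) (sorted_list_of_set Xs)"

definition word_less :: "'x::linorder set \<Rightarrow> ('x multiset list \<times> 'x multiset list) set" where
  "word_less Xs = inv_image (lenlex (lenlex less_than)) (map (exponents Xs))"

lemma exponents_inj:
  assumes "finite Xs"
  shows "inj_on (exponents Xs) {m. set_mset m \<subseteq> Xs}"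
proof (rule inj_onI, rule multiset_eqI)
  fix m n :: "'a multiset" and x
  assume m: "m \<in> {m. set_mset m \<subseteq> Xs}" "n \<in> {m. set_mset m \<subseteq> Xs}" and eq: "exponents Xs m = exponents Xs n"
  show "count m x = count n x"
  proof (cases "x \<in> Xs")
    case True
    then show ?thesis using eq assms by (simp add: exponents_def)
  next
    case False
    then have "x \<notin># m" "x \<notin># n" using m by auto
    then show ?thesis by (simp add: not_in_iff)
  qed
qed

lemma countable_monomials: "finite Xs \<Longrightarrow> countable {m. set_mset m \<subseteq> (Xs :: 'x::linorder set)}"
  using countable_image_inj_on[OF _ exponents_inj] by blast

lemma (in prime_modulus) infinite_if_letter_powers:
  assumes "\<And>i. replicate (p ^ i) s \<in> A"
  shows "infinite A"
proof
  assume "finite A"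
  then have "finite (range (\<lambda>i. replicate (p ^ i) s))" by (rule rev_finite_subset) (use assms in auto)
  moreover have "inj (\<lambda>i. replicate (p ^ i) s)"
    using p_gt_1 by (intro injI) (simp add: replicate_eq_replicate power_inject_exp)
  ultimately show False using finite_imageD infinite_UNIV_nat by blast
qed

locale monomial_words = prime_modulus p
  for p :: nat +
  fixes Xs :: "'x::linorder set" and S :: "'x multiset monoid" and l :: int
  assumes fin: "finite Xs" and S: "comm_monoid S" and carrier_S: "carrier S \<subseteq> {m. set_mset m \<subseteq> Xs}"
begin

sublocale W: weighted_word_order p "total_mult S" "carrier S" "word_less Xs" l
proof -
  interpret mixable_shuffle "total_mult S" for l by (rule mixable_shuffle_total_mult[OF S])
  interpret S: comm_monoid S by (rule S)
  have inj: "inj_on (map (exponents Xs)) (lists (carrier S))"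
    by (rule inj_on_map_lists[OF inj_on_subset[OF exponents_inj[OF fin] carrier_S]])
  show "weighted_word_order p (total_mult S) (carrier S) (word_less Xs)"
  proof unfold_locales
    show "wf (word_less Xs)" unfolding word_less_def by (intro wf_inv_image wf_lenlex wf_less_than)
    show "trans (word_less Xs)" unfolding word_less_def by (intro trans_inv_image lenlex_transI trans_less_than)
  next
    fix u v assume uv: "u \<in> lists (carrier S)" "v \<in> lists (carrier S)"
    show "(u, v) \<in> word_less Xs \<or> (v, u) \<in> word_less Xs" if "u \<noteq> v"
    proof -
      have "map (exponents Xs) u \<noteq> map (exponents Xs) v" using inj_onD[OF inj _ uv] that by blast
      then show ?thesis
        using total_lenlex[OF total_lenlex[OF total_less_than]] by (auto simp: word_less_def total_on_def)
    qed
    show "(u, v) \<in> word_less Xs" if "length u < length v"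
      using that by (simp add: word_less_def lenlex_conv)
  qed (auto intro: S.m_closed)
qed

lemma letter_power_eq:
  assumes "s \<in> carrier S"
  shows "W.L.letter_power s (p - 1) = s [^]\<^bsub>S\<^esub> p"
proof -
  interpret S: comm_monoid S by (rule S)
  have "W.L.letter_power s j = s [^]\<^bsub>S\<^esub> Suc j" for j
  proof (induction j)
    case 0
    then show ?case using assms by (simp add: W.L.letter_power_def)
  next
    case (Suc j)
    then show ?case using assms S.nat_pow_Suc2[OF assms, of "Suc j"] by (simp add: W.L.letter_power_Suc)
  qed
  from this[of "p - 1"] show ?thesis using p_gt_1 by simp
qed

lemma word_pow_p:
  assumes "w \<in> lists (carrier S)"
  shows "W.L.pow (frag_of w) p =\<^sub>p frag_cmul (l ^ ((p - 1) * length w)) (frag_of (letter_pow p S w))"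
proof -
  have "map (\<lambda>s. W.L.letter_power s (p - 1)) w = letter_pow p S w"
    unfolding letter_pow_def using assms by (intro map_cong refl letter_power_eq) auto
  then show ?thesis using W.L.pow_word_p[of w] by simp
qed

text \<open>If \<open>p\<close> does not divide \<open>l\<close>, then \<open>l\<^bsup>p - 1\<^esup>\<close> is congruent to \<open>1\<close> by Fermat's theorem.\<close>

lemma word_pow_p_unit:
  assumes w: "w \<in> lists (carrier S)" and l: "\<not> int p dvd l" "0 \<le> l"
  shows "W.L.pow (frag_of w) p =\<^sub>p frag_of (letter_pow p S w)"
proof -
  have "\<not> p dvd nat l" using l by (metis int_dvd_int_iff int_nat_eq)
  then have "[nat l ^ (p - 1) = 1] (mod p)" by (intro fermat_theorem p_prime)
  then have "[int (nat l ^ (p - 1)) = int 1] (mod int p)" by (simp only: cong_int_iff)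
  then have "[l ^ (p - 1) = 1] (mod int p)" using l(2) by simp
  then have "[l ^ ((p - 1) * length w) = 1] (mod int p)"
    unfolding power_mult using cong_pow[of "l ^ (p - 1)" 1 "int p" "length w"] by simp
  then have "int p dvd l ^ ((p - 1) * length w) - 1" by (simp add: cong_iff_dvd_diff)
  then have "frag_cmul (l ^ ((p - 1) * length w) - 1) (frag_of (letter_pow p S w)) =\<^sub>p 0"
    by (rule W.cmul_dvd_eqp)
  then have "frag_cmul (l ^ ((p - 1) * length w)) (frag_of (letter_pow p S w)) =\<^sub>p frag_of (letter_pow p S w)"
    by (simp add: frag_cmul_diff_distrib eqp_diff_0_iff)
  from eqp_trans[OF word_pow_p[OF w] this] show ?thesis .
qed

lemma leading_frag_of: "W.leading frag_of"
  by (simp add: W.leading_def)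

lemma gens_lists: "w \<in> W.gens \<Longrightarrow> w \<in> lists (carrier S)"
  by (simp add: W.gens_def)

lemma WA_eq: "WA S l = FA (lists (carrier S)) [] (mix (total_mult S) l)"
  by (simp add: WA_def)

lemma countable_gens: "countable W.gens"
proof (rule countable_subset)
  show "W.gens \<subseteq> lists (carrier S)" by (auto simp: W.gens_def)
  show "countable (lists (carrier S))"
    using countable_subset[OF carrier_S countable_monomials[OF fin]] by blast
qed

lemma words_nilpotent:
  assumes "l = 0"
  shows "alg_isomorphic F (WA S l) (TP W.gens (\<lambda>_. None))"
  unfolding WA_eq
proof (rule W.words_isomorphic_TP[OF leading_frag_of])
  fix v assume v: "v \<in> W.gens"
  have "v \<noteq> []" using W.Nil_not_gens v by blast
  then have "0 < (p - 1) * length v" using p_gt_1 by simp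
  then show "W.L.pow (frag_of v) p =\<^sub>p frag_extend (W.L.mon frag_of) (fr None)"
    using word_pow_p[OF gens_lists[OF v]] assms by (simp add: power_0_left)
qed simp

lemma words_boolean:
  assumes l: "\<not> int p dvd l" "0 \<le> l" and id: "\<And>s. s \<in> carrier S \<Longrightarrow> s [^]\<^bsub>S\<^esub> p = s"
  shows "alg_isomorphic F (WA S l) (TP W.gens (\<lambda>v. Some {#v#}))"
  unfolding WA_eq
proof (rule W.words_isomorphic_TP[OF leading_frag_of])
  fix v assume v: "v \<in> W.gens"
  have "letter_pow p S v = v"
    using gens_lists[OF v] id by (auto simp: letter_pow_def intro: map_idI)
  then show "W.L.pow (frag_of v) p =\<^sub>p frag_extend (W.L.mon frag_of) (fr (Some {#v#}))"
    using word_pow_p_unit[OF gens_lists[OF v] l] by simp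
qed simp

text \<open>The identity of every monoid considered is the empty monomial. Having the least exponents, it
  makes the unit word the smallest one of its length.\<close>

definition unit_word :: "'x multiset list \<Rightarrow> bool" where
  "unit_word w \<longleftrightarrow> w = replicate (length w) {#}"

lemma unit_word_less:
  assumes one: "{#} \<in> carrier S" and w: "w \<in> lists (carrier S)" "\<not> unit_word w"
  shows "(replicate (length w) {#}, w) \<in> word_less Xs"
proof (rule ccontr)
  assume "\<not> ?thesis"
  moreover have "replicate (length w) {#} \<in> lists (carrier S)" using one by auto
  ultimately have "(w, replicate (length w) {#}) \<in> word_less Xs"
    using W.total_less[of w "replicate (length w) {#}"] w by (auto simp: unit_word_def)
  then have "(map (exponents Xs) w, replicate (length w) (exponents Xs {#})) \<in> lex (lenlex less_than)"
    by (simp add: word_less_def lenlex_conv map_replicate)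
  then obtain zs a b xs' ys' where *: "replicate (length w) (exponents Xs {#}) = zs @ b # ys'" "(a, b) \<in> lenlex less_than"
    "map (exponents Xs) w = zs @ a # xs'"
    by (auto simp: lex_conv)
  have "b \<in> set (replicate (length w) (exponents Xs {#}))" unfolding *(1) by simp
  then have b: "b = exponents Xs {#}" by (simp split: if_splits)
  have "a \<in> set (map (exponents Xs) w)" unfolding *(3) by simp
  then have "length a = length b" by (auto simp: exponents_def b)
  then have "(a, b) \<in> lex less_than" using *(2) by (simp add: lenlex_conv)
  then obtain us c d cs ds where 2: "b = us @ d # ds" "(c, d) \<in> less_than"
    by (auto simp: lex_conv)
  have "d \<in> set b" unfolding 2(1) by simp
  then show False using 2(2) by (auto simp: b exponents_def)
qed

text \<open>If all letters are \<open>p\<close>-th roots of unity, subtracting from a word the power of the letter \<open>1\<close>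
  of the same length makes it nilpotent.\<close>

lemma words_unipotent:
  assumes l: "\<not> int p dvd l" "0 \<le> l" and one: "{#} \<in> carrier S"
    and id: "\<And>s. s \<in> carrier S \<Longrightarrow> s [^]\<^bsub>S\<^esub> p = {#}"
  shows "alg_isomorphic F (WA S l) (TP W.gens (\<lambda>v. if unit_word v then Some {#v#} else None))"
  unfolding WA_eq
proof -
  define g :: "'x multiset list \<Rightarrow> _" where
    "g w = (if unit_word w then frag_of w else frag_of w - frag_of (replicate (length w) {#}))" for w
  have u: "replicate n {#} \<in> lists (carrier S)" for n using one by auto
  have pw: "letter_pow p S w = replicate (length w) {#}" if "w \<in> lists (carrier S)" for w
    using that id by (auto simp: letter_pow_def intro: replicate_eqI)
  show "alg_isomorphic F (FA (lists (carrier S)) [] (mix (total_mult S) l))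
      (TP W.gens (\<lambda>v. if unit_word v then Some {#v#} else None))"
  proof (rule W.words_isomorphic_TP)
    show "W.leading g"
      unfolding W.leading_def
    proof
      fix w assume w: "w \<in> lists (carrier S)"
      show "g w - frag_of w \<in> chains {u \<in> lists (carrier S). (u, w) \<in> word_less Xs \<and> length u = length w}"
        using unit_word_less[OF one w] u by (auto simp: g_def)
    qed
    show "relations W.gens (\<lambda>v. if unit_word v then Some {#v#} else None)"
      by (auto simp: relations_def small_def split: if_splits)
    fix v assume v: "v \<in> W.gens"
    note vC = gens_lists[OF v]
    show "W.L.pow (g v) p =\<^sub>p frag_extend (W.L.mon g) (fr (if unit_word v then Some {#v#} else None))"
    proof (cases "unit_word v")
      case True
      then have "letter_pow p S v = v" using pw[OF vC] by (simp add: unit_word_def)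
      then show ?thesis using word_pow_p_unit[OF vC l] True by (simp add: g_def)
    next
      case False
      have "W.L.pow (g v) p =\<^sub>p W.L.pow (frag_of v) p - W.L.pow (frag_of (replicate (length v) {#})) p"
        using False by (simp add: g_def W.L.pow_diff_p)
      also have "\<dots> =\<^sub>p frag_of (letter_pow p S v) - frag_of (letter_pow p S (replicate (length v) {#}))"
        by (intro eqp_diff word_pow_p_unit vC u l)
      also have "\<dots> = 0" using pw[OF vC] pw[OF u] by simp
      finally show ?thesis using False by simp
    qed
  qed
qed

text \<open>In a free monoid the power map on letters is injective and monotone and hence maps generators
  to generators, as the relations require.\<close>

lemma words_free:
  assumes l: "\<not> int p dvd l" "0 \<le> l" and S_free: "S = free_comm_monoid Xs"
  shows "alg_isomorphic F (WA S l) (TP W.gens (\<lambda>v. Some {#map (repeat_mset p) v#}))"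
    and "\<And>v. v \<in> W.gens \<Longrightarrow> map (repeat_mset p) v \<in> W.gens"
proof -
  have pow: "s [^]\<^bsub>S\<^esub> (n::nat) = repeat_mset n s" if "s \<in> carrier S" for s n
  proof (induction n)
    case (Suc n)
    interpret S: comm_monoid S by (rule S)
    have "s [^]\<^bsub>S\<^esub> Suc n = s [^]\<^bsub>S\<^esub> n \<otimes>\<^bsub>S\<^esub> s" by (rule S.nat_pow_Suc)
    then show ?case using Suc by (simp add: S_free free_comm_monoid_def add.commute)
  qed (simp add: S_free free_comm_monoid_def)
  have inj: "inj_on (repeat_mset p) (carrier S)"
    using p_gt_1 by (intro inj_onI multiset_eqI) (metis count_repeat_mset mult_cancel1 not_one_less_zero)
  show gens: "map (repeat_mset p) v \<in> W.gens" if v: "v \<in> W.gens" for v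
  proof (rule W.map_in_gens[OF _ inj _ v])
    show "repeat_mset p a \<in> carrier S" if "a \<in> carrier S" for a
    proof -
      have "set_mset (repeat_mset n a) \<subseteq> set_mset a" for n by (induction n) auto
      then show ?thesis using that by (auto simp: S_free free_comm_monoid_def)
    qed
    fix u v assume "(u, v) \<in> word_less Xs"
    then have "(map (map ((*) p)) (map (exponents Xs) u), map (map ((*) p)) (map (exponents Xs) v)) \<in> lenlex (lenlex less_than)"
      unfolding word_less_def in_inv_image
      by (rule lenlex_map) (rule lenlex_map, assumption, use p_gt_1 in auto)
    moreover have "map ((*) p) (exponents Xs m) = exponents Xs (repeat_mset p m)" for m
      by (simp add: exponents_def)
    ultimately show "(map (repeat_mset p) u, map (repeat_mset p) v) \<in> word_less Xs"
      by (simp add: word_less_def comp_def)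
  qed
  show "alg_isomorphic F (WA S l) (TP W.gens (\<lambda>v. Some {#map (repeat_mset p) v#}))"
    unfolding WA_eq
  proof (rule W.words_isomorphic_TP[OF leading_frag_of])
    show "relations W.gens (\<lambda>v. Some {#map (repeat_mset p) v#})"
      using gens by (auto simp: relations_def small_def)
    fix v assume v: "v \<in> W.gens"
    have "letter_pow p S v = map (repeat_mset p) v"
      using gens_lists[OF v] pow by (auto simp: letter_pow_def)
    then show "W.L.pow (frag_of v) p =\<^sub>p frag_extend (W.L.mon frag_of) (fr (Some {#map (repeat_mset p) v#}))"
      using word_pow_p_unit[OF gens_lists[OF v] l] by simp
  qed
qed

end

section \<open>Sets of Lyndon words\<close>

text \<open>For a fixed kind of relations, a truncated polynomial algebra only depends on the cardinality
  of its set of variables. Single letters are Lyndon words, so that all sets of words in the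
  theorem are countably infinite unless they are empty.\<close>

lemma word_pow_single: "word_pow [s] k = replicate k s"
  unfolding word_pow_def by (induction k) auto

lemma single_Lyn: "s \<in> carrier S \<Longrightarrow> [s] \<in> Lyn S r"
  by (auto simp: Lyn_def Cons_eq_append_conv)

lemma Lyn_lists: "Lyn S r \<subseteq> lists (carrier S)"
  by (auto simp: Lyn_def)

lemma T_words_single: "[s] \<in> W \<Longrightarrow> replicate (p ^ i) s \<in> T_words p W"
  unfolding T_words_def word_pow_single[symmetric] by blast

lemma T_words_lists: "W \<subseteq> lists C \<Longrightarrow> T_words p W \<subseteq> lists C"
  unfolding T_words_def word_pow_def by (fastforce simp: in_lists_conv_set)

lemma countable_T_words:
  assumes "countable (carrier S)" "W \<subseteq> Lyn S r"
  shows "countable (T_words p W)"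
  using countable_subset[OF T_words_lists[OF subset_trans[OF assms(2) Lyn_lists]]] assms(1) by blast

lemma E_words_subset: "E_words p S W \<subseteq> W" and part_subset: "part1 p S W \<subseteq> W" "part2 p S W \<subseteq> W"
  by (auto simp: E_words_def part1_def part2_def)

lemma ex_bij_countably_infinite:
  assumes "countable A" "infinite A" "countable B" "infinite B"
  obtains f where "bij_betw f A B"
  using bij_betw_trans[OF to_nat_on_infinite[OF assms(1,2)] bij_betw_inv_into[OF to_nat_on_infinite[OF assms(3,4)]]]
  by blast

lemma bij_betw_case_sum:
  assumes "bij_betw f A P" "bij_betw g B Q" "P \<inter> Q = {}"
  shows "bij_betw (case_sum f g) (A <+> B) (P \<union> Q)"
proof -
  have "bij_betw (case_sum f g) (Inl ` A) P" "bij_betw (case_sum f g) (Inr ` B) Q"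
    using assms(1,2) by (auto simp: bij_betw_def inj_on_def image_image)
  from bij_betw_combine[OF this assms(3)] show ?thesis by (simp add: Plus_def)
qed

text \<open>Going backwards along \<open>\<phi>\<close> lowers \<open>\<mu>\<close>, so that every element lies on the orbit of an element
  outside of the image of \<open>\<phi>\<close>; by injectivity on only one.\<close>

lemma orbit_decomposition:
  assumes inj: "inj \<phi>" and stable: "\<And>u. u \<in> U \<Longrightarrow> \<phi> u \<in> U" and \<mu>: "\<And>u. u \<in> U \<Longrightarrow> \<mu> u < (\<mu> (\<phi> u) :: nat)"
  shows "bij_betw (\<lambda>(v, j). (\<phi> ^^ j) v) ((U - \<phi> ` U) \<times> UNIV) U"
  unfolding bij_betw_def
proof
  have iter: "(\<phi> ^^ j) u \<in> U" if "u \<in> U" for u j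
    using that by (induction j) (auto intro: stable)
  have inj_iter: "inj (\<phi> ^^ j)" for j using inj by (rule inj_fn)
  have eq: "v = w \<and> i = j" if "v \<in> U - \<phi> ` U" "w \<in> U - \<phi> ` U" "(\<phi> ^^ i) v = (\<phi> ^^ j) w" "i \<le> j" for v w i j
  proof -
    have "(\<phi> ^^ i) v = (\<phi> ^^ i) ((\<phi> ^^ (j - i)) w)"
      using that(3,4) by (metis comp_apply funpow_add le_add_diff_inverse)
    then have v: "v = (\<phi> ^^ (j - i)) w" using inj_iter[of i] by (simp add: inj_eq)
    show ?thesis
    proof (cases "j - i")
      case 0 then show ?thesis using v that by simp
    next
      case (Suc k)
      then have "v = \<phi> ((\<phi> ^^ k) w)" using v by simp
      then show ?thesis using that(1,2) iter by blast
    qed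
  qed
  show "inj_on (\<lambda>(v, j). (\<phi> ^^ j) v) ((U - \<phi> ` U) \<times> UNIV)"
  proof (rule inj_onI)
    fix a b assume "a \<in> (U - \<phi> ` U) \<times> (UNIV :: nat set)" "b \<in> (U - \<phi> ` U) \<times> (UNIV :: nat set)"
      "(case a of (v, j) \<Rightarrow> (\<phi> ^^ j) v) = (case b of (v, j) \<Rightarrow> (\<phi> ^^ j) v)"
    then show "a = b"
      using eq[of "fst a" "fst b" "snd a" "snd b"] eq[of "fst b" "fst a" "snd b" "snd a"]
      by (cases a; cases b) (auto simp: linorder_le_cases dest: linear[THEN disjE, rotated 2])
  qed
  have "\<exists>v\<in>U - \<phi> ` U. \<exists>j. u = (\<phi> ^^ j) v" if "u \<in> U" for u
    using that
  proof (induction "\<mu> u" arbitrary: u rule: less_induct)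
    case less
    show ?case
    proof (cases "u \<in> \<phi> ` U")
      case True
      then obtain u' where u': "u' \<in> U" "u = \<phi> u'" by blast
      obtain v j where "v \<in> U - \<phi> ` U" "u' = (\<phi> ^^ j) v" using less.hyps[OF _ u'(1)] \<mu>[OF u'(1)] u'(2) by blast
      then show ?thesis using u'(2) by (intro bexI[of _ v] exI[of _ "Suc j"]) auto
    next
      case False
      then show ?thesis using less.prems by (intro bexI[of _ u] exI[of _ 0]) auto
    qed
  qed
  then show "(\<lambda>(v, j). (\<phi> ^^ j) v) ` ((U - \<phi> ` U) \<times> UNIV) = U"
    using iter by (fastforce simp: image_iff)
qed


section \<open>Monoids of truncated monomials\<close>

context prime_modulus
begin

text \<open>Without relations \<open>v\<^sup>p = 0\<close> the normal form of a product of monomials is again a monomial,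
  and the algebra is that of a monoid. This exhibits the coefficient algebras of the last two parts
  of the theorem as monoid algebras, for which the \<open>p\<close>-th powers of basis elements are known.\<close>

definition reduced_monoid :: "'x set \<Rightarrow> ('x \<Rightarrow> 'x multiset option) \<Rightarrow> 'x multiset monoid" where
  "reduced_monoid V \<psi> = \<lparr>carrier = truncated V, monoid.mult = (\<lambda>m n. the (red \<psi> (m + n))), monoid.one = {#}\<rparr>"

lemma red_total:
  assumes "small \<psi>" "\<And>v. \<psi> v \<noteq> None"
  shows "red \<psi> m = Some (the (red \<psi> m))"
proof -
  have "red \<psi> m \<noteq> None"
  proof (induction "size m" arbitrary: m rule: less_induct)
    case less
    show ?case
    proof (cases m rule: red_cases[OF assms(1)])
      case (2 v)
      obtain k where k: "\<psi> v = Some k" using assms(2)[of v] by auto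
      have "red \<psi> (m - replicate_mset p v + k) \<noteq> None"
        using assms(1) k 2(1) by (intro less size_reduct) (auto simp: small_def)
      then show ?thesis using 2 k by simp
    qed simp
  qed
  then show ?thesis by simp
qed

context
  fixes V :: "'x set" and \<psi> :: "'x \<Rightarrow> 'x multiset option" and \<kappa>
  assumes \<psi>: "relations V \<psi>" and \<kappa>: "\<And>v. \<psi> v = Some (\<kappa> v)"
begin

private lemma total: "red \<psi> m = Some (the (red \<psi> m))"
  by (rule red_total[OF relations_small[OF \<psi>]]) (simp add: \<kappa>)

private lemma the_red_add: "the (red \<psi> (the (red \<psi> m) + n)) = the (red \<psi> (m + n))"
  using red_add[OF relations_small[OF \<psi>], of m n] total[of m] by (metis bind.bind_lunit)

private lemma the_red_truncated: "set_mset m \<subseteq> V \<Longrightarrow> the (red \<psi> m) \<in> truncated V"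
  using red_in_truncated[OF \<psi>, of m] total[of m] by (metis fr_simps(2) frag_of_chains)

lemma comm_monoid_reduced: "comm_monoid (reduced_monoid V \<psi>)"
proof (rule comm_monoidI)
  fix x y z
  assume "x \<in> carrier (reduced_monoid V \<psi>)" "y \<in> carrier (reduced_monoid V \<psi>)"
  then show "x \<otimes>\<^bsub>reduced_monoid V \<psi>\<^esub> y \<in> carrier (reduced_monoid V \<psi>)"
    using the_red_truncated[of "x + y"] by (auto simp: reduced_monoid_def truncated_def)
  show "x \<otimes>\<^bsub>reduced_monoid V \<psi>\<^esub> y = y \<otimes>\<^bsub>reduced_monoid V \<psi>\<^esub> x"
    by (simp add: reduced_monoid_def add.commute)
  show "x \<otimes>\<^bsub>reduced_monoid V \<psi>\<^esub> y \<otimes>\<^bsub>reduced_monoid V \<psi>\<^esub> z = x \<otimes>\<^bsub>reduced_monoid V \<psi>\<^esub> (y \<otimes>\<^bsub>reduced_monoid V \<psi>\<^esub> z)"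
    using the_red_add[of "x + y" z] the_red_add[of "y + z" x] by (simp add: reduced_monoid_def add_ac)
qed (auto simp: reduced_monoid_def truncated_red)

lemma TP_eq_monoid_alg: "TP V \<psi> = monoid_alg F (reduced_monoid V \<psi>)"
proof -
  have "fr (red \<psi> (u + v)) = frag_of (the (red \<psi> (u + v)))" for u v
    using total[of "u + v"] by (metis fr_simps(2))
  then show ?thesis by (simp add: TP_def monoid_alg_FA reduced_monoid_def)
qed

lemma reduced_pow:
  assumes "s \<in> truncated V"
  shows "s [^]\<^bsub>reduced_monoid V \<psi>\<^esub> (n::nat) = the (red \<psi> (repeat_mset n s))"
proof (induction n)
  case 0
  then show ?case by (simp add: reduced_monoid_def truncated_red[OF empty_truncated])
next
  case (Suc n)
  interpret comm_monoid "reduced_monoid V \<psi>" by (rule comm_monoid_reduced)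
  have "s [^]\<^bsub>reduced_monoid V \<psi>\<^esub> Suc n = s [^]\<^bsub>reduced_monoid V \<psi>\<^esub> n \<otimes>\<^bsub>reduced_monoid V \<psi>\<^esub> s"
    by (rule nat_pow_Suc)
  also have "\<dots> = the (red \<psi> (the (red \<psi> (repeat_mset n s)) + s))"
    unfolding Suc by (simp add: reduced_monoid_def)
  also have "\<dots> = the (red \<psi> (repeat_mset (Suc n) s))"
    unfolding the_red_add by (simp add: add.commute)
  finally show ?case .
qed

text \<open>A \<open>p\<close>-th power of a monomial is the product of the \<open>p\<close>-th powers of its variables.\<close>

lemma red_repeat_p: "red \<psi> (repeat_mset p m + k) = red \<psi> ((\<Sum>v\<in>#m. \<kappa> v) + k)"
proof (induction m arbitrary: k)
  case (add v m)
  let ?R = "repeat_mset p m"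
  have eq: "repeat_mset p (add_mset v m) = ?R + replicate_mset p v"
    by (intro multiset_eqI) auto
  have "red \<psi> (repeat_mset p (add_mset v m) + k)
      = Option.bind (\<psi> v) (\<lambda>j. red \<psi> (?R + replicate_mset p v + k - replicate_mset p v + j))"
    unfolding eq by (intro red_step relations_small[OF \<psi>]) simp
  also have "?R + replicate_mset p v + k - replicate_mset p v = ?R + k"
    by (intro multiset_eqI) simp
  also have "Option.bind (\<psi> v) (\<lambda>j. red \<psi> (?R + k + j)) = red \<psi> (?R + (k + \<kappa> v))"
    by (simp add: \<kappa> add_ac)
  also have "\<dots> = red \<psi> ((\<Sum>v\<in>#add_mset v m. \<kappa> v) + k)"
    unfolding add by (simp add: add_ac)
  finally show ?case .
qed simp

lemma reduced_pow_p:
  assumes "s \<in> truncated V"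
  shows "s [^]\<^bsub>reduced_monoid V \<psi>\<^esub> p = the (red \<psi> (\<Sum>v\<in>#s. \<kappa> v))"
  using reduced_pow[OF assms, of p] red_repeat_p[of s "{#}"] by simp

end

lemma reduced_pow_boolean:
  assumes "s \<in> truncated V"
  shows "s [^]\<^bsub>reduced_monoid V (\<lambda>v. Some {#v#})\<^esub> p = s"
  using reduced_pow_p[of V "\<lambda>v. Some {#v#}" "\<lambda>v. {#v#}", OF _ _ assms] truncated_red[OF assms] by simp

lemma reduced_pow_unipotent:
  assumes "s \<in> truncated V"
  shows "s [^]\<^bsub>reduced_monoid V (\<lambda>v. Some {#})\<^esub> p = {#}"
  using reduced_pow_p[of V "\<lambda>v. Some {#}" "\<lambda>v. {#}", OF _ _ assms] by (simp add: truncated_red[OF empty_truncated])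

end


section \<open>The monoids of the statement\<close>

lemma comm_monoid_monoid_power:
  assumes "comm_monoid G"
  shows "comm_monoid (monoid_power G I)"
proof -
  interpret comm_monoid G by fact
  show ?thesis
    unfolding monoid_power_def
    by (rule comm_monoidI) (auto simp: product_group_def m_assoc PiE_iff extensional_def fun_eq_iff intro: m_comm)
qed

lemma monoid_power_pow:
  assumes "comm_monoid G" "x \<in> carrier (monoid_power G I)" "i \<in> I"
  shows "(x [^]\<^bsub>monoid_power G I\<^esub> (n::nat)) i = x i [^]\<^bsub>G\<^esub> n"
proof (induction n)
  case 0
  then show ?case using assms(3) by (simp add: monoid_power_def product_group_def)
next
  case (Suc n)
  interpret G: comm_monoid G by fact
  interpret P: comm_monoid "monoid_power G I" by (rule comm_monoid_monoid_power[OF assms(1)])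
  have "x [^]\<^bsub>monoid_power G I\<^esub> Suc n = x [^]\<^bsub>monoid_power G I\<^esub> n \<otimes>\<^bsub>monoid_power G I\<^esub> x"
    by (rule P.nat_pow_Suc)
  then show ?case using Suc assms(3) G.nat_pow_Suc[of "x i" n] by (simp add: monoid_power_def product_group_def)
qed

lemma comm_monoid_adjoin_identity:
  assumes "comm_monoid G"
  shows "comm_monoid (adjoin_identity G)"
proof -
  interpret comm_monoid G by fact
  show ?thesis
    by (rule comm_monoidI) (auto simp: adjoin_identity_def m_assoc intro: m_comm split: option.splits)
qed

lemma adjoin_identity_pow:
  assumes "comm_monoid G" "a \<in> carrier G"
  shows "Some a [^]\<^bsub>adjoin_identity G\<^esub> Suc n = Some (a [^]\<^bsub>G\<^esub> Suc n)"
proof -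
  interpret G: comm_monoid G by fact
  interpret P: comm_monoid "adjoin_identity G" by (rule comm_monoid_adjoin_identity[OF assms(1)])
  show ?thesis
  proof (induction n)
    case 0
    then show ?case using assms(2) by (simp add: adjoin_identity_def)
  next
    case (Suc n)
    then show ?case using P.nat_pow_Suc[of "Some a" "Suc n"] G.nat_pow_Suc[of a "Suc n"]
      by (simp add: adjoin_identity_def del: G.nat_pow_Suc P.nat_pow_Suc)
  qed
qed

lemma comm_monoid_integer_mod_group: "comm_monoid (integer_mod_group n)"
  using abelian_integer_mod_group by (simp add: comm_group_def)

lemma finite_monoid_power: "finite I \<Longrightarrow> finite (carrier G) \<Longrightarrow> finite (carrier (monoid_power G I))"
  by (simp add: monoid_power_def finite_PiE)

lemma monoid_power_eqI:
  assumes "x \<in> carrier (monoid_power G I)" "y \<in> carrier (monoid_power G I)" "\<And>i. i \<in> I \<Longrightarrow> x i = y i"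
  shows "x = y"
  using assms by (auto simp: monoid_power_def intro: PiE_ext)

context prime_modulus
begin

abbreviation "boolean_monoid Xs \<equiv> monoid_power (adjoin_identity (integer_mod_group (p - 1))) Xs"
abbreviation "unipotent_monoid Xs \<equiv> monoid_power (integer_mod_group p) Xs"

lemma comm_monoid_boolean: "comm_monoid (boolean_monoid Xs)"
  by (intro comm_monoid_monoid_power comm_monoid_adjoin_identity comm_monoid_integer_mod_group)

lemma comm_monoid_unipotent: "comm_monoid (unipotent_monoid Xs)"
  by (intro comm_monoid_monoid_power comm_monoid_integer_mod_group)

lemma boolean_monoid_pow:
  assumes x: "x \<in> carrier (boolean_monoid Xs)"
  shows "x [^]\<^bsub>boolean_monoid Xs\<^esub> p = x"
proof -
  let ?G = "adjoin_identity (integer_mod_group (p - 1))"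
  have G: "comm_monoid ?G" by (intro comm_monoid_adjoin_identity comm_monoid_integer_mod_group)
  interpret comm_monoid "boolean_monoid Xs" by (rule comm_monoid_boolean)
  interpret G: comm_monoid ?G by (rule G)
  have "a [^]\<^bsub>?G\<^esub> p = a" if "a \<in> carrier ?G" for a
  proof (cases a)
    case None
    then show ?thesis using G.nat_pow_one[of p] by (simp add: adjoin_identity_def)
  next
    case (Some b)
    have b: "b \<in> carrier (integer_mod_group (p - 1))" using that Some by (auto simp: adjoin_identity_def)
    have p: "p = Suc (p - 1)" using p_gt_1 by simp
    have "Some b [^]\<^bsub>?G\<^esub> Suc (p - 1) = Some (b [^]\<^bsub>integer_mod_group (p - 1)\<^esub> Suc (p - 1))"
      by (rule adjoin_identity_pow[OF comm_monoid_integer_mod_group b])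
    also have "b [^]\<^bsub>integer_mod_group (p - 1)\<^esub> Suc (p - 1) = (int (Suc (p - 1)) * b) mod int (p - 1)"
      by (rule pow_integer_mod_group)
    also have "\<dots> = b mod int (p - 1)" by (simp add: distrib_right mod_add_left_eq)
    also have "\<dots> = b" using b p_gt_1 by (simp add: carrier_integer_mod_group)
    finally show ?thesis using p Some by simp
  qed
  then have "(x [^]\<^bsub>boolean_monoid Xs\<^esub> p) i = x i" if "i \<in> Xs" for i
    using monoid_power_pow[OF G x that] x that by (auto simp: monoid_power_def)
  then show ?thesis by (rule monoid_power_eqI[OF nat_pow_closed[OF x] x])
qed

lemma unipotent_monoid_pow:
  assumes x: "x \<in> carrier (unipotent_monoid Xs)"
  shows "x [^]\<^bsub>unipotent_monoid Xs\<^esub> p = \<one>\<^bsub>unipotent_monoid Xs\<^esub>"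
proof -
  interpret comm_monoid "unipotent_monoid Xs" by (rule comm_monoid_unipotent)
  have "(x [^]\<^bsub>unipotent_monoid Xs\<^esub> p) i = \<one>\<^bsub>unipotent_monoid Xs\<^esub> i" if "i \<in> Xs" for i
    using monoid_power_pow[OF comm_monoid_integer_mod_group x that] that
    by (simp add: monoid_power_def)
  then show ?thesis by (rule monoid_power_eqI[OF nat_pow_closed[OF x] one_closed])
qed

lemma class_P_boolean:
  assumes r: "well_order_on (carrier (boolean_monoid Xs)) r"
  shows "class_P p (boolean_monoid Xs) r"
proof -
  have "refl_on (carrier (boolean_monoid Xs)) r"
    using r by (simp add: well_order_on_def linear_order_on_def partial_order_on_def preorder_on_def)
  then show ?thesis
    unfolding class_P_def
    by (intro conjI ballI impI comm_monoid_boolean r) (simp_all only: boolean_monoid_pow refl_onD)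
qed

lemma class_J_unipotent:
  assumes "well_order_on (carrier (unipotent_monoid Xs)) r"
    and "\<And>g. g \<in> carrier (unipotent_monoid Xs) \<Longrightarrow> (\<one>\<^bsub>unipotent_monoid Xs\<^esub>, g) \<in> r"
  shows "class_J p (unipotent_monoid Xs) r"
proof -
  interpret comm_monoid "unipotent_monoid Xs" by (rule comm_monoid_unipotent)
  have "g [^]\<^bsub>unipotent_monoid Xs\<^esub> p\<^sup>2 = g [^]\<^bsub>unipotent_monoid Xs\<^esub> p" if g: "g \<in> carrier (unipotent_monoid Xs)" for g
    using nat_pow_pow[OF g, of p p] unipotent_monoid_pow[OF g] by (simp add: power2_eq_square)
  then show ?thesis
    unfolding class_J_def
    using assms comm_monoid_unipotent by (auto simp: unipotent_monoid_pow)
qed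

end

section \<open>The four isomorphisms\<close>

context prime_modulus
begin

lemma TP_cong_isomorphic:
  assumes "alg_isomorphic F A (TP V \<psi>)" "alg_isomorphic F B (TP V \<psi>)"
  shows "alg_isomorphic F A B"
  using alg_isomorphic_trans[OF assms(1) alg_isomorphic_sym[OF assms(2)]] .

lemma comm_monoid_free: "comm_monoid (free_comm_monoid Xs)"
  by (rule comm_monoidI) (auto simp: free_comm_monoid_def add_ac)

lemma unit_dvd: "l \<in> carrier F \<Longrightarrow> l \<noteq> 0 \<Longrightarrow> \<not> int p dvd l \<and> 0 \<le> l"
  by (auto dest: zdvd_imp_le)

lemma monomial_words_free: "finite Xs \<Longrightarrow> monomial_words p Xs (free_comm_monoid Xs)"
  by unfold_locales (auto simp: comm_monoid_free free_comm_monoid_def)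

lemma MS_poly_alg: "alg_isomorphic F (MS F l (poly_alg F Xs)) (WA (free_comm_monoid Xs) l)"
  by (rule MS_isomorphic[OF comm_monoid_free])
    (simp add: poly_alg_def[symmetric] alg_isomorphic_refl algebra_poly_alg)

lemma countable_free: "finite (Xs :: 'x::linorder set) \<Longrightarrow> countable (carrier (free_comm_monoid Xs))"
  using countable_monomials[of Xs] by (simp add: free_comm_monoid_def)

text \<open>All \<open>p\<close>-th powers of generators vanish, and there are as many generators as words in \<open>TL\<close>.\<close>

lemma Sha_weight_zero:
  fixes Xs :: "'x::linorder set"
  assumes Xs: "finite Xs"
  defines "V \<equiv> TL p (free_comm_monoid Xs) (deglex Xs)"
  shows "alg_isomorphic F (Sha F 0 (poly_alg F Xs))
    (tensor_alg F (poly_alg F Xs) (poly_quot F V (\<lambda>w. w [^]\<^bsub>poly_alg F V\<^esub> p)))"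
proof -
  let ?S = "free_comm_monoid Xs"
  interpret M: monomial_words p Xs ?S 0 by (rule monomial_words_free[OF Xs])
  have one: "{#} \<in> carrier ?S" by (simp add: free_comm_monoid_def)
  have "countable V" unfolding V_def TL_def by (rule countable_T_words[OF countable_free[OF Xs] order_refl])
  moreover have "infinite V"
    unfolding V_def TL_def
    by (rule infinite_if_letter_powers[of "{#}"]) (rule T_words_single[OF single_Lyn[OF one]])
  moreover have "infinite M.W.gens"
    by (rule infinite_if_letter_powers[of "{#}"]) (rule M.W.replicate_in_gens[OF one])
  ultimately obtain f where f: "bij_betw f M.W.gens V"
    using ex_bij_countably_infinite[OF M.countable_gens] by blast
  have "alg_isomorphic F (MS F 0 (poly_alg F Xs)) (TP M.W.gens (\<lambda>_. None))"
    using alg_isomorphic_trans[OF MS_poly_alg M.words_nilpotent] by simp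
  also have "alg_isomorphic F \<dots> (TP V (\<lambda>_. None))"
    by (rule TP_isomorphic_bij[OF f]) auto
  finally have MS: "alg_isomorphic F (MS F 0 (poly_alg F Xs)) (TP V (\<lambda>_. None))" .
  show ?thesis
    unfolding Sha_def
    by (rule TP_cong_isomorphic[OF tensor_TP[OF poly_alg_TP shift_relations MS]
        tensor_TP[OF poly_alg_TP shift_relations poly_quot_nilpotent]]) auto
qed

text \<open>The relations read \<open>v\<^sup>p = v\<^bsup>\<langle>p\<rangle>\<^esup>\<close>. Unit words are fixed by \<open>v \<mapsto> v\<^bsup>\<langle>p\<rangle>\<^esup>\<close> and contribute the
  Boolean variables \<open>W\<close>. On the other generators this map multiplies the total degree by \<open>p\<close>; it
  splits them into infinite orbits, each of which, by expansion in base \<open>p\<close>, is a polynomial ring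
  in one variable. There are as many orbits as elements of \<open>TEL\<^sub>2\<close>.\<close>

lemma Sha_poly_alg:
  fixes Xs :: "'x::linorder set"
  assumes Xs: "finite Xs" and l: "l \<in> carrier F" "l \<noteq> 0"
  defines "V \<equiv> TEL2 p (free_comm_monoid Xs) (deglex Xs)"
    and "W \<equiv> {word_pow [\<one>\<^bsub>free_comm_monoid Xs\<^esub>] (p ^ i) | i. True}"
  shows "alg_isomorphic F (Sha F l (poly_alg F Xs))
    (tensor_alg F (poly_alg F (Xs <+> V)) (poly_quot F W (\<lambda>w. w [^]\<^bsub>poly_alg F W\<^esub> p \<ominus>\<^bsub>poly_alg F W\<^esub> w)))"
proof -
  let ?S = "free_comm_monoid Xs" and ?\<phi> = "map (repeat_mset p)"
  interpret M: monomial_words p Xs ?S l by (rule monomial_words_free[OF Xs])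
  interpret S: comm_monoid ?S by (rule comm_monoid_free)
  let ?\<psi> = "\<lambda>v. Some {#?\<phi> v#}"
  have l': "\<not> int p dvd l" "0 \<le> l" using unit_dvd[OF l] by auto
  have carrier: "m \<in> carrier ?S \<longleftrightarrow> set_mset m \<subseteq> Xs" for m by (simp add: free_comm_monoid_def)
  have one: "{#} \<in> carrier ?S" by (simp add: free_comm_monoid_def)
  have \<phi>: "v \<in> M.W.gens \<Longrightarrow> ?\<phi> v \<in> M.W.gens" for v using M.words_free(2)[OF l'] by simp
  have inj_p: "inj (repeat_mset p)"
    using p_gt_1 by (intro injI multiset_eqI) (metis count_repeat_mset mult_cancel1 not_one_less_zero)
  have inj: "inj ?\<phi>" using inj_p by (simp add: inj_mapI)
  define U where "U = {w \<in> M.W.gens. \<not> M.unit_word w}"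
  define U1 where "U1 = {w \<in> M.W.gens. M.unit_word w}"
  have unit_iff: "M.unit_word w \<longleftrightarrow> set w \<subseteq> {{#}}" for w
  proof
    assume "M.unit_word w"
    then show "set w \<subseteq> {{#}}" unfolding M.unit_word_def by (metis insert_iff in_set_replicate subsetI)
  next
    assume "set w \<subseteq> {{#}}"
    then show "M.unit_word w" unfolding M.unit_word_def by (intro replicate_eqI) auto
  qed
  have zero_iff: "repeat_mset p g = {#} \<longleftrightarrow> g = {#}" for g :: "'x multiset"
    using inj_p by (metis inj_eq repeat_mset_empty)
  have \<phi>_unit: "M.unit_word (?\<phi> w) \<longleftrightarrow> M.unit_word w" for w
    unfolding unit_iff using zero_iff by auto
  have U: "?\<phi> u \<in> U" if "u \<in> U" for u using that \<phi> \<phi>_unit by (auto simp: U_def)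
  define \<mu> where "\<mu> w = sum_list (map size w)" for w :: "'x multiset list"
  have \<mu>_\<phi>: "\<mu> (?\<phi> w) = p * \<mu> w" for w
    by (induction w) (simp_all add: \<mu>_def algebra_simps)
  have \<mu>: "\<mu> u < \<mu> (?\<phi> u)" if "u \<in> U" for u
  proof -
    have "\<not> set u \<subseteq> {{#}}" using that by (simp add: U_def unit_iff)
    then obtain g where "g \<in> set u" "g \<noteq> {#}" by blast
    then have "\<mu> u \<noteq> 0" by (auto simp: \<mu>_def sum_list_eq_0_iff)
    then show ?thesis using p_gt_1 by (simp add: \<mu>_\<phi>)
  qed
  let ?Z = "U - ?\<phi> ` U"
  have orbits: "bij_betw (\<lambda>(v, j). (?\<phi> ^^ j) v) (?Z \<times> UNIV) U"
    by (rule orbit_decomposition[of ?\<phi> U \<mu>, OF inj U \<mu>])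
  \<comment> \<open>Without variables every word is a unit word and both sets are empty. Otherwise the powers of a
      variable \<open>x\<close>, which is not a \<open>p\<close>-th power itself, yield infinitely many elements of both
      sets.\<close>
  obtain f where f: "bij_betw f V ?Z"
  proof (cases "Xs = {}")
    case True
    then have c: "carrier ?S = {{#}}" using carrier by auto
    have unit: "M.unit_word w" if "w \<in> lists (carrier ?S)" for w
      using that c by (auto simp: unit_iff)
    then have "U = {}" using M.gens_lists by (auto simp: U_def)
    moreover have "letter_pow p ?S w = w" if "w \<in> lists (carrier ?S)" for w
      using that c S.nat_pow_one[of p] by (auto simp: letter_pow_def free_comm_monoid_def intro: map_idI)
    then have "part2 p ?S (Lyn ?S (deglex Xs)) = {}" using Lyn_lists by (fastforce simp: part2_def)
    then have "V = {}" by (simp add: V_def TEL2_def T_words_def E_words_def)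
    ultimately show ?thesis using that[of id] by (simp add: bij_betw_def)
  next
    case False
    then obtain x where x: "x \<in> Xs" by blast
    have xS: "{#x#} \<in> carrier ?S" using x carrier by simp
    have pow: "g [^]\<^bsub>?S\<^esub> (n::nat) = repeat_mset n g" for g n
      by (induction n) (simp_all add: free_comm_monoid_def nat_pow_def add.commute)
    have "{#x#} \<noteq> repeat_mset p g" for g
    proof
      assume "{#x#} = repeat_mset p g"
      then have "count {#x#} x = count (repeat_mset p g) x" by simp
      then have "1 = p * count g x" by simp
      then show False using p_gt_1 by simp
    qed
    note not_power = this
    have "[{#x#}] \<in> E_words p ?S (part2 p ?S (Lyn ?S (deglex Xs)))"
      using single_Lyn[OF xS] not_power not_power[of "{#x#}", symmetric]
      by (auto simp: E_words_def part2_def letter_pow_def pow)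
    then have "infinite V"
      unfolding V_def TEL2_def by (intro infinite_if_letter_powers[of "{#x#}"] T_words_single)
    moreover have "countable V"
      unfolding V_def TEL2_def
      by (rule countable_T_words[OF countable_free[OF Xs]]) (use E_words_subset part_subset in blast)
    moreover have "replicate (p ^ i) {#x#} \<in> ?Z" for i
    proof -
      have "0 < p ^ i" using p_gt_1 by simp
      then have "{#x#} \<in> set (replicate (p ^ i) {#x#})" by simp
      moreover from this have "replicate (p ^ i) {#x#} \<noteq> ?\<phi> u" for u
        using not_power by (metis (no_types, lifting) image_iff list.set_map)
      ultimately show ?thesis
        using M.W.replicate_in_gens[OF xS] by (auto simp: U_def unit_iff)
    qed
    then have "infinite ?Z" by (rule infinite_if_letter_powers)
    moreover have "countable ?Z"
      by (rule countable_subset[OF _ M.countable_gens]) (auto simp: U_def)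
    ultimately show ?thesis using ex_bij_countably_infinite that by metis
  qed
  obtain g where g: "bij_betw g W U1"
  proof (rule ex_bij_countably_infinite)
    have W: "W = range (\<lambda>i. replicate (p ^ i) {#})"
      by (auto simp: W_def word_pow_single free_comm_monoid_def)
    show "countable W" unfolding W by simp
    show "infinite W" by (rule infinite_if_letter_powers[of "{#}"]) (simp add: W)
    show "countable U1" by (rule countable_subset[OF _ M.countable_gens]) (auto simp: U1_def)
    show "infinite U1"
      by (rule infinite_if_letter_powers[of "{#}"])
        (use M.W.replicate_in_gens[OF one] in \<open>auto simp: U1_def unit_iff\<close>)
  qed
  define h where "h = case_sum (\<lambda>(v, j). (?\<phi> ^^ j) (f v)) g"
  have "bij_betw ((\<lambda>(v, j). (?\<phi> ^^ j) v) \<circ> map_prod f id) (V \<times> UNIV) U"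
    by (rule bij_betw_trans[OF bij_betw_map_prod[OF f bij_betw_id] orbits])
  also have "(\<lambda>(v, j). (?\<phi> ^^ j) v) \<circ> map_prod f id = (\<lambda>(v, j). (?\<phi> ^^ j) (f v))"
    by auto
  finally have "bij_betw h ((V \<times> UNIV) <+> W) (U \<union> U1)"
    unfolding h_def by (rule bij_betw_case_sum[OF _ g]) (auto simp: U_def U1_def)
  also have "U \<union> U1 = M.W.gens" by (auto simp: U_def U1_def)
  finally have h: "bij_betw h ((V \<times> UNIV) <+> W) M.W.gens" .
  have boolW: "relations W (\<lambda>w. Some {#w#})" by simp
  have rel: "relations ((V \<times> UNIV) <+> W) (sum_rel shift (\<lambda>w. Some {#w#}))"
    by (rule sum_rel_relations) auto
  have "alg_isomorphic F (TP ((V \<times> UNIV) <+> W) (sum_rel shift (\<lambda>w. Some {#w#}))) (TP M.W.gens ?\<psi>)"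
  proof (rule TP_isomorphic_bij[OF h rel])
    show "relations M.W.gens ?\<psi>" using \<phi> by (auto simp: relations_def small_def)
    fix v assume v: "v \<in> (V \<times> (UNIV :: nat set)) <+> W"
    show "?\<psi> (h v) = map_option (image_mset h) (sum_rel shift (\<lambda>w. Some {#w#}) v)"
    proof (cases v)
      case (Inl a)
      then show ?thesis by (cases a) (simp add: h_def shift_def)
    next
      case (Inr w)
      then have "g w \<in> U1" using v bij_betwE[OF g] by auto
      then have "?\<phi> (g w) = g w" by (auto simp: U1_def unit_iff intro!: map_idI)
      then show ?thesis by (simp add: Inr h_def)
    qed
  qed
  from alg_isomorphic_trans[OF alg_isomorphic_trans[OF MS_poly_alg M.words_free(1)[OF l' refl]] alg_isomorphic_sym[OF this]]
  have MS: "alg_isomorphic F (MS F l (poly_alg F Xs)) (TP ((V \<times> UNIV) <+> W) (sum_rel shift (\<lambda>w. Some {#w#})))" .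
  \<comment> \<open>The polynomial variables of the coefficient algebra and of the words are combined into one
      polynomial ring.\<close>
  let ?L = "(Xs \<times> (UNIV :: nat set)) <+> ((V \<times> (UNIV :: nat set)) <+> W)" and ?R = "((Xs <+> V) \<times> (UNIV :: nat set)) <+> W"
  let ?k = "case_sum (\<lambda>(x, j). Inl (Inl x, j)) (case_sum (\<lambda>(v, j). Inl (Inr v, j)) Inr)"
  have k_rel: "relations ?L (sum_rel shift (sum_rel shift (\<lambda>w. Some {#w#})))"
    "relations ?R (sum_rel shift (\<lambda>w. Some {#w#}))"
    by (intro sum_rel_relations rel shift_relations boolW)+
  have "alg_isomorphic F (TP ?L (sum_rel shift (sum_rel shift (\<lambda>w. Some {#w#})))) (TP ?R (sum_rel shift (\<lambda>w. Some {#w#})))"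
  proof (rule TP_isomorphic_bij[OF _ k_rel])
    show "bij_betw ?k ?L ?R"
      by (rule bij_betw_byWitness[where f' = "case_sum (\<lambda>(y, j). case y of Inl x \<Rightarrow> Inl (x, j) | Inr v \<Rightarrow> Inr (Inl (v, j))) (Inr \<circ> Inr)"])
        auto
    fix v assume "v \<in> ?L"
    then show "sum_rel shift (\<lambda>w. Some {#w#}) (?k v) = map_option (image_mset ?k) (sum_rel shift (sum_rel shift (\<lambda>w. Some {#w#})) v)"
      by (auto simp: shift_def)
  qed
  with tensor_TP[OF poly_alg_TP shift_relations MS rel]
  have "alg_isomorphic F (Sha F l (poly_alg F Xs)) (TP ?R (sum_rel shift (\<lambda>w. Some {#w#})))"
    unfolding Sha_def by (rule alg_isomorphic_trans)
  then show ?thesis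
    by (rule TP_cong_isomorphic[OF _ tensor_TP[OF poly_alg_TP shift_relations poly_quot_boolean boolW]])
qed

lemma monomial_words_reduced:
  assumes "finite Xs" "relations Xs \<psi>" "\<And>v. \<psi> v = Some (\<kappa> v)"
  shows "monomial_words p Xs (reduced_monoid Xs \<psi>)"
proof (intro monomial_words.intro prime_modulus_axioms monomial_words_axioms.intro)
  show "comm_monoid (reduced_monoid Xs \<psi>)" by (rule comm_monoid_reduced[OF assms(2,3)])
  show "carrier (reduced_monoid Xs \<psi>) \<subseteq> {m. set_mset m \<subseteq> Xs}"
    by (auto simp: reduced_monoid_def truncated_def)
qed (rule assms(1))

text \<open>Every letter equals its \<open>p\<close>-th power, and so does every word. In particular \<open>E\<close> does not
  exclude any Lyndon word.\<close>

lemma Sha_boolean: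
  fixes Xs :: "'x::linorder set" and r :: "('x \<Rightarrow> int option) rel"
  assumes Xs: "finite Xs" and l: "l \<in> carrier F" "l \<noteq> 0"
  defines "A \<equiv> poly_quot F Xs (\<lambda>x. x [^]\<^bsub>poly_alg F Xs\<^esub> p \<ominus>\<^bsub>poly_alg F Xs\<^esub> x)"
    and "V \<equiv> Xs <+> TEL p (boolean_monoid Xs) r"
  shows "alg_isomorphic F (Sha F l A) (poly_quot F V (\<lambda>w. w [^]\<^bsub>poly_alg F V\<^esub> p \<ominus>\<^bsub>poly_alg F V\<^esub> w))"
proof -
  let ?\<psi> = "\<lambda>v::'x. Some {#v#}" and ?G = "boolean_monoid Xs"
  define S where "S = reduced_monoid Xs ?\<psi>"
  have rel: "relations Xs ?\<psi>" by simp
  have S: "comm_monoid S" unfolding S_def by (rule comm_monoid_reduced[OF rel]) simp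
  have mw: "monomial_words p Xs S" unfolding S_def by (rule monomial_words_reduced[OF Xs rel]) simp
  interpret M: monomial_words p Xs S l by (rule mw)
  interpret G: comm_monoid ?G by (rule comm_monoid_boolean)
  have one: "{#} \<in> carrier S" by (simp add: S_def reduced_monoid_def)
  have A: "alg_isomorphic F A (TP Xs ?\<psi>)" unfolding A_def by (rule poly_quot_boolean)
  then have "alg_isomorphic F A (monoid_alg F S)"
    unfolding S_def TP_eq_monoid_alg[OF rel refl] .
  from alg_isomorphic_trans[OF MS_isomorphic[OF S this] M.words_boolean]
  have MS: "alg_isomorphic F (MS F l A) (TP M.W.gens (\<lambda>v. Some {#v#}))"
    using unit_dvd[OF l] by (simp add: S_def reduced_monoid_def reduced_pow_boolean[unfolded reduced_monoid_def])
  let ?T = "TEL p ?G r"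
  have "E_words p ?G (Lyn ?G r) = Lyn ?G r"
  proof -
    have "letter_pow p ?G w = w" if "w \<in> Lyn ?G r" for w
    proof -
      have "g [^]\<^bsub>?G\<^esub> p = g" if "g \<in> set w" for g
        using that \<open>w \<in> Lyn ?G r\<close> by (intro boolean_monoid_pow) (auto simp: Lyn_def)
      then show ?thesis unfolding letter_pow_def by (intro map_idI)
    qed
    then show ?thesis unfolding E_words_def by auto
  qed
  then have T: "?T = T_words p (Lyn ?G r)" by (simp only: TEL_def)
  have "finite (carrier ?G)"
    using Xs p_gt_1 by (intro finite_monoid_power) (simp_all add: adjoin_identity_def carrier_integer_mod_group)
  then have "countable ?T" unfolding T by (intro countable_T_words[OF _ order_refl] countable_finite)
  moreover have "infinite ?T"
    unfolding T
    by (rule infinite_if_letter_powers[of "\<one>\<^bsub>?G\<^esub>"]) (rule T_words_single[OF single_Lyn[OF G.one_closed]])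
  moreover have "infinite M.W.gens"
    by (rule infinite_if_letter_powers[of "{#}"]) (rule M.W.replicate_in_gens[OF one])
  ultimately obtain f where f: "bij_betw f M.W.gens ?T"
    using ex_bij_countably_infinite[OF M.countable_gens] by blast
  have bij: "bij_betw (case_sum Inl (Inr \<circ> f)) (Xs <+> M.W.gens) V"
  proof -
    have "bij_betw Inl Xs (Inl ` Xs)" "bij_betw (Inr \<circ> f) M.W.gens (Inr ` ?T)"
      using bij_betw_trans[OF f, of Inr "Inr ` ?T"] by (auto simp: bij_betw_def)
    from bij_betw_case_sum[OF this] show ?thesis by (auto simp: V_def Plus_def)
  qed
  have "alg_isomorphic F (TP (Xs <+> M.W.gens) (sum_rel ?\<psi> (\<lambda>v. Some {#v#}))) (TP V (\<lambda>v. Some {#v#}))"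
    by (rule TP_isomorphic_bij[OF bij sum_rel_relations]) auto
  with tensor_TP[OF A rel MS relations_simps(2)]
  have "alg_isomorphic F (Sha F l A) (TP V (\<lambda>v. Some {#v#}))"
    unfolding Sha_def by (rule alg_isomorphic_trans)
  then show ?thesis by (rule TP_cong_isomorphic[OF _ poly_quot_boolean])
qed

text \<open>The elements \<open>w - w\<^bsup>\<langle>p\<rangle>\<^esup>\<close> with \<open>w = g\<^bsup>\<otimes> p^i\<^esup>\<close> are distinct, since words are linearly
  independent.\<close>

lemma TL2_tilde_unipotent:
  fixes Xs :: "'x set"
  assumes Xs: "finite Xs" "Xs \<noteq> {}"
  shows "countable (TL2_tilde F l p (unipotent_monoid Xs) r)" "infinite (TL2_tilde F l p (unipotent_monoid Xs) r)"
proof -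
  let ?G = "unipotent_monoid Xs"
  let ?D = "\<lambda>w. MS_word F l ?G w \<ominus>\<^bsub>MS F l (monoid_alg F ?G)\<^esub> MS_word F l ?G (letter_pow p ?G w)"
  interpret G: comm_monoid ?G by (rule comm_monoid_unipotent)
  have tilde: "TL2_tilde F l p ?G r = ?D ` TL2 p ?G r" by (auto simp: TL2_tilde_def)
  have "finite (carrier ?G)"
    using Xs p_gt_1 by (intro finite_monoid_power) (simp_all add: carrier_integer_mod_group)
  then have "countable (TL2 p ?G r)"
    unfolding TL2_def by (intro countable_T_words[OF _ part_subset(2)] countable_finite)
  then show "countable (TL2_tilde F l p ?G r)" unfolding tilde by simp
  define g where "g = (\<lambda>x\<in>Xs. 1 :: int)"
  have g: "g \<in> carrier ?G" using p_gt_1 by (auto simp: g_def monoid_power_def carrier_integer_mod_group)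
  have g1: "g \<noteq> \<one>\<^bsub>?G\<^esub>"
  proof
    assume "g = \<one>\<^bsub>?G\<^esub>"
    moreover obtain x where "x \<in> Xs" using Xs by blast
    ultimately show False by (auto simp: g_def monoid_power_def dest!: fun_cong[of _ _ x])
  qed
  let ?w = "\<lambda>i. replicate (p ^ i) g"
  have lp: "letter_pow p ?G (?w i) = replicate (p ^ i) \<one>\<^bsub>?G\<^esub>" for i
    by (simp add: letter_pow_def unipotent_monoid_pow[OF g])
  have "[g] \<in> part2 p ?G (Lyn ?G r)"
    using single_Lyn[OF g] g1 by (auto simp: part2_def letter_pow_def unipotent_monoid_pow[OF g])
  then have mem: "?w i \<in> TL2 p ?G r" for i unfolding TL2_def by (rule T_words_single)
  have w_in: "?w i \<in> lists (carrier ?G)" "letter_pow p ?G (?w i) \<in> lists (carrier ?G)" for i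
    unfolding lp using g G.one_closed by auto
  have "inj (\<lambda>i. ?D (?w i))"
  proof (rule injI, rule ccontr)
    fix i j assume eq: "?D (?w i) = ?D (?w j)" and "i \<noteq> j"
    have "p ^ i \<noteq> p ^ j" using p_gt_1 \<open>i \<noteq> j\<close> by (simp add: power_inject_exp)
    then have ne: "?w i \<noteq> ?w j" by (simp add: replicate_eq_replicate)
    have pos: "0 < p ^ k" for k using p_gt_1 by simp
    have ne1: "?w i \<noteq> letter_pow p ?G (?w k)" for k
      unfolding lp using g1 pos[of i] pos[of k] by (simp add: replicate_eq_replicate)
    have "frag_of (?w i) - frag_of (letter_pow p ?G (?w i)) =\<^sub>p frag_of (?w j) - frag_of (letter_pow p ?G (?w j))"
      using eq MS_word_diff_eq_iff[OF comm_monoid_unipotent w_in w_in] by blast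
    then have "int p dvd Poly_Mapping.lookup ((frag_of (?w i) - frag_of (letter_pow p ?G (?w i)))
        - (frag_of (?w j) - frag_of (letter_pow p ?G (?w j)))) (?w i)"
      unfolding eqp_def by blast
    then show False using ne ne1[of i] ne1[of j] p_gt_1 by (simp add: lookup_minus)
  qed
  then have "infinite (range (\<lambda>i. ?D (?w i)))" by (simp add: finite_image_iff)
  moreover have "range (\<lambda>i. ?D (?w i)) \<subseteq> TL2_tilde F l p ?G r" unfolding tilde using mem by blast
  ultimately show "infinite (TL2_tilde F l p ?G r)" by (meson finite_subset)
qed

text \<open>Unit words contribute Boolean variables, and the differences of the other generators and unit
  words are nilpotent.\<close>

lemma Sha_unipotent:
  fixes Xs :: "'x::linorder set" and r :: "('x \<Rightarrow> int) rel"
  assumes Xs: "finite Xs" and l: "l \<in> carrier F" "l \<noteq> 0"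
  defines "A \<equiv> poly_quot F Xs (\<lambda>x. x [^]\<^bsub>poly_alg F Xs\<^esub> p \<ominus>\<^bsub>poly_alg F Xs\<^esub> \<one>\<^bsub>poly_alg F Xs\<^esub>)"
    and "V1 \<equiv> TL1 p (unipotent_monoid Xs) r" and "V2 \<equiv> TL2_tilde F l p (unipotent_monoid Xs) r"
  shows "alg_isomorphic F (Sha F l A)
    (tensor_alg F (tensor_alg F A (poly_quot F V1 (\<lambda>w. w [^]\<^bsub>poly_alg F V1\<^esub> p \<ominus>\<^bsub>poly_alg F V1\<^esub> w)))
      (poly_quot F V2 (\<lambda>w. w [^]\<^bsub>poly_alg F V2\<^esub> p)))"
proof -
  let ?\<psi> = "\<lambda>v::'x. Some {#} :: 'x multiset option" and ?G = "unipotent_monoid Xs"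
  define S where "S = reduced_monoid Xs ?\<psi>"
  have rel: "relations Xs ?\<psi>" by simp
  have S: "comm_monoid S" unfolding S_def by (rule comm_monoid_reduced[OF rel]) simp
  have mw: "monomial_words p Xs S" unfolding S_def by (rule monomial_words_reduced[OF Xs rel]) simp
  interpret M: monomial_words p Xs S l by (rule mw)
  interpret G: comm_monoid ?G by (rule comm_monoid_unipotent)
  have carrier_S: "carrier S = truncated Xs" by (simp add: S_def reduced_monoid_def)
  have one: "{#} \<in> carrier S" by (simp add: carrier_S)
  have A: "alg_isomorphic F A (TP Xs ?\<psi>)" unfolding A_def by (rule poly_quot_unipotent)
  then have AS: "alg_isomorphic F A (monoid_alg F S)"
    unfolding S_def TP_eq_monoid_alg[OF rel refl] .
  let ?\<chi> = "\<lambda>v. if M.unit_word v then Some {#v#} else None"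
  have "alg_isomorphic F (WA S l) (TP M.W.gens ?\<chi>)"
  proof (rule M.words_unipotent[OF _ _ one])
    show "s [^]\<^bsub>S\<^esub> p = {#}" if "s \<in> carrier S" for s
      using reduced_pow_unipotent[of s Xs] that by (simp add: S_def carrier_S[unfolded S_def])
  qed (use unit_dvd[OF l] in auto)
  from alg_isomorphic_trans[OF MS_isomorphic[OF S AS] this]
  have MS: "alg_isomorphic F (MS F l A) (TP M.W.gens ?\<chi>)" .
  define U1 where "U1 = {w \<in> M.W.gens. M.unit_word w}"
  define U2 where "U2 = {w \<in> M.W.gens. \<not> M.unit_word w}"
  have finG: "finite (carrier ?G)"
    using Xs p_gt_1 by (intro finite_monoid_power) (simp_all add: carrier_integer_mod_group)
  obtain f where f: "bij_betw f V1 U1"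
  proof (rule ex_bij_countably_infinite)
    show "countable V1"
      unfolding V1_def TL1_def by (intro countable_T_words[OF _ part_subset(1)] countable_finite finG)
    have "[\<one>\<^bsub>?G\<^esub>] \<in> part1 p ?G (Lyn ?G r)"
      using single_Lyn[OF G.one_closed] by (simp add: part1_def letter_pow_def)
    then show "infinite V1"
      unfolding V1_def TL1_def by (intro infinite_if_letter_powers[of "\<one>\<^bsub>?G\<^esub>"] T_words_single)
    show "countable U1" by (rule countable_subset[OF _ M.countable_gens]) (auto simp: U1_def)
    show "infinite U1"
      by (rule infinite_if_letter_powers[of "{#}"])
        (use M.W.replicate_in_gens[OF one] in \<open>auto simp: U1_def M.unit_word_def\<close>)
  qed
  obtain g where g: "bij_betw g V2 U2"
  proof (cases "Xs = {}")
    case True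
    have "carrier S = {{#}}" using True p_gt_1 by (auto simp: carrier_S truncated_def)
    then have "M.unit_word w" if "w \<in> M.W.gens" for w
      using M.gens_lists[OF that] unfolding M.unit_word_def by (auto intro!: replicate_eqI)
    then have "U2 = {}" by (auto simp: U2_def)
    moreover have "carrier ?G = {\<one>\<^bsub>?G\<^esub>}" using True by (auto simp: monoid_power_def product_group_def)
    then have "letter_pow p ?G w = w" if "w \<in> lists (carrier ?G)" for w
      using that by (auto simp: letter_pow_def intro!: map_idI)
    then have "part2 p ?G (Lyn ?G r) = {}" using Lyn_lists by (fastforce simp: part2_def)
    then have "V2 = {}" by (simp add: V2_def TL2_tilde_def TL2_def T_words_def)
    ultimately show ?thesis using that[of "\<lambda>_. []"] by (simp add: bij_betw_def)
  next
    case False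
    then obtain x where x: "x \<in> Xs" by blast
    have xS: "{#x#} \<in> carrier S" using x p_gt_1 by (simp add: carrier_S truncated_def)
    have "replicate (p ^ i) {#x#} \<in> U2" for i
      using M.W.replicate_in_gens[OF xS] p_gt_1 by (auto simp: U2_def M.unit_word_def replicate_eq_replicate)
    then have "infinite U2" by (rule infinite_if_letter_powers)
    moreover have "countable U2" by (rule countable_subset[OF _ M.countable_gens]) (auto simp: U2_def)
    ultimately show ?thesis
      using ex_bij_countably_infinite[OF TL2_tilde_unipotent[OF Xs False, of l r]] that unfolding V2_def by metis
  qed
  let ?b = "\<lambda>w. Some {#w#}" and ?n = "\<lambda>_. None"
  have "bij_betw (case_sum f g) (V1 <+> V2) (U1 \<union> U2)"
    by (rule bij_betw_case_sum[OF f g]) (auto simp: U1_def U2_def)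
  also have "U1 \<union> U2 = M.W.gens" by (auto simp: U1_def U2_def)
  finally have fg: "bij_betw (case_sum f g) (V1 <+> V2) M.W.gens" .
  have rel12: "relations (V1 <+> V2) (sum_rel ?b ?n)" by (rule sum_rel_relations) auto
  have "alg_isomorphic F (TP (V1 <+> V2) (sum_rel ?b ?n)) (TP M.W.gens ?\<chi>)"
  proof (rule TP_isomorphic_bij[OF fg rel12])
    show "relations M.W.gens ?\<chi>" by (auto simp: relations_def small_def split: if_splits)
    fix v assume "v \<in> V1 <+> V2"
    then show "?\<chi> (case_sum f g v) = map_option (image_mset (case_sum f g)) (sum_rel ?b ?n v)"
      using bij_betwE[OF f] bij_betwE[OF g] by (auto simp: U1_def U2_def)
  qed
  from alg_isomorphic_trans[OF MS alg_isomorphic_sym[OF this]]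
  have MS': "alg_isomorphic F (MS F l A) (TP (V1 <+> V2) (sum_rel ?b ?n))" .
  let ?L = "Xs <+> (V1 <+> V2)" and ?R = "(Xs <+> V1) <+> V2"
  let ?k = "case_sum (Inl \<circ> Inl) (case_sum (Inl \<circ> Inr) Inr)"
  have rel1: "relations (Xs <+> V1) (sum_rel ?\<psi> ?b)" by (rule sum_rel_relations) auto
  have k_rel: "relations ?L (sum_rel ?\<psi> (sum_rel ?b ?n))" "relations ?R (sum_rel (sum_rel ?\<psi> ?b) ?n)"
    by (rule sum_rel_relations[OF rel rel12], rule sum_rel_relations[OF rel1 relations_simps(1)])
  have "alg_isomorphic F (TP ?L (sum_rel ?\<psi> (sum_rel ?b ?n))) (TP ?R (sum_rel (sum_rel ?\<psi> ?b) ?n))"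
  proof (rule TP_isomorphic_bij[OF _ k_rel])
    show "bij_betw ?k ?L ?R"
      by (rule bij_betw_byWitness[where f' = "case_sum (case_sum Inl (Inr \<circ> Inl)) (Inr \<circ> Inr)"])
        auto
    fix v assume "v \<in> ?L"
    then show "sum_rel (sum_rel ?\<psi> ?b) ?n (?k v) = map_option (image_mset ?k) (sum_rel ?\<psi> (sum_rel ?b ?n) v)"
      by auto
  qed
  with tensor_TP[OF A rel MS' rel12]
  have "alg_isomorphic F (Sha F l A) (TP ?R (sum_rel (sum_rel ?\<psi> ?b) ?n))"
    unfolding Sha_def by (rule alg_isomorphic_trans)
  then show ?thesis
    by (rule TP_cong_isomorphic[OF _ tensor_TP[OF tensor_TP[OF A rel poly_quot_boolean relations_simps(2)] rel1
        poly_quot_nilpotent relations_simps(1)]])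
qed

end

theorem theorem3p20:
  fixes p :: nat and Xs :: "'x::linorder set"
  assumes "Factorial_Ring.prime p" and "finite Xs"
  shows
    "(let F = residue_ring (int p); S = free_comm_monoid Xs; V = TL p S (deglex Xs) in
        alg_isomorphic F
          (Sha F \<zero>\<^bsub>F\<^esub> (poly_alg F Xs))
          (tensor_alg F (poly_alg F Xs)
             (poly_quot F V (\<lambda>w. w [^]\<^bsub>poly_alg F V\<^esub> p))))
     \<and>
     (let F = residue_ring (int p); S = free_comm_monoid Xs; V = TEL2 p S (deglex Xs);
          W = {word_pow [\<one>\<^bsub>S\<^esub>] (p ^ i) | i. True} in
        \<forall>l \<in> carrier F. l \<noteq> \<zero>\<^bsub>F\<^esub> \<longrightarrow>
          alg_isomorphic F
            (Sha F l (poly_alg F Xs))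
            (tensor_alg F (poly_alg F (Xs <+> V))
               (poly_quot F W (\<lambda>w. w [^]\<^bsub>poly_alg F W\<^esub> p \<ominus>\<^bsub>poly_alg F W\<^esub> w))))
     \<and>
     (let F = residue_ring (int p);
          A = poly_quot F Xs (\<lambda>x. x [^]\<^bsub>poly_alg F Xs\<^esub> p \<ominus>\<^bsub>poly_alg F Xs\<^esub> x);
          S = monoid_power (adjoin_identity (integer_mod_group (p - 1))) Xs in
        \<forall>l \<in> carrier F. l \<noteq> \<zero>\<^bsub>F\<^esub> \<longrightarrow>
          (\<forall>r. well_order_on (carrier S) r \<longrightarrow>
             class_P p S r \<and>
             (let V = Xs <+> TEL p S r in
               alg_isomorphic F
                 (Sha F l A)
                 (poly_quot F V (\<lambda>w. w [^]\<^bsub>poly_alg F V\<^esub> p \<ominus>\<^bsub>poly_alg F V\<^esub> w)))))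
     \<and>
     (let F = residue_ring (int p);
          A = poly_quot F Xs (\<lambda>x. x [^]\<^bsub>poly_alg F Xs\<^esub> p \<ominus>\<^bsub>poly_alg F Xs\<^esub> \<one>\<^bsub>poly_alg F Xs\<^esub>);
          S = monoid_power (integer_mod_group p) Xs in
        \<forall>l \<in> carrier F. l \<noteq> \<zero>\<^bsub>F\<^esub> \<longrightarrow>
          (\<forall>r. well_order_on (carrier S) r \<and> (\<forall>g \<in> carrier S. (\<one>\<^bsub>S\<^esub>, g) \<in> r) \<longrightarrow>
             class_J p S r \<and>
             (let V1 = TL1 p S r; V2 = TL2_tilde F l p S r in
               alg_isomorphic F
                 (Sha F l A)
                 (tensor_alg F
                   (tensor_alg F A
                     (poly_quot F V1 (\<lambda>w. w [^]\<^bsub>poly_alg F V1\<^esub> p \<ominus>\<^bsub>poly_alg F V1\<^esub> w)))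
                   (poly_quot F V2 (\<lambda>w. w [^]\<^bsub>poly_alg F V2\<^esub> p))))))"
proof -
  interpret prime_modulus p by unfold_locales (rule assms(1))
  show ?thesis
    unfolding Let_def F_simps(2)
    by (intro conjI ballI allI impI; (elim conjE)?)
      (rule Sha_weight_zero[OF assms(2)] Sha_poly_alg[OF assms(2)] class_P_boolean
        Sha_boolean[OF assms(2)] class_J_unipotent Sha_unipotent[OF assms(2)]; blast)+
qed

end
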